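(* Let $(M,\omega)$ be a closed connected weakly monotone symplectic manifold and let $Z=(Z_t)_{t\in S^1}$ be a $1$-periodic time dependent symplectic vector field on $M$ such that the cohomology class $\beta=[i_{Z_t}\omega]\in H^1(M;\mathbb R)$ is independent of $t$. Then: (1) If in a given non-trivial homotopy class $\gamma$ of closed curves in $M$ with $\beta(\gamma)\neq 0$ there exists a non-degenerate $1$-periodic trajectory of $Z$, then there exists at least one more, geometrically different, possibly degenerate, $1$-periodic trajectory of $Z$ in the same homotopy class $\gamma$. (2) If all $1$-periodic trajectories of $Z$ in a given non-trivial homotopy class $\gamma$ of closed curves in $M$ with $\beta(\gamma)\neq 0$ are non-degenerate, then their number is even.
   Context: $S^1=\mathbb R/\mathbb Z$. A symplectic manifold $(M,\omega)$ of dimension $2n$ with first Chern class $c_1$ is weakly monotone if for all $\tau\in\pi_2(M)$: $3-n\le c_1(\tau)<0$ implies $\omega(\tau)\le 0$. A $1$-periodic time dependent symplectic vector field is a smooth map $Z:S^1\to\mathfrak X(M)$, $t\mapsto Z_t$, with each $i_{Z_t}\omega$ closed. A $1$-periodic trajectory of $Z$ is a smooth map $x:S^1\to M$ with $x'(t)=Z_t(x(t))$ for all $t$. Two trajectories are (geometrically) different if they are distinct maps $S^1\to M$. Let $\Psi^Z_1:M\to M$ be the time-$1$ map of the flow of $Z$; the trajectory $x$ is non-degenerate if the fixed point $x(0)$ of $\Psi_1^Z$ is non-degenerate, i.e. $1$ is not an eigenvalue of $d_{x(0)}\Psi^Z_1$. A homotopy class of closed curves is a connected component $\gamma\in\pi_0(C^\infty(S^1,M))$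 of the free loop space; it is non-trivial if it does not consist of contractible loops. $\beta(\gamma)\in\mathbb R$ denotes the pairing of $\beta$ with the homology class in $H_1(M;\mathbb Z)$ represented by any loop in $\gamma$. *)

theory Defs
  imports "HOL-Analysis.Analysis"
begin

section \<open>Smooth manifolds\<close>

text \<open>Smoothness is only ever used on open sets; all iterated directional derivatives are required
  to exist, as Frechet derivatives evaluated on fixed vectors, and to be continuous.\<close>

primrec times_differentiable_on ::
    "nat \<Rightarrow> ('e::real_normed_vector \<Rightarrow> 'f::real_normed_vector) \<Rightarrow> 'e set \<Rightarrow> bool" where
  "times_differentiable_on 0 f S \<longleftrightarrow> continuous_on S f"
| "times_differentiable_on (Suc k) f S \<longleftrightarrow>
     (\<forall>x\<in>S. f differentiable (at x)) \<and>
     (\<forall>v. times_differentiable_on k (\<lambda>x. frechet_derivative f (at x) v) S)"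

definition smooth_on :: "('e::real_normed_vector \<Rightarrow> 'f::real_normed_vector) \<Rightarrow> 'e set \<Rightarrow> bool" where
  "smooth_on f S \<longleftrightarrow> (\<forall>k. times_differentiable_on k f S)"

text \<open>The manifold is the whole (Hausdorff, second countable) type \<open>'a\<close>, with smooth structure given
  by an atlas of charts \<open>(U, \<phi>)\<close> onto open subsets of \<open>'b\<close>; so it has dimension \<open>DIM('b)\<close> and no
  boundary.\<close>

type_synonym ('a, 'b) atlas = "('a set \<times> ('a \<Rightarrow> 'b)) set"

definition smooth_atlas ::
    "('a::{t2_space,second_countable_topology}, 'b::euclidean_space) atlas \<Rightarrow> bool" where
  "smooth_atlas A \<longleftrightarrow>
     (\<Union>(U, \<phi>)\<in>A. U) = UNIV \<and>
     (\<forall>(U, \<phi>)\<in>A. open U \<and> open (\<phi> ` U) \<and> homeomorphism U (\<phi> ` U) \<phi> (inv_into U \<phi>)) \<and>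
     (\<forall>(U, \<phi>)\<in>A. \<forall>(V, \<psi>)\<in>A. smooth_on (\<phi> \<circ> inv_into V \<psi>) (\<psi> ` (U \<inter> V)))"

definition smooth_functions ::
    "('a::{t2_space,second_countable_topology}, 'b::euclidean_space) atlas \<Rightarrow> ('a \<Rightarrow> real) set" where
  "smooth_functions A = {f. \<forall>(U, \<phi>)\<in>A. smooth_on (f \<circ> inv_into U \<phi>) (\<phi> ` U)}"

definition smooth_map_into ::
    "('a::{t2_space,second_countable_topology}, 'b::euclidean_space) atlas \<Rightarrow>
      ('e::euclidean_space \<Rightarrow> 'a) \<Rightarrow> bool" where
  "smooth_map_into A u \<longleftrightarrow>
     continuous_on UNIV u \<and> (\<forall>(U, \<phi>)\<in>A. smooth_on (\<phi> \<circ> u) (u -` U))"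


section \<open>Tangent vectors and vector fields\<close>

text \<open>Tangent vectors at \<open>p\<close> are derivations of the algebra of smooth functions at \<open>p\<close>. They are set to
  0 on non-smooth functions, so that equality of tangent vectors is equality of HOL functions.\<close>

type_synonym 'a tvec = "('a \<Rightarrow> real) \<Rightarrow> real"
type_synonym 'a vfield = "'a \<Rightarrow> 'a tvec"

definition tangent_space ::
    "('a::{t2_space,second_countable_topology}, 'b::euclidean_space) atlas \<Rightarrow> 'a \<Rightarrow> 'a tvec set" where
  "tangent_space A p =
     {v. (\<forall>f. f \<notin> smooth_functions A \<longrightarrow> v f = 0) \<and>
         (\<forall>f\<in>smooth_functions A. \<forall>g\<in>smooth_functions A. \<forall>a b.
            v (\<lambda>q. a * f q + b * g q) = a * v f + b * v g) \<and>
         (\<forall>f\<in>smooth_functions A. \<forall>g\<in>smooth_functions A.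
            v (\<lambda>q. f q * g q) = f p * v g + g p * v f)}"

definition tv_lin :: "real \<Rightarrow> 'a tvec \<Rightarrow> real \<Rightarrow> 'a tvec \<Rightarrow> 'a tvec" where
  "tv_lin a v b w = (\<lambda>f. a * v f + b * w f)"

text \<open>The differential at \<open>z\<close>, applied to \<open>e\<close>, of a map \<open>u\<close> from (an open part of) a Euclidean space
  to the manifold.\<close>

definition differential ::
    "('a::{t2_space,second_countable_topology}, 'b::euclidean_space) atlas \<Rightarrow>
      ('e::euclidean_space \<Rightarrow> 'a) \<Rightarrow> 'e \<Rightarrow> 'e \<Rightarrow> 'a tvec" where
  "differential A u z e =
     (\<lambda>f. if f \<in> smooth_functions A then frechet_derivative (f \<circ> u) (at z) e else 0)"

abbreviation velocity ::
    "('a::{t2_space,second_countable_topology}, 'b::euclidean_space) atlas \<Rightarrow>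
      (real \<Rightarrow> 'a) \<Rightarrow> real \<Rightarrow> 'a tvec" where
  "velocity A c t \<equiv> differential A c t 1"

text \<open>The differential of a smooth self-map \<open>\<Psi>\<close>; the base point is not needed for derivations.\<close>

definition pushforward ::
    "('a::{t2_space,second_countable_topology}, 'b::euclidean_space) atlas \<Rightarrow>
      ('a \<Rightarrow> 'a) \<Rightarrow> 'a tvec \<Rightarrow> 'a tvec" where
  "pushforward A \<Psi> v = (\<lambda>f. if f \<in> smooth_functions A then v (f \<circ> \<Psi>) else 0)"

definition vector_fields ::
    "('a::{t2_space,second_countable_topology}, 'b::euclidean_space) atlas \<Rightarrow> 'a vfield set" where
  "vector_fields A =
     {X. (\<forall>p. X p \<in> tangent_space A p) \<and>
         (\<forall>f\<in>smooth_functions A. (\<lambda>p. X p f) \<in> smooth_functions A)}"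

definition vf_add :: "'a vfield \<Rightarrow> 'a vfield \<Rightarrow> 'a vfield" where
  "vf_add X Y = (\<lambda>p f. X p f + Y p f)"

definition vf_scale :: "('a \<Rightarrow> real) \<Rightarrow> 'a vfield \<Rightarrow> 'a vfield" where
  "vf_scale h X = (\<lambda>p f. h p * X p f)"

definition lie_bracket :: "'a vfield \<Rightarrow> 'a vfield \<Rightarrow> 'a vfield" where
  "lie_bracket X Y = (\<lambda>p f. X p (\<lambda>q. Y q f) - Y p (\<lambda>q. X q f))"

text \<open>The coordinate vector in \<open>'b\<close> of \<open>v\<close> at \<open>p\<close> with respect to the chart \<open>(U, \<phi>)\<close>.\<close>

definition tangent_coords ::
    "('a::{t2_space,second_countable_topology}, 'b::euclidean_space) atlas \<Rightarrow>
      'a set \<times> ('a \<Rightarrow> 'b) \<Rightarrow> 'a \<Rightarrow> 'a tvec \<Rightarrow> 'b" where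
  "tangent_coords A = (\<lambda>(U, \<phi>) p v. THE w. v = differential A (inv_into U \<phi>) (\<phi> p) w)"

text \<open>The real trace of an endomorphism of the tangent space at \<open>p\<close>, computed in the coordinate frame
  of an arbitrary chart around \<open>p\<close>.\<close>

definition tangent_trace ::
    "('a::{t2_space,second_countable_topology}, 'b::euclidean_space) atlas \<Rightarrow>
      'a \<Rightarrow> ('a tvec \<Rightarrow> 'a tvec) \<Rightarrow> real" where
  "tangent_trace A p L =
     (let (U, \<phi>) = (SOME c. c \<in> A \<and> p \<in> fst c) in
      \<Sum>b\<in>Basis. tangent_coords A (U, \<phi>) p (L (differential A (inv_into U \<phi>) (\<phi> p) b)) \<bullet> b)"


section \<open>Differential forms and de Rham classes in degrees 1 and 2\<close>

text \<open>A form is a function of a point and tangent vectors; its values on arguments that are not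
  tangent vectors at the point are irrelevant throughout.\<close>

type_synonym 'a form1 = "'a \<Rightarrow> 'a tvec \<Rightarrow> real"
type_synonym 'a form2 = "'a \<Rightarrow> 'a tvec \<Rightarrow> 'a tvec \<Rightarrow> real"

definition smooth_form1 ::
    "('a::{t2_space,second_countable_topology}, 'b::euclidean_space) atlas \<Rightarrow> 'a form1 \<Rightarrow> bool" where
  "smooth_form1 A \<alpha> \<longleftrightarrow>
     (\<forall>p. \<forall>v\<in>tangent_space A p. \<forall>w\<in>tangent_space A p. \<forall>a b.
        \<alpha> p (tv_lin a v b w) = a * \<alpha> p v + b * \<alpha> p w) \<and>
     (\<forall>X\<in>vector_fields A. (\<lambda>p. \<alpha> p (X p)) \<in> smooth_functions A)"

definition smooth_form2 ::
    "('a::{t2_space,second_countable_topology}, 'b::euclidean_space) atlas \<Rightarrow> 'a form2 \<Rightarrow> bool" where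
  "smooth_form2 A \<eta> \<longleftrightarrow>
     (\<forall>p. \<forall>v\<in>tangent_space A p. \<eta> p v v = 0) \<and>
     (\<forall>p. \<forall>u\<in>tangent_space A p. \<forall>v\<in>tangent_space A p. \<forall>w\<in>tangent_space A p. \<forall>a b.
        \<eta> p (tv_lin a v b w) u = a * \<eta> p v u + b * \<eta> p w u \<and>
        \<eta> p u (tv_lin a v b w) = a * \<eta> p u v + b * \<eta> p u w) \<and>
     (\<forall>X\<in>vector_fields A. \<forall>Y\<in>vector_fields A. (\<lambda>p. \<eta> p (X p) (Y p)) \<in> smooth_functions A)"

text \<open>Exterior derivatives, as functions of vector fields (Koszul formula).\<close>

definition d1 :: "'a form1 \<Rightarrow> 'a vfield \<Rightarrow> 'a vfield \<Rightarrow> 'a \<Rightarrow> real" where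
  "d1 \<alpha> X Y p =
     X p (\<lambda>q. \<alpha> q (Y q)) - Y p (\<lambda>q. \<alpha> q (X q)) - \<alpha> p (lie_bracket X Y p)"

definition d2 :: "'a form2 \<Rightarrow> 'a vfield \<Rightarrow> 'a vfield \<Rightarrow> 'a vfield \<Rightarrow> 'a \<Rightarrow> real" where
  "d2 \<eta> X Y W p =
     X p (\<lambda>q. \<eta> q (Y q) (W q)) - Y p (\<lambda>q. \<eta> q (X q) (W q)) + W p (\<lambda>q. \<eta> q (X q) (Y q))
     - \<eta> p (lie_bracket X Y p) (W p) + \<eta> p (lie_bracket X W p) (Y p)
     - \<eta> p (lie_bracket Y W p) (X p)"

definition closed_form1 ::
    "('a::{t2_space,second_countable_topology}, 'b::euclidean_space) atlas \<Rightarrow> 'a form1 \<Rightarrow> bool" where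
  "closed_form1 A \<alpha> \<longleftrightarrow> smooth_form1 A \<alpha> \<and>
     (\<forall>X\<in>vector_fields A. \<forall>Y\<in>vector_fields A. \<forall>p. d1 \<alpha> X Y p = 0)"

definition closed_form2 ::
    "('a::{t2_space,second_countable_topology}, 'b::euclidean_space) atlas \<Rightarrow> 'a form2 \<Rightarrow> bool" where
  "closed_form2 A \<eta> \<longleftrightarrow> smooth_form2 A \<eta> \<and>
     (\<forall>X\<in>vector_fields A. \<forall>Y\<in>vector_fields A. \<forall>W\<in>vector_fields A. \<forall>p. d2 \<eta> X Y W p = 0)"

definition de_rham_class1 ::
    "('a::{t2_space,second_countable_topology}, 'b::euclidean_space) atlas \<Rightarrow>
      'a form1 \<Rightarrow> 'a form1 set" where
  "de_rham_class1 A \<alpha> =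
     {\<alpha>'. closed_form1 A \<alpha>' \<and>
       (\<exists>f\<in>smooth_functions A. \<forall>p. \<forall>v\<in>tangent_space A p. \<alpha>' p v = \<alpha> p v + v f)}"

definition de_rham_class2 ::
    "('a::{t2_space,second_countable_topology}, 'b::euclidean_space) atlas \<Rightarrow>
      'a form2 \<Rightarrow> 'a form2 set" where
  "de_rham_class2 A \<eta> =
     {\<eta>'. closed_form2 A \<eta>' \<and>
       (\<exists>\<alpha>. smooth_form1 A \<alpha> \<and>
         (\<forall>X\<in>vector_fields A. \<forall>Y\<in>vector_fields A. \<forall>p.
            \<eta>' p (X p) (Y p) = \<eta> p (X p) (Y p) + d1 \<alpha> X Y p))}"


section \<open>Loops, spheres and pairings\<close>

text \<open>Maps from the circle \<open>\<real>/\<int>\<close> are 1-periodic maps on the real line.\<close>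

definition smooth_loops ::
    "('a::{t2_space,second_countable_topology}, 'b::euclidean_space) atlas \<Rightarrow> (real \<Rightarrow> 'a) set" where
  "smooth_loops A = {x. smooth_map_into A x \<and> (\<forall>t. x (t + 1) = x t)}"

text \<open>The \<open>C\<close>-infinity topology on the free loop space: the coarsest one for which each map
  \<open>x \<mapsto> (f \<circ> x)\<^sup>(\<^sup>k\<^sup>)\<close>, with \<open>f\<close> a smooth function, is continuous in the uniform norm.\<close>

definition free_loop_space ::
    "('a::{t2_space,second_countable_topology}, 'b::euclidean_space) atlas \<Rightarrow>
      (real \<Rightarrow> 'a) topology" where
  "free_loop_space A = topology_generated_by
     {{y \<in> smooth_loops A. \<forall>t. \<bar>(deriv ^^ k) (f \<circ> y) t - (deriv ^^ k) (f \<circ> x) t\<bar> < \<epsilon>}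
       | x f k \<epsilon>. x \<in> smooth_loops A \<and> f \<in> smooth_functions A \<and> 0 < \<epsilon>}"

definition homotopy_classes_of_loops ::
    "('a::{t2_space,second_countable_topology}, 'b::euclidean_space) atlas \<Rightarrow>
      (real \<Rightarrow> 'a) set set" where
  "homotopy_classes_of_loops A = connected_components_of (free_loop_space A)"

definition contractible_loop :: "(real \<Rightarrow> 'a::topological_space) \<Rightarrow> bool" where
  "contractible_loop x \<longleftrightarrow> (\<exists>p. homotopic_loops UNIV x (\<lambda>_. p))"

definition nontrivial_class :: "(real \<Rightarrow> 'a::topological_space) set \<Rightarrow> bool" where
  "nontrivial_class \<gamma> \<longleftrightarrow> \<not> (\<forall>x\<in>\<gamma>. contractible_loop x)"

text \<open>The pairing of a class in \<open>H\<^sup>1(M; \<real>)\<close> with a homotopy class of loops; the representatives are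
  arbitrary.\<close>

definition pairing1 ::
    "('a::{t2_space,second_countable_topology}, 'b::euclidean_space) atlas \<Rightarrow>
      'a form1 set \<Rightarrow> (real \<Rightarrow> 'a) set \<Rightarrow> real" where
  "pairing1 A \<beta> \<gamma> =
     (let \<alpha> = (SOME \<alpha>. \<alpha> \<in> \<beta>); x = (SOME x. x \<in> \<gamma>)
      in integral {0..1} (\<lambda>t. \<alpha> (x t) (velocity A x t)))"

text \<open>Elements of the second homotopy group at \<open>p\<close>: homotopy classes, relative to the boundary, of maps
  from the unit square mapping the boundary to \<open>p\<close>. (Values outside the square are irrelevant.)\<close>

abbreviation unit_square :: "(real \<times> real) set" where
  "unit_square \<equiv> cbox (0, 0) (1, 1)"

definition pi2 :: "'a::topological_space \<Rightarrow> (real \<times> real \<Rightarrow> 'a) set set" where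
  "pi2 p =
     (let based = (\<lambda>u. \<forall>z\<in>frontier unit_square. u z = p)
      in {u. continuous_on unit_square u \<and> based u} //
         {(u, v). homotopic_with_canon based unit_square UNIV u v})"

text \<open>The pairing of a class in \<open>H\<^sup>2(M; \<real>)\<close> with an element of the second homotopy group, by
  integration over an arbitrary smooth representative.\<close>

definition pairing2 ::
    "('a::{t2_space,second_countable_topology}, 'b::euclidean_space) atlas \<Rightarrow>
      'a form2 set \<Rightarrow> (real \<times> real \<Rightarrow> 'a) set \<Rightarrow> real" where
  "pairing2 A c \<tau> =
     (let \<eta> = (SOME \<eta>. \<eta> \<in> c); u = (SOME u. u \<in> \<tau> \<and> smooth_map_into A u)
      in integral unit_square
           (\<lambda>z. \<eta> (u z) (differential A u z (1, 0)) (differential A u z (0, 1))))"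


section \<open>Symplectic forms and the first Chern class\<close>

definition symplectic_form ::
    "('a::{t2_space,second_countable_topology}, 'b::euclidean_space) atlas \<Rightarrow> 'a form2 \<Rightarrow> bool" where
  "symplectic_form A \<omega> \<longleftrightarrow> closed_form2 A \<omega> \<and>
     (\<forall>p. \<forall>v\<in>tangent_space A p. v \<noteq> (\<lambda>f. 0) \<longrightarrow> (\<exists>w\<in>tangent_space A p. \<omega> p v w \<noteq> 0))"

text \<open>Compatible means that \<open>\<omega>(\<cdot>, J \<cdot>)\<close> is a Riemannian metric.\<close>

definition compatible_acs ::
    "('a::{t2_space,second_countable_topology}, 'b::euclidean_space) atlas \<Rightarrow> 'a form2 \<Rightarrow>
      ('a \<Rightarrow> 'a tvec \<Rightarrow> 'a tvec) \<Rightarrow> bool" where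
  "compatible_acs A \<omega> J \<longleftrightarrow>
     (\<forall>p. \<forall>v\<in>tangent_space A p.
        J p v \<in> tangent_space A p \<and> J p (J p v) = (\<lambda>f. - v f) \<and>
        (v \<noteq> (\<lambda>f. 0) \<longrightarrow> 0 < \<omega> p v (J p v))) \<and>
     (\<forall>p. \<forall>v\<in>tangent_space A p. \<forall>w\<in>tangent_space A p.
        \<omega> p (J p v) (J p w) = \<omega> p v w \<and>
        (\<forall>a b. J p (tv_lin a v b w) = tv_lin a (J p v) b (J p w))) \<and>
     (\<forall>X\<in>vector_fields A. (\<lambda>p. J p (X p)) \<in> vector_fields A)"

text \<open>Covariant derivatives on the complex vector bundle \<open>(TM, J)\<close>.\<close>

definition complex_connection ::
    "('a::{t2_space,second_countable_topology}, 'b::euclidean_space) atlas \<Rightarrow>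
      ('a \<Rightarrow> 'a tvec \<Rightarrow> 'a tvec) \<Rightarrow> ('a vfield \<Rightarrow> 'a vfield \<Rightarrow> 'a vfield) \<Rightarrow> bool" where
  "complex_connection A J D \<longleftrightarrow>
     (\<forall>X\<in>vector_fields A. \<forall>Y\<in>vector_fields A.
        D X Y \<in> vector_fields A \<and>
        (\<forall>X'\<in>vector_fields A. D (vf_add X X') Y = vf_add (D X Y) (D X' Y)) \<and>
        (\<forall>Y'\<in>vector_fields A. D X (vf_add Y Y') = vf_add (D X Y) (D X Y')) \<and>
        (\<forall>h\<in>smooth_functions A.
           D (vf_scale h X) Y = vf_scale h (D X Y) \<and>
           D X (vf_scale h Y) = vf_add (vf_scale (\<lambda>p. X p h) Y) (vf_scale h (D X Y))) \<and>
        D X (\<lambda>p. J p (Y p)) = (\<lambda>p. J p (D X Y p)))"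

definition curvature ::
    "('a vfield \<Rightarrow> 'a vfield \<Rightarrow> 'a vfield) \<Rightarrow> 'a vfield \<Rightarrow> 'a vfield \<Rightarrow> 'a vfield \<Rightarrow> 'a vfield" where
  "curvature D X Y W =
     (\<lambda>p f. D X (D Y W) p f - D Y (D X W) p f - D (lie_bracket X Y) W p f)"

definition extension_field ::
    "('a::{t2_space,second_countable_topology}, 'b::euclidean_space) atlas \<Rightarrow>
      'a \<Rightarrow> 'a tvec \<Rightarrow> 'a vfield" where
  "extension_field A p v = (SOME X. X \<in> vector_fields A \<and> X p = v)"

text \<open>Chern--Weil: the first Chern form of a connection with curvature \<open>R\<close> is \<open>i/(2\<pi>)\<close> times the complex
  trace of \<open>R\<close>. As the complex trace of a \<open>J\<close>-linear map \<open>L\<close> is \<open>(tr L - i tr (J L)) / 2\<close> with real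
  traces, its real part is \<open>tr (J R) / (4\<pi>)\<close>; the imaginary part is exact. The curvature is tensorial,
  so the choice of extensions of tangent vectors to vector fields does not matter. In this
  normalisation the round sphere, with \<open>J\<close> compatible with its area form, has total Chern number 2.\<close>

definition chern_form ::
    "('a::{t2_space,second_countable_topology}, 'b::euclidean_space) atlas \<Rightarrow>
      ('a \<Rightarrow> 'a tvec \<Rightarrow> 'a tvec) \<Rightarrow> ('a vfield \<Rightarrow> 'a vfield \<Rightarrow> 'a vfield) \<Rightarrow> 'a form2" where
  "chern_form A J D p v w =
     tangent_trace A p
       (\<lambda>\<xi>. J p (curvature D (extension_field A p v) (extension_field A p w)
                   (extension_field A p \<xi>) p)) / (4 * pi)"

text \<open>The (real) first Chern class of \<open>(M, \<omega>)\<close>, i.e. of \<open>(TM, J)\<close> for \<open>J\<close> compatible with \<open>\<omega>\<close>. All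
  choices of \<open>J\<close> and of the connection yield the same class.\<close>

definition first_chern_class ::
    "('a::{t2_space,second_countable_topology}, 'b::euclidean_space) atlas \<Rightarrow>
      'a form2 \<Rightarrow> 'a form2 set" where
  "first_chern_class A \<omega> =
     {\<eta>. \<exists>J D. compatible_acs A \<omega> J \<and> complex_connection A J D \<and>
               \<eta> \<in> de_rham_class2 A (chern_form A J D)}"

text \<open>Here \<open>2n\<close> is the dimension.\<close>

definition weakly_monotone ::
    "('a::{t2_space,second_countable_topology}, 'b::euclidean_space) atlas \<Rightarrow>
      nat \<Rightarrow> 'a form2 \<Rightarrow> bool" where
  "weakly_monotone A n \<omega> \<longleftrightarrow>
     (\<forall>p. \<forall>\<tau>\<in>pi2 p.
        3 - real n \<le> pairing2 A (first_chern_class A \<omega>) \<tau> \<and>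
        pairing2 A (first_chern_class A \<omega>) \<tau> < 0 \<longrightarrow>
        pairing2 A (de_rham_class2 A \<omega>) \<tau> \<le> 0)"


section \<open>Time dependent symplectic vector fields\<close>

definition contraction :: "'a vfield \<Rightarrow> 'a form2 \<Rightarrow> 'a form1" where
  "contraction X \<omega> = (\<lambda>p v. \<omega> p (X p) v)"

text \<open>Smooth maps from the circle to the vector fields are 1-periodic families that are jointly smooth
  in time and position.\<close>

definition periodic_vector_field ::
    "('a::{t2_space,second_countable_topology}, 'b::euclidean_space) atlas \<Rightarrow>
      (real \<Rightarrow> 'a vfield) \<Rightarrow> bool" where
  "periodic_vector_field A Z \<longleftrightarrow>
     (\<forall>t. Z (t + 1) = Z t) \<and>
     (\<forall>t p. Z t p \<in> tangent_space A p) \<and>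
     (\<forall>f\<in>smooth_functions A. \<forall>(U, \<phi>)\<in>A.
        smooth_on (\<lambda>(t, y). Z t (inv_into U \<phi> y) f) (UNIV \<times> \<phi> ` U))"

definition periodic_symplectic_vector_field ::
    "('a::{t2_space,second_countable_topology}, 'b::euclidean_space) atlas \<Rightarrow> 'a form2 \<Rightarrow>
      (real \<Rightarrow> 'a vfield) \<Rightarrow> bool" where
  "periodic_symplectic_vector_field A \<omega> Z \<longleftrightarrow>
     periodic_vector_field A Z \<and> (\<forall>t. closed_form1 A (contraction (Z t) \<omega>))"

definition integral_curve ::
    "('a::{t2_space,second_countable_topology}, 'b::euclidean_space) atlas \<Rightarrow>
      (real \<Rightarrow> 'a vfield) \<Rightarrow> (real \<Rightarrow> 'a) \<Rightarrow> bool" where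
  "integral_curve A Z c \<longleftrightarrow> smooth_map_into A c \<and> (\<forall>t. velocity A c t = Z t (c t))"

definition periodic_trajectories ::
    "('a::{t2_space,second_countable_topology}, 'b::euclidean_space) atlas \<Rightarrow>
      (real \<Rightarrow> 'a vfield) \<Rightarrow> (real \<Rightarrow> 'a) set" where
  "periodic_trajectories A Z = {x \<in> smooth_loops A. integral_curve A Z x}"

text \<open>Global integral curves exist when the manifold is compact.\<close>

definition flow ::
    "('a::{t2_space,second_countable_topology}, 'b::euclidean_space) atlas \<Rightarrow>
      (real \<Rightarrow> 'a vfield) \<Rightarrow> real \<Rightarrow> 'a \<Rightarrow> 'a" where
  "flow A Z t p = (THE c. integral_curve A Z c \<and> c 0 = p) t"

definition nondegenerate_fixed_point ::
    "('a::{t2_space,second_countable_topology}, 'b::euclidean_space) atlas \<Rightarrow>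
      ('a \<Rightarrow> 'a) \<Rightarrow> 'a \<Rightarrow> bool" where
  "nondegenerate_fixed_point A \<Psi> p \<longleftrightarrow>
     \<Psi> p = p \<and> \<not> (\<exists>v\<in>tangent_space A p. v \<noteq> (\<lambda>f. 0) \<and> pushforward A \<Psi> v = v)"

definition nondegenerate_trajectory ::
    "('a::{t2_space,second_countable_topology}, 'b::euclidean_space) atlas \<Rightarrow>
      (real \<Rightarrow> 'a vfield) \<Rightarrow> (real \<Rightarrow> 'a) \<Rightarrow> bool" where
  "nondegenerate_trajectory A Z x \<longleftrightarrow> nondegenerate_fixed_point A (flow A Z 1) (x 0)"

end

(* A trajectory in \<gamma> is a fixed point of the time-1 map. Deform the vector field to zero through
   sin s *\<^sub>R Z with 0 \<le> s \<le> pi/2. At s = 0 all trajectories are constant, hence contractible, so none lies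
   in the non-trivial class \<gamma>. The pairs (s, p) with p fixed by the time-1 map and trajectory in \<gamma> form
   a compact, relatively open set of fixed points, because loops that are uniformly close lie in
   the same component of the free loop space. A fixed point count modulo 2 is therefore invariant
   along the deformation: the number of trajectories in \<gamma> at s = pi/2 is even if they are all
   non-degenerate, and then a single non-degenerate one cannot be alone.

   To count fixed points without degree theory on manifolds, M is embedded in a Euclidean space
   (a compact Whitney embedding) with a smooth nearest point retraction f o r of a neighbourhood;
   fixed points become zeros of F (s, y) = y - \<Phi> s (f (r y)) 1, whose derivative at a zero is
   invertible exactly when 1 is not an eigenvalue on the tangent space. The parity comes from
   integrating the pullback under F of a bump form concentrated near 0: the pullback is closed, so
   its integrals over the two end slices agree, and at s = pi/2 the integral is a sum of as many
   signs as there are zeros. *)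

theory Submission
  imports Defs
begin

section \<open>Calculus of smooth maps\<close>

text \<open>The factor is \<open>sin s\<close> rather than \<open>s\<close> because the parameter is
  carried as an extra state variable: smoothness in s is then a case of smooth dependence on initial
  values, but the enlarged system must be Lipschitz on all of space for bounded times.
  \<open>sin\<close> is bounded, 1-Lipschitz, 0 at 0 and 1 at pi/2. The main obstacle is that only
  one homotopy class is counted, while the equation F = 0 sees all fixed points. Those outside
  \<gamma> form a compact set; removing it from the domain of F leaves an open set whose zeros over
  [0, pi/2] are exactly the pairs belonging to \<gamma>. Normal directions cause no trouble: the
  ambient flow preserves the embedded copy of M, so a zero of F lies on M, and an ambient vector
  fixed by the differential at such a zero turns out to be tangent to M. Smoothness is a recursion
  over directional derivatives along fixed vectors. Chain rules produce directions that vary with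
  the point; expanding them in \<open>Basis\<close> is the recurring device that leads back to fixed
  ones.\<close>

lemma times_differentiable_on_cong:
  assumes "open S" "\<And>x. x \<in> S \<Longrightarrow> f x = g x" "times_differentiable_on k f S"
  shows "times_differentiable_on k g S"
  using assms(2,3)
proof (induction k arbitrary: f g)
  case 0
  have "continuous_on S f" using 0(2) by simp
  then have "continuous_on S g" by (rule continuous_on_eq) (rule 0(1))
  then show ?case by simp
next
  case (Suc k)
  have D: "(g has_derivative frechet_derivative f (at x)) (at x)" if "x \<in> S" for x
  proof -
    have "(f has_derivative frechet_derivative f (at x)) (at x)"
      using Suc.prems(2) that by (simp add: frechet_derivative_works[symmetric])
    then show ?thesis
      by (rule has_derivative_transform_within_open[OF _ assms(1) that Suc.prems(1)])
  qed
  have "frechet_derivative g (at x) = frechet_derivative f (at x)" if "x \<in> S" for x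
    using frechet_derivative_at[OF D[OF that]] by simp
  moreover have "g differentiable (at x)" if "x \<in> S" for x
    using D[OF that] differentiable_def by blast
  moreover have "times_differentiable_on k (\<lambda>x. frechet_derivative g (at x) v) S" for v
    by (rule Suc.IH[of "\<lambda>x. frechet_derivative f (at x) v"]) (use Suc.prems(2) calculation in auto)
  ultimately show ?case by simp
qed

lemma times_differentiable_on_subset:
  "times_differentiable_on k f S \<Longrightarrow> T \<subseteq> S \<Longrightarrow> times_differentiable_on k f T"
  by (induction k arbitrary: f) (auto intro: continuous_on_subset)

lemma times_differentiable_on_imp_continuous_on:
  "times_differentiable_on k f S \<Longrightarrow> continuous_on S f"
proof -
  assume td: "times_differentiable_on k f S"
  show ?thesis
  proof (cases k)
    case 0 then show ?thesis using td by simp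
  next
    case (Suc l)
    then have "f differentiable (at x within S)" if "x \<in> S" for x
      using td that differentiable_at_withinI by auto
    then show ?thesis
      by (intro differentiable_imp_continuous_on) (simp add: differentiable_on_def)
  qed
qed

lemma times_differentiable_on_Suc_imp:
  "times_differentiable_on (Suc k) f S \<Longrightarrow> times_differentiable_on k f S"
proof (induction k arbitrary: f)
  case 0 show ?case using times_differentiable_on_imp_continuous_on[OF 0] by simp
next
  case (Suc k) then show ?case by (meson times_differentiable_on.simps(2))
qed

text \<open>\<open>frechet_derivative\<close> is a choice operator, but the derivative at a point is
  unique. So any explicit candidate \<open>D\<close> may stand in for it, and the later inductions
  on the order need not touch the choice.\<close>

lemma times_differentiable_on_SucI:
  assumes "open S" "\<And>x. x \<in> S \<Longrightarrow> (f has_derivative D x) (at x)"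
    "\<And>v. times_differentiable_on k (\<lambda>x. D x v) S"
  shows "times_differentiable_on (Suc k) f S"
proof -
  have "times_differentiable_on k (\<lambda>x. frechet_derivative f (at x) v) S" for v
    by (rule times_differentiable_on_cong[OF assms(1) _ assms(3)[of v]])
       (simp add: frechet_derivative_at[OF assms(2)])
  moreover have "f differentiable (at x)" if "x \<in> S" for x
    using assms that differentiable_def by blast
  ultimately show ?thesis by simp
qed

lemma times_differentiable_on_SucD:
  assumes "times_differentiable_on (Suc k) f S" "x \<in> S"
  shows "(f has_derivative frechet_derivative f (at x)) (at x)"
  using assms frechet_derivative_works by auto

lemma times_differentiable_on_UN:
  assumes "\<And>i. i \<in> I \<Longrightarrow> open (S i)" "\<And>i. i \<in> I \<Longrightarrow> times_differentiable_on k f (S i)"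
  shows "times_differentiable_on k f (\<Union>i\<in>I. S i)"
  using assms(2)
  by (induction k arbitrary: f) (auto intro!: continuous_on_open_UN assms(1))

lemma times_differentiable_on_const: "open S \<Longrightarrow> times_differentiable_on k (\<lambda>x. c) S"
proof (induction k arbitrary: c)
  case (Suc k)
  show ?case by (rule times_differentiable_on_SucI[OF Suc.prems has_derivative_const]) (rule Suc.IH[OF Suc.prems])
qed simp

lemma times_differentiable_on_add:
  assumes "open S" "times_differentiable_on k f S" "times_differentiable_on k g S"
  shows "times_differentiable_on k (\<lambda>x. f x + g x) S"
  using assms(2,3)
proof (induction k arbitrary: f g)
  case 0 then show ?case by (auto intro: continuous_on_add)
next
  case (Suc k)
  show ?case
    by (rule times_differentiable_on_SucI[OF assms(1)
          has_derivative_add[OF times_differentiable_on_SucD[OF Suc.prems(1)] times_differentiable_on_SucD[OF Suc.prems(2)]]])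
      (use Suc in auto)
qed

lemma (in bounded_linear) times_differentiable_on:
  assumes "open S" "times_differentiable_on k g S"
  shows "times_differentiable_on k (\<lambda>x. f (g x)) S"
  using assms(2)
proof (induction k arbitrary: g)
  case 0 then show ?case by (auto intro: continuous_on)
next
  case (Suc k)
  show ?case
    by (rule times_differentiable_on_SucI[OF assms(1) has_derivative[OF times_differentiable_on_SucD[OF Suc.prems]]])
      (use Suc in auto)
qed

lemma (in bounded_bilinear) times_differentiable_on:
  assumes "open S" "times_differentiable_on k f S" "times_differentiable_on k g S"
  shows "times_differentiable_on k (\<lambda>x. prod (f x) (g x)) S"
  using assms(2,3)
proof (induction k arbitrary: f g)
  case 0 then show ?case by (auto intro: continuous_on)
next
  case (Suc k)
  have *: "times_differentiable_on k f S" "times_differentiable_on k g S"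
    using Suc.prems times_differentiable_on_Suc_imp by blast+
  show ?case
    by (rule times_differentiable_on_SucI[OF assms(1)
        FDERIV[OF times_differentiable_on_SucD[OF Suc.prems(1)] times_differentiable_on_SucD[OF Suc.prems(2)]]])
      (use Suc * in \<open>auto intro!: times_differentiable_on_add assms(1)\<close>)
qed

lemma times_differentiable_on_ident: "open S \<Longrightarrow> times_differentiable_on k (\<lambda>x. x) S"
proof (induction k)
  case (Suc k)
  show ?case by (rule times_differentiable_on_SucI[OF Suc.prems has_derivative_ident])
     (rule times_differentiable_on_const[OF Suc.prems])
qed simp

lemma times_differentiable_on_sum:
  assumes "open S" "\<And>i. i \<in> I \<Longrightarrow> times_differentiable_on k (f i) S"
  shows "times_differentiable_on k (\<lambda>x. \<Sum>i\<in>I. f i x) S"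
  using assms(2)
  by (induction I rule: infinite_finite_induct)
    (auto intro!: times_differentiable_on_const times_differentiable_on_add assms(1))

lemma linear_eq_sum_Basis:
  fixes h :: "'e::euclidean_space \<Rightarrow> 'f::real_vector"
  assumes "linear h"
  shows "h v = (\<Sum>b\<in>Basis. (v \<bullet> b) *\<^sub>R h b)"
proof -
  have "h v = h (\<Sum>b\<in>Basis. (v \<bullet> b) *\<^sub>R b)" by (simp add: euclidean_representation)
  also have "\<dots> = (\<Sum>b\<in>Basis. (v \<bullet> b) *\<^sub>R h b)" by (simp only: linear_sum[OF assms] linear_cmul[OF assms])
  finally show ?thesis .
qed

text \<open>The chain rule applies the derivative of \<open>g\<close> to a moving direction, whereas
  the recursion speaks of fixed directions. Expanding the direction in \<open>Basis\<close> gives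
  products of coordinates of the derivative of \<open>f\<close> with fixed directional derivatives
  of \<open>g\<close>, to which the induction hypothesis applies; this is why \<open>f\<close> takes
  values in a Euclidean space.\<close>

lemma times_differentiable_on_compose:
  fixes f :: "'e::real_normed_vector \<Rightarrow> 'f::euclidean_space"
  assumes "open S" "times_differentiable_on k f S" "times_differentiable_on k g T" "f ` S \<subseteq> T"
  shows "times_differentiable_on k (\<lambda>x. g (f x)) S"
  using assms(2,3)
proof (induction k arbitrary: g)
  case 0 then show ?case using assms by (auto intro: continuous_on_compose2)
next
  case (Suc k)
  have fk: "times_differentiable_on k f S" using Suc.prems times_differentiable_on_Suc_imp by blast
  define D where "D x v = (\<Sum>b\<in>Basis. (frechet_derivative f (at x) v \<bullet> b) *\<^sub>R frechet_derivative g (at (f x)) b)" for x v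
  have "((\<lambda>x. g (f x)) has_derivative D x) (at x)" if x: "x \<in> S" for x
  proof -
    have g: "(g has_derivative frechet_derivative g (at (f x))) (at (f x))"
      using Suc.prems(2) assms(4) x times_differentiable_on_SucD by blast
    have "D x = (\<lambda>v. frechet_derivative g (at (f x)) (frechet_derivative f (at x) v))"
      unfolding D_def by (rule ext, rule linear_eq_sum_Basis[OF has_derivative_linear[OF g], symmetric])
    then show ?thesis
      using has_derivative_compose[OF times_differentiable_on_SucD[OF Suc.prems(1) x] g] by simp
  qed
  moreover have "times_differentiable_on k (\<lambda>x. D x v) S" for v
    unfolding D_def
    by (intro times_differentiable_on_sum bounded_bilinear.times_differentiable_on[OF bounded_bilinear_scaleR] assms(1)
       bounded_linear.times_differentiable_on[OF bounded_linear_inner_left] Suc.IH fk)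
       (use Suc.prems in auto)
  ultimately show ?case using times_differentiable_on_SucI[OF assms(1)] by blast
qed

section \<open>Closure properties of smooth maps on open sets\<close>

lemma smooth_onD: "smooth_on f S \<Longrightarrow> times_differentiable_on k f S"
  by (simp add: smooth_on_def)

lemma smooth_onI: "(\<And>k. times_differentiable_on k f S) \<Longrightarrow> smooth_on f S"
  by (simp add: smooth_on_def)

lemma smooth_on_cong:
  "open S \<Longrightarrow> (\<And>x. x \<in> S \<Longrightarrow> f x = g x) \<Longrightarrow> smooth_on f S \<Longrightarrow> smooth_on g S"
  unfolding smooth_on_def using times_differentiable_on_cong by blast

lemma smooth_on_subset: "smooth_on f S \<Longrightarrow> T \<subseteq> S \<Longrightarrow> smooth_on f T"
  unfolding smooth_on_def using times_differentiable_on_subset by blast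

lemma smooth_on_UN:
  "(\<And>i. i \<in> I \<Longrightarrow> open (S i)) \<Longrightarrow> (\<And>i. i \<in> I \<Longrightarrow> smooth_on f (S i)) \<Longrightarrow> smooth_on f (\<Union>i\<in>I. S i)"
  unfolding smooth_on_def using times_differentiable_on_UN by blast

lemma smooth_on_local:
  assumes "\<And>x. x \<in> S \<Longrightarrow> \<exists>U g. open U \<and> x \<in> U \<and> smooth_on g U \<and> (\<forall>y\<in>U. f y = g y)"
  shows "smooth_on f S"
proof -
  obtain U g where U: "\<And>x. x \<in> S \<Longrightarrow> open (U x) \<and> x \<in> U x \<and> smooth_on (g x) (U x) \<and> (\<forall>y\<in>U x. f y = g x y)"
    using assms by metis
  have "smooth_on f (U x)" if "x \<in> S" for x
    using U[OF that] by (metis smooth_on_cong)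
  then have "smooth_on f (\<Union>x\<in>S. U x)" using U by (intro smooth_on_UN) auto
  then show ?thesis by (rule smooth_on_subset) (use U in auto)
qed

lemma smooth_on_const: "open S \<Longrightarrow> smooth_on (\<lambda>x. c) S"
  by (simp add: smooth_on_def times_differentiable_on_const)

lemma smooth_on_ident: "open S \<Longrightarrow> smooth_on (\<lambda>x. x) S"
  by (simp add: smooth_on_def times_differentiable_on_ident)

lemma (in bounded_linear) smooth_on:
  "open S \<Longrightarrow> smooth_on g S \<Longrightarrow> smooth_on (\<lambda>x. f (g x)) S"
  by (simp add: smooth_on_def times_differentiable_on)

lemma (in bounded_bilinear) smooth_on:
  "open S \<Longrightarrow> smooth_on f S \<Longrightarrow> smooth_on g S \<Longrightarrow> smooth_on (\<lambda>x. prod (f x) (g x)) S"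
  by (simp add: smooth_on_def times_differentiable_on)

lemma smooth_on_add: "open S \<Longrightarrow> smooth_on f S \<Longrightarrow> smooth_on g S \<Longrightarrow> smooth_on (\<lambda>x. f x + g x) S"
  by (simp add: smooth_on_def times_differentiable_on_add)

lemma smooth_on_sum:
  "open S \<Longrightarrow> (\<And>i. i \<in> I \<Longrightarrow> smooth_on (f i) S) \<Longrightarrow> smooth_on (\<lambda>x. \<Sum>i\<in>I. f i x) S"
  by (simp add: smooth_on_def times_differentiable_on_sum)

lemmas smooth_on_scaleR = bounded_bilinear.smooth_on[OF bounded_bilinear_scaleR]
lemmas smooth_on_inner = bounded_bilinear.smooth_on[OF bounded_bilinear_inner]
lemmas smooth_on_fst = bounded_linear.smooth_on[OF bounded_linear_fst]
lemmas smooth_on_snd = bounded_linear.smooth_on[OF bounded_linear_snd]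
lemmas smooth_on_minus = bounded_linear.smooth_on[OF bounded_linear_minus[OF bounded_linear_ident]]

lemma smooth_on_mult:
  fixes f g :: "'e::real_normed_vector \<Rightarrow> real"
  shows "open S \<Longrightarrow> smooth_on f S \<Longrightarrow> smooth_on g S \<Longrightarrow> smooth_on (\<lambda>x. f x * g x) S"
  by (rule bounded_bilinear.smooth_on[OF bounded_bilinear_mult])

lemma smooth_on_diff: "open S \<Longrightarrow> smooth_on f S \<Longrightarrow> smooth_on g S \<Longrightarrow> smooth_on (\<lambda>x. f x - g x) S"
  using smooth_on_add[of S f "\<lambda>x. - g x"] smooth_on_minus by fastforce

lemma smooth_on_Pair:
  assumes "open S" "smooth_on f S" "smooth_on g S" shows "smooth_on (\<lambda>x. (f x, g x)) S"
proof -
  have "smooth_on (\<lambda>x. (f x, 0) + (0, g x)) S"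
    by (intro smooth_on_add assms bounded_linear.smooth_on[OF bounded_linear_Pair[OF bounded_linear_ident bounded_linear_zero]]
       bounded_linear.smooth_on[OF bounded_linear_Pair[OF bounded_linear_zero bounded_linear_ident]])
  then show ?thesis by simp
qed

lemma smooth_on_compose:
  fixes f :: "'e::real_normed_vector \<Rightarrow> 'f::euclidean_space"
  shows "open S \<Longrightarrow> smooth_on f S \<Longrightarrow> smooth_on g T \<Longrightarrow> f ` S \<subseteq> T \<Longrightarrow> smooth_on (\<lambda>x. g (f x)) S"
  unfolding smooth_on_def by (blast intro: times_differentiable_on_compose)

lemma smooth_on_has_derivative:
  "smooth_on f S \<Longrightarrow> x \<in> S \<Longrightarrow> (f has_derivative frechet_derivative f (at x)) (at x)"
  using smooth_onD times_differentiable_on_SucD by blast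

lemma smooth_on_frechet_derivative:
  "smooth_on f S \<Longrightarrow> smooth_on (\<lambda>x. frechet_derivative f (at x) v) S"
  unfolding smooth_on_def by (metis times_differentiable_on.simps(2))

lemma smooth_on_imp_continuous_on: "smooth_on f S \<Longrightarrow> continuous_on S f"
  by (metis smooth_on_def times_differentiable_on.simps(1))

text \<open>Joint smoothness in point and direction, once more by expanding the direction in
  \<open>Basis\<close>.\<close>

lemma smooth_on_frechet_derivative_apply:
  fixes f :: "'e::euclidean_space \<Rightarrow> 'f::real_normed_vector"
  assumes "open T" "smooth_on f S" "open S" "smooth_on g T" "smooth_on h T" "g ` T \<subseteq> S"
  shows "smooth_on (\<lambda>x. frechet_derivative f (at (g x)) (h x)) T"
proof -
  have "smooth_on (\<lambda>x. \<Sum>b\<in>Basis. (h x \<bullet> b) *\<^sub>R frechet_derivative f (at (g x)) b) T"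
    using assms by (intro smooth_on_sum smooth_on_scaleR bounded_linear.smooth_on[OF bounded_linear_inner_left]
      smooth_on_compose[OF _ _ smooth_on_frechet_derivative]) auto
  moreover have "(\<Sum>b\<in>Basis. (h x \<bullet> b) *\<^sub>R frechet_derivative f (at (g x)) b) = frechet_derivative f (at (g x)) (h x)"
    if "x \<in> T" for x
    by (rule linear_eq_sum_Basis[symmetric], rule has_derivative_linear, rule smooth_on_has_derivative[OF assms(2)])
      (use that assms(6) in auto)
  ultimately show ?thesis
    by (rule smooth_on_cong[OF assms(1), rotated]) assumption
qed

lemma times_differentiable_on_real_SucI:
  fixes f :: "real \<Rightarrow> 'f::real_normed_vector"
  assumes "open S" "\<And>x. x \<in> S \<Longrightarrow> (f has_vector_derivative f' x) (at x)" "times_differentiable_on k f' S"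
  shows "times_differentiable_on (Suc k) f S"
  by (rule times_differentiable_on_SucI[OF assms(1) assms(2)[unfolded has_vector_derivative_def]])
    (assumption, rule bounded_linear.times_differentiable_on[OF bounded_linear_scaleR_right assms(1) assms(3)])

lemma smooth_on_real_inverse:
  assumes "open S" "0 \<notin> S" shows "smooth_on (\<lambda>x::real. inverse x) S"
proof (rule smooth_onI)
  show "times_differentiable_on k (\<lambda>x::real. inverse x) S" for k
  proof (induction k)
    case 0
    show ?case using assms by (auto intro!: continuous_intros)
  next
    case (Suc k)
    show ?case
    proof (rule times_differentiable_on_real_SucI[OF assms(1), where f'="\<lambda>x. - (inverse x * inverse x)"])
      show "((\<lambda>x::real. inverse x) has_vector_derivative - (inverse x * inverse x)) (at x)" if "x \<in> S" for x
        unfolding has_real_derivative_iff_has_vector_derivative[symmetric]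
        using that assms by (auto intro!: derivative_eq_intros)
      show "times_differentiable_on k (\<lambda>x::real. - (inverse x * inverse x)) S"
        by (intro bounded_linear.times_differentiable_on[OF bounded_linear_minus[OF bounded_linear_ident]] assms Suc
           bounded_bilinear.times_differentiable_on[OF bounded_bilinear_mult])
    qed
  qed
qed

lemma smooth_on_divide:
  fixes f g :: "'e::real_normed_vector \<Rightarrow> real"
  assumes "open S" "smooth_on f S" "smooth_on g S" "\<And>x. x \<in> S \<Longrightarrow> g x \<noteq> 0"
  shows "smooth_on (\<lambda>x. f x / g x) S"
  unfolding divide_inverse
  by (intro smooth_on_mult assms smooth_on_compose[OF _ _ smooth_on_real_inverse[of "- {0}"]]) (use assms in auto)

lemma smooth_on_sin_cos: "smooth_on (sin::real\<Rightarrow>real) UNIV" "smooth_on (cos::real\<Rightarrow>real) UNIV"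
proof -
  have "times_differentiable_on k (sin::real\<Rightarrow>real) UNIV \<and> times_differentiable_on k (cos::real\<Rightarrow>real) UNIV" for k
  proof (induction k)
    case (Suc k)
    have "times_differentiable_on k (\<lambda>x::real. - sin x) UNIV"
      by (rule bounded_linear.times_differentiable_on[OF bounded_linear_minus[OF bounded_linear_ident]]) (use Suc in auto)
    moreover have "(sin has_vector_derivative cos x) (at x)" "(cos has_vector_derivative - sin x) (at x)" for x :: real
      unfolding has_real_derivative_iff_has_vector_derivative[symmetric] by (auto intro!: derivative_eq_intros)
    ultimately show ?case
      using Suc times_differentiable_on_real_SucI[of UNIV sin cos k]
        times_differentiable_on_real_SucI[of UNIV cos "\<lambda>x. - sin x" k]
      by blast
  qed (auto intro!: continuous_intros)
  then show "smooth_on (sin::real\<Rightarrow>real) UNIV" "smooth_on (cos::real\<Rightarrow>real) UNIV" by (auto simp: smooth_on_def)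
qed

section \<open>Bump functions and the inverse function theorem\<close>

text \<open>For \<open>p = 1\<close> this is the classical function all of whose derivatives vanish
  at 0. The polynomial is carried along because the derivatives of exp(-1/x) are polynomials in 1/x
  times exp(-1/x), so the family is closed under differentiation.\<close>

definition flat :: "real poly \<Rightarrow> real \<Rightarrow> real" where
  "flat p x = (if 0 < x then poly p (1 / x) * exp (- (1 / x)) else 0)"

lemma tendsto_poly_exp: "((\<lambda>u::real. poly p u * exp (- u)) \<longlongrightarrow> 0) at_top"
proof -
  have "((\<lambda>u. \<Sum>i\<le>degree p. coeff p i * (u ^ i / exp u)) \<longlongrightarrow> (\<Sum>i\<le>degree p. coeff p i * 0)) at_top"
    by (intro tendsto_intros tendsto_power_div_exp_0)
  moreover have "(\<Sum>i\<le>degree p. coeff p i * (u ^ i / exp u)) = poly p u * exp (- u)" for u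
    by (simp add: poly_altdef sum_distrib_right exp_minus divide_inverse mult.assoc)
  ultimately show ?thesis by simp
qed

text \<open>With u = 1/x one has d/dx = - u^2 d/du, and applied to p(u) exp(-u) this gives u^2 (p -
  p') exp(-u): hence the polynomial in the statement. At x = 0 the right difference quotient is u
  p(u) exp(-u), which tends to 0 as u grows.\<close>

lemma flat_has_derivative:
  "(flat p has_real_derivative flat (monom 1 2 * (p - pderiv p)) x) (at x)"
proof -
  consider "x < 0" | "x = 0" | "x > 0" by linarith
  then show ?thesis
  proof cases
    case 1
    have "((\<lambda>_. 0) has_real_derivative 0) (at x)" by simp
    then have "(flat p has_real_derivative 0) (at x)"
      by (rule has_field_derivative_transform_within_open[where S="{..<0}"]) (use 1 in \<open>auto simp: flat_def\<close>)
    then show ?thesis using 1 by (simp add: flat_def)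
  next
    case 2
    have "((\<lambda>h. flat p h / h) \<longlongrightarrow> 0) (at_right 0)"
    proof (rule tendsto_cong[THEN iffD2])
      show "\<forall>\<^sub>F h in at_right 0. flat p h / h = poly (p * monom 1 1) (inverse h) * exp (- inverse h)"
        by (rule eventually_at_rightI[of 0 1]) (auto simp: flat_def poly_monom divide_inverse)
      show "((\<lambda>h. poly (p * monom 1 1) (inverse h) * exp (- inverse h)) \<longlongrightarrow> (0::real)) (at_right 0)"
        by (rule filterlim_compose[OF tendsto_poly_exp filterlim_inverse_at_top_right])
    qed
    moreover have "((\<lambda>h. flat p h / h) \<longlongrightarrow> 0) (at_left 0)"
    proof (rule tendsto_cong[THEN iffD2])
      show "\<forall>\<^sub>F h in at_left 0. flat p h / h = 0"
        by (rule eventually_at_leftI[of "-1" 0]) (auto simp: flat_def)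
    qed simp
    ultimately have "((\<lambda>h. flat p h / h) \<longlongrightarrow> 0) (at 0)" by (simp add: filterlim_split_at)
    then show ?thesis using 2 by (simp add: DERIV_def flat_def)
  next
    case 3
    have "((\<lambda>x. poly p (1 / x) * exp (- (1 / x))) has_real_derivative
        flat (monom 1 2 * (p - pderiv p)) x) (at x)"
      using 3 by (auto intro!: derivative_eq_intros DERIV_chain2[OF poly_DERIV]
        simp: flat_def poly_monom field_simps power2_eq_square)
    then show ?thesis
      by (rule has_field_derivative_transform_within_open[where S="{0<..}"]) (use 3 in \<open>auto simp: flat_def\<close>)
  qed
qed

lemma smooth_on_flat: "smooth_on (flat p) UNIV"
proof (rule smooth_onI)
  show "times_differentiable_on k (flat p) UNIV" for k
  proof (induction k arbitrary: p)
    case 0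
    show ?case
      using DERIV_isCont[OF flat_has_derivative[of p]] by (simp add: continuous_on_eq_continuous_at)
  next
    case (Suc k)
    show ?case
      using times_differentiable_on_real_SucI[of UNIV "flat p", OF open_UNIV _ Suc.IH]
        flat_has_derivative[unfolded has_real_derivative_iff_has_vector_derivative] by blast
  qed
qed

lemma flat_1: "flat 1 x > 0 \<longleftrightarrow> x > 0" "flat 1 x \<ge> 0" "x \<le> 0 \<Longrightarrow> flat 1 x = 0"
  by (auto simp: flat_def)

definition smooth_step :: "real \<Rightarrow> real" where
  "smooth_step x = flat 1 x / (flat 1 x + flat 1 (1 - x))"

lemma smooth_step_denominator: "flat 1 x + flat 1 (1 - x) > 0"
  using flat_1(1,2)[of x] flat_1(1,2)[of "1 - x"] by (cases "x > 0") (auto intro: add_pos_nonneg add_nonneg_pos)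

lemma smooth_on_smooth_step: "smooth_on smooth_step UNIV"
  unfolding smooth_step_def
proof (intro smooth_on_divide smooth_on_add smooth_on_flat)
  show "smooth_on (\<lambda>x. flat 1 (1 - x)) UNIV"
    by (rule smooth_on_compose[OF _ _ smooth_on_flat]) (auto intro!: smooth_on_diff smooth_on_const smooth_on_ident)
  show "flat 1 x + flat 1 (1 - x) \<noteq> 0" for x using smooth_step_denominator[of x] by simp
qed auto

lemma smooth_step_bounds: "0 \<le> smooth_step x" "smooth_step x \<le> 1"
  using smooth_step_denominator[of x] flat_1(2)[of x] flat_1(2)[of "1 - x"]
  by (auto simp: smooth_step_def divide_simps)

lemma smooth_step_0: "x \<le> 0 \<Longrightarrow> smooth_step x = 0"
  by (simp add: smooth_step_def flat_1)

lemma smooth_step_1: "x \<ge> 1 \<Longrightarrow> smooth_step x = 1"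
  using smooth_step_denominator[of x] by (simp add: smooth_step_def flat_1(3))

text \<open>The value 1 is attained on a whole neighbourhood \<open>V\<close> of \<open>K\<close>,
  so that multiplying by \<open>h\<close> alters no derivative at points of \<open>K\<close>. The
  function vanishes off a compact \<open>C\<close> inside \<open>U\<close>, so that its product with
  a function defined on \<open>U\<close> only extends by zero.\<close>

lemma smooth_bump:
  fixes K U :: "'e::euclidean_space set"
  assumes "compact K" "open U" "K \<subseteq> U"
  obtains h :: "'e \<Rightarrow> real" and V C where "smooth_on h UNIV" "open V" "K \<subseteq> V" "\<And>x. x \<in> V \<Longrightarrow> h x = 1"
    "compact C" "C \<subseteq> U" "\<And>x. x \<notin> C \<Longrightarrow> h x = 0" "\<And>x. 0 \<le> h x" "\<And>x. h x \<le> 1"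
proof -
  have "\<forall>x\<in>K. \<exists>r>0. cball x r \<subseteq> U" using assms open_contains_cball by blast
  then obtain r where r: "\<And>x. x \<in> K \<Longrightarrow> r x > 0 \<and> cball x (r x) \<subseteq> U" by metis
  have "K \<subseteq> (\<Union>x\<in>K. ball x (r x))" using r by force
  then obtain D where D: "D \<subseteq> K" "finite D" "K \<subseteq> (\<Union>x\<in>D. ball x (r x))"
    using compactE_image[OF assms(1), of K "\<lambda>x. ball x (r x)"] by auto
  \<comment> \<open>Each summand is positive exactly on the open ball about its centre
    \<open>x\<close>; the squared distance keeps the argument smooth at the centre.\<close>
  define s where "s y = (\<Sum>x\<in>D. flat 1 ((r x)\<^sup>2 - (y - x) \<bullet> (y - x)))" for y
  have s: "smooth_on s UNIV"
    unfolding s_def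
    by (intro smooth_on_sum smooth_on_compose[OF _ _ smooth_on_flat] smooth_on_diff smooth_on_inner
        smooth_on_const smooth_on_ident) auto
  have inside: "flat 1 ((r x)\<^sup>2 - (y - x) \<bullet> (y - x)) > 0 \<longleftrightarrow> y \<in> ball x (r x)" if "x \<in> K" for x y
    unfolding flat_1(1) dot_square_norm
    using r[OF that] power2_less_imp_less[of "norm (y - x)" "r x"] power_strict_mono[of "norm (y - x)" "r x" 2]
    by (auto simp: dist_norm norm_minus_commute)
  have nonneg: "s y \<ge> 0" for y unfolding s_def by (intro sum_nonneg flat_1)
  have pos: "s y > 0" if "y \<in> K" for y
  proof -
    obtain x where "x \<in> D" "y \<in> ball x (r x)" using D(3) \<open>y \<in> K\<close> by auto
    then show ?thesis unfolding s_def using D inside flat_1(2) by (intro sum_pos2[of D x]) auto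
  qed
  obtain \<delta> where \<delta>: "\<delta> > 0" "\<And>y. y \<in> K \<Longrightarrow> s y \<ge> \<delta>"
  proof (cases "K = {}")
    case True then show ?thesis using that[of 1] by auto
  next
    case False
    obtain z where "z \<in> K" "\<And>y. y \<in> K \<Longrightarrow> s z \<le> s y"
      using continuous_attains_inf[OF assms(1) False, of s] smooth_on_imp_continuous_on[OF s] continuous_on_subset
      by blast
    then show ?thesis using that[of "s z"] pos by auto
  qed
  define C where "C = (\<Union>x\<in>D. cball x (r x))"
  have zero: "s y = 0" if "y \<notin> C" for y
  proof -
    have "flat 1 ((r x)\<^sup>2 - (y - x) \<bullet> (y - x)) = 0" if "x \<in> D" for x
    proof -
      have "y \<notin> ball x (r x)" using \<open>y \<notin> C\<close> that by (force simp: C_def)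
      then show ?thesis using inside[of x y] that D flat_1(2)[of "(r x)\<^sup>2 - (y - x) \<bullet> (y - x)"] by force
    qed
    then show ?thesis by (simp add: s_def)
  qed
  show ?thesis
  \<comment> \<open>\<open>s\<close> is at least \<delta> on \<open>K\<close>, so the threshold
    \<delta>/2 leaves an open margin around \<open>K\<close>; the factor \<open>2 / \<delta>\<close>
    moves this threshold to 1, where \<open>smooth_step\<close> is constant.\<close>
  proof (rule that[of "\<lambda>y. smooth_step (2 / \<delta> * s y)" "{y. s y > \<delta> / 2}" C])
    show "smooth_on (\<lambda>y. smooth_step (2 / \<delta> * s y)) UNIV"
      by (intro smooth_on_compose[OF _ _ smooth_on_smooth_step] smooth_on_mult smooth_on_const s) auto
    show "open {y. s y > \<delta> / 2}"
      by (intro open_Collect_less continuous_on_const smooth_on_imp_continuous_on[OF s])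
    show "K \<subseteq> {y. s y > \<delta> / 2}" using \<delta> by force
    show "smooth_step (2 / \<delta> * s x) = 1" if "x \<in> {y. s y > \<delta> / 2}" for x
      using that \<delta>(1) by (intro smooth_step_1) (simp add: field_simps)
    show "compact C" unfolding C_def using D by (intro compact_UN) auto
    show "C \<subseteq> U" unfolding C_def using D r by blast
    show "smooth_step (2 / \<delta> * s x) = 0" if "x \<notin> C" for x
      using zero[OF that] by (simp add: smooth_step_0)
  qed (rule smooth_step_bounds)+
qed

text \<open>\<open>A y0\<close> is bounded below by some c > 0, and for y near y0 the perturbation
  costs at most c/2. Hence the solution moves by at most 2/c times the residual
  \<open>w y - A y u\<close> of the old solution \<open>u\<close>, and this residual tends to
  0.\<close>

lemma continuous_on_inverse_apply:
  fixes A :: "'y::topological_space \<Rightarrow> 'e::euclidean_space \<Rightarrow> 'e"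
  assumes lin: "\<And>y. y \<in> V \<Longrightarrow> linear (A y)" and bij: "\<And>y. y \<in> V \<Longrightarrow> bij (A y)"
    and cont: "\<And>e. continuous_on V (\<lambda>y. A y e)" and w: "continuous_on V w"
  shows "continuous_on V (\<lambda>y. inv (A y) (w y))"
  unfolding continuous_on_def
proof (rule ballI)
  fix y0 assume y0: "y0 \<in> V"
  define u where "u = inv (A y0) (w y0)"
  have u: "A y0 u = w y0" unfolding u_def using bij[OF y0] by (simp add: bij_is_surj surj_f_inv_f)
  obtain c where c: "c > 0" "\<And>x. c * norm x \<le> norm (A y0 x)"
    using linear_inj_bounded_below_pos[OF lin[OF y0] bij_is_inj[OF bij[OF y0]]] by blast
  let ?F = "at y0 within V"
  define d where "d y = (\<Sum>b\<in>Basis. norm (A y b - A y0 b))" for y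
  have "(d \<longlongrightarrow> (\<Sum>b\<in>(Basis::'e set). norm (A y0 b - A y0 b))) ?F"
    unfolding d_def using cont y0 by (intro tendsto_intros) (auto simp: continuous_on_def)
  then have "(d \<longlongrightarrow> 0) ?F" by simp
  then have ev: "\<forall>\<^sub>F y in ?F. d y < c / 2" using c(1) by (intro order_tendstoD(2)) auto
  have near: "norm (A y x - A y0 x) \<le> d y * norm x" if "y \<in> V" for x y
  proof -
    have "A y x - A y0 x = (\<Sum>b\<in>Basis. (x \<bullet> b) *\<^sub>R (A y b - A y0 b))"
      using linear_eq_sum_Basis[OF lin[OF that], of x] linear_eq_sum_Basis[OF lin[OF y0], of x]
      by (simp add: scaleR_diff_right sum_subtractf)
    also have "norm \<dots> \<le> (\<Sum>b\<in>(Basis::'e set). norm x * norm (A y b - A y0 b))"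
      by (rule sum_norm_le) (auto intro!: mult_right_mono Basis_le_norm)
    finally show ?thesis by (simp add: d_def sum_distrib_left[symmetric] mult.commute)
  qed
  have "((\<lambda>y. 2 / c * norm (w y - A y u)) \<longlongrightarrow> 2 / c * norm (w y0 - A y0 u)) ?F"
    using w cont y0 by (intro tendsto_intros) (auto simp: continuous_on_def)
  then have lim: "((\<lambda>y. 2 / c * norm (w y - A y u)) \<longlongrightarrow> 0) ?F" by (simp add: u)
  have ev_V: "\<forall>\<^sub>F y in ?F. y \<in> V" by (simp add: eventually_at_filter)
  have "\<forall>\<^sub>F y in ?F. norm (inv (A y) (w y) - u) \<le> 2 / c * norm (w y - A y u)"
    using eventually_conj[OF ev ev_V]
  proof (rule eventually_mono)
    fix y assume y: "d y < c / 2 \<and> y \<in> V"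
    let ?x = "inv (A y) (w y) - u"
    have Ay: "A y (inv (A y) (w y)) = w y" using bij y by (simp add: bij_is_surj surj_f_inv_f)
    have "c * norm ?x \<le> norm (A y0 ?x)" by (rule c(2))
    also have "\<dots> \<le> norm (A y ?x) + norm (A y ?x - A y0 ?x)" by norm
    also have "\<dots> \<le> norm (A y ?x) + d y * norm ?x" using near y by auto
    also have "\<dots> \<le> norm (A y ?x) + c / 2 * norm ?x"
      using y by (intro add_left_mono mult_right_mono) auto
    also have "A y ?x = w y - A y u" using linear_diff[OF lin, of y] y Ay by simp
    finally have "c / 2 * norm ?x \<le> norm (w y - A y u)" by linarith
    then show "norm ?x \<le> 2 / c * norm (w y - A y u)" using c(1) by (simp add: field_simps)
  qed
  then have "((\<lambda>y. inv (A y) (w y) - u) \<longlongrightarrow> 0) ?F"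
    by (rule Lim_null_comparison[OF _ lim])
  then show "((\<lambda>y. inv (A y) (w y)) \<longlongrightarrow> inv (A y0) (w y0)) ?F"
    unfolding u_def[symmetric] by (rule Lim_null[THEN iffD2])
qed

text \<open>The formula comes from differentiating A u = w and solving A u' = w' - A' u.
  Differentiability itself is obtained by viewing (y, e) \<mapsto> (y, A y e) as an invertible map
  \<open>F\<close> and differentiating its inverse \<open>G\<close>.\<close>

lemma has_derivative_inverse_apply:
  fixes A :: "'y::euclidean_space \<Rightarrow> 'e::euclidean_space \<Rightarrow> 'e"
  assumes "open V" and lin: "\<And>y. y \<in> V \<Longrightarrow> linear (A y)" and bij: "\<And>y. y \<in> V \<Longrightarrow> bij (A y)"
    and A: "\<And>e y. y \<in> V \<Longrightarrow> ((\<lambda>y. A y e) has_derivative A' e y) (at y)"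
    and w: "(w has_derivative w') (at y0)" and y0: "y0 \<in> V"
  shows "((\<lambda>y. inv (A y) (w y)) has_derivative
    (\<lambda>h. inv (A y0) (w' h - (\<Sum>b\<in>Basis. (inv (A y0) (w y0) \<bullet> b) *\<^sub>R A' b y0 h)))) (at y0)"
proof -
  define F where "F = (\<lambda>(y, e). (y, \<Sum>b\<in>Basis. (e \<bullet> b) *\<^sub>R A y b))"
  define G where "G = (\<lambda>(y, e). (y, inv (A y) e))"
  define u where "u = inv (A y0) (w y0)"
  define F' where "F' = (\<lambda>(h, e). (h, \<Sum>b\<in>Basis. (u \<bullet> b) *\<^sub>R A' b y0 h + (e \<bullet> b) *\<^sub>R A y0 b))"
  define G' where "G' = (\<lambda>(h, e). (h, inv (A y0) (e - (\<Sum>b\<in>Basis. (u \<bullet> b) *\<^sub>R A' b y0 h))))"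
  have AA: "A y (inv (A y) e) = e" if "y \<in> V" for y e using bij[OF that] by (simp add: bij_is_surj surj_f_inv_f)
  have sumA: "(\<Sum>b\<in>Basis. (e \<bullet> b) *\<^sub>R A y b) = A y e" if "y \<in> V" for y e
    using linear_eq_sum_Basis[OF lin[OF that]] by metis
  have linv: "linear (inv (A y0))"
    using lin[OF y0] bij[OF y0] by (metis bij_betw_def inj_linear_imp_inv_linear)
  have linA': "bounded_linear (A' b y0)" for b using A[OF y0] by (rule has_derivative_bounded_linear)
  have F'_deriv: "(F has_derivative F') (at (G (y0, w y0)))"
  proof -
    have "((\<lambda>p. (fst p, \<Sum>b\<in>Basis. (snd p \<bullet> b) *\<^sub>R A (fst p) b)) has_derivative F') (at (y0, u))"
      unfolding F'_def split_def
      by (rule has_derivative_eq_rhs, (rule derivative_intros has_derivative_compose[OF has_derivative_fst[OF has_derivative_ident]] A)+)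
        (simp_all add: y0 add.commute A has_derivative_compose[OF has_derivative_fst[OF has_derivative_ident]])
    then show ?thesis by (simp add: F_def G_def u_def split_def)
  qed
  have G'_lin: "bounded_linear G'"
  proof -
    have "bounded_linear (\<lambda>p. (fst p, inv (A y0) (snd p - (\<Sum>b\<in>Basis. (u \<bullet> b) *\<^sub>R A' b y0 (fst p)))))"
      by (intro bounded_linear_Pair bounded_linear_fst bounded_linear_compose[OF linear_conv_bounded_linear[THEN iffD1, OF linv]]
          bounded_linear_sub bounded_linear_snd bounded_linear_sum bounded_linear_compose[OF bounded_linear_scaleR_right]
          bounded_linear_compose[OF linA'])
    then show ?thesis by (simp add: G'_def split_def)
  qed
  have inv1: "G' \<circ> F' = id"
  proof (rule ext, clarify)
    fix h :: 'y and e :: 'e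
    have "inv (A y0) (A y0 e) = e" using bij[OF y0] by (simp add: bij_is_inj)
    then show "(G' \<circ> F') (h, e) = id (h, e)"
      by (simp add: G'_def F'_def sum.distrib sumA[OF y0])
  qed
  have cont: "continuous (at (y0, w y0)) G"
  proof -
    have "continuous_on (V \<times> UNIV) (\<lambda>p. inv (A (fst p)) (snd p))"
    proof (rule continuous_on_inverse_apply)
      fix e
      have "continuous_on V (\<lambda>y. A y e)"
        by (intro continuous_at_imp_continuous_on ballI has_derivative_continuous[OF A])
      then show "continuous_on (V \<times> UNIV) (\<lambda>p. A (fst p) e)"
        by (rule continuous_on_compose2) (auto intro!: continuous_intros)
    qed (auto simp: lin bij intro!: continuous_intros)
    then have "continuous_on (V \<times> UNIV) G" unfolding G_def split_def by (intro continuous_intros)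
    then show ?thesis using y0 assms(1) by (simp add: continuous_on_eq_continuous_at open_Times)
  qed
  have "(G has_derivative G') (at (y0, w y0))"
    by (rule has_derivative_inverse_basic[OF F'_deriv G'_lin inv1 cont, of "V \<times> UNIV"])
      (use assms(1) y0 in \<open>auto simp: open_Times F_def G_def sumA AA\<close>)
  from has_derivative_compose[OF has_derivative_Pair[OF has_derivative_ident w] this]
  have "((\<lambda>y. snd (G (y, w y))) has_derivative (\<lambda>h. snd (G' (h, w' h)))) (at y0)"
    by (rule has_derivative_snd)
  then show ?thesis by (simp add: G_def G'_def u_def)
qed

text \<open>The derivative is again an inverse applied to a vector, one built from derivatives of
  \<open>A\<close> and \<open>w\<close> and from the function itself. So the induction closes once
  \<open>w\<close> is kept arbitrary.\<close>

lemma times_differentiable_on_inverse_apply: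
  fixes A :: "'y::euclidean_space \<Rightarrow> 'e::euclidean_space \<Rightarrow> 'e"
  assumes "open V" and lin: "\<And>y. y \<in> V \<Longrightarrow> linear (A y)" and bij: "\<And>y. y \<in> V \<Longrightarrow> bij (A y)"
    and "\<And>e. times_differentiable_on k (\<lambda>y. A y e) V" "times_differentiable_on k w V"
  shows "times_differentiable_on k (\<lambda>y. inv (A y) (w y)) V"
  using assms(4,5)
proof (induction k arbitrary: w)
  case 0
  then show ?case using continuous_on_inverse_apply[OF lin bij, where V=V and w=w] by (auto dest: spec)
next
  case (Suc k)
  note k = times_differentiable_on_Suc_imp[OF Suc.prems(1)] times_differentiable_on_Suc_imp[OF Suc.prems(2)]
  note D = times_differentiable_on_SucD[OF Suc.prems(1)] times_differentiable_on_SucD[OF Suc.prems(2)]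
  have "times_differentiable_on k (\<lambda>y. inv (A y) (frechet_derivative w (at y) h -
    (\<Sum>b\<in>Basis. (inv (A y) (w y) \<bullet> b) *\<^sub>R frechet_derivative (\<lambda>y. A y b) (at y) h))) V" for h
    unfolding diff_conv_add_uminus
    by (intro Suc.IH k times_differentiable_on_add times_differentiable_on_sum assms(1)
       bounded_linear.times_differentiable_on[OF bounded_linear_minus[OF bounded_linear_ident]]
       bounded_bilinear.times_differentiable_on[OF bounded_bilinear_scaleR]
       bounded_linear.times_differentiable_on[OF bounded_linear_inner_left])
      (use Suc.prems in auto)
  then show ?case
    by (intro times_differentiable_on_SucI[OF assms(1) has_derivative_inverse_apply[OF assms(1) lin bij D(1) D(2)]]) auto
qed

section \<open>The smooth inverse function theorem\<close>

lemma continuous_on_Blinfun_frechet_derivative: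
  fixes f :: "'e::euclidean_space \<Rightarrow> 'f::real_normed_vector"
  assumes "\<And>x. x \<in> S \<Longrightarrow> f differentiable (at x)" "\<And>v. continuous_on S (\<lambda>x. frechet_derivative f (at x) v)"
  shows "continuous_on S (\<lambda>x. Blinfun (frechet_derivative f (at x)))"
proof (rule continuous_on_blinfun_componentwise)
  fix i :: 'e assume "i \<in> Basis"
  have "bounded_linear (frechet_derivative f (at x))" if "x \<in> S" for x
    using assms(1)[OF that] frechet_derivative_works has_derivative_bounded_linear by blast
  then show "continuous_on S (\<lambda>x. blinfun_apply (Blinfun (frechet_derivative f (at x))) i)"
    by (intro continuous_on_eq[OF assms(2)[of i]]) (simp add: bounded_linear_Blinfun_apply)
qed

text \<open>The classical theorem gives a differentiable inverse whose derivative at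
  \<open>y\<close> is the inverse of the derivative of \<open>f\<close> at \<open>g y\<close>. This
  bootstraps: if \<open>g\<close> is k times differentiable, so is the right side, hence
  \<open>g\<close> is k + 1 times differentiable.\<close>

lemma smooth_inverse_function:
  fixes f :: "'e::euclidean_space \<Rightarrow> 'e"
  assumes "open U" and f: "smooth_on f U" and "x0 \<in> U" and inj: "inj (frechet_derivative f (at x0))"
  obtains U' V g where "open U'" "U' \<subseteq> U" "x0 \<in> U'" "open V" "f x0 \<in> V" "homeomorphism U' V f g"
    "smooth_on g V" "\<And>x. x \<in> U' \<Longrightarrow> inj (frechet_derivative f (at x))"
proof -
  define f' where "f' x = Blinfun (frechet_derivative f (at x))" for x
  have f'[simp]: "blinfun_apply (f' x) = frechet_derivative f (at x)" if "x \<in> U" for x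
    unfolding f'_def using smooth_on_has_derivative[OF f that] has_derivative_bounded_linear bounded_linear_Blinfun_apply by blast
  have cont: "continuous_on U f'"
    unfolding f'_def
    using smooth_on_has_derivative[OF f] smooth_on_imp_continuous_on[OF smooth_on_frechet_derivative[OF f]]
    by (intro continuous_on_Blinfun_frechet_derivative) (auto simp: differentiable_def)
  have lin: "linear (frechet_derivative f (at x))" if "x \<in> U" for x
    using smooth_on_has_derivative[OF f that] has_derivative_linear by blast
  obtain k where k: "linear k" "k \<circ> frechet_derivative f (at x0) = id"
    using linear_injective_left_inverse[OF lin[OF assms(3)] inj] by blast
  have invf: "Blinfun k o\<^sub>L f' x0 = id_blinfun"
    by (rule blinfun_eqI) (use k assms(3) in \<open>simp add: bounded_linear_Blinfun_apply linear_conv_bounded_linear o_def fun_eq_iff\<close>)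
  have der: "(f has_derivative blinfun_apply (f' x)) (at x)" if "x \<in> U" for x
    using smooth_on_has_derivative[OF f that] f'[OF that] by simp
  note inverse_thm = inverse_function_theorem[OF assms(1) der cont assms(3) invf]
  obtain U' V g g' where *: "open U'" "U' \<subseteq> U" "x0 \<in> U'" "open V" "f x0 \<in> V" "homeomorphism U' V f g"
    "\<And>y. y \<in> V \<Longrightarrow> (g has_derivative (g' y)) (at y)"
    "\<And>y. y \<in> V \<Longrightarrow> g' y = inv (blinfun_apply (f'(g y)))"
    "\<And>y. y \<in> V \<Longrightarrow> bij (blinfun_apply (f'(g y)))"
    by (rule inverse_thm) (assumption | rule that)+
  have gU: "g y \<in> U'" if "y \<in> V" for y using *(6) that by (auto simp: homeomorphism_def)
  have "smooth_on g V"
  proof (rule smooth_onI)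
    show "times_differentiable_on k g V" for k
    proof (induction k)
      case 0
      show ?case using *(6) by (simp add: homeomorphism_def)
    next
      case (Suc k)
      have "times_differentiable_on k (\<lambda>y. inv (frechet_derivative f (at (g y))) v) V" for v
      proof (rule times_differentiable_on_inverse_apply[OF *(4)])
        show "times_differentiable_on k (\<lambda>y. frechet_derivative f (at (g y)) e) V" for e
          by (rule times_differentiable_on_compose[OF *(4) Suc smooth_onD[OF smooth_on_frechet_derivative[OF f]]])
            (use gU *(2) in auto)
      qed (use lin gU *(2,4,9) f' in \<open>auto simp: times_differentiable_on_const subset_iff\<close>)
      moreover have "(g has_derivative inv (frechet_derivative f (at (g y)))) (at y)" if "y \<in> V" for y
        using *(7)[OF that] *(8)[OF that] gU[OF that] *(2) f' by (metis subsetD)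
      ultimately show ?case by (intro times_differentiable_on_SucI[OF *(4)]) auto
    qed
  qed
  moreover have "inj (frechet_derivative f (at x))" if "x \<in> U'" for x
  proof -
    have "f x \<in> V" "g (f x) = x" using *(6) that by (auto simp: homeomorphism_def)
    then have "bij (blinfun_apply (f' x))" using *(9)[of "f x"] by simp
    then show ?thesis using that *(2) f'[of x] bij_is_inj by (metis subsetD)
  qed
  ultimately show ?thesis using that *(1-6) by blast
qed

section \<open>Existence and uniqueness for ordinary differential equations\<close>

text \<open>The square \<open>d s \<bullet> d s\<close> is used because the norm is not
  differentiable at 0. The cross term is absorbed by 2 \<epsilon> |d| \<le> |d|^2 + \<epsilon>^2,
  which produces both the extra 1 in the rate \<open>2 * L + 1\<close> and the term \<epsilon>^2
  t.\<close>

lemma gronwall_nonneg: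
  fixes d :: "real \<Rightarrow> 'x::real_inner"
  assumes "0 \<le> t" and d: "\<And>s. s \<in> {0..t} \<Longrightarrow> (d has_vector_derivative d' s) (at s)"
    and bd: "\<And>s. s \<in> {0..t} \<Longrightarrow> norm (d' s) \<le> L * norm (d s) + \<epsilon>" and "0 \<le> L"
  shows "(norm (d t))\<^sup>2 \<le> ((norm (d 0))\<^sup>2 + \<epsilon>\<^sup>2 * t) * exp ((2 * L + 1) * t)"
proof -
  \<comment> \<open>The weighted square minus the accumulated error is nonincreasing; for s \<ge> 0
    the weight is at most 1, so the error enters with factor 1.\<close>
  define h where "h s = exp (- ((2 * L + 1) * s)) * (d s \<bullet> d s) - \<epsilon>\<^sup>2 * s" for s
  have "h t \<le> h 0"
  proof (rule DERIV_nonpos_imp_nonincreasing[OF assms(1)])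
    fix s assume s: "0 \<le> s" "s \<le> t"
    define e where "e = exp (- ((2 * L + 1) * s))"
    have e: "0 < e" "e \<le> 1" using s \<open>0 \<le> L\<close> by (auto simp: e_def)
    have dd: "((\<lambda>s. d s \<bullet> d s) has_real_derivative (2 * (d s \<bullet> d' s))) (at s)"
    proof -
      have "(d has_derivative (\<lambda>x. x *\<^sub>R d' s)) (at s)"
        using d[of s] s by (simp add: has_vector_derivative_def)
      from has_derivative_inner[OF this this]
      show ?thesis unfolding has_field_derivative_def
        by (rule has_derivative_eq_rhs) (auto simp: inner_commute)
    qed
    have "(h has_real_derivative (e * (2 * (d s \<bullet> d' s)) + (- (2 * L + 1)) * e * (d s \<bullet> d s) - \<epsilon>\<^sup>2)) (at s)"
      unfolding h_def e_def by (rule derivative_eq_intros dd refl | simp)+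
    moreover have "e * (2 * (d s \<bullet> d' s)) + (- (2 * L + 1)) * e * (d s \<bullet> d s) - \<epsilon>\<^sup>2 \<le> 0"
    proof -
      have "d s \<bullet> d' s \<le> norm (d s) * norm (d' s)" by (rule norm_cauchy_schwarz)
      also have "\<dots> \<le> norm (d s) * (L * norm (d s) + \<epsilon>)" using bd s by (intro mult_left_mono) auto
      finally have "2 * (d s \<bullet> d' s) - (2 * L + 1) * (d s \<bullet> d s) \<le> 2 * \<epsilon> * norm (d s) - (norm (d s))\<^sup>2"
        by (simp add: dot_square_norm power2_eq_square algebra_simps)
      also have "\<dots> \<le> \<epsilon>\<^sup>2" using zero_le_power2[of "\<epsilon> - norm (d s)"] by (simp add: power2_diff)
      finally have "e * (2 * (d s \<bullet> d' s) - (2 * L + 1) * (d s \<bullet> d s)) \<le> e * \<epsilon>\<^sup>2"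
        using e by (intro mult_left_mono) auto
      also have "\<dots> \<le> \<epsilon>\<^sup>2" using e by (simp add: mult_left_le_one_le)
      finally show ?thesis by (simp add: algebra_simps)
    qed
    ultimately show "\<exists>y. (h has_real_derivative y) (at s) \<and> y \<le> 0" by blast
  qed
  then have "exp (- ((2 * L + 1) * t)) * (norm (d t))\<^sup>2 \<le> (norm (d 0))\<^sup>2 + \<epsilon>\<^sup>2 * t"
    by (simp add: h_def dot_square_norm)
  then have "exp ((2 * L + 1) * t) * (exp (- ((2 * L + 1) * t)) * (norm (d t))\<^sup>2)
    \<le> exp ((2 * L + 1) * t) * ((norm (d 0))\<^sup>2 + \<epsilon>\<^sup>2 * t)" by (intro mult_left_mono) auto
  moreover have "exp ((2 * L + 1) * t) * (exp (- ((2 * L + 1) * t)) * (norm (d t))\<^sup>2) = (norm (d t))\<^sup>2"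
    by (simp add: exp_minus)
  ultimately show ?thesis by (simp only: mult.commute)
qed

lemma has_vector_derivative_reflect:
  assumes "(f has_vector_derivative f') (at (- s))"
  shows "((\<lambda>s. f (- s)) has_vector_derivative - f') (at (s::real))"
  using vector_diff_chain_at[of uminus "-1" s f f'] assms
  by (simp add: o_def has_vector_derivative_minus[OF has_vector_derivative_id])

lemma gronwall:
  fixes d :: "real \<Rightarrow> 'x::real_inner"
  assumes d: "\<And>s. \<bar>s\<bar> \<le> T \<Longrightarrow> (d has_vector_derivative d' s) (at s)"
    and bd: "\<And>s. \<bar>s\<bar> \<le> T \<Longrightarrow> norm (d' s) \<le> L * norm (d s) + \<epsilon>" and "0 \<le> L" and "\<bar>t\<bar> \<le> T"
  shows "(norm (d t))\<^sup>2 \<le> ((norm (d 0))\<^sup>2 + \<epsilon>\<^sup>2 * T) * exp ((2 * L + 1) * T)"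
proof -
  have "(norm (d t))\<^sup>2 \<le> ((norm (d 0))\<^sup>2 + \<epsilon>\<^sup>2 * \<bar>t\<bar>) * exp ((2 * L + 1) * \<bar>t\<bar>)"
  proof (cases "t \<ge> 0")
    case True
    then show ?thesis using gronwall_nonneg[of t d d' L \<epsilon>] assms by auto
  next
    case False
    have "(norm (d (- \<bar>t\<bar>)))\<^sup>2 \<le> ((norm (d (- 0)))\<^sup>2 + \<epsilon>\<^sup>2 * \<bar>t\<bar>) * exp ((2 * L + 1) * \<bar>t\<bar>)"
      by (rule gronwall_nonneg[where d="\<lambda>s. d (- s)" and d'="\<lambda>s. - d' (- s)"])
        (use assms in \<open>auto intro!: has_vector_derivative_reflect\<close>)
    then show ?thesis using False by simp
  qed
  also have "\<dots> \<le> ((norm (d 0))\<^sup>2 + \<epsilon>\<^sup>2 * T) * exp ((2 * L + 1) * T)"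
    using assms(3,4) by (intro mult_mono add_mono mult_left_mono iffD2[OF exp_le_cancel_iff]) auto
  finally show ?thesis .
qed

section \<open>Global solutions by a weighted contraction\<close>

definition antideriv :: "(real \<Rightarrow> 'x::euclidean_space) \<Rightarrow> real \<Rightarrow> 'x" where
  "antideriv g t = integral {0..t} g - integral {t..0} g"

lemma antideriv_0[simp]: "antideriv g 0 = 0" by (simp add: antideriv_def)

lemma antideriv_deriv:
  assumes g: "continuous_on UNIV g"
  shows "(antideriv g has_vector_derivative g t) (at t)"
proof -
  define T where "T = \<bar>t\<bar> + 1"
  have int: "g integrable_on {a..b}" for a b :: real
    using integrable_continuous_real continuous_on_subset[OF g] by blast
  have eq: "integral {-T..s} g - integral {-T..0} g = antideriv g s" if "s \<in> {-T<..<T}" for s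
  proof (cases "s \<ge> 0")
    case True
    then have "integral {-T..0} g + integral {0..s} g = integral {-T..s} g"
      using int by (intro Henstock_Kurzweil_Integration.integral_combine) (auto simp: T_def)
    moreover have "integral {s..0} g = 0" using True by (cases "s = 0") auto
    ultimately show ?thesis by (simp add: antideriv_def algebra_simps)
  next
    case False
    then have "integral {-T..s} g + integral {s..0} g = integral {-T..0} g"
      using int that by (intro Henstock_Kurzweil_Integration.integral_combine) auto
    then show ?thesis using False by (simp add: antideriv_def algebra_simps)
  qed
  have "((\<lambda>u. integral {-T..u} g) has_vector_derivative g t) (at t within {-T..T})"
    by (rule integral_has_vector_derivative) (auto intro: continuous_on_subset[OF g] simp: T_def)
  then have "((\<lambda>u. integral {-T..u} g) has_vector_derivative g t) (at t)"
    by (subst (asm) at_within_Icc_at) (auto simp: T_def)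
  then have "((\<lambda>u. integral {-T..u} g - integral {-T..0} g) has_vector_derivative g t - 0) (at t)"
    by (intro has_vector_derivative_diff has_vector_derivative_const)
  then have "((\<lambda>u. integral {-T..u} g - integral {-T..0} g) has_vector_derivative g t) (at t)" by simp
  then show ?thesis
    by (rule has_vector_derivative_transform_within_open[where S="{-T<..<T}"]) (simp_all add: eq, auto simp: T_def)
qed

text \<open>Integration improves an exponential bound by the factor 1/K. This gain makes the Picard
  operator a contraction on the whole line.\<close>

lemma antideriv_bound:
  assumes g: "continuous_on UNIV g" and bd: "\<And>t. norm (g t) \<le> C * exp (K * \<bar>t\<bar>)" and "K > 0"
  shows "norm (antideriv g t) \<le> C / K * exp (K * \<bar>t\<bar>)"
proof -
  have C: "C \<ge> 0" using bd[of 0] norm_ge_zero[of "g 0"] by (simp del: norm_ge_zero)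
  have main: "norm (f t) \<le> C / K * exp (K * t)"
    if f: "\<And>s. (f has_vector_derivative f' s) (at s)" "f 0 = 0" "\<And>s. s \<ge> 0 \<Longrightarrow> norm (f' s) \<le> C * exp (K * s)"
      and t: "0 < t" for f f' :: "real \<Rightarrow> 'a" and t
  proof -
    have "norm (f t - f 0) \<le> C / K * exp (K * t) - C / K * exp (K * 0)"
    proof (rule differentiable_bound_general[OF t, of f "\<lambda>s. C / K * exp (K * s)" f' "\<lambda>s. C * exp (K * s)"])
      show "continuous_on {0..t} f"
        using f(1) has_vector_derivative_continuous by (blast intro: continuous_at_imp_continuous_on)
      show "continuous_on {0..t} (\<lambda>s. C / K * exp (K * s))" by (intro continuous_intros)
      show "((\<lambda>s. C / K * exp (K * s)) has_vector_derivative C * exp (K * x)) (at x)" for x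
        unfolding has_real_derivative_iff_has_vector_derivative[symmetric]
        using \<open>K > 0\<close> by (auto intro!: derivative_eq_intros)
    qed (use f in auto)
    moreover have "C / K \<ge> 0" using C \<open>K > 0\<close> by auto
    ultimately show ?thesis using f(2) by simp
  qed
  consider "t > 0" | "t = 0" | "t < 0" by linarith
  then show ?thesis
  proof cases
    case 1
    have "norm (g s) \<le> C * exp (K * s)" if "s \<ge> 0" for s using bd[of s] that by simp
    then show ?thesis using main[OF antideriv_deriv[OF g], of t] 1 by simp
  next
    case 2
    then show ?thesis using C \<open>K > 0\<close> by simp
  next
    case 3
    have "norm ((\<lambda>s. antideriv g (- s)) (- t)) \<le> C / K * exp (K * (- t))"
      by (rule main[OF has_vector_derivative_reflect[OF antideriv_deriv[OF g]]])
        (use bd 3 in \<open>auto, metis abs_minus_cancel abs_of_nonneg\<close>)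
    then show ?thesis using 3 by simp
  qed
qed

lemma continuous_on_apply2:
  assumes "continuous_on UNIV (\<lambda>(t, x). W t x)" "continuous_on S f" "continuous_on S g"
  shows "continuous_on S (\<lambda>s. W (f s) (g s))"
  using continuous_on_compose2[OF assms(1) continuous_on_Pair[OF assms(2,3)]] by simp

text \<open>A Picard argument in a weighted sup norm: the unknown \<open>u\<close> is the deviation
  x t - x0 divided by exp (K |t|), taken as a bounded continuous function. A single application of
  Banach's theorem then gives a solution for all times.\<close>

lemma ode_exists_uniform:
  fixes W :: "real \<Rightarrow> 'x::euclidean_space \<Rightarrow> 'x"
  assumes cont: "continuous_on UNIV (\<lambda>(t, x). W t x)"
    and lip: "\<And>t x y. norm (W t x - W t y) \<le> L * norm (x - y)"
    and bd: "\<And>t. norm (W t x0) \<le> B"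
  obtains x where "x 0 = x0" "\<And>t. (x has_vector_derivative W t (x t)) (at t)"
proof -
  have contW: "continuous_on UNIV (\<lambda>t. W t (x t))" if "continuous_on UNIV x" for x :: "real \<Rightarrow> 'x"
    using continuous_on_compose2[OF cont, of UNIV "\<lambda>t. (t, x t)"] continuous_on_Pair[OF continuous_on_id that]
    by simp
  \<comment> \<open>The contraction ratio is |L| / K, at most 1/2; the summand 1 keeps K positive
    when L = 0.\<close>
  define K where "K = 2 * \<bar>L\<bar> + 1"
  have K: "K > 0" "\<bar>L\<bar> / K \<le> 1 / 2" "\<bar>L\<bar> / K \<ge> 0" by (auto simp: K_def field_simps)
  have lip: "norm (W t x - W t y) \<le> \<bar>L\<bar> * norm (x - y)" for t x y
    using order_trans[OF lip[of t x y] mult_right_mono[of L "\<bar>L\<bar>" "norm (x - y)"]] by simp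
  define g where "g u t = W t (x0 + exp (K * \<bar>t\<bar>) *\<^sub>R apply_bcontfun u t)" for u t
  have g: "continuous_on UNIV (g u)" for u
    unfolding g_def by (intro contW continuous_intros continuous_on_apply_bcontfun)
  define P where "P u t = exp (- (K * \<bar>t\<bar>)) *\<^sub>R antideriv (g u) t" for u t
  have E: "exp (- (K * \<bar>t\<bar>)) * exp (K * \<bar>t\<bar>) = 1" for t :: real by (simp add: exp_minus)
  have gb: "norm (g u t) \<le> (\<bar>B\<bar> + \<bar>L\<bar> * norm u) * exp (K * \<bar>t\<bar>)" for u t
  proof -
    have "norm (g u t) \<le> norm (W t x0) + norm (g u t - W t x0)" by norm
    also have "\<dots> \<le> \<bar>B\<bar> + \<bar>L\<bar> * norm (exp (K * \<bar>t\<bar>) *\<^sub>R apply_bcontfun u t)"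
      using bd[of t] lip[of t "x0 + exp (K * \<bar>t\<bar>) *\<^sub>R apply_bcontfun u t" x0] unfolding g_def by simp
    also have "\<dots> \<le> \<bar>B\<bar> * exp (K * \<bar>t\<bar>) + \<bar>L\<bar> * (exp (K * \<bar>t\<bar>) * norm u)"
      using K norm_bounded[of u t] by (intro add_mono mult_left_mono) (auto intro!: mult_left_mono mult_le_cancel_left1[THEN iffD2])
    finally show ?thesis by (simp add: algebra_simps)
  qed
  have Pb: "norm (P u t) \<le> (\<bar>B\<bar> + \<bar>L\<bar> * norm u) / K" for u t
  proof -
    have "norm (P u t) \<le> exp (- (K * \<bar>t\<bar>)) * ((\<bar>B\<bar> + \<bar>L\<bar> * norm u) / K * exp (K * \<bar>t\<bar>))"
      unfolding P_def using mult_left_mono[OF antideriv_bound[OF g gb K(1), of u t], of "exp (- (K * \<bar>t\<bar>))"] by simp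
    also have "\<dots> = (\<bar>B\<bar> + \<bar>L\<bar> * norm u) / K * (exp (- (K * \<bar>t\<bar>)) * exp (K * \<bar>t\<bar>))" by (simp only: mult_ac)
    finally show ?thesis by (simp only: E mult_1_right)
  qed
  have Pcont: "continuous_on UNIV (P u)" for u
    unfolding P_def
    by (intro continuous_intros continuous_at_imp_continuous_on ballI has_vector_derivative_continuous[OF antideriv_deriv[OF g]])
  have Pbc: "P u \<in> bcontfun" for u
    using Pcont Pb by (auto simp: bcontfun_def bounded_iff)
  have Papp: "apply_bcontfun (Bcontfun (P u)) = P u" for u by (rule Bcontfun_inverse[OF Pbc])
  have "\<exists>!u. Bcontfun (P u) = u"
  proof (rule banach_fix_type[of "1/2"])
    show "\<forall>u v. dist (Bcontfun (P u)) (Bcontfun (P v)) \<le> 1 / 2 * dist u v"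
    proof (intro allI)
      fix u v :: "real \<Rightarrow>\<^sub>C 'x"
      show "dist (Bcontfun (P u)) (Bcontfun (P v)) \<le> 1 / 2 * dist u v"
      proof (rule dist_bound, unfold Papp)
        fix t
        let ?d = "\<lambda>t. g u t - g v t"
        have db: "norm (?d t) \<le> (\<bar>L\<bar> * dist u v) * exp (K * \<bar>t\<bar>)" for t
        proof -
          have "norm (?d t) \<le> \<bar>L\<bar> * norm (exp (K * \<bar>t\<bar>) *\<^sub>R (apply_bcontfun u t - apply_bcontfun v t))"
            unfolding g_def by (rule order_trans[OF lip]) (simp add: scaleR_diff_right)
          also have "\<dots> \<le> \<bar>L\<bar> * (exp (K * \<bar>t\<bar>) * dist u v)"
            using dist_bounded[of u t v] by (intro mult_left_mono) (auto simp: dist_norm)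
          finally show ?thesis by (simp add: mult_ac)
        qed
        have "antideriv (g u) t - antideriv (g v) t = antideriv ?d t"
          using integrable_continuous_real[OF continuous_on_subset[OF g]]
          by (simp add: antideriv_def integral_diff)
        then have "dist (P u t) (P v t) = exp (- (K * \<bar>t\<bar>)) * norm (antideriv ?d t)"
          by (simp add: P_def dist_norm scaleR_diff_right[symmetric])
        also have "\<dots> \<le> exp (- (K * \<bar>t\<bar>)) * (\<bar>L\<bar> * dist u v / K * exp (K * \<bar>t\<bar>))"
          by (intro mult_left_mono antideriv_bound continuous_on_diff g db K) auto
        also have "\<dots> = \<bar>L\<bar> / K * dist u v * (exp (- (K * \<bar>t\<bar>)) * exp (K * \<bar>t\<bar>))" by simp
        also have "\<dots> \<le> 1 / 2 * dist u v"
          unfolding E mult_1_right by (rule mult_right_mono[OF K(2)]) simp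
        finally show "dist (P u t) (P v t) \<le> 1 / 2 * dist u v" .
      qed
    qed
  qed auto
  then obtain u where u: "Bcontfun (P u) = u" by blast
  define x where "x t = x0 + antideriv (g u) t" for t
  have "antideriv (g u) t = exp (K * \<bar>t\<bar>) *\<^sub>R apply_bcontfun u t" for t
  proof -
    have "apply_bcontfun u t = P u t" using Papp[of u] u by simp
    then show ?thesis by (simp add: P_def exp_minus)
  qed
  then have "g u t = W t (x t)" for t by (simp add: g_def x_def)
  moreover have "(x has_vector_derivative g u t) (at t)" for t
    unfolding x_def using has_vector_derivative_add[OF has_vector_derivative_const antideriv_deriv[OF g]] by simp
  ultimately show ?thesis using that[of x] by (simp add: x_def)
qed

lemma ode_unique:
  fixes x y :: "real \<Rightarrow> 'x::euclidean_space"
  assumes lip: "\<And>t a b. \<bar>t\<bar> \<le> T \<Longrightarrow> norm (W t a - W t b) \<le> L * norm (a - b)"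
    and x: "\<And>t. \<bar>t\<bar> \<le> T \<Longrightarrow> (x has_vector_derivative W t (x t)) (at t)"
    and y: "\<And>t. \<bar>t\<bar> \<le> T \<Longrightarrow> (y has_vector_derivative W t (y t)) (at t)"
    and "x 0 = y 0" "\<bar>t\<bar> \<le> T"
  shows "x t = y t"
proof -
  have "(norm (x t - y t))\<^sup>2 \<le> ((norm (x 0 - y 0))\<^sup>2 + 0\<^sup>2 * T) * exp ((2 * \<bar>L\<bar> + 1) * T)"
  proof (rule gronwall[where d="\<lambda>t. x t - y t" and d'="\<lambda>t. W t (x t) - W t (y t)"])
    fix s assume s: "\<bar>s\<bar> \<le> T"
    show "((\<lambda>t. x t - y t) has_vector_derivative W s (x s) - W s (y s)) (at s)"
      using x y s by (intro has_vector_derivative_diff) auto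
    show "norm (W s (x s) - W s (y s)) \<le> \<bar>L\<bar> * norm (x s - y s) + 0"
      using order_trans[OF lip[OF s, of "x s" "y s"] mult_right_mono[of L "\<bar>L\<bar>" "norm (x s - y s)"]] by simp
  qed (use assms in auto)
  then show ?thesis using assms(4) by simp
qed

text \<open>The Lipschitz constant may grow with time. On each window of times the field is frozen
  outside the window, which restores uniform constants, and the solutions belonging to different
  windows agree by uniqueness.\<close>

lemma ode_exists:
  fixes W :: "real \<Rightarrow> 'x::euclidean_space \<Rightarrow> 'x"
  assumes cont: "continuous_on UNIV (\<lambda>(t, x). W t x)"
    and lip: "\<And>T. \<exists>L. \<forall>t x y. \<bar>t\<bar> \<le> T \<longrightarrow> norm (W t x - W t y) \<le> L * norm (x - y)"
  obtains x where "x 0 = x0" "\<And>t. (x has_vector_derivative W t (x t)) (at t)"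
proof -
  have "\<exists>x. x 0 = x0 \<and> (\<forall>t. \<bar>t\<bar> < T \<longrightarrow> (x has_vector_derivative W t (x t)) (at t))" if "T > 0" for T
  proof -
    define c where "c t = max (- T) (min T t)" for t
    have c: "\<bar>c t\<bar> \<le> T" "continuous_on UNIV c" for t using that by (auto simp: c_def intro!: continuous_intros)
    have c_id: "c t = t" if "\<bar>t\<bar> < T" for t using that by (auto simp: c_def)
    obtain L where L: "\<And>t x y. \<bar>t\<bar> \<le> T \<Longrightarrow> norm (W t x - W t y) \<le> L * norm (x - y)" using lip[of T] by blast
    have "continuous_on {-T..T} (\<lambda>t. W t x0)"
      by (intro continuous_on_apply2[OF cont] continuous_intros)
    then have "bounded ((\<lambda>t. W t x0) ` {-T..T})" by (intro compact_imp_bounded compact_continuous_image) auto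
    then have "\<exists>B. \<forall>t\<in>{-T..T}. norm (W t x0) \<le> B" by (simp add: bounded_iff)
    then obtain B where B: "\<And>t. t \<in> {-T..T} \<Longrightarrow> norm (W t x0) \<le> B" by blast
    have contc: "continuous_on UNIV (\<lambda>(t, x). W (c t) x)"
      unfolding split_def
      by (intro continuous_on_apply2[OF cont] continuous_on_compose2[OF c(2)] continuous_intros subset_UNIV)
    obtain x where "x 0 = x0" "\<And>t. (x has_vector_derivative W (c t) (x t)) (at t)"
    proof (rule ode_exists_uniform[OF contc])
      show "norm (W (c t) x - W (c t) y) \<le> L * norm (x - y)" for t x y by (rule L[OF c(1)])
      show "norm (W (c t) x0) \<le> B" for t using B[of "c t"] c(1)[of t] by (simp add: abs_le_iff)
    qed (rule that)
    then have "x 0 = x0 \<and> (\<forall>t. \<bar>t\<bar> < T \<longrightarrow> (x has_vector_derivative W t (x t)) (at t))"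
      using c_id by (metis (no_types))
    then show ?thesis by (rule exI[of _ x])
  qed
  then obtain X where X: "\<And>T. T > 0 \<Longrightarrow> X T 0 = x0 \<and> (\<forall>t. \<bar>t\<bar> < T \<longrightarrow> (X T has_vector_derivative W t (X T t)) (at t))"
    by metis
  have agree: "X S t = X T t" if "\<bar>t\<bar> < S" "\<bar>t\<bar> < T" for S T t :: real
  proof -
    have ST: "S > 0" "T > 0" using that by auto
    obtain L where "\<And>s x y. \<bar>s\<bar> \<le> \<bar>t\<bar> \<Longrightarrow> norm (W s x - W s y) \<le> L * norm (x - y)" using lip[of "\<bar>t\<bar>"] by blast
    then show ?thesis
      by (rule ode_unique[where T="\<bar>t\<bar>"]) (use X[OF ST(1)] X[OF ST(2)] that in auto)
  qed
  \<comment> \<open>The window of size |t| + 1 has t in its interior, and near t it may be held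
    fixed because of \<open>agree\<close>; so the derivative at t can be read off from one
    solution.\<close>
  define x where "x t = X (\<bar>t\<bar> + 1) t" for t
  have "(x has_vector_derivative W t (x t)) (at t)" for t
  proof -
    have "(X (\<bar>t\<bar> + 1) has_vector_derivative W t (X (\<bar>t\<bar> + 1) t)) (at t)" using X[of "\<bar>t\<bar> + 1"] by auto
    then have "(X (\<bar>t\<bar> + 1) has_vector_derivative W t (x t)) (at t)" by (simp add: x_def)
    then show ?thesis
      by (rule has_vector_derivative_transform_within_open[where S="{- \<bar>t\<bar> - 1<..<\<bar>t\<bar> + 1}"])
        (auto simp: x_def intro!: agree)
  qed
  moreover have "x 0 = x0" using X[of 1] by (simp add: x_def)
  ultimately show ?thesis by (intro that[of x])
qed

text \<open>The increment is made one coordinate at a time. Along each coordinate the mean value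
  inequality compares the partial derivative with its value at \<open>z\<close>, and continuity of
  the partial derivatives makes the error small. The induction runs over the set \<open>S\<close> of
  coordinates already changed.\<close>

lemma has_derivative_from_partials:
  fixes f :: "'e::euclidean_space \<Rightarrow> 'f::real_normed_vector"
  assumes part: "\<And>z b. b \<in> Basis \<Longrightarrow> ((\<lambda>h. f (z + h *\<^sub>R b)) has_vector_derivative D b z) (at 0)"
    and cont: "\<And>b. b \<in> Basis \<Longrightarrow> continuous_on UNIV (D b)"
  shows "(f has_derivative (\<lambda>v. \<Sum>b\<in>Basis. (v \<bullet> b) *\<^sub>R D b z)) (at z)"
proof -
  have part': "((\<lambda>h. f (z + h *\<^sub>R b)) has_vector_derivative D b (z + s *\<^sub>R b)) (at s)" if "b \<in> Basis" for z b s
  proof -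
    have "((\<lambda>h. f ((z + s *\<^sub>R b) + (h - s) *\<^sub>R b)) has_vector_derivative 1 *\<^sub>R D b (z + s *\<^sub>R b)) (at s)"
      by (rule vector_diff_chain_at[of "\<lambda>h. h - s" 1 s "\<lambda>h. f ((z + s *\<^sub>R b) + h *\<^sub>R b)", unfolded o_def])
        (use part[OF that, of "z + s *\<^sub>R b"] in \<open>auto intro!: derivative_eq_intros simp: has_vector_derivative_def\<close>)
    then show ?thesis by (simp add: algebra_simps)
  qed
  define p where "p S v = (\<Sum>b\<in>S. (v \<bullet> b) *\<^sub>R b)" for S and v :: 'e
  have bound: "\<exists>\<delta>>0. \<forall>v. norm v < \<delta> \<longrightarrow> norm (f (z + p S v) - f z - (\<Sum>b\<in>S. (v \<bullet> b) *\<^sub>R D b z)) \<le> e * norm v"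
    if "finite S" "S \<subseteq> Basis" "e > 0" for S e
    using that
  proof (induction S arbitrary: e rule: finite_induct)
    case empty
    then show ?case by (intro exI[of _ 1]) (simp add: p_def)
  next
    case (insert b S)
    obtain \<delta>1 where 1: "\<delta>1 > 0" "\<And>v. norm v < \<delta>1 \<Longrightarrow>
        norm (f (z + p S v) - f z - (\<Sum>b\<in>S. (v \<bullet> b) *\<^sub>R D b z)) \<le> e / 2 * norm v"
      using insert.IH[of "e / 2"] insert.prems by auto
    have b: "b \<in> Basis" using insert.prems by auto
    \<comment> \<open>Two errors of size e/8 on the segment give e/4, a third one at its start gives
      e/8, and the total stays below the e/2 reserved for this coordinate.\<close>
    obtain \<delta>2 where 2: "\<delta>2 > 0" "\<And>y. dist y z < \<delta>2 \<Longrightarrow> dist (D b y) (D b z) < e / 8"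
    proof -
      have "e / 8 > 0" using insert.prems by simp
      then show ?thesis using cont[OF b, unfolded continuous_on_iff] that by blast
    qed
    \<comment> \<open>All points on the broken path lie within N |v| of \<open>z\<close>: one |v|
      for each coordinate and one for the current step.\<close>
    define N where "N = real (card (Basis::'e set)) + 1"
    have N: "N > 0" by (simp add: N_def)
    have pN: "norm (p S v) \<le> (N - 1) * norm v" for v
    proof -
      have "norm (p S v) \<le> (\<Sum>b\<in>S. norm v)"
        unfolding p_def using insert.prems by (intro sum_norm_le) (auto simp: Basis_le_norm)
      also have "\<dots> \<le> real (card (Basis::'e set)) * norm v"
        using insert.prems card_mono[of Basis S] by (auto intro!: mult_right_mono)
      finally show ?thesis by (simp add: N_def)
    qed
    show ?case
    proof (intro exI[of _ "min \<delta>1 (\<delta>2 / N)"] conjI allI impI)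
      show "min \<delta>1 (\<delta>2 / N) > 0" using 1(1) 2(1) N by simp
      fix v :: 'e assume v: "norm v < min \<delta>1 (\<delta>2 / N)"
      let ?q = "z + p S v"
      have vb: "\<bar>v \<bullet> b\<bar> \<le> norm v" by (rule Basis_le_norm[OF b])
      have close: "dist (D b (?q + h *\<^sub>R b)) (D b z) < e / 8" if "\<bar>h\<bar> \<le> norm v" for h
      proof (rule 2(2))
        have "norm (p S v + h *\<^sub>R b) \<le> norm (p S v) + norm (h *\<^sub>R b)" by (rule norm_triangle_ineq)
        also have "\<dots> \<le> (N - 1) * norm v + norm v" using pN[of v] that b by (intro add_mono) auto
        also have "\<dots> = N * norm v" by (simp add: algebra_simps)
        also have "\<dots> < \<delta>2" using v N by (simp add: field_simps)
        finally show "dist (?q + h *\<^sub>R b) z < \<delta>2" by (simp add: dist_norm add.assoc)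
      qed
      have seg: "\<bar>h\<bar> \<le> norm v" if "h \<in> closed_segment 0 (v \<bullet> b)" for h
        using that vb by (auto simp: closed_segment_eq_real_ivl split: if_splits)
      have "norm (f (?q + (v \<bullet> b) *\<^sub>R b) - f (?q + 0 *\<^sub>R b) - (v \<bullet> b - 0) *\<^sub>R D b (?q + 0 *\<^sub>R b)) \<le> norm (v \<bullet> b - 0) * (e / 4)"
      proof (rule vector_differentiable_bound_linearization[where S="closed_segment 0 (v \<bullet> b)" and f'="\<lambda>h. D b (?q + h *\<^sub>R b)"])
        show "norm (D b (?q + x *\<^sub>R b) - D b (?q + 0 *\<^sub>R b)) \<le> e / 4" if "x \<in> closed_segment 0 (v \<bullet> b)" for x
          using close[OF seg[OF that]] close[of 0] dist_triangle2[of "D b (?q + x *\<^sub>R b)" "D b (?q + 0 *\<^sub>R b)" "D b z"]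
          by (simp add: dist_norm)
      qed (auto intro: has_vector_derivative_at_within part'[OF b])
      then have A: "norm (f (?q + (v \<bullet> b) *\<^sub>R b) - f ?q - (v \<bullet> b) *\<^sub>R D b ?q) \<le> \<bar>v \<bullet> b\<bar> * (e / 4)" by simp
      have "norm ((v \<bullet> b) *\<^sub>R D b ?q - (v \<bullet> b) *\<^sub>R D b z) = \<bar>v \<bullet> b\<bar> * norm (D b ?q - D b z)"
        by (simp add: scaleR_diff_right[symmetric])
      also have "\<dots> \<le> \<bar>v \<bullet> b\<bar> * (e / 8)" using close[of 0] by (intro mult_left_mono) (auto simp: dist_norm)
      finally have B: "norm ((v \<bullet> b) *\<^sub>R D b ?q - (v \<bullet> b) *\<^sub>R D b z) \<le> \<bar>v \<bullet> b\<bar> * (e / 8)" .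
      have "norm (f (?q + (v \<bullet> b) *\<^sub>R b) - f ?q - (v \<bullet> b) *\<^sub>R D b z) \<le> \<bar>v \<bullet> b\<bar> * (e / 4) + \<bar>v \<bullet> b\<bar> * (e / 8)"
        using norm_triangle_mono[OF A B] by simp
      also have "\<dots> \<le> norm v * (e / 4) + norm v * (e / 8)"
        using vb insert.prems by (intro add_mono mult_right_mono) auto
      also have "\<dots> \<le> e / 2 * norm v" using insert.prems by (simp add: algebra_simps)
      finally have "norm (f (?q + (v \<bullet> b) *\<^sub>R b) - f ?q - (v \<bullet> b) *\<^sub>R D b z) \<le> e / 2 * norm v" .
      moreover have "norm (f ?q - f z - (\<Sum>b\<in>S. (v \<bullet> b) *\<^sub>R D b z)) \<le> e / 2 * norm v" using 1(2) v by simp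
      moreover have "z + p (insert b S) v = ?q + (v \<bullet> b) *\<^sub>R b" using insert.hyps by (simp add: p_def add_ac)
      moreover have "(\<Sum>b\<in>insert b S. (v \<bullet> b) *\<^sub>R D b z) = (v \<bullet> b) *\<^sub>R D b z + (\<Sum>b\<in>S. (v \<bullet> b) *\<^sub>R D b z)"
        using insert.hyps by simp
      ultimately show "norm (f (z + p (insert b S) v) - f z - (\<Sum>b\<in>insert b S. (v \<bullet> b) *\<^sub>R D b z)) \<le> e * norm v"
        using norm_triangle_ineq[of "f (?q + (v \<bullet> b) *\<^sub>R b) - f ?q - (v \<bullet> b) *\<^sub>R D b z" "f ?q - f z - (\<Sum>b\<in>S. (v \<bullet> b) *\<^sub>R D b z)"]
        by (simp add: algebra_simps)
    qed
  qed
  have pB: "p Basis v = v" for v by (simp add: p_def euclidean_representation)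
  show ?thesis
    unfolding has_derivative_at_alt
  proof (intro conjI allI impI)
    show "bounded_linear (\<lambda>v. \<Sum>b\<in>Basis. (v \<bullet> b) *\<^sub>R D b z)"
      by (intro bounded_linear_sum bounded_linear_compose[OF bounded_linear_scaleR_left] bounded_linear_inner_left)
    fix e :: real assume "0 < e"
    obtain \<delta> where "\<delta> > 0" "\<And>v. norm v < \<delta> \<Longrightarrow> norm (f (z + v) - f z - (\<Sum>b\<in>Basis. (v \<bullet> b) *\<^sub>R D b z)) \<le> e * norm v"
      using bound[of Basis e] \<open>0 < e\<close> unfolding pB by auto
    moreover from this(2)[of "y - z" for y]
    have "norm (y - z) < \<delta> \<Longrightarrow> norm (f y - f z - (\<Sum>b\<in>Basis. ((y - z) \<bullet> b) *\<^sub>R D b z)) \<le> e * norm (y - z)" for y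
      by simp
    ultimately show "\<exists>d>0. \<forall>y. norm (y - z) < d \<longrightarrow>
        norm (f y - f z - (\<Sum>b\<in>Basis. ((y - z) \<bullet> b) *\<^sub>R D b z)) \<le> e * norm (y - z)"
      by blast
  qed
qed

section \<open>Smooth dependence on initial values\<close>

lemma linear_norm_le_Basis:
  fixes A :: "'x::euclidean_space \<Rightarrow> 'f::real_normed_vector"
  assumes "linear A"
  shows "norm (A x) \<le> (\<Sum>e\<in>Basis. norm (A e)) * norm x"
proof -
  have "norm (A x) = norm (\<Sum>e\<in>Basis. (x \<bullet> e) *\<^sub>R A e)" using linear_eq_sum_Basis[OF assms, of x] by simp
  also have "\<dots> \<le> (\<Sum>e\<in>Basis. norm x * norm (A e))"
    by (rule sum_norm_le) (auto intro!: mult_right_mono Basis_le_norm)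
  finally show ?thesis by (simp add: sum_distrib_left[symmetric] mult.commute)
qed

lemma continuous_on_linear_apply:
  fixes A :: "'z::topological_space \<Rightarrow> 'x::euclidean_space \<Rightarrow> 'f::real_normed_vector"
  assumes "\<And>z. z \<in> S \<Longrightarrow> linear (A z)" "\<And>e. continuous_on S (\<lambda>z. A z e)" "continuous_on S w"
  shows "continuous_on S (\<lambda>z. A z (w z))"
proof -
  have "continuous_on S (\<lambda>z. \<Sum>e\<in>Basis. (w z \<bullet> e) *\<^sub>R A z e)" by (intro continuous_intros assms)
  then show ?thesis
    by (rule continuous_on_eq) (use linear_eq_sum_Basis[OF assms(1)] in metis)
qed

lemma times_differentiable_on_linear_apply:
  fixes A :: "'z::real_normed_vector \<Rightarrow> 'x::euclidean_space \<Rightarrow> 'f::real_normed_vector"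
  assumes "open S" "\<And>z. z \<in> S \<Longrightarrow> linear (A z)" "\<And>e. times_differentiable_on k (\<lambda>z. A z e) S"
    "times_differentiable_on k w S"
  shows "times_differentiable_on k (\<lambda>z. A z (w z)) S"
proof -
  have "times_differentiable_on k (\<lambda>z. \<Sum>e\<in>Basis. (w z \<bullet> e) *\<^sub>R A z e) S"
    by (intro times_differentiable_on_sum bounded_bilinear.times_differentiable_on[OF bounded_bilinear_scaleR]
       bounded_linear.times_differentiable_on[OF bounded_linear_inner_left] assms)
  then show ?thesis
    by (rule times_differentiable_on_cong[OF assms(1), rotated]) (use linear_eq_sum_Basis[OF assms(2)] in metis)
qed

lemma compact_bound:
  fixes f :: "'z::topological_space \<Rightarrow> real"
  assumes "compact C" "continuous_on C f"
  obtains L where "L \<ge> 0" "\<And>z. z \<in> C \<Longrightarrow> f z \<le> L"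
proof -
  have "bounded (f ` C)" using assms by (intro compact_imp_bounded compact_continuous_image)
  then obtain B where B: "\<And>x. x \<in> f ` C \<Longrightarrow> norm x \<le> B" unfolding bounded_iff by blast
  show ?thesis
  proof (rule that[of "max 0 B"])
    show "f z \<le> max 0 B" if "z \<in> C" for z
      using B[OF imageI[OF that]] by (simp add: abs_le_iff le_max_iff_disj)
  qed simp
qed

text \<open>The difference of the solutions for \<open>y\<close> and \<open>y0\<close> solves the
  equation at \<open>y\<close> with source \<phi>, which vanishes at \<open>y0\<close> and is
  uniformly small nearby by compactness. Gronwall bounds the difference uniformly in time;
  continuity in t of the single solution for \<open>y0\<close> does the rest.\<close>

lemma linear_ode_continuous:
  fixes A :: "real \<times> 'y::euclidean_space \<Rightarrow> 'x::euclidean_space \<Rightarrow> 'x"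
  assumes lin: "\<And>z. linear (A z)" and A: "\<And>e. continuous_on UNIV (\<lambda>z. A z e)"
    and b: "continuous_on UNIV b" and v: "continuous_on UNIV v"
    and \<xi>0: "\<And>y. \<xi> 0 y = v y"
    and \<xi>: "\<And>t y. ((\<lambda>t. \<xi> t y) has_vector_derivative A (t, y) (\<xi> t y) + b (t, y)) (at t)"
  shows "continuous_on UNIV (\<lambda>(t, y). \<xi> t y)"
proof -
  have "\<exists>d>0. \<forall>p'. dist p' (t0, y0) < d \<longrightarrow> dist (case p' of (t, y) \<Rightarrow> \<xi> t y) (\<xi> t0 y0) < e"
    if "e > 0" for t0 y0 e
  proof -
    define T where "T = \<bar>t0\<bar> + 1"
    define C where "C = {-T..T} \<times> cball y0 1"
    have C: "compact C" unfolding C_def by (intro compact_Times) auto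
    have ct: "continuous_on UNIV (\<lambda>t. \<xi> t y)" for y
      using \<xi> has_vector_derivative_continuous by (blast intro: continuous_at_imp_continuous_on)
    have "continuous_on C (\<lambda>z. \<Sum>e\<in>Basis. norm (A z e))"
      by (intro continuous_intros continuous_on_subset[OF A]) auto
    then obtain L where L: "L \<ge> 0" "\<And>z. z \<in> C \<Longrightarrow> (\<Sum>e\<in>Basis. norm (A z e)) \<le> L"
      using compact_bound[OF C] by blast
    have AL: "norm (A z x) \<le> L * norm x" if "z \<in> C" for z x
      by (rule order_trans[OF linear_norm_le_Basis[OF lin] mult_right_mono[OF L(2)[OF that]]]) simp
    define \<phi> where "\<phi> z = (A z (\<xi> (fst z) y0) + b z) - (A (fst z, y0) (\<xi> (fst z) y0) + b (fst z, y0))" for z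
    have c1: "continuous_on C (\<lambda>z. \<xi> (fst z) y0)"
      by (rule continuous_on_compose2[OF ct[of y0] continuous_on_fst[OF continuous_on_id]]) simp
    have c2: "continuous_on C (\<lambda>z. (fst z, y0))" by (intro continuous_intros)
    have c3: "continuous_on C (\<lambda>z. A (fst z, y0) e)" "continuous_on C (\<lambda>z. b (fst z, y0))" for e
      by (rule continuous_on_compose2[OF A c2], simp, rule continuous_on_compose2[OF b c2], simp)
    have c4: "continuous_on C (\<lambda>z. A z e)" for e
      by (rule continuous_on_subset[OF A subset_UNIV])
    have c5: "continuous_on C b"
      by (rule continuous_on_subset[OF b subset_UNIV])
    have c6: "continuous_on C (\<lambda>z. A z (\<xi> (fst z) y0))"
      by (rule continuous_on_linear_apply[where A=A and w="\<lambda>z. \<xi> (fst z) y0", OF lin c4 c1])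
    have c7: "continuous_on C (\<lambda>z. A (fst z, y0) (\<xi> (fst z) y0))"
      by (rule continuous_on_linear_apply[where A="\<lambda>z. A (fst z, y0)" and w="\<lambda>z. \<xi> (fst z) y0", OF lin c3(1) c1])
    have "continuous_on C \<phi>"
      unfolding \<phi>_def by (rule continuous_on_diff[OF continuous_on_add[OF c6 c5] continuous_on_add[OF c7 c3(2)]])
    then have uc: "uniformly_continuous_on C \<phi>" using C by (rule compact_uniformly_continuous)
    have \<phi>0: "\<phi> (s, y0) = 0" for s by (simp add: \<phi>_def)
    define N where "N = (1 + T) * exp ((2 * L + 1) * T)"
    have N: "N > 0" by (simp add: N_def T_def)
    \<comment> \<open>Chosen so that the Gronwall bound, \<open>e1\<^sup>2 * N\<close>, is strictly
      below (e/2)^2.\<close>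
    define e1 where "e1 = e / 2 / sqrt (N + 1)"
    have e1: "e1 > 0" using that N by (simp add: e1_def)
    have "e1\<^sup>2 * N = (e / 2)\<^sup>2 * (N / (N + 1))" using N by (simp add: e1_def power_divide)
    also have "\<dots> < (e / 2)\<^sup>2 * 1" using that N by (intro mult_strict_left_mono) auto
    finally have e1N: "e1\<^sup>2 * N < (e / 2)\<^sup>2" by simp
    obtain d1 where d1: "d1 > 0" "\<And>x x'. x \<in> C \<Longrightarrow> x' \<in> C \<Longrightarrow> dist x' x < d1 \<Longrightarrow> dist (\<phi> x') (\<phi> x) < e1"
      using uc e1 unfolding uniformly_continuous_on_def by metis
    obtain d2 where d2: "d2 > 0" "\<And>y. dist y y0 < d2 \<Longrightarrow> dist (v y) (v y0) < e1"
      using v e1 unfolding continuous_on_iff by (metis UNIV_I)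
    obtain d3 where d3: "d3 > 0" "\<And>t. dist t t0 < d3 \<Longrightarrow> dist (\<xi> t y0) (\<xi> t0 y0) < e / 2"
      using ct[of y0] half_gt_zero[OF \<open>e > 0\<close>] unfolding continuous_on_iff by (metis UNIV_I)
    define d where "d = min (min d1 d2) (min d3 1)"
    have "dist (\<xi> t y) (\<xi> t0 y0) < e" if near: "dist (t, y) (t0, y0) < d" for t y
    proof -
      have ty: "dist t t0 < d" "dist y y0 < d"
        using near dist_fst_le[of "(t, y)" "(t0, y0)"] dist_snd_le[of "(t, y)" "(t0, y0)"] by auto
      have T: "\<bar>t\<bar> \<le> T" using ty(1) by (auto simp: T_def d_def dist_real_def)
      have inC: "(s, y) \<in> C" "(s, y0) \<in> C" if "\<bar>s\<bar> \<le> T" for s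
        using that ty(2) by (auto simp: C_def d_def dist_commute)
      have "(norm (\<xi> t y - \<xi> t y0))\<^sup>2 \<le> ((norm (\<xi> 0 y - \<xi> 0 y0))\<^sup>2 + e1\<^sup>2 * T) * exp ((2 * L + 1) * T)"
      proof (rule gronwall[where d="\<lambda>s. \<xi> s y - \<xi> s y0" and d'="\<lambda>s. (A (s, y) (\<xi> s y) + b (s, y)) - (A (s, y0) (\<xi> s y0) + b (s, y0))"])
        fix s assume s: "\<bar>s\<bar> \<le> T"
        show "((\<lambda>s. \<xi> s y - \<xi> s y0) has_vector_derivative
          (A (s, y) (\<xi> s y) + b (s, y)) - (A (s, y0) (\<xi> s y0) + b (s, y0))) (at s)"
          by (intro has_vector_derivative_diff \<xi>)
        have "(A (s, y) (\<xi> s y) + b (s, y)) - (A (s, y0) (\<xi> s y0) + b (s, y0)) = A (s, y) (\<xi> s y - \<xi> s y0) + \<phi> (s, y)"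
          by (simp add: \<phi>_def linear_diff[OF lin])
        moreover have "norm (\<phi> (s, y)) \<le> e1"
          using d1(2)[OF inC(2)[OF s] inC(1)[OF s]] ty(2) by (simp add: \<phi>0 d_def dist_Pair_Pair)
        moreover have "norm (A (s, y) (\<xi> s y - \<xi> s y0)) \<le> L * norm (\<xi> s y - \<xi> s y0)" by (rule AL[OF inC(1)[OF s]])
        ultimately show "norm ((A (s, y) (\<xi> s y) + b (s, y)) - (A (s, y0) (\<xi> s y0) + b (s, y0))) \<le> L * norm (\<xi> s y - \<xi> s y0) + e1"
          by (simp add: norm_triangle_mono)
      qed (fact L(1), fact T)
      also have "\<dots> \<le> (e1\<^sup>2 + e1\<^sup>2 * T) * exp ((2 * L + 1) * T)"
        using d2(2)[of y] ty(2)
        by (intro mult_right_mono add_right_mono power_mono) (auto simp: \<xi>0 dist_norm d_def)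
      also have "\<dots> = e1\<^sup>2 * N" by (simp add: N_def algebra_simps)
      also have "\<dots> < (e / 2)\<^sup>2" by (rule e1N)
      finally have "norm (\<xi> t y - \<xi> t y0) < e / 2" by (rule power2_less_imp_less) (use \<open>e > 0\<close> in simp)
      moreover have "dist (\<xi> t y0) (\<xi> t0 y0) < e / 2" using d3(2)[of t] ty(1) by (simp add: d_def)
      ultimately show ?thesis using dist_triangle[of "\<xi> t y" "\<xi> t0 y0" "\<xi> t y0"] by (simp add: dist_norm)
    qed
    moreover have "d > 0" using d1 d2 d3 by (simp add: d_def)
    ultimately show ?thesis by (intro exI[of _ d]) auto
  qed
  then show ?thesis by (auto simp: continuous_on_iff)
qed

lemma linear_ode_exists:
  fixes A :: "real \<Rightarrow> 'x::euclidean_space \<Rightarrow> 'x"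
  assumes lin: "\<And>t. linear (A t)" and A: "\<And>e. continuous_on UNIV (\<lambda>t. A t e)" and b: "continuous_on UNIV b"
  obtains x where "x 0 = x0" "\<And>t. (x has_vector_derivative A t (x t) + b t) (at t)"
proof (rule ode_exists[of "\<lambda>t x. A t x + b t"])
  have "continuous_on UNIV (\<lambda>z. A (fst z) (snd z) + b (fst z))"
  proof (rule continuous_on_add[OF continuous_on_linear_apply[where A="\<lambda>z. A (fst z)" and w=snd, OF lin]])
    show "continuous_on UNIV (\<lambda>z. A (fst z) e)" for e
      by (rule continuous_on_compose2[OF A continuous_on_fst[OF continuous_on_id] subset_UNIV])
    show "continuous_on UNIV (\<lambda>z. b (fst z))"
      by (rule continuous_on_compose2[OF b continuous_on_fst[OF continuous_on_id] subset_UNIV])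
    show "continuous_on UNIV (snd :: real \<times> 'x \<Rightarrow> 'x)" by (rule continuous_on_snd[OF continuous_on_id])
  qed
  then show "continuous_on UNIV (\<lambda>(t, x). A t x + b t)" by (simp add: split_def)
  show "\<exists>L. \<forall>t x y. \<bar>t\<bar> \<le> T \<longrightarrow> norm (A t x + b t - (A t y + b t)) \<le> L * norm (x - y)" for T
  proof -
    have "continuous_on {-T..T} (\<lambda>t. \<Sum>e\<in>Basis. norm (A t e))"
      by (intro continuous_intros continuous_on_subset[OF A]) auto
    then obtain L where L: "\<And>t. t \<in> {-T..T} \<Longrightarrow> (\<Sum>e\<in>Basis. norm (A t e)) \<le> L"
      using compact_bound[of "{-T..T}"] by blast
    have "norm (A t x + b t - (A t y + b t)) \<le> L * norm (x - y)" if "\<bar>t\<bar> \<le> T" for t x y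
    proof -
      have "norm (A t x + b t - (A t y + b t)) = norm (A t (x - y))" by (simp add: linear_diff[OF lin])
      also have "\<dots> \<le> (\<Sum>e\<in>Basis. norm (A t e)) * norm (x - y)" by (rule linear_norm_le_Basis[OF lin])
      also have "\<dots> \<le> L * norm (x - y)" using L[of t] that by (intro mult_right_mono) (auto simp: abs_le_iff)
      finally show ?thesis .
    qed
    then show ?thesis by blast
  qed
qed (rule that)

section \<open>Difference quotients as integrals\<close>

lemma integral_frechet_derivative:
  fixes F :: "'z::real_normed_vector \<Rightarrow> 'f::banach"
  assumes "times_differentiable_on (Suc k) F UNIV"
  shows "F (z + w) - F z = integral {0..1} (\<lambda>\<theta>. frechet_derivative F (at (z + \<theta> *\<^sub>R w)) w)"
proof -
  have "((\<lambda>\<theta>. F (z + \<theta> *\<^sub>R w)) has_vector_derivative frechet_derivative F (at (z + \<theta> *\<^sub>R w)) w) (at \<theta> within {0..1})" for \<theta>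
  proof -
    have 1: "((\<lambda>\<theta>. z + \<theta> *\<^sub>R w) has_derivative (\<lambda>h. h *\<^sub>R w)) (at \<theta>)" by (auto intro!: derivative_eq_intros)
    have 2: "(F has_derivative frechet_derivative F (at (z + \<theta> *\<^sub>R w))) (at (z + \<theta> *\<^sub>R w))"
      using times_differentiable_on_SucD[OF assms] by simp
    have "((\<lambda>\<theta>. F (z + \<theta> *\<^sub>R w)) has_vector_derivative frechet_derivative F (at (z + \<theta> *\<^sub>R w)) w) (at \<theta>)"
      unfolding has_vector_derivative_def
      using has_derivative_compose[OF 1 2] linear_cmul[OF has_derivative_linear[OF 2]] by simp
    then show ?thesis by (rule has_vector_derivative_at_within)
  qed
  from fundamental_theorem_of_calculus[OF _ this] show ?thesis
    by (simp add: integral_unique)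
qed

lemma continuous_on_integral_param:
  fixes g :: "'z::topological_space \<Rightarrow> real \<Rightarrow> 'f::banach"
  assumes "continuous_on UNIV (\<lambda>p. g (fst p) (snd p))"
  shows "continuous_on UNIV (\<lambda>z. integral {0..1} (g z))"
proof -
  have "continuous_on (UNIV \<times> cbox 0 1) (\<lambda>(z, \<theta>). g z \<theta>)"
    using continuous_on_subset[OF assms] by (auto simp: split_def)
  from integral_continuous_on_param[OF this] show ?thesis by simp
qed

lemma has_vector_derivative_from_quotient:
  fixes q :: "real \<Rightarrow> 'f::real_normed_vector"
  assumes q: "continuous_on UNIV q" and f: "\<And>h. f h - f 0 = h *\<^sub>R q h"
  shows "(f has_vector_derivative q 0) (at 0)"
proof -
  have "((\<lambda>h. norm (f h - f 0 - h *\<^sub>R q 0) / norm h) \<longlongrightarrow> 0) (at 0)"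
  proof (rule tendsto_cong[THEN iffD2])
    show "\<forall>\<^sub>F h in at 0. norm (f h - f 0 - h *\<^sub>R q 0) / norm h = norm (q h - q 0)"
      by (rule eventually_at_topological[THEN iffD2], intro exI[of _ UNIV])
        (simp add: f scaleR_diff_right[symmetric])
    have "(q \<longlongrightarrow> q 0) (at 0)" using q by (auto simp: continuous_on_def)
    then show "((\<lambda>h. norm (q h - q 0)) \<longlongrightarrow> 0) (at 0)" by (simp add: LIM_zero tendsto_norm_zero)
  qed
  then show ?thesis
    unfolding has_vector_derivative_def has_derivative_at by (auto intro: bounded_linear_scaleR_left)
qed

text \<open>The quotient (F (z + h w) - F z) / h in integral form, which makes sense and is
  continuous at h = 0 as well, where it is the directional derivative.\<close>

definition diff_quot :: "('z::real_normed_vector \<Rightarrow> 'f::banach) \<Rightarrow> 'z \<Rightarrow> 'z \<Rightarrow> real \<Rightarrow> 'f" where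
  "diff_quot F w z h = integral {0..1} (\<lambda>\<theta>. frechet_derivative F (at (z + (\<theta> * h) *\<^sub>R w)) w)"

lemma diff_quot_0: "diff_quot F w z 0 = frechet_derivative F (at z) w"
  by (simp add: diff_quot_def)

lemma diff_quot_eq:
  assumes "times_differentiable_on (Suc k) F UNIV"
  shows "F (z + h *\<^sub>R w) - F z = h *\<^sub>R diff_quot F w z h"
proof -
  have lin: "linear (frechet_derivative F (at x))" for x
    using has_derivative_linear[OF times_differentiable_on_SucD[OF assms]] by simp
  show ?thesis
    unfolding integral_frechet_derivative[OF assms] diff_quot_def by (simp add: linear_cmul[OF lin])
qed

lemma continuous_on_diff_quot:
  assumes F: "times_differentiable_on (Suc k) F UNIV" and z: "continuous_on UNIV z" and h: "continuous_on UNIV h"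
  shows "continuous_on UNIV (\<lambda>p. diff_quot F w (z p) (h p))"
proof -
  have c: "continuous_on UNIV (\<lambda>x. frechet_derivative F (at x) w)"
    by (rule times_differentiable_on_imp_continuous_on[of k]) (use F in simp)
  have "continuous_on UNIV (\<lambda>p. frechet_derivative F (at (z (fst p) + (snd p * h (fst p)) *\<^sub>R w)) w)"
  proof (rule continuous_on_compose2[OF c _ subset_UNIV])
    show "continuous_on UNIV (\<lambda>p. z (fst p) + (snd p * h (fst p)) *\<^sub>R w)"
      by (intro continuous_on_add continuous_on_scaleR continuous_on_mult continuous_on_const
          continuous_on_compose2[OF z continuous_on_fst[OF continuous_on_id] subset_UNIV]
          continuous_on_compose2[OF h continuous_on_fst[OF continuous_on_id] subset_UNIV]
          continuous_on_snd[OF continuous_on_id])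
  qed
  then show ?thesis unfolding diff_quot_def
    by (rule continuous_on_integral_param[where g="\<lambda>p \<theta>. frechet_derivative F (at (z p + (\<theta> * h p) *\<^sub>R w)) w"])
qed

lemma Basis_prod_cases:
  assumes "c \<in> (Basis :: (real \<times> 'y::euclidean_space) set)"
  obtains "c = (1, 0)" | u where "c = (0, u)" "u \<in> Basis"
  using assms by (auto simp: Basis_prod_def)

lemma has_vector_derivative_scaled_diff:
  assumes "\<And>t. (f has_vector_derivative f' t) (at t)" "\<And>t. (g has_vector_derivative g' t) (at t)"
  shows "((\<lambda>t. inverse h *\<^sub>R (f t - g t)) has_vector_derivative inverse h *\<^sub>R (f' t - g' t)) (at t)"
  by (intro bounded_linear.has_vector_derivative[OF bounded_linear_scaleR_right] has_vector_derivative_diff assms)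

lemma continuous_on_slice:
  assumes "continuous_on UNIV (g :: 'a::topological_space \<times> 'b::topological_space \<Rightarrow> 'c::topological_space)"
  shows "continuous_on UNIV (\<lambda>t. g (t, y))" "continuous_on UNIV (\<lambda>y. g (t, y))"
  by (rule continuous_on_compose2[OF assms _ subset_UNIV], intro continuous_intros)+

text \<open>The derivative \<eta> in a direction \<open>u\<close> should solve the variational
  equation: the same \<open>A\<close>, with a new source \<open>b'\<close> formed from \<xi> and the
  derivatives of \<open>A\<close> and \<open>b\<close>. Its data are k times differentiable, so the
  induction hypothesis, with \<open>b\<close>, \<open>v\<close> and \<xi> arbitrary, applies to
  \<eta>. This is why a source term is allowed at all.\<close>

lemma linear_ode_times_differentiable:
  fixes A :: "real \<times> 'y::euclidean_space \<Rightarrow> 'x::euclidean_space \<Rightarrow> 'x"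
  assumes lin: "\<And>z. linear (A z)" and "\<And>e. times_differentiable_on k (\<lambda>z. A z e) UNIV"
    "times_differentiable_on k b UNIV" "times_differentiable_on k v UNIV"
    "\<And>y. \<xi> 0 y = v y"
    "\<And>t y. ((\<lambda>t. \<xi> t y) has_vector_derivative A (t, y) (\<xi> t y) + b (t, y)) (at t)"
  shows "times_differentiable_on k (\<lambda>z. \<xi> (fst z) (snd z)) UNIV"
  using assms(2-)
proof (induction k arbitrary: b v \<xi>)
  case 0
  have "continuous_on UNIV (\<lambda>(t, y). \<xi> t y)"
    by (rule linear_ode_continuous[OF lin _ _ _ 0(4,5)]) (use 0(1-3) in simp_all)
  then show ?case by (simp add: split_def)
next
  case (Suc k)
  note A = Suc.prems(1) and b = Suc.prems(2) and v = Suc.prems(3) and \<xi>0 = Suc.prems(4) and \<xi> = Suc.prems(5)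
  note Ak = times_differentiable_on_Suc_imp[OF A] and bk = times_differentiable_on_Suc_imp[OF b]
    and vk = times_differentiable_on_Suc_imp[OF v]
  have A_cont: "continuous_on UNIV (\<lambda>z. A z e)" for e by (rule times_differentiable_on_imp_continuous_on[OF A])
  have b_cont: "continuous_on UNIV b" by (rule times_differentiable_on_imp_continuous_on[OF b])
  have \<xi>k: "times_differentiable_on k (\<lambda>z. \<xi> (fst z) (snd z)) UNIV"
    by (rule Suc.IH[OF Ak bk vk \<xi>0 \<xi>])
  have \<xi>_cont: "continuous_on UNIV (\<lambda>z. \<xi> (fst z) (snd z))"
    by (rule times_differentiable_on_imp_continuous_on[OF \<xi>k])
  define b' where "b' u z = (\<Sum>e\<in>Basis. (\<xi> (fst z) (snd z) \<bullet> e) *\<^sub>R frechet_derivative (\<lambda>z. A z e) (at z) (0, u))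
    + frechet_derivative b (at z) (0, u)" for u z
  have b'k: "times_differentiable_on k (b' u) UNIV" for u
    unfolding b'_def
    by (intro times_differentiable_on_add times_differentiable_on_sum open_UNIV
        bounded_bilinear.times_differentiable_on[OF bounded_bilinear_scaleR]
        bounded_linear.times_differentiable_on[OF bounded_linear_inner_left] \<xi>k)
      (use A b in auto)
  define v' where "v' u y = frechet_derivative v (at y) u" for u y
  have v'k: "times_differentiable_on k (v' u) UNIV" for u unfolding v'_def using v by auto
  have "\<exists>x. x 0 = v' u y \<and> (\<forall>t. (x has_vector_derivative A (t, y) (x t) + b' u (t, y)) (at t))" for u y
    by (rule linear_ode_exists[of "\<lambda>t. A (t, y)" "\<lambda>t. b' u (t, y)" "v' u y"])
      (auto intro: lin continuous_on_slice(1)[OF A_cont] continuous_on_slice(1)[OF times_differentiable_on_imp_continuous_on[OF b'k]])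
  then obtain \<eta> where \<eta>: "\<And>u y. \<eta> u y 0 = v' u y"
    "\<And>u y t. (\<eta> u y has_vector_derivative A (t, y) (\<eta> u y t) + b' u (t, y)) (at t)" by metis
  have \<eta>k: "times_differentiable_on k (\<lambda>z. \<eta> u (snd z) (fst z)) UNIV" for u
    by (rule Suc.IH[OF Ak b'k v'k, where \<xi>="\<lambda>t y. \<eta> u y t"]) (rule \<eta>)+
  have gateaux: "((\<lambda>h. \<xi> t (y + h *\<^sub>R u)) has_vector_derivative \<eta> u y t) (at 0)" for t y u
  proof -
    \<comment> \<open>To see that \<eta> is the derivative, the difference quotients and the
      candidate are put into one family in h. The family solves a linear equation with source
      \<open>b1\<close> whose data are continuous in h, h = 0 included, so
      \<open>linear_ode_continuous\<close> makes the quotients converge to \<eta>.\<close>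
    define q where "q t h = (if h = 0 then \<eta> u y t else inverse h *\<^sub>R (\<xi> t (y + h *\<^sub>R u) - \<xi> t y))" for t h
    define b1 where "b1 z = (\<Sum>e\<in>Basis. (\<xi> (fst z) y \<bullet> e) *\<^sub>R diff_quot (\<lambda>z. A z e) (0, u) (fst z, y) (snd z))
      + diff_quot b (0, u) (fst z, y) (snd z)" for z
    have ty: "continuous_on UNIV (\<lambda>z. (fst z, y))" "continuous_on UNIV (\<lambda>z. (fst z, y + snd z *\<^sub>R u))"
      for z :: "real \<times> real" by (intro continuous_intros)+
    have sc: "continuous_on UNIV (snd :: real \<times> real \<Rightarrow> real)" by (intro continuous_intros)
    have \<xi>y: "continuous_on UNIV (\<lambda>z::real\<times>real. \<xi> (fst z) y)"
      using continuous_on_compose2[OF \<xi>_cont ty(1) subset_UNIV] by simp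
    have "continuous_on UNIV (\<lambda>(t, h). q t h)"
    proof (rule linear_ode_continuous[where A="\<lambda>z. A (fst z, y + snd z *\<^sub>R u)" and b=b1 and v="diff_quot v u y"])
      show "continuous_on UNIV (\<lambda>z. A (fst z, y + snd z *\<^sub>R u) e)" for e
        by (rule continuous_on_compose2[OF A_cont ty(2) subset_UNIV])
      show "continuous_on UNIV b1"
        unfolding b1_def
        by (intro continuous_on_add continuous_on_sum continuous_on_scaleR continuous_on_inner \<xi>y continuous_on_const
            continuous_on_diff_quot[OF A ty(1) sc] continuous_on_diff_quot[OF b ty(1) sc])
      show "continuous_on UNIV (diff_quot v u y)"
        using continuous_on_diff_quot[OF v continuous_on_const[of UNIV y] continuous_on_id] by simp
      show "q 0 h = diff_quot v u y h" for h
        using diff_quot_eq[OF v, of y h u] by (simp add: q_def \<xi>0 \<eta> diff_quot_0 v'_def)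
      show "((\<lambda>t. q t h) has_vector_derivative A (fst (t, h), y + snd (t, h) *\<^sub>R u) (q t h) + b1 (t, h)) (at t)" for t h
      proof (cases "h = 0")
        case True
        then show ?thesis using \<eta>(2)[of u y t] by (simp add: q_def b1_def diff_quot_0 b'_def)
      next
        case False
        have lA: "linear (A z)" for z by (rule lin)
        have dA: "A (t, y + h *\<^sub>R u) e - A (t, y) e = h *\<^sub>R diff_quot (\<lambda>z. A z e) (0, u) (t, y) h" for e
          using diff_quot_eq[OF A[of e], of "(t, y)" h "(0, u)"] by simp
        have db: "b (t, y + h *\<^sub>R u) - b (t, y) = h *\<^sub>R diff_quot b (0, u) (t, y) h"
          using diff_quot_eq[OF b, of "(t, y)" h "(0, u)"] by simp
        have "A (t, y + h *\<^sub>R u) x - A (t, y) x = h *\<^sub>R (\<Sum>e\<in>Basis. (x \<bullet> e) *\<^sub>R diff_quot (\<lambda>z. A z e) (0, u) (t, y) h)" for x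
        proof -
          have "(\<Sum>e\<in>Basis. (x \<bullet> e) *\<^sub>R A (t, y + h *\<^sub>R u) e) - (\<Sum>e\<in>Basis. (x \<bullet> e) *\<^sub>R A (t, y) e)
            = (\<Sum>e\<in>Basis. (x \<bullet> e) *\<^sub>R (h *\<^sub>R diff_quot (\<lambda>z. A z e) (0, u) (t, y) h))"
            unfolding dA[symmetric] scaleR_diff_right sum_subtractf ..
          also have "\<dots> = h *\<^sub>R (\<Sum>e\<in>Basis. (x \<bullet> e) *\<^sub>R diff_quot (\<lambda>z. A z e) (0, u) (t, y) h)"
            unfolding scaleR_sum_right by (rule sum.cong[OF refl]) (rule scaleR_left_commute)
          finally show ?thesis
            unfolding linear_eq_sum_Basis[OF lA[of "(t, y + h *\<^sub>R u)"], of x, symmetric]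
              linear_eq_sum_Basis[OF lA[of "(t, y)"], of x, symmetric] .
        qed
        note dAx = this
        have "inverse h *\<^sub>R ((A (t, y + h *\<^sub>R u) (\<xi> t (y + h *\<^sub>R u)) + b (t, y + h *\<^sub>R u)) - (A (t, y) (\<xi> t y) + b (t, y)))
          = inverse h *\<^sub>R (A (t, y + h *\<^sub>R u) (\<xi> t (y + h *\<^sub>R u)) - A (t, y + h *\<^sub>R u) (\<xi> t y))
            + inverse h *\<^sub>R (A (t, y + h *\<^sub>R u) (\<xi> t y) - A (t, y) (\<xi> t y)) + inverse h *\<^sub>R (b (t, y + h *\<^sub>R u) - b (t, y))"
          unfolding scaleR_add_right[symmetric] by (rule arg_cong[where f="scaleR (inverse h)"]) simp
        also have "\<dots> = A (t, y + h *\<^sub>R u) (q t h) + b1 (t, h)"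
          unfolding dAx db using False by (simp add: q_def b1_def linear_cmul[OF lA] linear_diff[OF lA])
        finally show ?thesis
          using has_vector_derivative_scaled_diff[OF \<xi>[of "y + h *\<^sub>R u"] \<xi>[of y], of h t] False by (simp add: q_def)
      qed
    qed (rule lin)
    then have "continuous_on UNIV (q t)"
      using continuous_on_slice(2)[of "\<lambda>(t, h). q t h" t] by simp
    then have "((\<lambda>h. \<xi> t (y + h *\<^sub>R u)) has_vector_derivative q t 0) (at 0)"
      by (rule has_vector_derivative_from_quotient) (simp add: q_def)
    then show ?thesis by (simp add: q_def)
  qed
  \<comment> \<open>The partial derivatives of \<xi>: in the time direction the right side of the
    equation, in a space direction the solution of the variational equation. Both are k times
    differentiable.\<close>
  define D where "D c z = (if fst c \<noteq> 0 then A z (\<xi> (fst z) (snd z)) + b z else \<eta> (snd c) (snd z) (fst z))" for c :: "real \<times> 'y" and z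
  have Dk: "times_differentiable_on k (D c) UNIV" for c
    unfolding D_def
    by (cases "fst c \<noteq> 0") (simp_all add: \<eta>k times_differentiable_on_add[OF open_UNIV
        times_differentiable_on_linear_apply[OF open_UNIV lin Ak \<xi>k] bk])
  have "((\<lambda>z. \<xi> (fst z) (snd z)) has_derivative (\<lambda>w. \<Sum>c\<in>Basis. (w \<bullet> c) *\<^sub>R D c z)) (at z)" for z
  proof (rule has_derivative_from_partials)
    show "continuous_on UNIV (D c)" for c by (rule times_differentiable_on_imp_continuous_on[OF Dk])
    fix z c :: "real \<times> 'y" assume c: "c \<in> Basis"
    show "((\<lambda>h. \<xi> (fst (z + h *\<^sub>R c)) (snd (z + h *\<^sub>R c))) has_vector_derivative D c z) (at 0)"
    proof (rule Basis_prod_cases[OF c])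
      assume [simp]: "c = (1, 0)"
      have "((\<lambda>h. \<xi> (fst z + h) (snd z)) has_vector_derivative 1 *\<^sub>R (A z (\<xi> (fst z) (snd z)) + b z)) (at 0)"
        by (rule vector_diff_chain_at[of "\<lambda>h. fst z + h" 1 0 "\<lambda>t. \<xi> t (snd z)", unfolded o_def])
          (use \<xi>[where y="snd z" and t="fst z"] in \<open>auto intro!: derivative_eq_intros simp: has_vector_derivative_def\<close>)
      then show ?thesis by (simp add: D_def)
    next
      fix u assume [simp]: "c = (0, u)"
      show ?thesis using gateaux[of "fst z" "snd z" u] by (simp add: D_def)
    qed
  qed
  note deriv = this
  have "times_differentiable_on k (\<lambda>z. \<Sum>c\<in>Basis. (w \<bullet> c) *\<^sub>R D c z) UNIV" for w
    by (rule times_differentiable_on_sum[OF open_UNIV])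
      (rule bounded_linear.times_differentiable_on[OF bounded_linear_scaleR_right open_UNIV Dk])
  then show ?case by (rule times_differentiable_on_SucI[OF open_UNIV deriv])
qed

section \<open>Smoothness of the flow of a vector field\<close>

lemma flow_continuous:
  fixes V :: "real \<times> 'x::euclidean_space \<Rightarrow> 'x"
  assumes lip: "\<And>T. \<exists>L. \<forall>t x y. \<bar>t\<bar> \<le> T \<longrightarrow> norm (V (t, x) - V (t, y)) \<le> L * norm (x - y)"
    and \<Phi>0: "\<And>x. \<Phi> 0 x = x"
    and \<Phi>: "\<And>t x. ((\<lambda>t. \<Phi> t x) has_vector_derivative V (t, \<Phi> t x)) (at t)"
  shows "continuous_on UNIV (\<lambda>z. \<Phi> (fst z) (snd z))"
proof -
  have "((\<lambda>z. \<Phi> (fst z) (snd z)) \<longlongrightarrow> \<Phi> t0 x0) (at (t0, x0))" for t0 x0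
  proof -
    define T where "T = \<bar>t0\<bar> + 1"
    obtain L where L': "\<forall>t x y. \<bar>t\<bar> \<le> T \<longrightarrow> norm (V (t, x) - V (t, y)) \<le> L * norm (x - y)" using lip[of T] by (rule exE)
    have L: "norm (V (t, x) - V (t, y)) \<le> L * norm (x - y)" if "\<bar>t\<bar> \<le> T" for t x y
      by (rule L'[rule_format, OF that])
    define K where "K = sqrt (exp ((2 * \<bar>L\<bar> + 1) * T))"
    have close: "norm (\<Phi> t x - \<Phi> t x0) \<le> K * norm (x - x0)" if t: "\<bar>t\<bar> \<le> T" for t x
    proof -
      have "(norm (\<Phi> t x - \<Phi> t x0))\<^sup>2 \<le> ((norm (\<Phi> 0 x - \<Phi> 0 x0))\<^sup>2 + 0\<^sup>2 * T) * exp ((2 * \<bar>L\<bar> + 1) * T)"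
      proof (rule gronwall[where d="\<lambda>s. \<Phi> s x - \<Phi> s x0" and d'="\<lambda>s. V (s, \<Phi> s x) - V (s, \<Phi> s x0)"])
        fix s assume s: "\<bar>s\<bar> \<le> T"
        show "((\<lambda>s. \<Phi> s x - \<Phi> s x0) has_vector_derivative V (s, \<Phi> s x) - V (s, \<Phi> s x0)) (at s)"
          by (intro has_vector_derivative_diff \<Phi>)
        show "norm (V (s, \<Phi> s x) - V (s, \<Phi> s x0)) \<le> \<bar>L\<bar> * norm (\<Phi> s x - \<Phi> s x0) + 0"
          using order_trans[OF L[OF s] mult_right_mono[OF abs_ge_self norm_ge_zero]] by simp
      qed (use t in simp_all)
      then have "sqrt ((norm (\<Phi> t x - \<Phi> t x0))\<^sup>2) \<le> sqrt ((norm (x - x0))\<^sup>2 * exp ((2 * \<bar>L\<bar> + 1) * T))"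
        by (simp add: \<Phi>0 del: real_sqrt_abs)
      then show ?thesis by (simp add: real_sqrt_mult K_def mult.commute)
    qed
    have ev: "\<forall>\<^sub>F z in at (t0, x0). \<bar>fst z\<bar> \<le> T"
    proof -
      have "((\<lambda>z. \<bar>fst z\<bar>) \<longlongrightarrow> \<bar>fst (t0, x0)\<bar>) (at (t0, x0))" by (intro tendsto_intros)
      then have "\<forall>\<^sub>F z in at (t0, x0). \<bar>fst z\<bar> < T" by (rule order_tendstoD) (simp add: T_def)
      then show ?thesis by (rule eventually_mono) simp
    qed
    have "((\<lambda>z. K * norm (snd z - x0)) \<longlongrightarrow> K * norm (snd (t0, x0) - x0)) (at (t0, x0))" by (intro tendsto_intros)
    then have lim: "((\<lambda>z. K * norm (snd z - x0)) \<longlongrightarrow> 0) (at (t0, x0))" by simp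
    have "\<forall>\<^sub>F z in at (t0, x0). norm (\<Phi> (fst z) (snd z) - \<Phi> (fst z) x0) \<le> K * norm (snd z - x0)"
      by (rule eventually_mono[OF ev]) (rule close)
    then have "((\<lambda>z. \<Phi> (fst z) (snd z) - \<Phi> (fst z) x0) \<longlongrightarrow> 0) (at (t0, x0))"
      by (rule Lim_null_comparison[OF _ lim])
    moreover have "((\<lambda>z. \<Phi> (fst z) x0) \<longlongrightarrow> \<Phi> t0 x0) (at (t0, x0))"
    proof -
      have "isCont (\<lambda>t. \<Phi> t x0) (fst (t0, x0))" using has_vector_derivative_continuous[OF \<Phi>] by simp
      moreover have "(fst \<longlongrightarrow> fst (t0, x0)) (at (t0, x0))" by (intro tendsto_intros)
      ultimately have "((\<lambda>z. \<Phi> (fst z) x0) \<longlongrightarrow> \<Phi> (fst (t0, x0)) x0) (at (t0, x0))"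
        by (rule isCont_tendsto_compose)
      then show ?thesis by simp
    qed
    ultimately have "((\<lambda>z. (\<Phi> (fst z) (snd z) - \<Phi> (fst z) x0) + \<Phi> (fst z) x0) \<longlongrightarrow> 0 + \<Phi> t0 x0) (at (t0, x0))"
      by (rule tendsto_add)
    then show ?thesis by simp
  qed
  then show ?thesis by (auto simp: continuous_on_def)
qed

text \<open>A bootstrap: if \<Phi> is k times differentiable, so are the coefficients
  \<open>A\<close> of the equation linearised along \<Phi>, hence its solutions \<eta>, hence all
  partial derivatives of \<Phi>. The induction starts from continuity, and the first derivatives
  come from difference quotients as in the linear case.\<close>

lemma smooth_flow:
  fixes V :: "real \<times> 'x::euclidean_space \<Rightarrow> 'x"
  assumes V: "smooth_on V UNIV"
    and lip: "\<And>T. \<exists>L. \<forall>t x y. \<bar>t\<bar> \<le> T \<longrightarrow> norm (V (t, x) - V (t, y)) \<le> L * norm (x - y)"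
    and \<Phi>0: "\<And>x. \<Phi> 0 x = x"
    and \<Phi>: "\<And>t x. ((\<lambda>t. \<Phi> t x) has_vector_derivative V (t, \<Phi> t x)) (at t)"
  shows "smooth_on (\<lambda>z. \<Phi> (fst z) (snd z)) UNIV"
proof -
  note V1 = smooth_onD[OF V, of 1, unfolded One_nat_def]
  have \<Phi>_cont: "continuous_on UNIV (\<lambda>z. \<Phi> (fst z) (snd z))" by (rule flow_continuous[OF lip \<Phi>0 \<Phi>])
  have V'_lin: "linear (frechet_derivative V (at z))" for z
    using has_derivative_linear[OF smooth_on_has_derivative[OF V]] by simp
  have V'_cont: "continuous_on UNIV (\<lambda>z. frechet_derivative V (at z) w)" for w
    by (rule smooth_on_imp_continuous_on[OF smooth_on_frechet_derivative[OF V]])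
  define A where "A z e = frechet_derivative V (at (fst z, \<Phi> (fst z) (snd z))) (0, e)" for z e
  have A_lin: "linear (A z)" for z
    unfolding A_def by (rule linear_compose[of "\<lambda>e. (0, e)", unfolded o_def, OF _ V'_lin]) (auto intro!: linearI)
  have A_cont: "continuous_on UNIV (\<lambda>z. A z e)" for e
    unfolding A_def
    by (rule continuous_on_compose2[OF V'_cont _ subset_UNIV]) (intro continuous_on_Pair continuous_on_fst continuous_on_id \<Phi>_cont)
  have "\<exists>x. x 0 = u \<and> (\<forall>t. (x has_vector_derivative A (t, y) (x t) + 0) (at t))" for u y
    by (rule linear_ode_exists[of "\<lambda>t. A (t, y)" "\<lambda>t. 0" u]) (auto intro: A_lin continuous_on_slice(1)[OF A_cont])
  then obtain \<eta> where \<eta>: "\<And>u y. \<eta> u y 0 = u"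
    "\<And>u y t. (\<eta> u y has_vector_derivative A (t, y) (\<eta> u y t) + 0) (at t)" by metis
  have gateaux: "((\<lambda>h. \<Phi> t (y + h *\<^sub>R u)) has_vector_derivative \<eta> u y t) (at 0)" for t y u
  proof -
    define q where "q t h = (if h = 0 then \<eta> u y t else inverse h *\<^sub>R (\<Phi> t (y + h *\<^sub>R u) - \<Phi> t y))" for t h
    define p where "p z \<theta> = \<Phi> (fst z) y + \<theta> *\<^sub>R (\<Phi> (fst z) (y + snd z *\<^sub>R u) - \<Phi> (fst z) y)" for z :: "real \<times> real" and \<theta> :: real
    \<comment> \<open>The mean of the space derivative of \<open>V\<close> over the segment between
      two solutions. With it the difference of the two satisfies an exact linear equation, and at h
      = 0 it reduces to \<open>A\<close>.\<close>
    define A1 where "A1 z e = integral {0..1} (\<lambda>\<theta>. frechet_derivative V (at (fst z, p z \<theta>)) (0, e))" for z e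
    have c1: "continuous_on UNIV (\<lambda>z::(real \<times> real) \<times> real. \<Phi> (fst (fst z)) y)"
      "continuous_on UNIV (\<lambda>z::(real \<times> real) \<times> real. \<Phi> (fst (fst z)) (y + snd (fst z) *\<^sub>R u))"
      using continuous_on_compose2[OF \<Phi>_cont, of UNIV "\<lambda>z::(real \<times> real) \<times> real. (fst (fst z), y)"]
        continuous_on_compose2[OF \<Phi>_cont, of UNIV "\<lambda>z::(real \<times> real) \<times> real. (fst (fst z), y + snd (fst z) *\<^sub>R u)"]
      by (simp_all add: continuous_on_Pair continuous_on_fst continuous_on_snd continuous_on_id continuous_on_add continuous_on_scaleR)
    have c2: "continuous_on UNIV (\<lambda>z. frechet_derivative V (at (fst (fst z), p (fst z) (snd z))) (0, e))" for e
      unfolding p_def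
      by (rule continuous_on_compose2[OF V'_cont _ subset_UNIV])
        (intro continuous_on_Pair continuous_on_add continuous_on_scaleR continuous_on_diff c1 continuous_on_fst continuous_on_snd continuous_on_id)
    have A1_cont: "continuous_on UNIV (\<lambda>z. A1 z e)" for e
      unfolding A1_def by (rule continuous_on_integral_param[OF c2])
    have int: "(\<lambda>\<theta>. frechet_derivative V (at (fst z, p z \<theta>)) (0, e)) integrable_on {0..1}" for z e
      using continuous_on_slice(2)[OF c2, of z e] by (auto intro!: integrable_continuous_real intro: continuous_on_subset)
    have A1_lin: "linear (A1 z)" for z
    proof (rule linearI)
      show "A1 z (e + e') = A1 z e + A1 z e'" for e e'
        using linear_add[OF V'_lin, of _ "(0, e)" "(0, e')"] int by (simp add: A1_def integral_add[symmetric])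
      show "A1 z (r *\<^sub>R e) = r *\<^sub>R A1 z e" for r e
        using linear_cmul[OF V'_lin, of _ r "(0, e)"] by (simp add: A1_def)
    qed
    have "continuous_on UNIV (\<lambda>(t, h). q t h)"
    proof (rule linear_ode_continuous[OF A1_lin A1_cont continuous_on_const[of _ 0] continuous_on_const[of _ u]])
      show "q 0 h = u" for h by (simp add: q_def \<eta> \<Phi>0)
      show "((\<lambda>t. q t h) has_vector_derivative A1 (t, h) (q t h) + 0) (at t)" for t h
      proof (cases "h = 0")
        case True
        have "A1 (t, 0) e = A (t, y) e" for e by (simp add: A1_def A_def p_def)
        then show ?thesis using True \<eta>(2)[of u y t] by (simp add: q_def)
      next
        case False
        let ?d = "\<Phi> t (y + h *\<^sub>R u) - \<Phi> t y"
        have "V (t, \<Phi> t (y + h *\<^sub>R u)) - V (t, \<Phi> t y) = V ((t, \<Phi> t y) + (0, ?d)) - V (t, \<Phi> t y)" by simp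
        also have "\<dots> = A1 (t, h) ?d"
          unfolding integral_frechet_derivative[OF V1] A1_def p_def by simp
        finally have "inverse h *\<^sub>R (V (t, \<Phi> t (y + h *\<^sub>R u)) - V (t, \<Phi> t y)) = A1 (t, h) (q t h)"
          using False by (simp add: q_def linear_cmul[OF A1_lin])
        then show ?thesis
          using has_vector_derivative_scaled_diff[OF \<Phi>[of "y + h *\<^sub>R u"] \<Phi>[of y], of h t] False by (simp add: q_def)
      qed
    qed
    then have "continuous_on UNIV (q t)"
      using continuous_on_slice(2)[of "\<lambda>(t, h). q t h" t] by simp
    then have "((\<lambda>h. \<Phi> t (y + h *\<^sub>R u)) has_vector_derivative q t 0) (at 0)"
      by (rule has_vector_derivative_from_quotient) (simp add: q_def)
    then show ?thesis by (simp add: q_def)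
  qed
  define D where "D c z = (if fst c \<noteq> 0 then V (fst z, \<Phi> (fst z) (snd z)) else \<eta> (snd c) (snd z) (fst z))" for c :: "real \<times> 'x" and z
  have Dk: "times_differentiable_on k (D c) UNIV" if "times_differentiable_on k (\<lambda>z. \<Phi> (fst z) (snd z)) UNIV" for k c
  proof -
    have p: "times_differentiable_on k (\<lambda>z. (fst z, \<Phi> (fst z) (snd z))) UNIV"
    proof -
      have "times_differentiable_on k (\<lambda>z. (fst z, 0) + (0, \<Phi> (fst z) (snd z))) UNIV"
        by (intro times_differentiable_on_add open_UNIV
            bounded_linear.times_differentiable_on[OF bounded_linear_Pair[OF bounded_linear_fst bounded_linear_zero] _ times_differentiable_on_ident]
            bounded_linear.times_differentiable_on[OF bounded_linear_Pair[OF bounded_linear_zero bounded_linear_ident] _ that])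
      then show ?thesis by simp
    qed
    have "times_differentiable_on k (\<lambda>z. V (fst z, \<Phi> (fst z) (snd z))) UNIV"
      by (rule times_differentiable_on_compose[OF open_UNIV p smooth_onD[OF V] subset_UNIV])
    moreover have "times_differentiable_on k (\<lambda>z. \<eta> u (snd z) (fst z)) UNIV" for u
    proof (rule linear_ode_times_differentiable[where \<xi>="\<lambda>t y. \<eta> u y t" and b="\<lambda>z. 0" and v="\<lambda>y. u", OF A_lin _ _ _ \<eta>])
      show "times_differentiable_on k (\<lambda>z. A z e) UNIV" for e
        unfolding A_def
        by (rule times_differentiable_on_compose[OF open_UNIV p smooth_onD[OF smooth_on_frechet_derivative[OF V]] subset_UNIV])
    qed (simp_all add: times_differentiable_on_const)
    ultimately show ?thesis unfolding D_def by (cases "fst c \<noteq> 0") simp_all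
  qed
  have "((\<lambda>z. \<Phi> (fst z) (snd z)) has_derivative (\<lambda>w. \<Sum>c\<in>Basis. (w \<bullet> c) *\<^sub>R D c z)) (at z)" for z
  proof (rule has_derivative_from_partials)
    have "times_differentiable_on 0 (\<lambda>z. \<Phi> (fst z) (snd z)) UNIV" using \<Phi>_cont by simp
    from Dk[OF this] show "continuous_on UNIV (D c)" for c by simp
    fix z c :: "real \<times> 'x" assume c: "c \<in> Basis"
    show "((\<lambda>h. \<Phi> (fst (z + h *\<^sub>R c)) (snd (z + h *\<^sub>R c))) has_vector_derivative D c z) (at 0)"
    proof (rule Basis_prod_cases[OF c])
      assume [simp]: "c = (1, 0)"
      have "((\<lambda>h. \<Phi> (fst z + h) (snd z)) has_vector_derivative 1 *\<^sub>R V (fst z, \<Phi> (fst z) (snd z))) (at 0)"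
        by (rule vector_diff_chain_at[of "\<lambda>h. fst z + h" 1 0 "\<lambda>t. \<Phi> t (snd z)", unfolded o_def])
          (use \<Phi>[where x="snd z" and t="fst z"] in \<open>auto intro!: derivative_eq_intros simp: has_vector_derivative_def\<close>)
      then show ?thesis by (simp add: D_def)
    next
      fix u assume [simp]: "c = (0, u)"
      show ?thesis using gateaux[of "fst z" "snd z" u] by (simp add: D_def)
    qed
  qed
  note deriv = this
  show ?thesis
  proof (rule smooth_onI)
    show "times_differentiable_on k (\<lambda>z. \<Phi> (fst z) (snd z)) UNIV" for k
    proof (induction k)
      case 0
      show ?case using \<Phi>_cont by simp
    next
      case (Suc k)
      have "times_differentiable_on k (\<lambda>z. \<Sum>c\<in>Basis. (w \<bullet> c) *\<^sub>R D c z) UNIV" for w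
        by (rule times_differentiable_on_sum[OF open_UNIV])
          (rule bounded_linear.times_differentiable_on[OF bounded_linear_scaleR_right open_UNIV Dk[OF Suc]])
      then show ?case by (rule times_differentiable_on_SucI[OF open_UNIV deriv])
    qed
  qed
qed

section \<open>Parity of the zeros at the end of a homotopy\<close>

lemma frechet_derivative_vector:
  assumes "smooth_on F S" "x \<in> S"
  shows "((\<lambda>h. F (x + h *\<^sub>R v)) has_vector_derivative frechet_derivative F (at x) v) (at 0)"
proof -
  have 1: "((\<lambda>h::real. x + h *\<^sub>R v) has_derivative (\<lambda>h. h *\<^sub>R v)) (at 0)" by (auto intro!: derivative_eq_intros)
  have 2: "(F has_derivative frechet_derivative F (at x)) (at (x + 0 *\<^sub>R v))"
    using smooth_on_has_derivative[OF assms] by simp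
  show ?thesis
    unfolding has_vector_derivative_def
    using has_derivative_compose[OF 1 2] linear_cmul[OF has_derivative_linear[OF 2]] by simp
qed

text \<open>The increment of \<open>F\<close> along t v is t times an integral of \<open>Fv\<close>.
  Differentiating under the integral in direction u shows that Fu (z + t v) - Fu z is t times an
  average of \<open>Fvu\<close> over the segment, and so the derivative of \<open>Fu\<close> along v
  at t = 0 is \<open>Fvu z\<close>.\<close>

lemma frechet_derivative_commute_UNIV:
  fixes F :: "'e::euclidean_space \<Rightarrow> 'f::euclidean_space"
  assumes F: "smooth_on F UNIV"
  shows "frechet_derivative (\<lambda>x. frechet_derivative F (at x) v) (at z) u
    = frechet_derivative (\<lambda>x. frechet_derivative F (at x) u) (at z) v"
proof -
  define Fv where "Fv x = frechet_derivative F (at x) v" for x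
  define Fu where "Fu x = frechet_derivative F (at x) u" for x
  define Fvu where "Fvu x = frechet_derivative Fv (at x) u" for x
  have Fv: "smooth_on Fv UNIV" and Fu: "smooth_on Fu UNIV"
    unfolding Fv_def Fu_def by (rule smooth_on_frechet_derivative[OF F])+
  have Fvu: "continuous_on UNIV Fvu"
    unfolding Fvu_def by (rule smooth_on_imp_continuous_on[OF smooth_on_frechet_derivative[OF Fv]])
  have cFv: "continuous_on UNIV Fv" by (rule smooth_on_imp_continuous_on[OF Fv])
  define q where "q t = integral {0..1} (\<lambda>\<theta>. Fvu (z + (\<theta> * t) *\<^sub>R v))" for t
  have q: "continuous_on UNIV q"
    unfolding q_def
    by (rule continuous_on_integral_param, rule continuous_on_compose2[OF Fvu _ subset_UNIV]) (intro continuous_intros)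
  have "Fu (z + t *\<^sub>R v) - Fu (z + 0 *\<^sub>R v) = t *\<^sub>R q t" for t
  proof -
    have "((\<lambda>s. integral (cbox 0 1) (\<lambda>\<theta>. Fv (z + (\<theta> * t) *\<^sub>R v + s *\<^sub>R u))) has_vector_derivative
        integral (cbox 0 1) (\<lambda>\<theta>. Fvu (z + (\<theta> * t) *\<^sub>R v + 0 *\<^sub>R u))) (at 0 within UNIV)"
    proof (rule leibniz_rule_vector_derivative[where fx="\<lambda>s \<theta>. Fvu (z + (\<theta> * t) *\<^sub>R v + s *\<^sub>R u)"])
      show "((\<lambda>s. Fv (z + (\<theta> * t) *\<^sub>R v + s *\<^sub>R u)) has_vector_derivative Fvu (z + (\<theta> * t) *\<^sub>R v + s *\<^sub>R u)) (at s within UNIV)" for s \<theta>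
      proof -
        have 1: "((\<lambda>s. z + (\<theta> * t) *\<^sub>R v + s *\<^sub>R u) has_derivative (\<lambda>h. h *\<^sub>R u)) (at s)" by (auto intro!: derivative_eq_intros)
        have 2: "(Fv has_derivative frechet_derivative Fv (at (z + (\<theta> * t) *\<^sub>R v + s *\<^sub>R u))) (at (z + (\<theta> * t) *\<^sub>R v + s *\<^sub>R u))"
          using smooth_on_has_derivative[OF Fv] by simp
        show ?thesis
          unfolding has_vector_derivative_def Fvu_def
          using has_derivative_compose[OF 1 2] linear_cmul[OF has_derivative_linear[OF 2]] by simp
      qed
      show "(\<lambda>\<theta>. Fv (z + (\<theta> * t) *\<^sub>R v + s *\<^sub>R u)) integrable_on cbox 0 1" for s
        by (rule integrable_continuous, rule continuous_on_compose2[OF cFv _ subset_UNIV]) (intro continuous_intros)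
      show "continuous_on (UNIV \<times> cbox 0 1) (\<lambda>(s, \<theta>). Fvu (z + (\<theta> * t) *\<^sub>R v + s *\<^sub>R u))"
        unfolding split_def by (rule continuous_on_compose2[OF Fvu _ subset_UNIV]) (intro continuous_intros)
    qed auto
    then have "((\<lambda>s. t *\<^sub>R integral {0..1} (\<lambda>\<theta>. Fv (z + (\<theta> * t) *\<^sub>R v + s *\<^sub>R u))) has_vector_derivative t *\<^sub>R q t) (at 0)"
      unfolding q_def by (intro bounded_linear.has_vector_derivative[OF bounded_linear_scaleR_right]) simp
    moreover have "t *\<^sub>R integral {0..1} (\<lambda>\<theta>. Fv (z + (\<theta> * t) *\<^sub>R v + s *\<^sub>R u))
      = F ((z + t *\<^sub>R v) + s *\<^sub>R u) - F (z + s *\<^sub>R u)" for s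
      using diff_quot_eq[OF smooth_onD[OF F, of 1, unfolded One_nat_def], of "z + s *\<^sub>R u" t v]
      by (simp add: diff_quot_def Fv_def algebra_simps)
    ultimately have "((\<lambda>s. F ((z + t *\<^sub>R v) + s *\<^sub>R u) - F (z + s *\<^sub>R u)) has_vector_derivative t *\<^sub>R q t) (at 0)"
      by simp
    moreover have "((\<lambda>s. F ((z + t *\<^sub>R v) + s *\<^sub>R u) - F (z + s *\<^sub>R u)) has_vector_derivative Fu (z + t *\<^sub>R v) - Fu z) (at 0)"
      unfolding Fu_def by (intro has_vector_derivative_diff frechet_derivative_vector[OF F]) auto
    ultimately show ?thesis using vector_derivative_unique_at by force
  qed
  then have "((\<lambda>t. Fu (z + t *\<^sub>R v)) has_vector_derivative q 0) (at 0)"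
    by (rule has_vector_derivative_from_quotient[OF q])
  moreover have "((\<lambda>t. Fu (z + t *\<^sub>R v)) has_vector_derivative frechet_derivative Fu (at z) v) (at 0)"
    by (rule frechet_derivative_vector[OF Fu]) simp
  ultimately have "q 0 = frechet_derivative Fu (at z) v" by (rule vector_derivative_unique_at)
  then show ?thesis by (simp add: q_def Fvu_def Fu_def[abs_def] Fv_def[abs_def])
qed

lemma frechet_derivative_transform:
  assumes "open S" "x \<in> S" "\<And>y. y \<in> S \<Longrightarrow> f y = g y"
  shows "frechet_derivative f (at x) = frechet_derivative g (at x)"
proof -
  have "(f has_derivative D) (at x) \<longleftrightarrow> (g has_derivative D) (at x)" for D
    using has_derivative_transform_within_open[OF _ assms(1,2), of f D UNIV g]
      has_derivative_transform_within_open[OF _ assms(1,2), of g D UNIV f] assms(3) by auto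
  then show ?thesis by (simp add: frechet_derivative_def)
qed

text \<open>Second derivatives at \<open>z\<close> depend only on values near \<open>z\<close>, so a
  cutoff reduces the claim to functions on the whole space.\<close>

lemma frechet_derivative_commute:
  fixes F :: "'e::euclidean_space \<Rightarrow> 'f::euclidean_space"
  assumes F: "smooth_on F S" and S: "open S" "z \<in> S"
  shows "frechet_derivative (\<lambda>x. frechet_derivative F (at x) v) (at z) u
    = frechet_derivative (\<lambda>x. frechet_derivative F (at x) u) (at z) v"
proof -
  obtain b V C where b: "smooth_on b UNIV" "open V" "{z} \<subseteq> V" "\<And>x. x \<in> V \<Longrightarrow> b x = (1::real)"
    "compact C" "C \<subseteq> S" "\<And>x. x \<notin> C \<Longrightarrow> b x = 0" "\<And>x. 0 \<le> b x" "\<And>x. b x \<le> 1"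
  proof (rule smooth_bump[of "{z}" S])
    show "compact {z}" "open S" "{z} \<subseteq> S" using S by auto
  qed (rule that)
  define G where "G x = (if x \<in> S then b x *\<^sub>R F x else 0)" for x
  have "smooth_on G (\<Union>X\<in>{S, - C}. X)"
  proof (rule smooth_on_UN)
    fix X assume X: "X \<in> {S, - C}"
    then show "open X" using S b(5) by (auto simp: open_Compl compact_imp_closed)
    show "smooth_on G X"
    proof (cases "X = S")
      case True
      have "smooth_on (\<lambda>x. b x *\<^sub>R F x) S"
        by (intro smooth_on_scaleR S F smooth_on_subset[OF b(1)]) auto
      then show ?thesis unfolding True by (rule smooth_on_cong[OF S(1), rotated]) (simp add: G_def)
    next
      case False
      then have "X = - C" using X by simp
      then show ?thesis
        using smooth_on_cong[OF \<open>open X\<close> _ smooth_on_const[OF \<open>open X\<close>], of 0 G] b(7) by (auto simp: G_def)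
    qed
  qed
  moreover have "(\<Union>X\<in>{S, - C}. X) = UNIV" using b(6) by auto
  ultimately have G: "smooth_on G UNIV" by simp
  have W: "open (V \<inter> S)" "z \<in> V \<inter> S" using b S by auto
  have eq: "frechet_derivative F (at x) = frechet_derivative G (at x)" if "x \<in> V \<inter> S" for x
    by (rule frechet_derivative_transform[OF W(1) that]) (use b(4) in \<open>auto simp: G_def\<close>)
  have "frechet_derivative (\<lambda>x. frechet_derivative F (at x) w) (at z) = frechet_derivative (\<lambda>x. frechet_derivative G (at x) w) (at z)" for w
    by (rule frechet_derivative_transform[OF W]) (simp add: eq)
  then show ?thesis using frechet_derivative_commute_UNIV[OF G] by simp
qed

section \<open>Determinants as functions of their rows\<close>

definition replace_row :: "('n \<Rightarrow> real^'n) \<Rightarrow> 'n \<Rightarrow> real^'n \<Rightarrow> real^'n^'n" where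
  "replace_row r i h = (\<chi> j. if j = i then h else r j)"

lemma has_derivative_det:
  fixes r :: "'n::finite \<Rightarrow> 'z::real_normed_vector \<Rightarrow> real^'n"
  assumes r: "\<And>i. (r i has_derivative r' i) (at z)"
  shows "((\<lambda>z. det (\<chi> i. r i z)) has_derivative (\<lambda>h. \<Sum>i\<in>UNIV. det (replace_row (\<lambda>j. r j z) i (r' i h)))) (at z)"
proof -
  have c: "((\<lambda>z. r i z $ j) has_derivative (\<lambda>h. r' i h $ j)) (at z)" for i j
    by (rule bounded_linear.has_derivative[OF bounded_linear_vec_nth r])
  have "((\<lambda>z. \<Sum>p | p permutes UNIV. of_int (sign p) * (\<Prod>i\<in>UNIV. r i z $ p i)) has_derivative
    (\<lambda>h. \<Sum>p | p permutes UNIV. of_int (sign p) * (\<Sum>i\<in>UNIV. r' i h $ p i * (\<Prod>j\<in>UNIV - {i}. r j z $ p j)))) (at z)"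
    by (intro has_derivative_sum has_derivative_mult_right has_derivative_prod c)
  moreover have "(\<Sum>p | p permutes UNIV. of_int (sign p) * (\<Sum>i\<in>UNIV. r' i h $ p i * (\<Prod>j\<in>UNIV - {i}. r j z $ p j)))
    = (\<Sum>i\<in>UNIV. det (replace_row (\<lambda>j. r j z) i (r' i h)))" for h
  proof -
    have "r' i h $ p i * (\<Prod>j\<in>UNIV - {i}. r j z $ p j) = (\<Prod>j\<in>UNIV. replace_row (\<lambda>j. r j z) i (r' i h) $ j $ p j)" for i p
    proof -
      have "(\<Prod>j\<in>UNIV. replace_row (\<lambda>j. r j z) i (r' i h) $ j $ p j)
        = replace_row (\<lambda>j. r j z) i (r' i h) $ i $ p i * (\<Prod>j\<in>UNIV - {i}. replace_row (\<lambda>j. r j z) i (r' i h) $ j $ p j)"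
        by (rule prod.remove) auto
      also have "(\<Prod>j\<in>UNIV - {i}. replace_row (\<lambda>j. r j z) i (r' i h) $ j $ p j) = (\<Prod>j\<in>UNIV - {i}. r j z $ p j)"
        by (rule prod.cong) (auto simp: replace_row_def)
      finally show ?thesis by (simp add: replace_row_def)
    qed
    then show ?thesis
      unfolding det_def sum_distrib_left by (subst sum.swap) simp
  qed
  ultimately show ?thesis unfolding det_def by simp
qed

text \<open>If the rows are independent, \<open>h\<close> is a combination of them whose
  coefficients are given by Cramer's rule, and the identity is the linearity of the inner product.
  The singular case is settled by differentiating a determinant that vanishes identically.\<close>

lemma sum_replace_row:
  fixes r :: "'n::finite \<Rightarrow> real^'n"
  shows "(\<Sum>i\<in>UNIV. (r i \<bullet> l) * det (replace_row r i h)) = (h \<bullet> l) * det (\<chi> i. r i)"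
proof (cases "det (\<chi> i. r i) = 0")
  case True
  \<comment> \<open>Adding t (r_i \<bullet> l) h to each row r_i amounts to multiplying the matrix
    from the right by I + t l h^T. So the determinant stays 0 for all t, and its derivative at t = 0
    is the sum in question.\<close>
  define B :: "real \<Rightarrow> real^'n^'n" where "B t = (\<chi> k j. (if k = j then 1 else 0) + t * (l $ k * h $ j))" for t
  have B: "(\<chi> i. r i + t *\<^sub>R ((r i \<bullet> l) *\<^sub>R h)) = (\<chi> i. r i) ** B t" for t
  proof -
    have "r i $ j + t * ((r i \<bullet> l) * h $ j) = (\<Sum>k\<in>UNIV. r i $ k * ((if k = j then 1 else 0) + t * (l $ k * h $ j)))" for i j
    proof -
      have "(\<Sum>k\<in>UNIV. r i $ k * (t * (l $ k * h $ j))) = t * ((r i \<bullet> l) * h $ j)"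
        unfolding inner_vec_def by (simp add: sum_distrib_left sum_distrib_right mult_ac)
      moreover have "(\<Sum>k\<in>UNIV. r i $ k * (if k = j then 1 else 0)) = r i $ j"
        using sum.delta[of UNIV j "\<lambda>k. r i $ k"] by (simp add: if_distrib[of "(*) _"] cong: if_cong)
      ultimately show ?thesis by (simp only: distrib_left sum.distrib)
    qed
    then show ?thesis by (simp add: vec_eq_iff matrix_matrix_mult_def B_def mult.assoc)
  qed
  have "((\<lambda>t. det (\<chi> i. r i + t *\<^sub>R ((r i \<bullet> l) *\<^sub>R h))) has_derivative
    (\<lambda>s. \<Sum>i\<in>UNIV. det (replace_row (\<lambda>j. r j + 0 *\<^sub>R ((r j \<bullet> l) *\<^sub>R h)) i (s *\<^sub>R ((r i \<bullet> l) *\<^sub>R h))))) (at (0::real))"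
    by (rule has_derivative_det) (auto intro!: derivative_eq_intros)
  then have "((\<lambda>t. 0) has_derivative (\<lambda>s. \<Sum>i\<in>UNIV. det (replace_row r i (s *\<^sub>R ((r i \<bullet> l) *\<^sub>R h))))) (at (0::real))"
    unfolding B det_mul True mult_zero_left scaleR_zero_left add_0_right .
  then have "(\<lambda>s. \<Sum>i\<in>UNIV. det (replace_row r i (s *\<^sub>R ((r i \<bullet> l) *\<^sub>R h)))) = (\<lambda>s. 0)"
    using has_derivative_unique[OF _ has_derivative_const] by blast
  from fun_cong[OF this, of 1] have "(\<Sum>i\<in>UNIV. det (replace_row r i ((r i \<bullet> l) *\<^sub>R h))) = 0" by simp
  moreover have "det (replace_row r i (c *\<^sub>R h)) = c * det (replace_row r i h)" for i c
  proof -
    have "c *\<^sub>R h = c *s h" by (simp add: vec_eq_iff)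
    show ?thesis unfolding replace_row_def \<open>c *\<^sub>R h = c *s h\<close> by (rule det_row_mul)
  qed
  ultimately show ?thesis using True by simp
next
  case False
  define A :: "real^'n^'n" where "A = (\<chi> i. r i)"
  have "invertible (transpose A)" using False by (simp add: invertible_det_nz A_def)
  then obtain B where B: "transpose A ** B = mat 1" unfolding invertible_def by blast
  define x where "x = B *v h"
  have h: "h = (\<Sum>i\<in>UNIV. x $ i *s r i)"
  proof -
    have "h = transpose A *v x" using B by (simp add: x_def matrix_vector_mul_assoc)
    then show ?thesis by (simp add: matrix_mult_sum column_transpose A_def row_def vec_lambda_eta)
  qed
  have row: "row i A = r i" for i by (simp add: row_def A_def vec_eq_iff)
  have D: "det (replace_row r k h) = x $ k * det A" for k
    using cramer_lemma_transpose[of k x A, unfolded row h[symmetric]] unfolding replace_row_def .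
  have "(\<Sum>i\<in>UNIV. (r i \<bullet> l) * det (replace_row r i h)) = (\<Sum>i\<in>UNIV. x $ i * (r i \<bullet> l)) * det A"
    by (simp add: D sum_distrib_right sum_distrib_left mult_ac)
  also have "(\<Sum>i\<in>UNIV. x $ i * (r i \<bullet> l)) = h \<bullet> l"
  proof -
    have "(\<Sum>i\<in>UNIV. x $ i *s r i) \<bullet> l = (\<Sum>i\<in>UNIV. x $ i * (r i \<bullet> l))"
      by (simp add: inner_sum_left scalar_mult_eq_scaleR)
    then show ?thesis unfolding h[symmetric] by (rule sym)
  qed
  finally show ?thesis by (simp add: A_def)
qed

lemma det_replace_two_rows_swap:
  fixes r :: "'n::finite \<Rightarrow> real^'n"
  assumes "i \<noteq> j"
  shows "det (replace_row (\<lambda>k. if k = i then a else r k) j b) = - det (replace_row (\<lambda>k. if k = j then a else r k) i b)"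
proof -
  let ?p = "Transposition.transpose i j"
  let ?M = "replace_row (\<lambda>k. if k = j then a else r k) i b"
  have "det (\<chi> k. ?M $ ?p k) = of_int (sign ?p) * det ?M"
    by (rule det_permute_rows) (rule permutes_swap_id; simp)
  moreover have "(\<chi> k. ?M $ ?p k) = replace_row (\<lambda>k. if k = i then a else r k) j b"
    using assms by (auto simp: replace_row_def vec_eq_iff Transposition.transpose_def)
  ultimately show ?thesis using assms by (simp add: sign_swap_id)
qed

lemma smooth_on_vec_nth: "open S \<Longrightarrow> smooth_on f S \<Longrightarrow> smooth_on (\<lambda>x. f x $ i) S"
  by (rule bounded_linear.smooth_on[OF bounded_linear_vec_nth])

lemma smooth_on_prod:
  fixes f :: "'i \<Rightarrow> 'e::real_normed_vector \<Rightarrow> real"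
  shows "open S \<Longrightarrow> (\<And>i. i \<in> I \<Longrightarrow> smooth_on (f i) S) \<Longrightarrow> smooth_on (\<lambda>x. \<Prod>i\<in>I. f i x) S"
  by (induction I rule: infinite_finite_induct) (auto intro: smooth_on_const smooth_on_mult)

lemma smooth_on_det:
  fixes r :: "'n::finite \<Rightarrow> 'z::real_normed_vector \<Rightarrow> real^'n"
  assumes "open S" "\<And>i. smooth_on (r i) S"
  shows "smooth_on (\<lambda>z. det (\<chi> i. r i z)) S"
proof -
  have "smooth_on (\<lambda>z. \<Sum>p | p permutes UNIV. of_int (sign p) * (\<Prod>i\<in>UNIV. r i z $ p i)) S"
    by (intro smooth_on_sum smooth_on_mult smooth_on_const smooth_on_prod smooth_on_vec_nth assms)
  then show ?thesis by (simp add: det_def)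
qed

lemma frechet_derivative_mult:
  fixes f g :: "'e::real_normed_vector \<Rightarrow> real"
  assumes "smooth_on f S" "smooth_on g S" "x \<in> S"
  shows "frechet_derivative (\<lambda>x. f x * g x) (at x) v = f x * frechet_derivative g (at x) v + frechet_derivative f (at x) v * g x"
  using frechet_derivative_at[OF has_derivative_mult[OF smooth_on_has_derivative[OF assms(1,3)] smooth_on_has_derivative[OF assms(2,3)]]]
  by (metis (mono_tags, lifting))

section \<open>Integrals of compactly supported functions\<close>

lemma integral_cbox_UNIV:
  fixes w :: "'e::euclidean_space \<Rightarrow> real"
  assumes w: "continuous_on UNIV w" "\<And>y. R \<le> norm y \<Longrightarrow> w y = 0" and "\<And>y. norm y < R \<Longrightarrow> y \<in> cbox a b"
  shows "(w has_integral integral UNIV w) (cbox a b)" "(w has_integral integral UNIV w) UNIV"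
proof -
  have "w integrable_on cbox a b" by (rule integrable_continuous[OF continuous_on_subset[OF w(1) subset_UNIV]])
  then have 1: "(w has_integral integral (cbox a b) w) (cbox a b)" by (rule integrable_integral)
  have z: "w y = 0" if "y \<notin> cbox a b" for y using assms(3)[of y] w(2)[of y] that by fastforce
  have 2: "(w has_integral integral (cbox a b) w) UNIV"
    by (rule has_integral_on_superset[OF 1 z subset_UNIV])
  then have "integral UNIV w = integral (cbox a b) w" by (rule integral_unique)
  then show "(w has_integral integral UNIV w) (cbox a b)" "(w has_integral integral UNIV w) UNIV" using 1 2 by simp_all
qed

text \<open>The box leaves a margin 1 around the ball of radius R, so that translations by vectors
  of norm at most 1 keep the support inside.\<close>

definition big_box :: "real \<Rightarrow> 'e::euclidean_space set" where
  "big_box R = cbox (- ((R + 1) *\<^sub>R One)) ((R + 1) *\<^sub>R One)"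

lemma in_big_box: "norm (y - c) < R \<Longrightarrow> norm c \<le> 1 \<Longrightarrow> (y :: 'e::euclidean_space) \<in> big_box R"
proof -
  assume 1: "norm (y - c) < R" "norm c \<le> 1"
  have "norm y < R + 1" using norm_triangle_ineq[of "y - c" c] 1 by simp
  then have "\<bar>y \<bullet> i\<bar> \<le> R + 1" if "i \<in> Basis" for i using Basis_le_norm[OF that, of y] by simp
  then have "- (R + 1) \<le> y \<bullet> i \<and> y \<bullet> i \<le> R + 1" if "i \<in> Basis" for i using that by (fastforce simp: abs_le_iff)
  then show ?thesis by (simp add: big_box_def mem_box)
qed

text \<open>By translation invariance the integral of w (y + t e) is constant for |t| < 1; its
  derivative at t = 0, taken under the integral, is the integral in question.\<close>

lemma integral_derivative_compact_support:
  fixes w :: "'e::euclidean_space \<Rightarrow> real"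
  assumes w: "smooth_on w UNIV" "\<And>y. R \<le> norm y \<Longrightarrow> w y = 0" and e: "norm e \<le> 1"
  shows "integral (big_box R) (\<lambda>y. frechet_derivative w (at y) e) = 0"
proof -
  have cw: "continuous_on UNIV w" by (rule smooth_on_imp_continuous_on[OF w(1)])
  have cw': "continuous_on UNIV (\<lambda>y. frechet_derivative w (at y) e)"
    by (rule smooth_on_imp_continuous_on[OF smooth_on_frechet_derivative[OF w(1)]])
  have const: "integral (big_box R) (\<lambda>y. w (y + t *\<^sub>R e)) = integral UNIV w" if "t \<in> {-1<..<1}" for t
  proof -
    have t: "norm (t *\<^sub>R e) \<le> 1" using that e by (simp add: mult_le_one abs_le_iff)
    have "integral (big_box R) (w \<circ> (+) (t *\<^sub>R e)) =
      integral (cbox (- ((R + 1) *\<^sub>R One) + t *\<^sub>R e) ((R + 1) *\<^sub>R One + t *\<^sub>R e)) w"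
      unfolding big_box_def by (rule integral_shift_cbox_plus)
    also have "\<dots> = integral UNIV w"
    proof (rule integral_unique, rule integral_cbox_UNIV(1)[OF cw w(2)])
      fix y :: 'e assume y: "norm y < R"
      have "y - t *\<^sub>R e \<in> big_box R" using y t in_big_box[of "y - t *\<^sub>R e" "- (t *\<^sub>R e)" R] by simp
      then have b: "- (R + 1) \<le> (y - t *\<^sub>R e) \<bullet> i" "(y - t *\<^sub>R e) \<bullet> i \<le> R + 1" if "i \<in> Basis" for i
        using that by (auto simp: big_box_def mem_box)
      show "y \<in> cbox (- ((R + 1) *\<^sub>R One) + t *\<^sub>R e) ((R + 1) *\<^sub>R One + t *\<^sub>R e)"
        unfolding mem_box
      proof (intro ballI conjI)
        fix i :: 'e assume i: "i \<in> Basis"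
        show "(- ((R + 1) *\<^sub>R One) + t *\<^sub>R e) \<bullet> i \<le> y \<bullet> i" "y \<bullet> i \<le> ((R + 1) *\<^sub>R One + t *\<^sub>R e) \<bullet> i"
          using b[OF i] i by (simp_all add: inner_diff_left inner_add_left)
      qed
    qed
    finally show ?thesis by (simp add: o_def add.commute)
  qed
  have D: "((\<lambda>t. integral (big_box R) (\<lambda>y. w (y + t *\<^sub>R e))) has_vector_derivative
    integral (big_box R) (\<lambda>y. frechet_derivative w (at (y + 0 *\<^sub>R e)) e)) (at 0 within UNIV)"
    unfolding big_box_def
  proof (rule leibniz_rule_vector_derivative[where fx="\<lambda>t y. frechet_derivative w (at (y + t *\<^sub>R e)) e"])
    show "((\<lambda>t. w (y + t *\<^sub>R e)) has_vector_derivative frechet_derivative w (at (y + t *\<^sub>R e)) e) (at t within UNIV)" for t y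
    proof -
      have 1: "((\<lambda>t. y + t *\<^sub>R e) has_derivative (\<lambda>h. h *\<^sub>R e)) (at t)" by (auto intro!: derivative_eq_intros)
      have 2: "(w has_derivative frechet_derivative w (at (y + t *\<^sub>R e))) (at (y + t *\<^sub>R e))"
        using smooth_on_has_derivative[OF w(1)] by simp
      show ?thesis unfolding has_vector_derivative_def
        using has_derivative_compose[OF 1 2] linear_cmul[OF has_derivative_linear[OF 2]] by simp
    qed
    show "(\<lambda>y. w (y + t *\<^sub>R e)) integrable_on cbox (- ((R + 1) *\<^sub>R One)) ((R + 1) *\<^sub>R One)" for t
      by (rule integrable_continuous, rule continuous_on_compose2[OF cw _ subset_UNIV]) (intro continuous_intros)
    show "continuous_on (UNIV \<times> cbox (- ((R + 1) *\<^sub>R One)) ((R + 1) *\<^sub>R One)) (\<lambda>(t, y). frechet_derivative w (at (y + t *\<^sub>R e)) e)"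
      unfolding split_def by (rule continuous_on_compose2[OF cw' _ subset_UNIV]) (intro continuous_intros)
  qed auto
  have Z: "((\<lambda>t. integral (big_box R) (\<lambda>y. w (y + t *\<^sub>R e))) has_vector_derivative 0) (at 0)"
    by (rule has_vector_derivative_transform_within_open[where f="\<lambda>_. integral UNIV w" and S="{-1<..<1}"])
      (simp_all add: const)
  show ?thesis using vector_derivative_unique_at[OF D Z] by simp
qed

text \<open>Stokes' theorem on the slab in the form of a continuity equation: the rate of change of
  the density \<open>J\<close> in \<open>s\<close> is a spatial divergence, whose integral vanishes
  by compact support.\<close>

lemma integral_divergence_invariant:
  fixes J :: "real \<times> (real^'n::finite) \<Rightarrow> real" and w :: "'n \<Rightarrow> real \<times> (real^'n) \<Rightarrow> real"
  assumes J: "smooth_on J UNIV" "\<And>s y. R \<le> norm y \<Longrightarrow> J (s, y) = 0"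
    and w: "\<And>i. smooth_on (w i) UNIV" "\<And>i s y. R \<le> norm y \<Longrightarrow> w i (s, y) = 0"
    and div: "\<And>s y. s \<in> {0..a} \<Longrightarrow> frechet_derivative J (at (s, y)) (1, 0)
      = (\<Sum>i\<in>UNIV. frechet_derivative (w i) (at (s, y)) (0, axis i 1))"
    and "0 \<le> a"
  shows "integral UNIV (\<lambda>y. J (a, y)) = integral UNIV (\<lambda>y. J (0, y))"
proof -
  let ?I = "\<lambda>s. integral (big_box R) (\<lambda>y. J (s, y))"
  have cJ: "continuous_on UNIV J" by (rule smooth_on_imp_continuous_on[OF J(1)])
  have cJ': "continuous_on UNIV (\<lambda>z. frechet_derivative J (at z) (1, 0))"
    by (rule smooth_on_imp_continuous_on[OF smooth_on_frechet_derivative[OF J(1)]])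
  have sub: "y \<in> big_box R" if "norm y < R" for y :: "real^'n" using in_big_box[of y 0 R] that by simp
  have slice: "smooth_on (\<lambda>y. w i (s, y)) UNIV" for i s
    by (rule smooth_on_compose[OF open_UNIV _ w(1) subset_UNIV]) (intro smooth_on_Pair open_UNIV smooth_on_const smooth_on_ident)
  have slice': "frechet_derivative (w i) (at (s, y)) (0, v) = frechet_derivative (\<lambda>y. w i (s, y)) (at y) v" for i s y v
  proof -
    have "((\<lambda>y. w i (s, y)) has_derivative (\<lambda>v. frechet_derivative (w i) (at (s, y)) (0, v))) (at y)"
      by (rule has_derivative_compose[OF has_derivative_Pair[OF has_derivative_const has_derivative_ident] smooth_on_has_derivative[OF w(1) UNIV_I]])
    then show ?thesis by (rule fun_cong[OF frechet_derivative_at])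
  qed
  have cw': "continuous_on UNIV (\<lambda>y. frechet_derivative (\<lambda>y. w i (s, y)) (at y) v)" for i s v
    by (rule smooth_on_imp_continuous_on[OF smooth_on_frechet_derivative[OF slice]])
  have "(?I has_vector_derivative 0) (at s within {0..a})" if s: "s \<in> {0..a}" for s
  proof -
    have "(?I has_vector_derivative integral (big_box R) (\<lambda>y. frechet_derivative J (at (s, y)) (1, 0))) (at s within UNIV)"
      unfolding big_box_def
    proof (rule leibniz_rule_vector_derivative[where fx="\<lambda>s y. frechet_derivative J (at (s, y)) (1, 0)"])
      show "((\<lambda>s. J (s, y)) has_vector_derivative frechet_derivative J (at (s, y)) (1, 0)) (at s within UNIV)" for s y
      proof -
        have 1: "((\<lambda>s. (s, y)) has_derivative (\<lambda>h. (h, 0))) (at s)" by (auto intro!: derivative_eq_intros)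
        have 2: "(J has_derivative frechet_derivative J (at (s, y))) (at (s, y))"
          using smooth_on_has_derivative[OF J(1)] by simp
        have "frechet_derivative J (at (s, y)) (h, 0) = h *\<^sub>R frechet_derivative J (at (s, y)) (1, 0)" for h
          using linear_cmul[OF has_derivative_linear[OF 2], of h "(1, 0)"] by simp
        note eq = ext[of "\<lambda>h. frechet_derivative J (at (s, y)) (h, 0)", OF this]
        show ?thesis unfolding has_vector_derivative_def eq[symmetric] by (rule has_derivative_compose[OF 1 2])
      qed
      show "(\<lambda>y. J (s, y)) integrable_on cbox (- ((R + 1) *\<^sub>R One)) ((R + 1) *\<^sub>R One)" for s
        by (rule integrable_continuous, rule continuous_on_compose2[OF cJ _ subset_UNIV]) (intro continuous_intros)
      show "continuous_on (UNIV \<times> cbox (- ((R + 1) *\<^sub>R One)) ((R + 1) *\<^sub>R One)) (\<lambda>(s, y). frechet_derivative J (at (s, y)) (1, 0))"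
        using continuous_on_subset[OF cJ' subset_UNIV] by (simp add: split_def)
    qed auto
    moreover have "integral (big_box R) (\<lambda>y. frechet_derivative J (at (s, y)) (1, 0)) = 0"
    proof -
      have "integral (big_box R) (\<lambda>y. \<Sum>i\<in>UNIV. frechet_derivative (\<lambda>y. w i (s, y)) (at y) (axis i 1))
        = (\<Sum>i\<in>UNIV. integral (big_box R) (\<lambda>y. frechet_derivative (\<lambda>y. w i (s, y)) (at y) (axis i 1)))"
        unfolding big_box_def by (rule integral_sum) (auto intro!: integrable_continuous continuous_on_subset[OF cw'])
      also have "\<dots> = 0"
        by (rule sum.neutral) (auto intro!: integral_derivative_compact_support[OF slice w(2)])
      finally show ?thesis using div[OF s] by (simp add: slice')
    qed
    ultimately show ?thesis by (simp add: has_vector_derivative_at_within)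
  qed
  then have "?I a = ?I 0"
    using has_vector_derivative_zero_constant[of "{0..a}" ?I] \<open>0 \<le> a\<close> by (metis atLeastAtMost_iff convex_real_interval(5) order_refl)
  moreover have "?I s = integral UNIV (\<lambda>y. J (s, y))" for s
    unfolding big_box_def
    by (rule integral_unique, rule integral_cbox_UNIV(1)[where R=R])
      (use J(2) sub in \<open>auto simp: big_box_def intro!: continuous_on_compose2[OF cJ _ subset_UNIV] continuous_intros\<close>)
  ultimately show ?thesis by simp
qed

lemma smooth_on_extend_by_zero:
  fixes f :: "'e::real_normed_vector \<Rightarrow> 'f::real_normed_vector"
  assumes "open D" "smooth_on f D" "closed C" "C \<subseteq> D" "\<And>x. x \<in> D \<Longrightarrow> x \<notin> C \<Longrightarrow> f x = 0"
  shows "smooth_on (\<lambda>x. if x \<in> D then f x else 0) UNIV"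
proof (rule smooth_on_local)
  fix x
  show "\<exists>U g. open U \<and> x \<in> U \<and> smooth_on g U \<and> (\<forall>y\<in>U. (if y \<in> D then f y else 0) = g y)"
  proof (cases "x \<in> D")
    case True
    then show ?thesis using assms(1,2) by (intro exI[of _ D] exI[of _ f]) simp
  next
    case False
    have "open (- C)" using assms(3) by (simp add: open_Compl)
    then show ?thesis using False assms(4,5) smooth_on_const[of "- C" "0::'f"]
      by (intro exI[of _ "- C"] exI[of _ "\<lambda>_. 0"]) auto
  qed
qed

text \<open>In coordinates, this is the closedness of the pullback under \<open>F\<close> of the top
  degree form with density \<rho>. Its slice coefficient is \<rho>(F) times the determinant of the
  space derivatives; the other coefficients arise by putting the time derivative \<open>h\<close>
  into row i. The terms with the derivative of \<rho> match by \<open>sum_replace_row\<close>, and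
  the surplus second derivatives of \<open>F\<close> cancel in pairs.\<close>

lemma homotopy_divergence:
  fixes F :: "real \<times> (real^'n::finite) \<Rightarrow> real^'n"
  assumes F: "smooth_on F D" and D: "open D" "z \<in> D" and \<rho>: "smooth_on \<rho> UNIV"
  defines "c \<equiv> \<lambda>i x. frechet_derivative F (at x) (0, axis i 1)" and "h \<equiv> \<lambda>x. frechet_derivative F (at x) (1, 0)"
  shows "frechet_derivative (\<lambda>z. \<rho> (F z) * det (\<chi> i. c i z)) (at z) (1, 0)
    = (\<Sum>i\<in>UNIV. frechet_derivative (\<lambda>z. \<rho> (F z) * det (replace_row (\<lambda>j. c j z) i (h z))) (at z) (0, axis i 1))"
proof -
  have sc: "smooth_on (c i) D" and sh: "smooth_on h D" for i
    unfolding c_def h_def by (rule smooth_on_frechet_derivative[OF F])+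
  have s\<rho>: "smooth_on (\<lambda>z. \<rho> (F z)) D" by (rule smooth_on_compose[OF D(1) F \<rho> subset_UNIV])
  have srow: "smooth_on (\<lambda>z. if j = i then h z else c j z) D" for i j using sc sh by (cases "j = i") simp_all
  have sdet: "smooth_on (\<lambda>z. det (replace_row (\<lambda>j. c j z) i (h z))) D" for i
    unfolding replace_row_def by (rule smooth_on_det[OF D(1) srow])
  have sdet0: "smooth_on (\<lambda>z. det (\<chi> i. c i z)) D" by (rule smooth_on_det[OF D(1) sc])
  define d2 where "d2 i = frechet_derivative (c i) (at z)" for i
  define dh where "dh = frechet_derivative h (at z)"
  \<comment> \<open>Row i holds the time derivative, and row j is differentiated along the direction
    i. Exchanging i and j leaves the second derivative the same but interchanges two rows, whence
    the sign.\<close>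
  define T where "T i j = det (replace_row (\<lambda>k. if k = i then h z else c k z) j (d2 j (0, axis i 1)))" for i j
  define r where "r j = c j z" for j
  have rr: "(\<lambda>j. c j z) = r" by (simp add: r_def fun_eq_iff)
  have cr: "det (\<chi> i. c i z) = det (\<chi> i. r i)" by (simp add: r_def)
  note dc = smooth_on_has_derivative[OF sc D(2), folded d2_def]
  have d\<rho>: "frechet_derivative (\<lambda>z. \<rho> (F z)) (at z) v = frechet_derivative \<rho> (at (F z)) (frechet_derivative F (at z) v)" for v
    by (rule fun_cong[OF frechet_derivative_at[OF has_derivative_compose[OF smooth_on_has_derivative[OF F D(2)]
      smooth_on_has_derivative[OF \<rho> UNIV_I]]], symmetric])
  \<comment> \<open>The gradient of \<rho> at \<open>F z\<close>: it writes the derivative as an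
    inner product, the form in which \<open>sum_replace_row\<close> is stated.\<close>
  obtain l where l: "\<And>x. frechet_derivative \<rho> (at (F z)) x = x \<bullet> l"
  proof -
    have "linear (frechet_derivative \<rho> (at (F z)))"
      by (rule has_derivative_linear[OF smooth_on_has_derivative[OF \<rho> UNIV_I]])
    then have "frechet_derivative \<rho> (at (F z)) x = x \<bullet> adjoint (frechet_derivative \<rho> (at (F z))) 1" for x
      using adjoint_works[of "frechet_derivative \<rho> (at (F z))" x 1] by (simp add: inner_commute)
    then show ?thesis by (rule that)
  qed
  have d\<rho>c: "frechet_derivative (\<lambda>z. \<rho> (F z)) (at z) (0, axis i 1) = r i \<bullet> l" for i
    unfolding d\<rho> l r_def c_def ..
  have d\<rho>h: "frechet_derivative (\<lambda>z. \<rho> (F z)) (at z) (1, 0) = h z \<bullet> l"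
    unfolding d\<rho> l h_def ..
  have d0: "frechet_derivative (\<lambda>z. det (\<chi> i. c i z)) (at z) v = (\<Sum>i\<in>UNIV. det (replace_row r i (d2 i v)))" for v
    unfolding r_def by (rule fun_cong[OF frechet_derivative_at[OF has_derivative_det[of c, OF dc]], symmetric])
  have d1: "frechet_derivative (\<lambda>z. det (replace_row (\<lambda>j. c j z) i (h z))) (at z) v
    = (\<Sum>j\<in>UNIV. if j = i then det (replace_row r i (dh v)) else det (replace_row (\<lambda>k. if k = i then h z else c k z) j (d2 j v)))" for i v
  proof -
    have "((\<lambda>z. det (\<chi> j. if j = i then h z else c j z)) has_derivative
      (\<lambda>v. \<Sum>j\<in>UNIV. det (replace_row (\<lambda>k. if k = i then h z else c k z) j (if j = i then dh v else d2 j v)))) (at z)"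
    proof (rule has_derivative_det)
      show "((\<lambda>z. if j = i then h z else c j z) has_derivative (\<lambda>v. if j = i then dh v else d2 j v)) (at z)" for j
        using dc[of j] smooth_on_has_derivative[OF sh D(2), folded dh_def] by (cases "j = i") simp_all
    qed
    from fun_cong[OF frechet_derivative_at[OF this], of v, symmetric]
    have "frechet_derivative (\<lambda>z. det (replace_row (\<lambda>j. c j z) i (h z))) (at z) v
      = (\<Sum>j\<in>UNIV. det (replace_row (\<lambda>k. if k = i then h z else c k z) j (if j = i then dh v else d2 j v)))"
      by (simp only: replace_row_def[of "\<lambda>j. c j _" i "h _"])
    also have "\<dots> = (\<Sum>j\<in>UNIV. if j = i then det (replace_row r i (dh v)) else det (replace_row (\<lambda>k. if k = i then h z else c k z) j (d2 j v)))"
    proof (rule sum.cong[OF refl])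
      fix j
      have "replace_row (\<lambda>k. if k = i then h z else c k z) i x = replace_row r i x" for x
        by (simp add: replace_row_def r_def vec_eq_iff)
      then show "det (replace_row (\<lambda>k. if k = i then h z else c k z) j (if j = i then dh v else d2 j v))
        = (if j = i then det (replace_row r i (dh v)) else det (replace_row (\<lambda>k. if k = i then h z else c k z) j (d2 j v)))"
        by (cases "j = i") simp_all
    qed
    finally show ?thesis .
  qed
  have sym1: "d2 i (1, 0) = dh (0, axis i 1)" for i
    unfolding d2_def dh_def c_def h_def by (rule frechet_derivative_commute[OF F D])
  have sym2: "d2 j (0, axis i 1) = d2 i (0, axis j 1)" for i j
    unfolding d2_def c_def by (rule frechet_derivative_commute[OF F D])
  have anti: "T i j = - T j i" if "i \<noteq> j" for i j
    unfolding T_def sym2[of j i] by (rule det_replace_two_rows_swap[OF that])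
  have T0: "(\<Sum>i\<in>UNIV. \<Sum>j\<in>UNIV. if j = i then 0 else T i j) = 0"
  proof -
    let ?T = "\<lambda>i j. if j = i then 0 else T i j"
    have "(\<Sum>i\<in>UNIV. \<Sum>j\<in>UNIV. ?T i j) = (\<Sum>j\<in>UNIV. \<Sum>i\<in>UNIV. ?T i j)" by (rule sum.swap)
    also have "\<dots> = (\<Sum>j\<in>UNIV. \<Sum>i\<in>UNIV. - ?T j i)" proof (intro sum.cong refl)
      show "?T i j = - ?T j i" for i j using anti[of i j] by (cases "i = j") auto
    qed
    also have "\<dots> = - (\<Sum>i\<in>UNIV. \<Sum>j\<in>UNIV. ?T i j)" by (simp add: sum_negf)
    finally show ?thesis by simp
  qed
  have "(\<Sum>i\<in>UNIV. frechet_derivative (\<lambda>z. \<rho> (F z) * det (replace_row (\<lambda>j. c j z) i (h z))) (at z) (0, axis i 1))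
    = (\<Sum>i\<in>UNIV. \<rho> (F z) * (\<Sum>j\<in>UNIV. if j = i then det (replace_row r i (dh (0, axis i 1))) else T i j)
        + (r i \<bullet> l) * det (replace_row r i (h z)))"
    unfolding frechet_derivative_mult[OF s\<rho> sdet D(2)] d1 d\<rho>c T_def rr ..
  also have "\<dots> = \<rho> (F z) * (\<Sum>i\<in>UNIV. \<Sum>j\<in>UNIV. if j = i then det (replace_row r i (dh (0, axis i 1))) else T i j)
        + (h z \<bullet> l) * det (\<chi> i. r i)"
    by (simp add: sum.distrib sum_distrib_left sum_replace_row)
  also have "(\<Sum>i\<in>UNIV. \<Sum>j\<in>UNIV. if j = i then det (replace_row r i (dh (0, axis i 1))) else T i j)
    = (\<Sum>i\<in>UNIV. det (replace_row r i (dh (0, axis i 1))) + (\<Sum>j\<in>UNIV. if j = i then 0 else T i j))"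
  proof (rule sum.cong[OF refl])
    fix i :: 'n
    show "(\<Sum>j\<in>UNIV. if j = i then det (replace_row r i (dh (0, axis i 1))) else T i j)
      = det (replace_row r i (dh (0, axis i 1))) + (\<Sum>j\<in>UNIV. if j = i then 0 else T i j)"
      by (subst (1 2) sum.remove[of UNIV i]) (auto intro!: sum.cong)
  qed
  also have "\<dots> = (\<Sum>i\<in>UNIV. det (replace_row r i (d2 i (1, 0))))"
    unfolding sum.distrib T0 sym1 by simp
  also have "\<rho> (F z) * \<dots> + (h z \<bullet> l) * det (\<chi> i. r i) = frechet_derivative (\<lambda>z. \<rho> (F z) * det (\<chi> i. c i z)) (at z) (1, 0)"
    unfolding frechet_derivative_mult[OF s\<rho> sdet0 D(2)] d0 d\<rho>h cr ..
  finally show ?thesis by simp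
qed

section \<open>Counting zeros by integrating a bump\<close>

lemma integral_bump_pos:
  fixes \<rho> :: "'e::euclidean_space \<Rightarrow> real"
  assumes "continuous_on UNIV \<rho>" "\<And>y. R \<le> norm y \<Longrightarrow> \<rho> y = 0" "\<And>y. 0 \<le> \<rho> y" "\<rho> 0 > 0" "R > 0"
  shows "integral UNIV \<rho> > 0" "(\<rho> has_integral integral UNIV \<rho>) UNIV"
proof -
  have sub: "y \<in> big_box R" if "norm y < R" for y :: 'e using in_big_box[of y 0 R] that by simp
  note I = integral_cbox_UNIV[OF assms(1,2) sub[unfolded big_box_def]]
  show "(\<rho> has_integral integral UNIV \<rho>) UNIV" by (rule I(2))
  have "integral UNIV \<rho> \<ge> 0" by (rule integral_nonneg) (use I(2) assms(3) in auto)
  moreover have "integral UNIV \<rho> \<noteq> 0"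
  proof
    assume "integral UNIV \<rho> = 0"
    then have "(\<rho> has_integral 0) (cbox (- ((R + 1) *\<^sub>R One)) ((R + 1) *\<^sub>R One))" using I(1) by simp
    then have "\<rho> 0 = 0"
    proof (rule has_integral_0_cbox_imp_0[rotated 2])
      show "continuous_on (cbox (- ((R + 1) *\<^sub>R One)) ((R + 1) *\<^sub>R One)) \<rho>"
        by (rule continuous_on_subset[OF assms(1) subset_UNIV])
      show "box (- ((R + 1) *\<^sub>R One)) ((R + 1) *\<^sub>R One :: 'e) \<noteq> {}" using \<open>R > 0\<close> by (simp add: box_ne_empty)
      show "(0::'e) \<in> cbox (- ((R + 1) *\<^sub>R One)) ((R + 1) *\<^sub>R One)" using \<open>R > 0\<close> by (simp add: mem_box)
    qed (use assms(3) in simp)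
    then show False using assms(4) by simp
  qed
  ultimately show "integral UNIV \<rho> > 0" by simp
qed

text \<open>The change of variables formula carries the absolute value of the Jacobian; as the sign
  \<sigma> is constant on \<open>B\<close>, passing to the signed Jacobian costs just the factor
  \<sigma>.\<close>

lemma change_of_variables_bump:
  fixes f :: "real^'n::{finite,wellorder} \<Rightarrow> real^'n::_" and \<rho> :: "real^'n::_ \<Rightarrow> real"
  assumes B: "open B" and f: "smooth_on f B" "inj_on f B" and img: "f ` B = ball 0 \<epsilon>"
    and sgn: "\<And>x. x \<in> B \<Longrightarrow> det (\<chi> i. frechet_derivative f (at x) (axis i 1)) = \<sigma> * \<bar>det (\<chi> i. frechet_derivative f (at x) (axis i 1))\<bar>"
    and \<rho>: "continuous_on UNIV \<rho>" "\<And>y. \<epsilon> \<le> norm y \<Longrightarrow> \<rho> y = 0"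
  shows "((\<lambda>x. if x \<in> B then \<rho> (f x) * det (\<chi> i. frechet_derivative f (at x) (axis i 1)) else 0) has_integral \<sigma> * integral UNIV \<rho>) UNIV"
proof -
  let ?d = "\<lambda>x. det (\<chi> i. frechet_derivative f (at x) (axis i 1))"
  \<comment> \<open>The change of variables theorem is applied to a vector valued integrand: the
    scalar \<rho> is carried along a unit vector and recovered by the inner product with it.\<close>
  define v :: "real^'n::_" where "v = axis undefined 1"
  have v: "v \<bullet> v = 1" by (simp add: v_def inner_axis_axis)
  have sub: "y \<in> big_box \<epsilon>" if "norm y < \<epsilon>" for y :: "real^'n::_" using in_big_box[of y 0 \<epsilon>] that by simp
  note I = integral_cbox_UNIV[OF \<rho> sub[unfolded big_box_def]]
  have abs: "(\<lambda>y. \<rho> y *\<^sub>R v) absolutely_integrable_on ball 0 \<epsilon>"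
  proof (rule set_integrable_subset[where A="big_box \<epsilon>"])
    show "(\<lambda>y. \<rho> y *\<^sub>R v) absolutely_integrable_on big_box \<epsilon>"
      unfolding big_box_def
      by (intro absolutely_integrable_continuous continuous_on_scaleR continuous_on_const continuous_on_subset[OF \<rho>(1)]) simp
  qed (use sub in auto)
  have Bm: "B \<in> sets lebesgue" using B by (simp add: borel_open)
  have "((\<lambda>y. \<rho> y) has_integral integral UNIV \<rho>) (ball 0 \<epsilon>)"
  proof -
    have "((\<lambda>y. if y \<in> ball 0 \<epsilon> then \<rho> y else 0) has_integral integral UNIV \<rho>) UNIV"
      by (rule has_integral_eq[OF _ I(2)]) (use \<rho>(2) in auto)
    then show ?thesis by (simp only: has_integral_restrict_UNIV)
  qed
  then have "integral (ball 0 \<epsilon>) (\<lambda>y. \<rho> y *\<^sub>R v) = integral UNIV \<rho> *\<^sub>R v"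
    by (intro integral_unique has_integral_scaleR_left)
  then have rhs: "(\<lambda>y. \<rho> y *\<^sub>R v) absolutely_integrable_on f ` B \<and> integral (f ` B) (\<lambda>y. \<rho> y *\<^sub>R v) = integral UNIV \<rho> *\<^sub>R v"
    unfolding img using abs by (intro conjI)
  have df: "(f has_derivative frechet_derivative f (at x)) (at x within B)" if "x \<in> B" for x
    by (rule has_derivative_at_withinI[OF smooth_on_has_derivative[OF f(1) that]])
  let ?g = "\<lambda>x. \<bar>det (matrix (frechet_derivative f (at x)))\<bar> *\<^sub>R (\<rho> (f x) *\<^sub>R v)"
  have lhs: "?g absolutely_integrable_on B \<and> integral B ?g = integral UNIV \<rho> *\<^sub>R v"
    by (rule has_absolute_integral_change_of_variables[OF Bm df f(2), THEN iffD2, OF _ rhs])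
  have "(?g has_integral integral B ?g) B"
    by (rule integrable_integral[OF set_lebesgue_integral_eq_integral(1)[OF conjunct1[OF lhs]]])
  then have "(((\<lambda>x. x \<bullet> v) \<circ> ?g) has_integral (integral UNIV \<rho> *\<^sub>R v) \<bullet> v) B"
    unfolding conjunct2[OF lhs] by (rule has_integral_linear[OF _ bounded_linear_inner_left])
  then have "((\<lambda>x. \<bar>det (matrix (frechet_derivative f (at x)))\<bar> * \<rho> (f x)) has_integral integral UNIV \<rho>) B"
    by (simp add: o_def v)
  then have 1: "((\<lambda>x. \<sigma> * (\<bar>det (matrix (frechet_derivative f (at x)))\<bar> * \<rho> (f x))) has_integral \<sigma> * integral UNIV \<rho>) B"
    by (rule has_integral_mult_right)
  have mat: "det (matrix (frechet_derivative f (at x))) = ?d x" for x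
  proof -
    have "transpose (\<chi> i. frechet_derivative f (at x) (axis i 1)) = matrix (frechet_derivative f (at x))"
      by (simp add: transpose_def matrix_def)
    then show ?thesis by (metis det_transpose)
  qed
  have "\<sigma> * (\<bar>det (matrix (frechet_derivative f (at x)))\<bar> * \<rho> (f x)) = \<rho> (f x) * ?d x" if "x \<in> B" for x
  proof -
    have "\<sigma> * (\<bar>?d x\<bar> * \<rho> (f x)) = \<rho> (f x) * (\<sigma> * \<bar>?d x\<bar>)" by simp
    then show ?thesis unfolding mat sgn[OF that, symmetric] .
  qed
  then have "((\<lambda>x. \<rho> (f x) * ?d x) has_integral \<sigma> * integral UNIV \<rho>) B"
    by (rule has_integral_eq[OF _ 1])
  then show ?thesis by (simp only: has_integral_restrict_UNIV)
qed

text \<open>The density \<open>J\<close> integrates to 0 over the slice s = 0, where it vanishes,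
  and over the slice s = a to the integral of \<rho> times the sum of the Jacobian signs at the
  zeros. The two integrals agree, so the signs add up to 0 and there are as many positive as
  negative ones.\<close>

theorem even_card_zeros:
  fixes F :: "real \<times> (real^'n::{finite,wellorder}) \<Rightarrow> real^'n::_"
  assumes D: "open D" and F: "smooth_on F D" and a: "0 \<le> a" and C: "compact C" "C \<subseteq> D"
    and slab: "C \<subseteq> {0..a} \<times> UNIV"
    and zeros: "\<And>z. z \<in> D \<Longrightarrow> fst z \<in> {0..a} \<Longrightarrow> F z = 0 \<longleftrightarrow> z \<in> C"
    and start: "\<And>y. (0, y) \<notin> C"
    and nondeg: "\<And>y. (a, y) \<in> C \<Longrightarrow> inj (\<lambda>v. frechet_derivative F (at (a, y)) (0, v))"
  shows "finite {y. (a, y) \<in> C}" "even (card {y. (a, y) \<in> C})"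
proof -
  \<comment> \<open>The cutoff gives \<open>J\<close> compact support inside \<open>D\<close>: the
    values of \<open>F\<close> outside \<open>D\<close> are arbitrary, and inside \<open>D\<close>
    they may become small far from \<open>C\<close>.\<close>
  obtain \<kappa> V K where \<kappa>: "smooth_on \<kappa> UNIV" "open V" "C \<subseteq> V" "\<And>z. z \<in> V \<Longrightarrow> \<kappa> z = (1::real)"
    "compact K" "K \<subseteq> D" "\<And>z. z \<notin> K \<Longrightarrow> \<kappa> z = 0" "\<And>z. 0 \<le> \<kappa> z" "\<And>z. \<kappa> z \<le> 1"
    by (rule smooth_bump[OF C(1) D C(2)]) (rule that)
  have cF: "continuous_on K F" by (rule continuous_on_subset[OF smooth_on_imp_continuous_on[OF F] \<kappa>(6)])
  have lower: "\<exists>e>0. \<forall>z\<in>Q. e \<le> norm (F z)" if Q: "compact Q" "Q \<subseteq> K" "\<And>z. z \<in> Q \<Longrightarrow> F z \<noteq> 0" for Q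
  proof (cases "Q = {}")
    case True then show ?thesis by (intro exI[of _ 1]) simp
  next
    case False
    have "continuous_on Q (\<lambda>z. norm (F z))" by (intro continuous_on_norm continuous_on_subset[OF cF Q(2)])
    from continuous_attains_inf[OF Q(1) False this] obtain z where "z \<in> Q" "\<forall>y\<in>Q. norm (F z) \<le> norm (F y)" by blast
    then show ?thesis using Q(3) by (intro exI[of _ "norm (F z)"]) simp
  qed
  define c where "c i z = frechet_derivative F (at z) (0, axis i 1)" for i z
  define h where "h z = frechet_derivative F (at z) (1, 0)" for z
  define f where "f y = F (a, y)" for y
  define U where "U = {y. (a, y) \<in> V \<inter> D}"
  have slice_open: "open {y. (a, y) \<in> X}" if "open X" for X :: "(real \<times> (real^'n::_)) set"
    using open_vimage[OF that, of "\<lambda>y. (a, y)"] by (simp add: vimage_def continuous_on_Pair continuous_on_const continuous_on_id)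
  have U: "open U" unfolding U_def using \<kappa>(2) D by (intro slice_open) auto
  have slice_smooth: "smooth_on (\<lambda>y. (a, y)) S" if "open S" for S :: "(real^'n::_) set"
    by (intro smooth_on_Pair smooth_on_const smooth_on_ident that)
  have f: "smooth_on f U" unfolding f_def
    by (rule smooth_on_compose[OF U slice_smooth[OF U] F]) (auto simp: U_def)
  have f': "frechet_derivative f (at y) v = frechet_derivative F (at (a, y)) (0, v)" if "y \<in> U" for y v
  proof -
    have "(a, y) \<in> D" using that by (simp add: U_def)
    then have "(f has_derivative (\<lambda>v. frechet_derivative F (at (a, y)) (0, v))) (at y)"
      unfolding f_def
      by (rule has_derivative_compose[OF has_derivative_Pair[OF has_derivative_const has_derivative_ident] smooth_on_has_derivative[OF F]])
    then show ?thesis by (rule fun_cong[OF frechet_derivative_at, symmetric])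
  qed
  define d where "d y = det (\<chi> i. frechet_derivative f (at y) (axis i 1))" for y
  have d_cont: "continuous_on U d"
    unfolding d_def by (rule smooth_on_imp_continuous_on[OF smooth_on_det[OF U smooth_on_frechet_derivative[OF f]]])
  define Y where "Y = {y. (a, y) \<in> C}"
  have YU: "Y \<subseteq> U" using \<kappa>(3) C(2) by (auto simp: Y_def U_def)
  have fY: "f y = 0 \<longleftrightarrow> y \<in> Y" if "(a, y) \<in> D" for y using zeros[OF that] a by (simp add: f_def Y_def)
  have dY: "d y \<noteq> 0" if "y \<in> Y" for y
  proof -
    have yU: "y \<in> U" using that YU by blast
    have lin: "linear (frechet_derivative f (at y))" by (rule has_derivative_linear[OF smooth_on_has_derivative[OF f yU]])
    have "inj (frechet_derivative f (at y))" using nondeg[of y] that f'[OF yU] by (simp add: Y_def inj_def)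
    then have "det (matrix (frechet_derivative f (at y))) \<noteq> 0" using det_nz_iff_inj[OF lin] by simp
    moreover have "transpose (\<chi> i. frechet_derivative f (at y) (axis i 1)) = matrix (frechet_derivative f (at y))"
      by (simp add: transpose_def matrix_def)
    ultimately show ?thesis unfolding d_def by (metis det_transpose)
  qed
  \<comment> \<open>Besides the local inverse, the Jacobian is required to keep on U' the sign that
    it has at \<open>y\<close>.\<close>
  define Q where "Q y U' W g \<longleftrightarrow> open U' \<and> U' \<subseteq> U \<and> y \<in> U' \<and> open W \<and> 0 \<in> W \<and> homeomorphism U' W f g \<and> (\<forall>x\<in>U'. d x * d y > 0)"
    for y U' W and g :: "real^'n::_ \<Rightarrow> real^'n::_"
  have "\<exists>U' W g. Q y U' W g"
    if y: "y \<in> Y" for y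
  proof -
    define S where "S = U \<inter> (\<lambda>x. d x * d y) -` {0<..}"
    have oS: "open S"
      unfolding S_def by (rule continuous_open_preimage[OF continuous_on_mult_right[OF d_cont] U open_greaterThan])
    have yS: "y \<in> S" using y YU dY[OF y] by (auto simp: S_def zero_less_mult_iff linorder_neq_iff)
    have fS: "smooth_on f S" by (rule smooth_on_subset[OF f]) (simp add: S_def)
    have yU: "y \<in> U" using y YU by blast
    have inj: "inj (frechet_derivative f (at y))" using nondeg[of y] y f'[OF yU] by (simp add: Y_def inj_def)
    obtain U' W g where "open U'" "U' \<subseteq> S" "y \<in> U'" "open W" "f y \<in> W" "homeomorphism U' W f g"
      "smooth_on g W" "\<And>x. x \<in> U' \<Longrightarrow> inj (frechet_derivative f (at x))"
      by (rule smooth_inverse_function[OF oS fS yS inj]) (rule that)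
    moreover have "f y = 0" using fY[of y] y C(2) by (auto simp: Y_def)
    ultimately show ?thesis by (intro exI[of _ U'] exI[of _ W] exI[of _ g]) (auto simp: S_def Q_def)
  qed
  then obtain N W g where "\<And>y. y \<in> Y \<Longrightarrow> Q y (N y) (W y) (g y)" by metis
  then have N: "\<And>y. y \<in> Y \<Longrightarrow> open (N y)" "\<And>y. y \<in> Y \<Longrightarrow> N y \<subseteq> U" "\<And>y. y \<in> Y \<Longrightarrow> y \<in> N y"
    "\<And>y. y \<in> Y \<Longrightarrow> open (W y)" "\<And>y. y \<in> Y \<Longrightarrow> 0 \<in> W y" "\<And>y. y \<in> Y \<Longrightarrow> homeomorphism (N y) (W y) f (g y)"
    "\<And>y x. y \<in> Y \<Longrightarrow> x \<in> N y \<Longrightarrow> d x * d y > 0" unfolding Q_def by blast+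
  have f_inj: "inj_on f (N y)" if "y \<in> Y" for y
    using N(6)[OF that] by (auto simp: homeomorphism_def intro: inj_on_inverseI)
  have f0: "f y = 0" if "y \<in> Y" for y using fY[of y] that C(2) by (auto simp: Y_def)
  have "compact (snd ` (C \<inter> ({a} \<times> UNIV)))"
    by (intro compact_continuous_image compact_Int_closed C closed_Times continuous_on_snd continuous_on_id) auto
  moreover have "snd ` (C \<inter> ({a} \<times> UNIV)) = Y" by (force simp: Y_def)
  ultimately have "compact Y" by simp
  then obtain Y0 where Y0: "Y0 \<subseteq> Y" "finite Y0" "Y \<subseteq> (\<Union>y\<in>Y0. N y)"
    by (rule compactE_image[where C=Y and f=N]) (use N in auto)
  \<comment> \<open>\<open>f\<close> is injective on each neighbourhood, so each contains a single
    zero, and a finite subcover already lists all zeros.\<close>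
  have "Y \<subseteq> Y0"
  proof
    fix y assume y: "y \<in> Y"
    then obtain y' where y': "y' \<in> Y0" "y \<in> N y'" using Y0 by blast
    have y'Y: "y' \<in> Y" using y'(1) Y0(1) by blast
    have "y = y'" by (rule inj_onD[OF f_inj[OF y'Y] _ y'(2) N(3)[OF y'Y]]) (simp add: f0 y y'Y)
    then show "y \<in> Y0" using y' by simp
  qed
  then have finY: "finite Y" by (rule finite_subset[OF _ Y0(2)])
  then show "finite {y. (a, y) \<in> C}" by (simp add: Y_def)
  obtain B where B: "\<And>y. y \<in> Y \<Longrightarrow> open (B y)" "\<And>y. y \<in> Y \<Longrightarrow> y \<in> B y"
    "\<And>x y. x \<in> Y \<Longrightarrow> y \<in> Y \<Longrightarrow> x \<noteq> y \<Longrightarrow> B x \<inter> B y = {}"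
  proof -
    have "\<exists>\<delta>>0. \<forall>x\<in>Y. \<forall>y\<in>Y. x \<noteq> y \<longrightarrow> \<delta> \<le> dist x y"
    proof (cases "\<exists>x\<in>Y. \<exists>y\<in>Y. x \<noteq> y")
      case True
      let ?P = "(\<lambda>(x, y). dist x y) ` {p \<in> Y \<times> Y. fst p \<noteq> snd p}"
      have P: "finite ?P" "?P \<noteq> {}" using finY True by auto
      have "Min ?P > 0" using P by (subst Min_gr_iff) auto
      moreover have "Min ?P \<le> dist x y" if "x \<in> Y" "y \<in> Y" "x \<noteq> y" for x y
        using that by (intro Min_le[OF P(1)] image_eqI[of _ _ "(x, y)"]) auto
      ultimately show ?thesis by blast
    qed (auto intro: exI[of _ 1])
    then obtain \<delta> where \<delta>: "\<delta> > 0" "\<And>x y. x \<in> Y \<Longrightarrow> y \<in> Y \<Longrightarrow> x \<noteq> y \<Longrightarrow> \<delta> \<le> dist x y" by blast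
    have "ball x (\<delta> / 2) \<inter> ball y (\<delta> / 2) = {}" if "x \<in> Y" "y \<in> Y" "x \<noteq> y" for x y
      using \<delta>(2)[OF that] by (intro disjoint_ballI) simp
    then show ?thesis using \<delta>(1) by (intro that[of "\<lambda>y. ball y (\<delta> / 2)"]) auto
  qed
  \<comment> \<open>The local inverse maps a small ball about 0 into the prescribed neighbourhood of
    \<open>y\<close>, so that the preimages attached to different zeros are disjoint.\<close>
  have "\<exists>\<eta>>0. ball 0 \<eta> \<subseteq> W y \<inter> g y -` (B y \<inter> N y)" if y: "y \<in> Y" for y
  proof -
    have gc: "continuous_on (W y) (g y)" and g0: "g y 0 = y"
      using N(6)[OF y] N(3)[OF y] f0[OF y] by (auto simp: homeomorphism_def)
    have "open (W y \<inter> g y -` (B y \<inter> N y))"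
      using continuous_open_preimage[OF gc N(4)[OF y] open_Int[OF B(1)[OF y] N(1)[OF y]]] .
    moreover have "0 \<in> W y \<inter> g y -` (B y \<inter> N y)" using N(3,5)[OF y] B(2)[OF y] g0 by simp
    ultimately show ?thesis using open_contains_ball by blast
  qed
  then obtain \<eta> where \<eta>: "\<And>y. y \<in> Y \<Longrightarrow> \<eta> y > 0" "\<And>y. y \<in> Y \<Longrightarrow> ball 0 (\<eta> y) \<subseteq> W y \<inter> g y -` (B y \<inter> N y)" by metis
  define P where "P y = N y \<inter> f -` ball 0 (\<eta> y)" for y
  have fc: "continuous_on (N y) f" if "y \<in> Y" for y
    by (rule continuous_on_subset[OF smooth_on_imp_continuous_on[OF f] N(2)[OF that]])
  have P_open: "open (N y \<inter> f -` ball 0 e)" if "y \<in> Y" for y e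
    by (rule continuous_open_preimage[OF fc[OF that] N(1)[OF that] open_ball])
  have closed_slab: "closed ({t} \<times> (UNIV :: (real^'n::_) set))" "closed ({0..a} \<times> (UNIV :: (real^'n::_) set))" for t :: real
    by (intro closed_Times; simp)+
  \<comment> \<open>Three lower bounds for |F|, each by compactness: e1 where the cutoff may differ
    from 1, e2 on the initial slice, e3 on the final slice away from the chosen neighbourhoods of
    the zeros. A bump supported in a ball of smaller radius, composed with \<open>F\<close>,
    vanishes on all three sets.\<close>
  obtain e1 where e1: "e1 > 0" "\<And>z. z \<in> K \<inter> ({0..a} \<times> UNIV) - V \<Longrightarrow> e1 \<le> norm (F z)"
  proof -
    have nz: "F z \<noteq> 0" if "z \<in> K \<inter> ({0..a} \<times> UNIV) - V" for z
    proof -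
      have "z \<in> D" "fst z \<in> {0..a}" "z \<notin> C" using that \<kappa>(3,6) by (auto simp: mem_Times_iff)
      then show ?thesis using zeros by blast
    qed
    have "\<exists>e>0. \<forall>z\<in>K \<inter> ({0..a} \<times> UNIV) - V. e \<le> norm (F z)"
      by (rule lower[OF compact_diff[OF compact_Int_closed[OF \<kappa>(5) closed_slab(2)] \<kappa>(2)] _ nz]) auto
    then show ?thesis using that by (elim exE conjE) blast
  qed
  obtain e2 where e2: "e2 > 0" "\<And>z. z \<in> K \<inter> ({0} \<times> UNIV) \<Longrightarrow> e2 \<le> norm (F z)"
  proof -
    have nz: "F z \<noteq> 0" if "z \<in> K \<inter> ({0} \<times> UNIV)" for z
    proof -
      have "z \<in> D" "fst z = 0" using that \<kappa>(6) by (auto simp: mem_Times_iff)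
      moreover have "z \<notin> C" using start[of "snd z"] \<open>fst z = 0\<close> by (metis prod.collapse)
      ultimately show ?thesis using zeros[of z] a by simp
    qed
    have "\<exists>e>0. \<forall>z\<in>K \<inter> ({0} \<times> UNIV). e \<le> norm (F z)"
      by (rule lower[OF compact_Int_closed[OF \<kappa>(5) closed_slab(1)] _ nz]) auto
    then show ?thesis using that by (elim exE conjE) blast
  qed
  obtain e3 where e3: "e3 > 0" "\<And>y. (a, y) \<in> K \<Longrightarrow> y \<notin> (\<Union>y\<in>Y. P y) \<Longrightarrow> e3 \<le> norm (f y)"
  proof -
    have eq: "UNIV \<times> (\<Union>y\<in>Y. P y) = (UNIV :: real set) \<times> (\<Union>y\<in>Y. N y \<inter> f -` ball 0 (\<eta> y))" by (simp add: P_def)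
    have op: "open ((UNIV :: real set) \<times> (\<Union>y\<in>Y. P y))"
      unfolding eq using P_open by (intro open_Times open_UN) auto
    have nz: "F z \<noteq> 0" if z: "z \<in> K \<inter> ({a} \<times> UNIV) - UNIV \<times> (\<Union>y\<in>Y. P y)" for z
    proof
      assume "F z = 0"
      moreover have "z \<in> D" "fst z = a" using z \<kappa>(6) by (auto simp: mem_Times_iff)
      ultimately have "z \<in> C" using zeros[of z] a by simp
      then have "(a, snd z) \<in> C" using \<open>fst z = a\<close> by (metis prod.collapse)
      then have Y: "snd z \<in> Y" by (simp add: Y_def)
      then have "snd z \<in> P (snd z)" using N(3)[OF Y] \<eta>(1)[OF Y] f0[OF Y] by (simp add: P_def)
      then show False using z Y by (auto simp: mem_Times_iff)
    qed
    have "\<exists>e>0. \<forall>z\<in>K \<inter> ({a} \<times> UNIV) - UNIV \<times> (\<Union>y\<in>Y. P y). e \<le> norm (F z)"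
      by (rule lower[OF compact_diff[OF compact_Int_closed[OF \<kappa>(5) closed_slab(1)] op] _ nz]) auto
    then obtain e where "e > 0" "\<And>z. z \<in> K \<inter> ({a} \<times> UNIV) - UNIV \<times> (\<Union>y\<in>Y. P y) \<Longrightarrow> e \<le> norm (F z)" by blast
    then show ?thesis by (intro that[of e]) (auto simp: f_def)
  qed
  obtain \<epsilon> where \<epsilon>: "\<epsilon> > 0" "\<epsilon> \<le> e1" "\<epsilon> \<le> e2" "\<epsilon> \<le> e3" "\<And>y. y \<in> Y \<Longrightarrow> \<epsilon> \<le> \<eta> y"
  proof
    let ?S = "insert e1 (insert e2 (insert e3 (\<eta> ` Y)))"
    have S: "finite ?S" using finY by simp
    show "Min ?S > 0" using S e1(1) e2(1) e3(1) \<eta>(1) by (subst Min_gr_iff) auto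
    show "Min ?S \<le> e1" "Min ?S \<le> e2" "Min ?S \<le> e3" by (rule Min_le[OF S], simp)+
    show "Min ?S \<le> \<eta> y" if "y \<in> Y" for y by (rule Min_le[OF S]) (use that in simp)
  qed
  obtain \<rho> V\<rho> K\<rho> where \<rho>: "smooth_on \<rho> UNIV" "open V\<rho>" "{0::real^'n::_} \<subseteq> V\<rho>" "\<And>z. z \<in> V\<rho> \<Longrightarrow> \<rho> z = (1::real)"
    "compact K\<rho>" "K\<rho> \<subseteq> ball 0 \<epsilon>" "\<And>z. z \<notin> K\<rho> \<Longrightarrow> \<rho> z = 0" "\<And>z. 0 \<le> \<rho> z" "\<And>z. \<rho> z \<le> 1"
  proof (rule smooth_bump[of "{0::real^'n::_}" "ball 0 \<epsilon>"])
    show "compact {0::real^'n::_}" "open (ball (0::real^'n::_) \<epsilon>)" "{0::real^'n::_} \<subseteq> ball 0 \<epsilon>" using \<epsilon>(1) by auto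
  qed (rule that)
  have \<rho>0: "\<rho> y = 0" if "\<epsilon> \<le> norm y" for y using \<rho>(6,7) that by force
  have \<rho>c: "continuous_on UNIV \<rho>" by (rule smooth_on_imp_continuous_on[OF \<rho>(1)])
  have I: "integral UNIV \<rho> > 0" by (rule integral_bump_pos[OF \<rho>c \<rho>0 \<rho>(8) _ \<epsilon>(1)]) (use \<rho>(3) \<rho>(4)[of 0] in auto)
  define J0 where "J0 z = \<rho> (F z) * det (\<chi> i. c i z)" for z
  define w0 where "w0 i z = \<rho> (F z) * det (replace_row (\<lambda>j. c j z) i (h z))" for i z
  define J where "J z = (if z \<in> D then \<kappa> z * J0 z else 0)" for z
  define w where "w i z = (if z \<in> D then \<kappa> z * w0 i z else 0)" for i z
  have sc: "smooth_on (c i) D" and sh: "smooth_on h D" for i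
    unfolding c_def h_def by (rule smooth_on_frechet_derivative[OF F])+
  have s\<rho>: "smooth_on (\<lambda>z. \<rho> (F z)) D" by (rule smooth_on_compose[OF D F \<rho>(1) subset_UNIV])
  have srow: "smooth_on (\<lambda>z. if j = i then h z else c j z) D" for i j using sc sh by (cases "j = i") simp_all
  have sJ0: "smooth_on J0 D" unfolding J0_def by (rule smooth_on_mult[OF D s\<rho> smooth_on_det[OF D sc]])
  have sw0: "smooth_on (w0 i) D" for i
    unfolding w0_def replace_row_def by (rule smooth_on_mult[OF D s\<rho> smooth_on_det[OF D srow]])
  have s\<kappa>: "smooth_on \<kappa> D" by (rule smooth_on_subset[OF \<kappa>(1)]) simp
  have K_closed: "closed K" by (rule compact_imp_closed[OF \<kappa>(5)])
  have sJ: "smooth_on J UNIV" unfolding J_def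
    by (rule smooth_on_extend_by_zero[OF D smooth_on_mult[OF D s\<kappa> sJ0] K_closed \<kappa>(6)]) (simp add: \<kappa>(7))
  have sw: "smooth_on (w i) UNIV" for i unfolding w_def
    by (rule smooth_on_extend_by_zero[OF D smooth_on_mult[OF D s\<kappa> sw0] K_closed \<kappa>(6)]) (simp add: \<kappa>(7))
  obtain R where R: "\<And>z. z \<in> K \<Longrightarrow> norm z < R"
    using compact_imp_bounded[OF \<kappa>(5)] unfolding bounded_pos_less by blast
  have outside: "\<kappa> (s, y) = 0" if "R \<le> norm y" for s y
    using \<kappa>(7)[of "(s, y)"] R[of "(s, y)"] norm_snd_le[of y s] that by fastforce
  have div: "frechet_derivative J (at z) (1, 0) = (\<Sum>i\<in>UNIV. frechet_derivative (w i) (at z) (0, axis i 1))"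
    if z: "fst z \<in> {0..a}" for z
  proof -
    have const: "frechet_derivative f (at z) v = 0" if "open S" "z \<in> S" "\<And>x. x \<in> S \<Longrightarrow> f x = 0"
      for S v and f :: "real \<times> (real^'n::_) \<Rightarrow> real"
      using frechet_derivative_transform[OF that(1,2), of f "\<lambda>_. 0"] that(3) by simp
    \<comment> \<open>Where \<kappa> is 1 the divergence identity applies, and outside
      \<open>K\<close> everything vanishes. In the transition region |F z| is at least e1, so
      \<open>F z\<close> lies off the closed support of \<rho>, and \<rho>(F) vanishes on a whole
      neighbourhood of \<open>z\<close>.\<close>
    consider "z \<in> V \<inter> D" | "z \<notin> K" | "z \<in> K" "z \<notin> V" using \<kappa>(6) by blast
    then show ?thesis
    proof cases
      case 1
      have o: "open (V \<inter> D)" using \<kappa>(2) D by blast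
      have J_eq: "frechet_derivative J (at z) = frechet_derivative J0 (at z)"
        by (rule frechet_derivative_transform[OF o 1]) (simp add: J_def \<kappa>(4))
      have w_eq: "frechet_derivative (w i) (at z) = frechet_derivative (w0 i) (at z)" for i
        by (rule frechet_derivative_transform[OF o 1]) (simp add: w_def \<kappa>(4))
      have "z \<in> D" using 1 by blast
      have J0': "J0 = (\<lambda>z. \<rho> (F z) * det (\<chi> i. frechet_derivative F (at z) (0, axis i 1)))"
        by (rule ext) (simp add: J0_def c_def)
      have w0': "w0 i = (\<lambda>z. \<rho> (F z) * det (replace_row (\<lambda>j. frechet_derivative F (at z) (0, axis j 1)) i (frechet_derivative F (at z) (1, 0))))" for i
        by (rule ext) (simp add: w0_def c_def h_def)
      show ?thesis unfolding J_eq w_eq J0' w0' by (rule homotopy_divergence[OF F D \<open>z \<in> D\<close> \<rho>(1)])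
    next
      case 2
      have o: "open (- K)" "z \<in> - K" using K_closed 2 by auto
      show ?thesis
        using const[OF o, of J] const[OF o, of "w _"] by (simp add: J_def w_def \<kappa>(7))
    next
      case 3
      have zD: "z \<in> D" using 3 \<kappa>(6) by blast
      define S where "S = D \<inter> F -` (- K\<rho>)"
      have "open S" unfolding S_def
        by (rule continuous_open_preimage[OF smooth_on_imp_continuous_on[OF F] D]) (use \<rho>(5) compact_imp_closed in auto)
      moreover have "z \<in> S"
        using e1(2)[of z] 3 z \<epsilon>(2) \<rho>(6) zD by (cases z) (force simp: S_def)
      moreover have "J x = 0" "w i x = 0" if "x \<in> S" for x i
        using that \<rho>(7) by (auto simp: S_def J_def w_def J0_def w0_def)
      ultimately show ?thesis using const[of S J] const[of S "w _"] by simp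
    qed
  qed
  have inv: "integral UNIV (\<lambda>y. J (a, y)) = integral UNIV (\<lambda>y. J (0, y))"
  proof (rule integral_divergence_invariant[where R=R and w=w, OF sJ _ sw _ _ a])
    show "frechet_derivative J (at (s, y)) (1, 0) = (\<Sum>i\<in>UNIV. frechet_derivative (w i) (at (s, y)) (0, axis i 1))"
      if "s \<in> {0..a}" for s y using div[of "(s, y)"] that by simp
  qed (simp_all add: J_def w_def outside)
  have "J (0, y) = 0" for y
  proof (cases "(0, y) \<in> K")
    case True
    then have "\<rho> (F (0, y)) = 0" using e2(2)[of "(0, y)"] \<epsilon>(3) by (intro \<rho>0) simp
    then show ?thesis by (simp add: J_def J0_def)
  qed (simp add: J_def \<kappa>(7))
  then have J0: "integral UNIV (\<lambda>y. J (a, y)) = 0" using inv by simp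
  \<comment> \<open>The preimage near \<open>y\<close> of the ball that carries the bump. Each is
    mapped bijectively onto this ball and different ones are disjoint, so the slice integral splits
    into one change of variables per zero.\<close>
  define A where "A y = N y \<inter> f -` ball 0 \<epsilon>" for y
  have A_open: "open (A y)" if "y \<in> Y" for y unfolding A_def by (rule P_open[OF that])
  have A_sub: "A y \<subseteq> N y" for y by (auto simp: A_def)
  have gf: "g y (f x) = x" if "y \<in> Y" "x \<in> N y" for x y using N(6)[OF that(1)] that(2) by (simp add: homeomorphism_def)
  have fg: "f (g y x) = x" if "y \<in> Y" "x \<in> W y" for x y using N(6)[OF that(1)] that(2) by (simp add: homeomorphism_def)
  have A_B: "A y \<subseteq> B y" if "y \<in> Y" for y
  proof
    fix x assume x: "x \<in> A y"
    then have "f x \<in> ball 0 (\<eta> y)" using \<epsilon>(5)[OF that] by (simp add: A_def)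
    then have "g y (f x) \<in> B y" using \<eta>(2)[OF that] by auto
    then show "x \<in> B y" using gf[OF that] x by (simp add: A_def)
  qed
  have A_img: "f ` A y = ball 0 \<epsilon>" if "y \<in> Y" for y
  proof
    show "ball 0 \<epsilon> \<subseteq> f ` A y"
    proof
      fix x :: "real^'n::_" assume x: "x \<in> ball 0 \<epsilon>"
      then have "x \<in> ball 0 (\<eta> y)" using \<epsilon>(5)[OF that] by simp
      then have "x \<in> W y" "g y x \<in> N y" using \<eta>(2)[OF that] by auto
      then show "x \<in> f ` A y" using fg[OF that] x by (intro image_eqI[of _ _ "g y x"]) (simp_all add: A_def)
    qed
  qed (auto simp: A_def)
  have A_int: "((\<lambda>x. if x \<in> A y then \<rho> (f x) * d x else 0) has_integral sgn (d y) * integral UNIV \<rho>) UNIV" if y: "y \<in> Y" for y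
    unfolding d_def
  proof (rule change_of_variables_bump[OF A_open[OF y] _ _ A_img[OF y] _ \<rho>c \<rho>0], unfold d_def[symmetric])
    show "smooth_on f (A y)" by (rule smooth_on_subset[OF f]) (use A_sub N(2)[OF y] in blast)
    show "inj_on f (A y)" by (rule inj_on_subset[OF f_inj[OF y] A_sub])
    show "d x = sgn (d y) * \<bar>d x\<bar>" if "x \<in> A y" for x
    proof -
      have "x \<in> N y" using that A_sub by blast
      then have "d x * d y > 0" by (rule N(7)[OF y])
      then show ?thesis by (auto simp: sgn_if zero_less_mult_iff)
    qed
  qed
  have "J (a, x) = (\<Sum>y\<in>Y. if x \<in> A y then \<rho> (f x) * d x else 0)" for x
  proof (cases "\<exists>y\<in>Y. x \<in> A y")
    case True
    then obtain y where y: "y \<in> Y" "x \<in> A y" by blast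
    have "x \<in> A y' \<longleftrightarrow> y' = y" if "y' \<in> Y" for y'
      using B(3)[of y y'] A_B y that by blast
    then have "(\<Sum>y\<in>Y. if x \<in> A y then \<rho> (f x) * d x else 0) = (\<Sum>y'\<in>Y. if y' = y then \<rho> (f x) * d x else 0)"
      by (intro sum.cong) auto
    also have "\<dots> = \<rho> (f x) * d x" using finY y by simp
    also have "\<dots> = J (a, x)"
    proof -
      have xU: "x \<in> U" using y A_sub N(2) by blast
      then show ?thesis
        unfolding d_def f'[OF xU] by (simp add: J_def J0_def f_def c_def U_def \<kappa>(4))
    qed
    finally show ?thesis by simp
  next
    case False
    have "J (a, x) = 0"
    proof (cases "(a, x) \<in> K")
      case True
      have "\<epsilon> \<le> norm (f x)"
      proof (cases "x \<in> (\<Union>y\<in>Y. P y)")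
        case True
        then obtain y where y: "y \<in> Y" "x \<in> P y" by blast
        then have "x \<notin> A y" using \<open>\<not> (\<exists>y\<in>Y. x \<in> A y)\<close> by blast
        then show ?thesis using y by (simp add: P_def A_def)
      next
        case False
        then show ?thesis using e3(2)[OF \<open>(a, x) \<in> K\<close>] \<epsilon>(4) by simp
      qed
      then show ?thesis using \<rho>0[of "f x"] by (simp add: J_def J0_def f_def)
    qed (simp add: J_def \<kappa>(7))
    then show ?thesis using False by (simp add: sum.neutral)
  qed
  then have Jint: "((\<lambda>x. J (a, x)) has_integral (\<Sum>y\<in>Y. sgn (d y) * integral UNIV \<rho>)) UNIV"
    using has_integral_sum[OF finY A_int] by simp
  have "(\<Sum>y\<in>Y. sgn (d y)) * integral UNIV \<rho> = 0"
    using integral_unique[OF Jint] J0 by (simp add: sum_distrib_right)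
  then have sum0: "(\<Sum>y\<in>Y. sgn (d y)) = 0" using I by simp
  \<comment> \<open>A nonzero sign is 2 [d y > 0] - 1, so a vanishing sum says that
    \<open>card Y\<close> is twice the number of positive signs.\<close>
  have "(\<Sum>y\<in>Y. sgn (d y)) = (\<Sum>y\<in>Y. 2 * of_bool (d y > 0) - 1)"
    using dY by (intro sum.cong) (auto simp: sgn_if)
  also have "\<dots> = 2 * real (card {y \<in> Y. d y > 0}) - real (card Y)"
    using finY by (simp add: sum_subtractf sum_distrib_left[symmetric] Int_def)
  finally have "real (card Y) = real (2 * card {y \<in> Y. d y > 0})" using sum0 by simp
  then have "card Y = 2 * card {y \<in> Y. d y > 0}" by (simp only: of_nat_eq_iff)
  then show "even (card {y. (a, y) \<in> C})" unfolding Y_def[symmetric] by simp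
qed

section \<open>Whitney embedding\<close>

lemma smooth_on_vec_lambda:
  fixes f :: "'e::real_normed_vector \<Rightarrow> real^'n::finite"
  assumes "open S" "\<And>k. smooth_on (\<lambda>x. f x $ k) S"
  shows "smooth_on f S"
proof -
  have "smooth_on (\<lambda>x. \<Sum>k\<in>UNIV. (f x $ k) *\<^sub>R axis k (1::real)) S"
    by (intro smooth_on_sum smooth_on_scaleR smooth_on_const assms)
  moreover have "(\<Sum>k\<in>UNIV. (f x $ k) *\<^sub>R axis k (1::real)) = f x" for x
    by (simp add: vec_eq_iff axis_def if_distrib cong: if_cong)
  ultimately show ?thesis by (simp only:)
qed

section \<open>Charts and smooth functions on a compact manifold\<close>

locale compact_manifold =
  fixes A :: "('a::{t2_space,second_countable_topology}, 'b::euclidean_space) atlas"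
  assumes atlas: "smooth_atlas A" and compact_UNIV': "compact (UNIV :: 'a set)"
begin

lemma chart_open: "(U, \<phi>) \<in> A \<Longrightarrow> open U" "(U, \<phi>) \<in> A \<Longrightarrow> open (\<phi> ` U)"
  and chart_homeo: "(U, \<phi>) \<in> A \<Longrightarrow> homeomorphism U (\<phi> ` U) \<phi> (inv_into U \<phi>)"
  and chart_transition: "(U, \<phi>) \<in> A \<Longrightarrow> (V, \<psi>) \<in> A \<Longrightarrow> smooth_on (\<lambda>y. \<phi> (inv_into V \<psi> y)) (\<psi> ` (U \<inter> V))"
proof -
  have 1: "\<forall>c\<in>A. case c of (U, \<phi>) \<Rightarrow> open U \<and> open (\<phi> ` U) \<and> homeomorphism U (\<phi> ` U) \<phi> (inv_into U \<phi>)"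
    and 2: "\<forall>c\<in>A. case c of (U, \<phi>) \<Rightarrow> \<forall>c\<in>A. case c of (V, \<psi>) \<Rightarrow> smooth_on (\<phi> \<circ> inv_into V \<psi>) (\<psi> ` (U \<inter> V))"
    using atlas unfolding smooth_atlas_def by (rule conjunct1[OF conjunct2], rule conjunct2[OF conjunct2])
  show "(U, \<phi>) \<in> A \<Longrightarrow> open U" "(U, \<phi>) \<in> A \<Longrightarrow> open (\<phi> ` U)"
    "(U, \<phi>) \<in> A \<Longrightarrow> homeomorphism U (\<phi> ` U) \<phi> (inv_into U \<phi>)"
    using bspec[OF 1, of "(U, \<phi>)"] by simp_all
  show "smooth_on (\<lambda>y. \<phi> (inv_into V \<psi> y)) (\<psi> ` (U \<inter> V))" if "(U, \<phi>) \<in> A" "(V, \<psi>) \<in> A"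
    using bspec[OF bspec[OF 2 that(1), unfolded split_conv] that(2)] by (simp add: o_def)
qed

lemma chart_exists: obtains U \<phi> where "(U, \<phi>) \<in> A" "p \<in> U"
proof -
  have "p \<in> (\<Union>(U, \<phi>)\<in>A. U)" using atlas unfolding smooth_atlas_def by simp
  then show ?thesis using that by auto
qed

lemma chart_inv: "(U, \<phi>) \<in> A \<Longrightarrow> p \<in> U \<Longrightarrow> inv_into U \<phi> (\<phi> p) = p"
  using chart_homeo[of U \<phi>] by (auto simp: homeomorphism_def)

lemma chart_inv': "y \<in> \<phi> ` U \<Longrightarrow> inv_into U \<phi> y \<in> U" "y \<in> \<phi> ` U \<Longrightarrow> \<phi> (inv_into U \<phi> y) = y"
  by (auto simp: inv_into_into f_inv_into_f)

lemma chart_continuous: "(U, \<phi>) \<in> A \<Longrightarrow> continuous_on U \<phi>" "(U, \<phi>) \<in> A \<Longrightarrow> continuous_on (\<phi> ` U) (inv_into U \<phi>)"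
  using chart_homeo[of U \<phi>] by (auto simp: homeomorphism_def)

lemma chart_image_open:
  assumes "(U, \<phi>) \<in> A" "open W" "W \<subseteq> U"
  shows "open (\<phi> ` W)"
proof -
  have "\<phi> ` W = \<phi> ` U \<inter> inv_into U \<phi> -` W"
  proof (intro equalityI subsetI)
    fix y assume "y \<in> \<phi> ` W"
    then obtain p where p: "p \<in> W" "y = \<phi> p" by blast
    then have "p \<in> U" using assms(3) by blast
    then show "y \<in> \<phi> ` U \<inter> inv_into U \<phi> -` W" using p chart_inv[OF assms(1) \<open>p \<in> U\<close>] by simp
  next
    fix y assume "y \<in> \<phi> ` U \<inter> inv_into U \<phi> -` W"
    then show "y \<in> \<phi> ` W" using chart_inv'(2)[of y \<phi> U] by (metis IntE imageI vimageE)
  qed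
  then show ?thesis
    using continuous_open_preimage[OF chart_continuous(2)[OF assms(1)] chart_open(2)[OF assms(1)] assms(2)] by simp
qed

lemma smooth_functionsD:
  "f \<in> smooth_functions A \<Longrightarrow> (U, \<phi>) \<in> A \<Longrightarrow> smooth_on (\<lambda>y. f (inv_into U \<phi> y)) (\<phi> ` U)"
  by (auto simp: smooth_functions_def o_def)

text \<open>One chart around each point suffices, since the transition maps carry smoothness over to
  all the others.\<close>

lemma smooth_functionsI_local:
  assumes "\<And>p. \<exists>U \<phi> W. (U, \<phi>) \<in> A \<and> open W \<and> p \<in> W \<and> W \<subseteq> U \<and> smooth_on (\<lambda>y. f (inv_into U \<phi> y)) (\<phi> ` W)"
  shows "f \<in> smooth_functions A"
  unfolding smooth_functions_def o_def
proof clarify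
  fix V \<psi> assume V: "(V, \<psi>) \<in> A"
  show "smooth_on (\<lambda>y. f (inv_into V \<psi> y)) (\<psi> ` V)"
  proof (rule smooth_on_local)
    fix y assume "y \<in> \<psi> ` V"
    then obtain q where q: "q \<in> V" "y = \<psi> q" by blast
    obtain U \<phi> W where W: "(U, \<phi>) \<in> A" "open W" "q \<in> W" "W \<subseteq> U" "smooth_on (\<lambda>y. f (inv_into U \<phi> y)) (\<phi> ` W)"
      using assms[of q] by blast
    have o: "open (\<psi> ` (W \<inter> V))" using W(2) chart_open(1)[OF V] by (intro chart_image_open[OF V]) auto
    have s: "smooth_on (\<lambda>y. \<phi> (inv_into V \<psi> y)) (\<psi> ` (W \<inter> V))"
      using W(4) by (intro smooth_on_subset[OF chart_transition[OF W(1) V]] image_mono) auto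
    have im: "inv_into V \<psi> z \<in> W \<inter> V" if "z \<in> \<psi> ` (W \<inter> V)" for z
      using that chart_inv[OF V] by auto
    have "smooth_on (\<lambda>z. f (inv_into U \<phi> (\<phi> (inv_into V \<psi> z)))) (\<psi> ` (W \<inter> V))"
      by (rule smooth_on_compose[OF o s W(5)]) (use im in auto)
    moreover have "f (inv_into V \<psi> z) = f (inv_into U \<phi> (\<phi> (inv_into V \<psi> z)))" if "z \<in> \<psi> ` (W \<inter> V)" for z
      using chart_inv[OF W(1), of "inv_into V \<psi> z"] im[OF that] W(4) by auto
    ultimately show "\<exists>U g. open U \<and> y \<in> U \<and> smooth_on g U \<and> (\<forall>z\<in>U. f (inv_into V \<psi> z) = g z)"
      using o q W(3) by (intro exI[of _ "\<psi> ` (W \<inter> V)"] exI[of _ "\<lambda>z. f (inv_into U \<phi> (\<phi> (inv_into V \<psi> z)))"]) auto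
  qed
qed

text \<open>At points outside \<open>U\<close> the function vanishes nearby: the subset of
  \<open>U\<close> corresponding to \<open>C\<close> is compact, hence closed because the space is
  Hausdorff, and the function is 0 on its complement.\<close>

lemma chart_function_smooth:
  assumes U: "(U, \<phi>) \<in> A" and k: "smooth_on k (\<phi> ` U)" and C: "compact C" "C \<subseteq> \<phi> ` U"
    and zero: "\<And>y. y \<in> \<phi> ` U \<Longrightarrow> y \<notin> C \<Longrightarrow> k y = 0"
  shows "(\<lambda>q. if q \<in> U then k (\<phi> q) else 0) \<in> smooth_functions A"
proof (rule smooth_functionsI_local)
  fix p
  let ?f = "\<lambda>q. if q \<in> U then k (\<phi> q) else 0"
  let ?C = "inv_into U \<phi> ` C"
  have C': "closed ?C"
    by (intro compact_imp_closed compact_continuous_image C continuous_on_subset[OF chart_continuous(2)[OF U]])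
  show "\<exists>V \<psi> W. (V, \<psi>) \<in> A \<and> open W \<and> p \<in> W \<and> W \<subseteq> V \<and> smooth_on (\<lambda>y. ?f (inv_into V \<psi> y)) (\<psi> ` W)"
  proof (cases "p \<in> U")
    case True
    have "smooth_on (\<lambda>y. ?f (inv_into U \<phi> y)) (\<phi> ` U)"
      by (rule smooth_on_cong[OF chart_open(2)[OF U] _ k]) (simp add: chart_inv')
    then show ?thesis using U True chart_open(1)[OF U] by blast
  next
    case False
    obtain V \<psi> where V: "(V, \<psi>) \<in> A" "p \<in> V" using chart_exists by blast
    have pC: "p \<notin> ?C" using False C(2) by (auto simp: chart_inv')
    have W: "open (V - ?C)" using chart_open(1)[OF V(1)] C' by blast
    have o: "open (\<psi> ` (V - ?C))" by (rule chart_image_open[OF V(1) W]) blast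
    have zero': "?f q = 0" if "q \<in> V - ?C" for q
    proof (cases "q \<in> U")
      case True
      have "\<phi> q \<notin> C"
      proof
        assume "\<phi> q \<in> C"
        then have "inv_into U \<phi> (\<phi> q) \<in> ?C" by (rule imageI)
        then show False using that chart_inv[OF U True] by simp
      qed
      then show ?thesis using zero True by simp
    qed simp
    have "smooth_on (\<lambda>y. ?f (inv_into V \<psi> y)) (\<psi> ` (V - ?C))"
    proof (rule smooth_on_cong[OF o _ smooth_on_const[OF o, of 0]])
      fix y assume "y \<in> \<psi> ` (V - ?C)"
      then obtain q where q: "q \<in> V - ?C" "y = \<psi> q" by blast
      then have "inv_into V \<psi> y = q" using chart_inv[OF V(1)] by blast
      then show "0 = ?f (inv_into V \<psi> y)" using zero'[OF q(1)] by metis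
    qed
    then show ?thesis using V W pC by (intro exI[of _ V] exI[of _ \<psi>] exI[of _ "V - ?C"]) auto
  qed
qed

text \<open>Coordinates near \<open>p\<close>, cut off to become functions on the whole manifold.
  The cutoff \<mu> is returned as well: a nonzero value of it certifies membership in
  \<open>U\<close>, which the cut off coordinates alone do not show, as they may vanish inside
  \<open>U\<close>.\<close>

lemma local_coordinates:
  obtains U \<phi> N \<mu> and X :: "'b \<Rightarrow> 'a \<Rightarrow> real" where "(U, \<phi>) \<in> A" "open N" "p \<in> N" "N \<subseteq> U" "\<mu> \<in> smooth_functions A"
    "\<And>q. q \<in> N \<Longrightarrow> \<mu> q = 1" "\<And>q. \<mu> q \<noteq> 0 \<Longrightarrow> q \<in> U" "\<And>b. X b \<in> smooth_functions A"
    "\<And>b q. q \<in> U \<Longrightarrow> X b q = \<mu> q * (\<phi> q \<bullet> b)"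
proof -
  obtain U \<phi> where U: "(U, \<phi>) \<in> A" "p \<in> U" by (rule chart_exists)
  obtain h V C where h: "smooth_on h UNIV" "open V" "{\<phi> p} \<subseteq> V" "\<And>x. x \<in> V \<Longrightarrow> h x = (1::real)"
    "compact C" "C \<subseteq> \<phi> ` U" "\<And>x. x \<notin> C \<Longrightarrow> h x = 0" "\<And>x. 0 \<le> h x" "\<And>x. h x \<le> 1"
  proof (rule smooth_bump[of "{\<phi> p}" "\<phi> ` U"])
    show "compact {\<phi> p}" "{\<phi> p} \<subseteq> \<phi> ` U" using U(2) by auto
    show "open (\<phi> ` U)" by (rule chart_open(2)[OF U(1)])
  qed (rule that)
  note oU = chart_open(2)[OF U(1)]
  have hU: "smooth_on h (\<phi> ` U)" by (rule smooth_on_subset[OF h(1)]) simp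
  have hb: "smooth_on (\<lambda>y. h y * (y \<bullet> b)) (\<phi> ` U)" for b
    by (intro smooth_on_mult smooth_on_inner smooth_on_ident smooth_on_const hU oU)
  show ?thesis
  proof (rule that[of U \<phi> "U \<inter> \<phi> -` V" "\<lambda>q. if q \<in> U then h (\<phi> q) else 0" "\<lambda>b q. if q \<in> U then h (\<phi> q) * (\<phi> q \<bullet> b) else 0"])
    show "open (U \<inter> \<phi> -` V)"
      by (rule continuous_open_preimage[OF chart_continuous(1)[OF U(1)] chart_open(1)[OF U(1)] h(2)])
    show "(\<lambda>q. if q \<in> U then h (\<phi> q) else 0) \<in> smooth_functions A"
      by (rule chart_function_smooth[OF U(1) hU h(5,6,7)])
    show "(\<lambda>q. if q \<in> U then h (\<phi> q) * (\<phi> q \<bullet> b) else 0) \<in> smooth_functions A" for b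
      by (rule chart_function_smooth[OF U(1) hb h(5,6)]) (simp add: h(7))
    show "(U, \<phi>) \<in> A" by (rule U(1))
    show "p \<in> U \<inter> \<phi> -` V" "U \<inter> \<phi> -` V \<subseteq> U" using U(2) h(3) by auto
    show "(if q \<in> U then h (\<phi> q) else 0) = 1" if "q \<in> U \<inter> \<phi> -` V" for q using that h(4) by simp
    show "q \<in> U" if "(if q \<in> U then h (\<phi> q) else 0) \<noteq> 0" for q using that by presburger
    show "(if q \<in> U then h (\<phi> q) * (\<phi> q \<bullet> b) else 0) = (if q \<in> U then h (\<phi> q) else 0) * (\<phi> q \<bullet> b)"
      if "q \<in> U" for b q using that by simp
  qed
qed

text \<open>A finite family separating points and tangent vectors. If all its members agree at p and
  q, take a chart whose cutoff is 1 at p; it is then 1 at q too, so both points lie in the domain of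
  that chart, and there the coordinates agree.\<close>

lemma finite_coordinate_cover:
  obtains T :: "('a set \<times> ('a \<Rightarrow> 'b)) set" and H :: "('a \<Rightarrow> real) list"
  where "finite T" "T \<subseteq> A" "(\<Union>(U, \<phi>)\<in>T. U) = UNIV" "set H \<subseteq> smooth_functions A"
    "\<And>p q. p \<noteq> q \<Longrightarrow> \<exists>h\<in>set H. h p \<noteq> h q"
    "\<And>p. \<exists>(U, \<phi>)\<in>T. p \<in> U \<and> (\<forall>w. w \<noteq> 0 \<longrightarrow> (\<exists>h\<in>set H. frechet_derivative (\<lambda>y. h (inv_into U \<phi> y)) (at (\<phi> p)) w \<noteq> 0))"
proof -
  define Q where "Q N U \<phi> \<mu> X \<longleftrightarrow> (U, \<phi>) \<in> A \<and> open N \<and> N \<subseteq> U \<and> \<mu> \<in> smooth_functions A \<and>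
    (\<forall>q\<in>N. \<mu> q = 1) \<and> (\<forall>q. \<mu> q \<noteq> 0 \<longrightarrow> q \<in> U) \<and> (\<forall>b. X b \<in> smooth_functions A) \<and> (\<forall>b. \<forall>q\<in>U. X b q = \<mu> q * (\<phi> q \<bullet> b))"
    for N U and \<phi> :: "'a \<Rightarrow> 'b" and \<mu> :: "'a \<Rightarrow> real" and X :: "'b \<Rightarrow> 'a \<Rightarrow> real"
  have "\<exists>N U \<phi> \<mu> X. p \<in> N \<and> Q N U \<phi> \<mu> X" for p
  proof -
    obtain U \<phi> N \<mu> and X :: "'b \<Rightarrow> 'a \<Rightarrow> real" where "(U, \<phi>) \<in> A" "open N" "p \<in> N" "N \<subseteq> U" "\<mu> \<in> smooth_functions A"
      "\<And>q. q \<in> N \<Longrightarrow> \<mu> q = 1" "\<And>q. \<mu> q \<noteq> 0 \<Longrightarrow> q \<in> U" "\<And>b. X b \<in> smooth_functions A"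
      "\<And>b q. q \<in> U \<Longrightarrow> X b q = \<mu> q * (\<phi> q \<bullet> b)"
      by (rule local_coordinates[of p]) (rule that)
    then have "p \<in> N \<and> Q N U \<phi> \<mu> X" unfolding Q_def by simp
    then show ?thesis by (intro exI)
  qed
  then obtain N U \<phi> \<mu> X where NQ: "\<And>p. p \<in> N p \<and> Q (N p) (U p) (\<phi> p) (\<mu> p) (X p)" by metis
  have U: "(U p, \<phi> p) \<in> A" and N: "open (N p)" "p \<in> N p" "N p \<subseteq> U p" and l: "\<mu> p \<in> smooth_functions A"
    "\<And>q. q \<in> N p \<Longrightarrow> \<mu> p q = 1" "\<And>q. \<mu> p q \<noteq> 0 \<Longrightarrow> q \<in> U p" and X: "\<And>b. X p b \<in> smooth_functions A"
    "\<And>b q. q \<in> U p \<Longrightarrow> X p b q = \<mu> p q * (\<phi> p q \<bullet> b)" for p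
    using NQ[of p] by (simp_all add: Q_def)
  obtain P where P: "finite P" "UNIV \<subseteq> (\<Union>p\<in>P. N p)"
    by (rule compactE_image[OF compact_UNIV', of UNIV N]) (use N in auto)
  define HS where "HS = (\<lambda>p. \<mu> p) ` P \<union> (\<lambda>(p, b). X p b) ` (P \<times> Basis)"
  have "finite HS" unfolding HS_def using P by auto
  then obtain H where H: "set H = HS" using finite_list by blast
  show ?thesis
  proof (rule that[of "(\<lambda>p. (U p, \<phi> p)) ` P" H])
    show "(\<Union>(U, \<phi>)\<in>(\<lambda>p. (U p, \<phi> p)) ` P. U) = UNIV" using P(2) N(3) by fastforce
    show "set H \<subseteq> smooth_functions A" unfolding H HS_def using l(1) X(1) by auto
    show "\<exists>h\<in>set H. h p \<noteq> h q" if "p \<noteq> q" for p q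
    proof (rule ccontr)
      assume "\<not> ?thesis"
      then have eq: "h p = h q" if "h \<in> HS" for h using that H by blast
      obtain c where c: "c \<in> P" "p \<in> N c" using P(2) by blast
      have lc: "\<mu> c \<in> HS" and Xc: "\<And>b. b \<in> Basis \<Longrightarrow> X c b \<in> HS" using c by (auto simp: HS_def)
      have 1: "\<mu> c p = 1" "\<mu> c q = 1" using l(2)[OF c(2)] eq[OF lc] by auto
      then have inU: "p \<in> U c" "q \<in> U c" using l(3) by auto
      have "\<phi> c p \<bullet> b = \<phi> c q \<bullet> b" if "b \<in> Basis" for b
        using eq[OF Xc[OF that]] X(2)[OF inU(1)] X(2)[OF inU(2)] 1 by simp
      then have "\<phi> c p = \<phi> c q" by (rule euclidean_eqI)
      then have "p = q" using chart_inv[OF U inU(1)] chart_inv[OF U inU(2)] by metis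
      then show False using that by simp
    qed
    show "\<exists>(V, \<psi>)\<in>(\<lambda>p. (U p, \<phi> p)) ` P. p \<in> V \<and> (\<forall>w. w \<noteq> 0 \<longrightarrow> (\<exists>h\<in>set H. frechet_derivative (\<lambda>y. h (inv_into V \<psi> y)) (at (\<psi> p)) w \<noteq> 0))" for p
    proof -
      obtain c where c: "c \<in> P" "p \<in> N c" using P(2) by blast
      have pU: "p \<in> U c" using c(2) N(3) by blast
      have "\<exists>h\<in>set H. frechet_derivative (\<lambda>y. h (inv_into (U c) (\<phi> c) y)) (at (\<phi> c p)) w \<noteq> 0" if w: "w \<noteq> 0" for w
      proof -
        obtain b where b: "b \<in> Basis" "w \<bullet> b \<noteq> 0" using w by (metis euclidean_eqI inner_zero_left)
        have o: "open (\<phi> c ` N c)" by (rule chart_image_open[OF U N(1,3)])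
        have "frechet_derivative (\<lambda>y. X c b (inv_into (U c) (\<phi> c) y)) (at (\<phi> c p)) = frechet_derivative (\<lambda>y. y \<bullet> b) (at (\<phi> c p))"
        proof (rule frechet_derivative_transform[OF o])
          show "\<phi> c p \<in> \<phi> c ` N c" using c(2) by simp
          fix y assume "y \<in> \<phi> c ` N c"
          then obtain q where q: "q \<in> N c" "y = \<phi> c q" by blast
          then have qU: "q \<in> U c" using N(3) by blast
          show "X c b (inv_into (U c) (\<phi> c) y) = y \<bullet> b"
            using q chart_inv[OF U qU] X(2)[OF qU] l(2)[OF q(1)] by simp
        qed
        also have "\<dots> = (\<lambda>y. y \<bullet> b)"
          using frechet_derivative_at[OF bounded_linear.has_derivative[OF bounded_linear_inner_left has_derivative_ident]] by metis
        finally have "frechet_derivative (\<lambda>y. X c b (inv_into (U c) (\<phi> c) y)) (at (\<phi> c p)) w \<noteq> 0" using b by simp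
        moreover have "X c b \<in> set H" unfolding H HS_def using c b by auto
        ultimately show ?thesis by blast
      qed
      then show ?thesis using c(1) pU by blast
    qed
  qed (use P U in auto)
qed

section \<open>Injective immersions by generic perturbation\<close>

definition smooth_vec :: "('a \<Rightarrow> real^'n::finite) \<Rightarrow> bool" where
  "smooth_vec f \<longleftrightarrow> (\<forall>k. (\<lambda>p. f p $ k) \<in> smooth_functions A)"

lemma smooth_vecD:
  assumes "smooth_vec f" "(U, \<phi>) \<in> A" shows "smooth_on (\<lambda>y. f (inv_into U \<phi> y)) (\<phi> ` U)"
  by (rule smooth_on_vec_lambda[OF chart_open(2)[OF assms(2)]])
    (use assms smooth_functionsD in \<open>auto simp: smooth_vec_def\<close>)

lemma smooth_vec_add_scaleR:
  assumes f: "smooth_vec f" and h: "h \<in> smooth_functions A"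
  shows "smooth_vec (\<lambda>p. f p + h p *\<^sub>R a)"
  unfolding smooth_vec_def smooth_functions_def o_def
proof clarify
  fix k U \<phi> assume U: "(U, \<phi>) \<in> A"
  have "(\<lambda>p. f p $ k) \<in> smooth_functions A" using f by (simp add: smooth_vec_def)
  from smooth_functionsD[OF this U] smooth_functionsD[OF h U] chart_open(2)[OF U]
  show "smooth_on (\<lambda>y. (f (inv_into U \<phi> y) + h (inv_into U \<phi> y) *\<^sub>R a) $ k) (\<phi> ` U)"
    by (simp, intro smooth_on_add smooth_on_mult smooth_on_const)
qed

text \<open>Adding h times a vector \<open>a\<close> is meant to separate whatever h distinguishes.
  The vectors that fail are values of smooth maps on open sets of dimension 2 DIM('b), for pairs of
  points as well as for tangent vectors, so they form a null set in a space of larger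
  dimension.\<close>

lemma whitney_step:
  fixes f :: "'a \<Rightarrow> real^'n::finite"
  assumes T: "finite T" "T \<subseteq> A" and f: "smooth_vec f" and h: "h \<in> smooth_functions A" and dim: "2 * DIM('b) < CARD('n)"
  obtains a where
    "\<And>U \<phi> V \<psi> p q. (U, \<phi>) \<in> T \<Longrightarrow> (V, \<psi>) \<in> T \<Longrightarrow> p \<in> U \<Longrightarrow> q \<in> V \<Longrightarrow> h p \<noteq> h q \<Longrightarrow> f p + h p *\<^sub>R a \<noteq> f q + h q *\<^sub>R a"
    "\<And>U \<phi> p w. (U, \<phi>) \<in> T \<Longrightarrow> p \<in> U \<Longrightarrow> frechet_derivative (\<lambda>y. h (inv_into U \<phi> y)) (at (\<phi> p)) w \<noteq> 0 \<Longrightarrow>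
      frechet_derivative (\<lambda>y. f (inv_into U \<phi> y)) (at (\<phi> p)) w + frechet_derivative (\<lambda>y. h (inv_into U \<phi> y)) (at (\<phi> p)) w *\<^sub>R a \<noteq> 0"
proof -
  define hc where "hc c y = h (inv_into (fst c) (snd c) y)" for c :: "'a set \<times> ('a \<Rightarrow> 'b)" and y
  define fc where "fc c y = f (inv_into (fst c) (snd c) y)" for c :: "'a set \<times> ('a \<Rightarrow> 'b)" and y
  define R where "R c = snd c ` fst c" for c :: "'a set \<times> ('a \<Rightarrow> 'b)"
  have sh: "smooth_on (hc c) (R c)" and sf: "smooth_on (fc c) (R c)" and oR: "open (R c)" if "c \<in> T" for c
  proof -
    have c: "(fst c, snd c) \<in> A" using that T(2) by auto
    show "smooth_on (hc c) (R c)" "smooth_on (fc c) (R c)" "open (R c)"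
      unfolding hc_def[abs_def] fc_def[abs_def] R_def
      by (rule smooth_functionsD[OF h c] smooth_vecD[OF f c] chart_open(2)[OF c])+
  qed
  \<comment> \<open>\<open>B1\<close> and \<open>B2\<close> collect the bad vectors: the solutions
    \<open>a\<close> of (f p - f q) + (h p - h q) a = 0, and those of f' w + (h' w) a = 0.\<close>
  define S1 where "S1 c d = {z \<in> R c \<times> R d. hc c (fst z) - hc d (snd z) \<noteq> 0}" for c d
  define B1 where "B1 c d = (\<lambda>z. inverse (hc c (fst z) - hc d (snd z)) *\<^sub>R - (fc c (fst z) - fc d (snd z))) ` S1 c d" for c d
  define S2 where "S2 c = {z \<in> R c \<times> UNIV. frechet_derivative (hc c) (at (fst z)) (snd z) \<noteq> 0}" for c
  define B2 where "B2 c = (\<lambda>z. inverse (frechet_derivative (hc c) (at (fst z)) (snd z)) *\<^sub>R - frechet_derivative (fc c) (at (fst z)) (snd z)) ` S2 c" for c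
  have neg: "negligible ((\<lambda>z. inverse (u z) *\<^sub>R v z) ` {z \<in> W. u z \<noteq> 0})"
    if "open W" "smooth_on u W" "smooth_on v W" for W and u :: "'b \<times> 'b \<Rightarrow> real" and v :: "'b \<times> 'b \<Rightarrow> real^'n"
  proof (rule negligible_differentiable_image_lowdim)
    show "DIM('b \<times> 'b) < DIM(real^'n)" using dim by simp
    have oS: "open {z \<in> W. u z \<noteq> 0}"
    proof -
      have "{z \<in> W. u z \<noteq> 0} = W \<inter> u -` (- {0})" by auto
      then show ?thesis using continuous_open_preimage[OF smooth_on_imp_continuous_on[OF that(2)] that(1), of "- {0}"] by auto
    qed
    have su: "smooth_on u {z \<in> W. u z \<noteq> 0}" "smooth_on v {z \<in> W. u z \<noteq> 0}"
      using that smooth_on_subset by (metis (no_types, lifting) mem_Collect_eq subsetI)+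
    have "smooth_on (\<lambda>z. inverse (u z) *\<^sub>R v z) {z \<in> W. u z \<noteq> 0}"
      by (intro smooth_on_scaleR oS su smooth_on_compose[OF oS su(1) smooth_on_real_inverse[of "- {0}"]]) auto
    then show "(\<lambda>z. inverse (u z) *\<^sub>R v z) differentiable_on {z \<in> W. u z \<noteq> 0}"
      using smooth_on_has_derivative unfolding differentiable_on_def differentiable_def by (blast intro: has_derivative_at_withinI)
  qed
  have n1: "negligible (B1 c d)" if cd: "c \<in> T" "d \<in> T" for c d
  proof -
    have o: "open (R c \<times> R d)" by (intro open_Times oR cd)
    have fst: "smooth_on (\<lambda>z. k (fst z)) (R c \<times> R d)" if "smooth_on k (R c)" for k :: "'b \<Rightarrow> 'z::real_normed_vector"
      by (rule smooth_on_compose[OF o smooth_on_fst[OF o smooth_on_ident[OF o]] that]) auto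
    have snd: "smooth_on (\<lambda>z. k (snd z)) (R c \<times> R d)" if "smooth_on k (R d)" for k :: "'b \<Rightarrow> 'z::real_normed_vector"
      by (rule smooth_on_compose[OF o smooth_on_snd[OF o smooth_on_ident[OF o]] that]) auto
    show ?thesis unfolding B1_def S1_def
      by (rule neg[OF o]) (intro smooth_on_minus smooth_on_diff o fst snd sh sf cd)+
  qed
  have n2: "negligible (B2 c)" if c: "c \<in> T" for c
  proof -
    have o: "open (R c \<times> (UNIV :: 'b set))" by (intro open_Times oR c open_UNIV)
    have d: "smooth_on (\<lambda>z. frechet_derivative k (at (fst z)) (snd z)) (R c \<times> UNIV)" if "smooth_on k (R c)" for k :: "'b \<Rightarrow> 'z::real_normed_vector"
      by (rule smooth_on_frechet_derivative_apply[OF o that oR[OF c] smooth_on_fst[OF o smooth_on_ident[OF o]] smooth_on_snd[OF o smooth_on_ident[OF o]]]) auto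
    show ?thesis unfolding B2_def S2_def
      by (rule neg[OF o]) (intro smooth_on_minus o d sh sf c)+
  qed
  have "negligible (\<Union>((\<lambda>(c, d). B1 c d) ` (T \<times> T)))" "negligible (\<Union>(B2 ` T))"
    by (rule negligible_Union, use T(1) n1 n2 in auto)+
  then have negl: "negligible ((\<Union>(c, d)\<in>T \<times> T. B1 c d) \<union> (\<Union>c\<in>T. B2 c))" by (rule negligible_Un)
  have "(\<Union>(c, d)\<in>T \<times> T. B1 c d) \<union> (\<Union>c\<in>T. B2 c) \<noteq> UNIV"
  proof
    assume eq: "(\<Union>(c, d)\<in>T \<times> T. B1 c d) \<union> (\<Union>c\<in>T. B2 c) = UNIV"
    show False using negl unfolding eq by (simp add: non_negligible_UNIV)
  qed
  then obtain a where a: "\<And>c d. c \<in> T \<Longrightarrow> d \<in> T \<Longrightarrow> a \<notin> B1 c d" "\<And>c. c \<in> T \<Longrightarrow> a \<notin> B2 c" by blast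
  have solve: "a = inverse u *\<^sub>R - v" if "v + u *\<^sub>R a = 0" "u \<noteq> 0" for u :: real and v
  proof -
    have "u *\<^sub>R a = - v" using that(1) by (metis add_eq_0_iff)
    then have "inverse u *\<^sub>R (u *\<^sub>R a) = inverse u *\<^sub>R - v" by (simp only:)
    then show ?thesis using that(2) by simp
  qed
  show ?thesis
  proof (rule that)
    fix U \<phi> V \<psi> p q assume c: "(U, \<phi>) \<in> T" "(V, \<psi>) \<in> T" "p \<in> U" "q \<in> V" "h p \<noteq> h q"
    have cA: "(U, \<phi>) \<in> A" "(V, \<psi>) \<in> A" using c T(2) by auto
    show "f p + h p *\<^sub>R a \<noteq> f q + h q *\<^sub>R a"
    proof
      assume "f p + h p *\<^sub>R a = f q + h q *\<^sub>R a"
      then have "(f p - f q) + (h p - h q) *\<^sub>R a = 0" by (simp add: algebra_simps)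
      then have "a = inverse (h p - h q) *\<^sub>R - (f p - f q)" using c(5) by (intro solve) auto
      then have "a \<in> B1 (U, \<phi>) (V, \<psi>)"
        unfolding B1_def S1_def using c
        by (intro image_eqI[of _ _ "(\<phi> p, \<psi> q)"]) (auto simp: hc_def fc_def R_def chart_inv[OF cA(1)] chart_inv[OF cA(2)])
      then show False using a(1) c by blast
    qed
  next
    fix U \<phi> p w assume c: "(U, \<phi>) \<in> T" "p \<in> U" "frechet_derivative (\<lambda>y. h (inv_into U \<phi> y)) (at (\<phi> p)) w \<noteq> 0"
    show "frechet_derivative (\<lambda>y. f (inv_into U \<phi> y)) (at (\<phi> p)) w + frechet_derivative (\<lambda>y. h (inv_into U \<phi> y)) (at (\<phi> p)) w *\<^sub>R a \<noteq> 0"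
    proof
      assume "frechet_derivative (\<lambda>y. f (inv_into U \<phi> y)) (at (\<phi> p)) w + frechet_derivative (\<lambda>y. h (inv_into U \<phi> y)) (at (\<phi> p)) w *\<^sub>R a = 0"
      from solve[OF this c(3)] have "a \<in> B2 (U, \<phi>)"
        unfolding B2_def S2_def using c
        by (intro image_eqI[of _ _ "(\<phi> p, w)"]) (auto simp: hc_def[abs_def] fc_def[abs_def] R_def)
      then show False using a(2) c by blast
    qed
  qed
qed

text \<open>The functions in \<open>H\<close> are incorporated one at a time into a map with a fixed
  target, starting from 0, instead of mapping first into a space of large dimension and projecting.
  Earlier achievements persist: where h does not distinguish, the added term drops out, and where it
  does, the perturbation itself separates.\<close>

lemma whitney_embedding:
  assumes dim: "2 * DIM('b) < CARD('n::finite)"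
  obtains f :: "'a \<Rightarrow> real^'n" and T where "finite T" "T \<subseteq> A" "smooth_vec f" "inj f"
    "\<And>p. \<exists>(U, \<phi>)\<in>T. p \<in> U \<and> inj (frechet_derivative (\<lambda>y. f (inv_into U \<phi> y)) (at (\<phi> p)))"
proof -
  obtain T H where T: "finite T" "T \<subseteq> A" "(\<Union>(U, \<phi>)\<in>T. U) = UNIV" and H: "set H \<subseteq> smooth_functions A"
    and sep: "\<And>p q. p \<noteq> q \<Longrightarrow> \<exists>h\<in>set H. h p \<noteq> h q"
    and sep': "\<And>p. \<exists>(U, \<phi>)\<in>T. p \<in> U \<and> (\<forall>w. w \<noteq> 0 \<longrightarrow> (\<exists>h\<in>set H. frechet_derivative (\<lambda>y. h (inv_into U \<phi> y)) (at (\<phi> p)) w \<noteq> 0))"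
    by (rule finite_coordinate_cover) (rule that)
  have cover: "\<exists>c\<in>T. p \<in> fst c" for p
  proof -
    have "p \<in> (\<Union>(U, \<phi>)\<in>T. U)" unfolding T(3) by simp
    then show ?thesis by force
  qed
  define good where "good f h \<longleftrightarrow> (\<forall>p q. h p \<noteq> h q \<longrightarrow> f p \<noteq> f q) \<and> (\<forall>c\<in>T. \<forall>p\<in>fst c. \<forall>w.
      frechet_derivative (\<lambda>y. h (inv_into (fst c) (snd c) y)) (at (snd c p)) w \<noteq> 0 \<longrightarrow>
      frechet_derivative (\<lambda>y. f (inv_into (fst c) (snd c) y)) (at (snd c p)) w \<noteq> 0)"
    for f :: "'a \<Rightarrow> real^'n" and h :: "'a \<Rightarrow> real"
  have "\<exists>f. smooth_vec f \<and> (\<forall>h\<in>set H. good f h)"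
    using H
  proof (induction H)
    case Nil
    have "(\<lambda>p. 0) \<in> smooth_functions A" unfolding smooth_functions_def o_def
      using chart_open(2) smooth_on_const by blast
    then have "smooth_vec (\<lambda>p. 0 :: real^'n)" by (simp add: smooth_vec_def)
    then show ?case by auto
  next
    case (Cons h H)
    then obtain f where f: "smooth_vec f" "\<forall>h\<in>set H. good f h" by auto
    have h: "h \<in> smooth_functions A" using Cons.prems by simp
    obtain a where a: "\<And>U \<phi> V \<psi> p q. (U, \<phi>) \<in> T \<Longrightarrow> (V, \<psi>) \<in> T \<Longrightarrow> p \<in> U \<Longrightarrow> q \<in> V \<Longrightarrow> h p \<noteq> h q \<Longrightarrow> f p + h p *\<^sub>R a \<noteq> f q + h q *\<^sub>R a"
      "\<And>U \<phi> p w. (U, \<phi>) \<in> T \<Longrightarrow> p \<in> U \<Longrightarrow> frechet_derivative (\<lambda>y. h (inv_into U \<phi> y)) (at (\<phi> p)) w \<noteq> 0 \<Longrightarrow>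
        frechet_derivative (\<lambda>y. f (inv_into U \<phi> y)) (at (\<phi> p)) w + frechet_derivative (\<lambda>y. h (inv_into U \<phi> y)) (at (\<phi> p)) w *\<^sub>R a \<noteq> 0"
      by (rule whitney_step[OF T(1,2) f(1) h dim]) (rule that)
    let ?f = "\<lambda>p. f p + h p *\<^sub>R a"
    have step: "?f p \<noteq> ?f q" if "h p \<noteq> h q" for p q
    proof -
      obtain c d where "c \<in> T" "p \<in> fst c" "d \<in> T" "q \<in> fst d" using cover by blast
      then show ?thesis using a(1)[of "fst c" "snd c" "fst d" "snd d" p q] that by simp
    qed
    have d: "frechet_derivative (\<lambda>y. ?f (inv_into (fst c) (snd c) y)) (at (snd c p)) w =
      frechet_derivative (\<lambda>y. f (inv_into (fst c) (snd c) y)) (at (snd c p)) w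
      + frechet_derivative (\<lambda>y. h (inv_into (fst c) (snd c) y)) (at (snd c p)) w *\<^sub>R a" if c: "c \<in> T" "p \<in> fst c" for c p w
    proof -
      have cA: "(fst c, snd c) \<in> A" using c(1) T(2) by auto
      have y: "snd c p \<in> snd c ` fst c" using c(2) by simp
      show ?thesis
        by (rule fun_cong[OF frechet_derivative_at[OF has_derivative_add[OF smooth_on_has_derivative[OF smooth_vecD[OF f(1) cA] y]
          has_derivative_scaleR_left[OF smooth_on_has_derivative[OF smooth_functionsD[OF h cA] y]]]], symmetric])
    qed
    have "good ?f k" if k: "k \<in> set (h # H)" for k
      unfolding good_def
    proof (intro conjI allI impI ballI)
      fix p q assume kpq: "k p \<noteq> k q"
      show "?f p \<noteq> ?f q"
      proof (cases "h p = h q")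
        case True
        then have "k \<in> set H" using k kpq by auto
        then have "f p \<noteq> f q" using f(2) kpq unfolding good_def by blast
        then show ?thesis using True by simp
      qed (rule step)
    next
      fix c p w assume c: "c \<in> T" "p \<in> fst c" and kw: "frechet_derivative (\<lambda>y. k (inv_into (fst c) (snd c) y)) (at (snd c p)) w \<noteq> 0"
      show "frechet_derivative (\<lambda>y. ?f (inv_into (fst c) (snd c) y)) (at (snd c p)) w \<noteq> 0"
      proof (cases "frechet_derivative (\<lambda>y. h (inv_into (fst c) (snd c) y)) (at (snd c p)) w = 0")
        case True
        then have "k \<in> set H" using k kw by auto
        then have "frechet_derivative (\<lambda>y. f (inv_into (fst c) (snd c) y)) (at (snd c p)) w \<noteq> 0"
          using f(2) kw c unfolding good_def by blast
        then show ?thesis unfolding d[OF c] True by simp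
      next
        case False
        then show ?thesis unfolding d[OF c] using a(2)[of "fst c" "snd c" p w] c by simp
      qed
    qed
    then show ?case using smooth_vec_add_scaleR[OF f(1) h, of a] by blast
  qed
  then obtain f where f: "smooth_vec f" "\<And>h. h \<in> set H \<Longrightarrow> good f h" by blast
  show ?thesis
  proof (rule that[OF T(1,2) f(1)])
    show "inj f"
    proof (rule injI, rule ccontr)
      fix p q assume "f p = f q" "p \<noteq> q"
      then show False using sep[of p q] f(2) unfolding good_def by blast
    qed
    show "\<exists>(U, \<phi>)\<in>T. p \<in> U \<and> inj (frechet_derivative (\<lambda>y. f (inv_into U \<phi> y)) (at (\<phi> p)))" for p
    proof -
      obtain c where c: "c \<in> T" "p \<in> fst c" and w: "\<And>w. w \<noteq> 0 \<Longrightarrow>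
          \<exists>h\<in>set H. frechet_derivative (\<lambda>y. h (inv_into (fst c) (snd c) y)) (at (snd c p)) w \<noteq> 0"
        using sep'[of p] by (force simp: case_prod_unfold)
      have cA: "(fst c, snd c) \<in> A" using c(1) T(2) by auto
      have y: "snd c p \<in> snd c ` fst c" using c(2) by simp
      let ?D = "frechet_derivative (\<lambda>y. f (inv_into (fst c) (snd c) y)) (at (snd c p))"
      have lin: "linear ?D" by (rule has_derivative_linear[OF smooth_on_has_derivative[OF smooth_vecD[OF f(1) cA] y]])
      have "?D w \<noteq> 0" if w0: "w \<noteq> 0" for w
      proof -
        obtain h where "h \<in> set H" "frechet_derivative (\<lambda>y. h (inv_into (fst c) (snd c) y)) (at (snd c p)) w \<noteq> 0"
          using w[OF w0] by blast
        then show ?thesis using f(2)[of h] c unfolding good_def by blast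
      qed
      then have "inj ?D" unfolding linear_injective_0[OF lin] by blast
      then show ?thesis using c by (intro bexI[of _ c]) (auto simp: case_prod_unfold)
    qed
  qed
qed

lemma smooth_vec_continuous:
  assumes "smooth_vec (f :: 'a \<Rightarrow> real^'n::finite)" shows "continuous_on UNIV f"
proof -
  have "continuous_on U f" if U: "(U, \<phi>) \<in> A" for U \<phi>
  proof -
    have "continuous_on U (\<lambda>p. f (inv_into U \<phi> (\<phi> p)))"
      by (rule continuous_on_compose2[OF smooth_on_imp_continuous_on[OF smooth_vecD[OF assms U]] chart_continuous(1)[OF U]]) simp
    then show ?thesis by (rule continuous_on_eq) (simp add: chart_inv[OF U])
  qed
  note cont = this
  have "continuous_on (\<Union>c\<in>A. fst c) f"
  proof (rule continuous_on_open_UN)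
    fix c assume "c \<in> A"
    then have c: "(fst c, snd c) \<in> A" by simp
    show "open (fst c)" by (rule chart_open(1)[OF c])
    show "continuous_on (fst c) f" by (rule cont[OF c])
  qed
  moreover have "(\<Union>c\<in>A. fst c) = UNIV"
  proof -
    have "p \<in> (\<Union>c\<in>A. fst c)" for p
    proof -
      obtain U \<phi> where "(U, \<phi>) \<in> A" "p \<in> U" by (rule chart_exists)
      then show ?thesis by (intro UN_I[of "(U, \<phi>)"]) simp_all
    qed
    then show ?thesis by blast
  qed
  ultimately show ?thesis by simp
qed

lemma nearest_point_critical:
  fixes P :: "'b \<Rightarrow> real^'n::finite"
  assumes P: "smooth_on P S" "open S" "x \<in> S" and min: "\<And>x'. x' \<in> S \<Longrightarrow> dist y (P x) \<le> dist y (P x')"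
  shows "(y - P x) \<bullet> frechet_derivative P (at x) b = 0"
proof -
  let ?g = "\<lambda>x. (y - P x) \<bullet> (y - P x)"
  have dP: "((\<lambda>x. y - P x) has_derivative (\<lambda>b. - frechet_derivative P (at x) b)) (at x)"
    using has_derivative_diff[OF has_derivative_const smooth_on_has_derivative[OF P(1,3)]] by simp
  have "?g x \<le> ?g x'" if "x' \<in> S" for x'
    using power_mono[OF min[OF that], of 2] by (simp add: dist_norm dot_square_norm)
  then have "eventually (\<lambda>x'. ?g x \<le> ?g x') (at x)"
    using P(2,3) by (auto simp: eventually_at_topological)
  from has_derivative_local_min[OF has_derivative_inner[OF dP dP] this]
  have "(y - P x) \<bullet> - frechet_derivative P (at x) b + - frechet_derivative P (at x) b \<bullet> (y - P x) = 0" by meson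
  then show ?thesis by (simp add: inner_commute)
qed

end

section \<open>The nearest point retraction\<close>

context compact_manifold
begin

text \<open>In a chart, a nearest point x to y satisfies (y - P x) \<bullet> P' x b = 0 for all b.
  These expressions together with y form the map \<open>K\<close>, which is locally invertible at (f
  p0, x0); so the nearest point is a smooth function of y, read off from the inverse at (y,
  0).\<close>

lemma nearest_point_chart:
  fixes f :: "'a \<Rightarrow> real^'n::finite" and p0 :: 'a
  assumes f: "smooth_vec f" "inj f" and U: "(U, \<phi>) \<in> A" "p0 \<in> U"
    and imm: "inj (frechet_derivative (\<lambda>y. f (inv_into U \<phi> y)) (at (\<phi> p0)))"
    and r: "\<And>y q. dist y (f (r y)) \<le> dist y (f q)"
  obtains \<delta> X where "0 < \<delta>" "smooth_on X (ball (f p0) \<delta>)"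
    "\<And>y. y \<in> ball (f p0) \<delta> \<Longrightarrow> X y \<in> \<phi> ` U" "\<And>y. y \<in> ball (f p0) \<delta> \<Longrightarrow> r y = inv_into U \<phi> (X y)"
proof -
  define S where "S = \<phi> ` U"
  define P where "P x = f (inv_into U \<phi> x)" for x
  define dP where "dP b x = frechet_derivative P (at x) b" for b x
  define x0 where "x0 = \<phi> p0"
  have oS: "open S" unfolding S_def by (rule chart_open(2)[OF U(1)])
  have x0S: "x0 \<in> S" using U(2) by (simp add: x0_def S_def)
  have sP: "smooth_on P S" unfolding P_def S_def by (rule smooth_vecD[OF f(1) U(1)])
  have sdP: "smooth_on (dP b) S" for b unfolding dP_def by (rule smooth_on_frechet_derivative[OF sP])
  have P\<phi>: "P (\<phi> q) = f q" if "q \<in> U" for q by (simp add: P_def chart_inv[OF U(1) that])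
  define K where "K z = (fst z, \<Sum>b\<in>Basis. ((fst z - P (snd z)) \<bullet> dP b (snd z)) *\<^sub>R b)" for z :: "(real^'n) \<times> 'b"
  define z0 where "z0 = (f p0, x0)"
  have oUS: "open ((UNIV :: (real^'n) set) \<times> S)" by (intro open_Times open_UNIV oS)
  have s_snd: "smooth_on (\<lambda>z. k (snd z)) ((UNIV :: (real^'n) set) \<times> S)" if "smooth_on k S" for k :: "'b \<Rightarrow> real^'n"
    by (rule smooth_on_compose[OF oUS smooth_on_snd[OF oUS smooth_on_ident[OF oUS]] that]) auto
  have s_fst: "smooth_on (\<lambda>z. fst z) ((UNIV :: (real^'n) set) \<times> S)" by (rule smooth_on_fst[OF oUS smooth_on_ident[OF oUS]])
  have sK: "smooth_on K (UNIV \<times> S)"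
    unfolding K_def
    by (intro smooth_on_Pair smooth_on_sum smooth_on_scaleR smooth_on_inner smooth_on_diff smooth_on_const s_fst s_snd sP sdP oUS)
  have z0: "z0 \<in> UNIV \<times> S" using x0S by (simp add: z0_def)
  let ?DP = "frechet_derivative P (at x0)"
  have linDP: "linear ?DP" by (rule has_derivative_linear[OF smooth_on_has_derivative[OF sP x0S]])
  have injDP: "inj ?DP" using imm unfolding P_def x0_def by simp
  \<comment> \<open>The derivative of \<open>K\<close> at \<open>z0\<close>. The term with second
    derivatives of \<open>P\<close> is paired with f p0 - P x0 = 0 and drops out; what remains in
    the x direction is minus the Gram form of the derivative of \<open>P\<close>, which is
    invertible because that derivative is injective.\<close>
  define D where "D v = (fst v, \<Sum>b\<in>Basis. ((fst v - ?DP (snd v)) \<bullet> dP b x0) *\<^sub>R b)" for v :: "(real^'n) \<times> 'b"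
  have q0: "fst z0 - P (snd z0) = 0" using P\<phi>[OF U(2)] by (simp add: z0_def x0_def)
  have "(K has_derivative D) (at z0)"
  proof -
    have dsnd: "(snd has_derivative snd) (at z0)" and dfst: "(fst has_derivative fst) (at z0)"
      by (rule has_derivative_snd[OF has_derivative_ident] has_derivative_fst[OF has_derivative_ident])+
    have x0': "snd z0 = x0" by (simp add: z0_def)
    have P': "((\<lambda>z. P (snd z)) has_derivative (\<lambda>v. ?DP (snd v))) (at z0)"
      by (rule has_derivative_compose[OF dsnd, where g=P], unfold x0', rule smooth_on_has_derivative[OF sP x0S])
    have 1: "((\<lambda>z. fst z - P (snd z)) has_derivative (\<lambda>v. fst v - ?DP (snd v))) (at z0)"
      by (rule has_derivative_diff[OF dfst P'])
    have 2: "((\<lambda>z. dP b (snd z)) has_derivative (\<lambda>v. frechet_derivative (dP b) (at x0) (snd v))) (at z0)" for b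
      by (rule has_derivative_compose[OF dsnd, where g="dP b"], unfold x0', rule smooth_on_has_derivative[OF sdP x0S])
    have 3: "((\<lambda>z. (fst z - P (snd z)) \<bullet> dP b (snd z)) has_derivative (\<lambda>v. (fst v - ?DP (snd v)) \<bullet> dP b x0)) (at z0)" for b
      using has_derivative_inner[OF 1 2[of b]] unfolding q0[unfolded x0'] x0' by simp
    show ?thesis unfolding K_def[abs_def] D_def[abs_def]
      by (intro has_derivative_Pair dfst has_derivative_sum has_derivative_scaleR_left 3)
  qed
  then have KD: "frechet_derivative K (at z0) = D" by (rule frechet_derivative_at[symmetric])
  have "linear D" using has_derivative_linear[OF smooth_on_has_derivative[OF sK z0]] unfolding KD .
  have "inj D"
    unfolding linear_injective_0[OF \<open>linear D\<close>]
  proof (intro allI impI)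
    fix v assume "D v = 0"
    then have Dv: "D v = (0, 0)" by (simp add: zero_prod_def)
    then have v1: "fst v = 0" unfolding D_def by (rule Pair_inject)
    from Dv have s0: "(\<Sum>b\<in>Basis. ((fst v - ?DP (snd v)) \<bullet> dP b x0) *\<^sub>R b) = 0" unfolding D_def by (rule Pair_inject)
    have c0: "?DP (snd v) \<bullet> dP b x0 = 0" if "b \<in> Basis" for b
    proof -
      have "(\<Sum>b\<in>Basis. ((fst v - ?DP (snd v)) \<bullet> dP b x0) *\<^sub>R b) \<bullet> b = (fst v - ?DP (snd v)) \<bullet> dP b x0"
        using that by (rule inner_sum_left_Basis)
      then have "(fst v - ?DP (snd v)) \<bullet> dP b x0 = 0" unfolding s0 by simp
      then show ?thesis unfolding v1 by simp
    qed
    have "?DP (snd v) \<bullet> ?DP (snd v) = ?DP (snd v) \<bullet> (\<Sum>b\<in>Basis. (snd v \<bullet> b) *\<^sub>R ?DP b)"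
      unfolding linear_eq_sum_Basis[OF linDP, of "snd v", symmetric] ..
    also have "\<dots> = 0" using c0 by (simp add: inner_sum_right dP_def)
    finally have "?DP (snd v) = 0" by simp
    then have "snd v = 0" using injDP linear_injective_0[OF linDP] by blast
    then show "v = 0" using v1 by (simp add: prod_eq_iff)
  qed
  then have injK: "inj (frechet_derivative K (at z0))" unfolding KD .
  obtain U' V' G where G: "open U'" "U' \<subseteq> UNIV \<times> S" "z0 \<in> U'" "open V'" "K z0 \<in> V'" "homeomorphism U' V' K G"
    "smooth_on G V'" "\<And>x. x \<in> U' \<Longrightarrow> inj (frechet_derivative K (at x))"
    by (rule smooth_inverse_function[OF oUS sK z0 injK]) (rule that)
  have Kz0: "K z0 = (f p0, 0)" using q0 by (simp add: K_def z0_def)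
  obtain A1 B1 where AB: "open A1" "open B1" "f p0 \<in> A1" "x0 \<in> B1" "A1 \<times> B1 \<subseteq> U'"
    using G(1,3) unfolding z0_def by (rule open_prod_elim) auto
  define W where "W = A1 \<inter> (\<lambda>y. (y, 0)) -` V'"
  have oW: "open W"
    unfolding W_def by (rule continuous_open_preimage[OF _ AB(1) G(4)]) (intro continuous_intros)
  have "f p0 \<in> W" using AB(3) G(5) Kz0 by (simp add: W_def)
  then obtain \<epsilon> where \<epsilon>: "\<epsilon> > 0" "ball (f p0) \<epsilon> \<subseteq> W" using oW open_contains_ball by blast
  define Q where "Q = U \<inter> \<phi> -` B1"
  have oQ: "open Q" unfolding Q_def by (rule continuous_open_preimage[OF chart_continuous(1)[OF U(1)] chart_open(1)[OF U(1)] AB(2)])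
  have p0Q: "p0 \<in> Q" using U(2) AB(4) by (simp add: Q_def x0_def)
  \<comment> \<open>The local inverse sees only critical points near \<open>x0\<close>. By
    compactness the points outside \<open>Q\<close> have distance at least m from f p0, so a nearest
    point of any y within m/2 lies in \<open>Q\<close>; the half comes from using the triangle
    inequality and the minimality of r y.\<close>
  obtain m where m: "m > 0" "\<And>q. q \<notin> Q \<Longrightarrow> m \<le> dist (f p0) (f q)"
  proof (cases "- Q = {}")
    case True then show ?thesis using that[of 1] by auto
  next
    case False
    have cQ: "compact (- Q)" using compact_diff[OF compact_UNIV' oQ] by (simp add: Compl_eq_Diff_UNIV)
    have "continuous_on (- Q) (\<lambda>q. dist (f p0) (f q))"
      by (intro continuous_on_dist continuous_on_const continuous_on_subset[OF smooth_vec_continuous[OF f(1)] subset_UNIV])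
    from continuous_attains_inf[OF cQ False this] obtain q where q: "q \<in> - Q" "\<forall>q'\<in>- Q. dist (f p0) (f q) \<le> dist (f p0) (f q')" by blast
    have "f p0 \<noteq> f q"
    proof
      assume "f p0 = f q"
      then have "p0 = q" by (rule injD[OF f(2)])
      then show False using q(1) p0Q by simp
    qed
    then show ?thesis using that[of "dist (f p0) (f q)"] q(2) by simp
  qed
  define \<delta> where "\<delta> = min \<epsilon> (m / 2)"
  have key: "r y \<in> Q \<and> snd (G (y, 0)) = \<phi> (r y) \<and> (y, 0) \<in> V'" if y: "y \<in> ball (f p0) \<delta>" for y
  proof -
    have yd: "dist (f p0) y < \<epsilon>" "dist (f p0) y < m / 2" using y by (auto simp: \<delta>_def)
    have "dist (f p0) (f (r y)) \<le> dist (f p0) y + dist y (f (r y))" by (rule dist_triangle)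
    also have "\<dots> \<le> dist (f p0) y + dist y (f p0)" using r[of y p0] by simp
    also have "\<dots> < m" using yd(2) by (simp add: dist_commute)
    finally have rQ: "r y \<in> Q" using m(2)[of "r y"] by force
    then have rU: "r y \<in> U" and xB: "\<phi> (r y) \<in> B1" by (auto simp: Q_def)
    have yW: "y \<in> A1" "(y, 0) \<in> V'" using yd(1) \<epsilon>(2) by (auto simp: W_def)
    have inU': "(y, \<phi> (r y)) \<in> U'" using AB(5) yW(1) xB by blast
    have xS: "\<phi> (r y) \<in> S" using rU by (simp add: S_def)
    have "(y - P (\<phi> (r y))) \<bullet> dP b (\<phi> (r y)) = 0" for b
      unfolding dP_def
    proof (rule nearest_point_critical[OF sP oS xS])
      show "dist y (P (\<phi> (r y))) \<le> dist y (P x')" for x' using r unfolding P\<phi>[OF rU] unfolding P_def .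
    qed
    then have "K (y, \<phi> (r y)) = (y, 0)" by (simp add: K_def)
    then have "G (y, 0) = (y, \<phi> (r y))" using G(6) inU' by (metis homeomorphism_def)
    then show ?thesis using rQ yW by simp
  qed
  have oB: "open (ball (f p0) \<delta>)" by simp
  show ?thesis
  proof (rule that[of \<delta> "\<lambda>y. snd (G (y, 0))"])
    show "\<delta> > 0" using \<epsilon>(1) m(1) by (simp add: \<delta>_def)
    have "smooth_on (\<lambda>y. G (y, 0)) (ball (f p0) \<delta>)"
      by (rule smooth_on_compose[OF oB _ G(7)]) (use key in \<open>auto intro!: smooth_on_Pair smooth_on_ident smooth_on_const\<close>)
    then show "smooth_on (\<lambda>y. snd (G (y, 0))) (ball (f p0) \<delta>)" by (rule smooth_on_snd[OF oB])
    fix y assume "y \<in> ball (f p0) \<delta>"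
    from key[OF this] have "r y \<in> U" "snd (G (y, 0)) = \<phi> (r y)" by (auto simp: Q_def)
    then show "snd (G (y, 0)) \<in> \<phi> ` U" "r y = inv_into U \<phi> (snd (G (y, 0)))" by (simp_all add: chart_inv[OF U(1)])
  qed
qed

text \<open>\<open>r\<close> is an arbitrary choice of nearest points on the whole ambient space.
  Near the image it coincides with the local smooth solutions, and \<open>D\<close> is the union of
  the balls on which this happens.\<close>

lemma tubular_retraction:
  fixes f :: "'a \<Rightarrow> real^'n::finite"
  assumes f: "smooth_vec f" "inj f"
    and imm: "\<And>p. \<exists>(U, \<phi>)\<in>A. p \<in> U \<and> inj (frechet_derivative (\<lambda>y. f (inv_into U \<phi> y)) (at (\<phi> p)))"
  obtains r D where "open D" "range f \<subseteq> D" "\<And>p. r (f p) = p"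
    "\<And>V \<psi>. (V, \<psi>) \<in> A \<Longrightarrow> open (D \<inter> r -` V) \<and> smooth_on (\<lambda>y. \<psi> (r y)) (D \<inter> r -` V)"
proof -
  have "\<exists>p. \<forall>q. dist y (f p) \<le> dist y (f q)" for y
  proof -
    have "continuous_on UNIV (\<lambda>q. dist y (f q))" by (intro continuous_on_dist continuous_on_const smooth_vec_continuous f)
    from continuous_attains_inf[OF compact_UNIV' UNIV_not_empty this] show ?thesis by blast
  qed
  then obtain r where r: "\<And>y q. dist y (f (r y)) \<le> dist y (f q)" by metis
  define L where "L p \<delta> U \<phi> X \<longleftrightarrow> (U, \<phi>) \<in> A \<and> 0 < \<delta> \<and> smooth_on X (ball (f p) \<delta>) \<and>
    (\<forall>y\<in>ball (f p) \<delta>. X y \<in> \<phi> ` U \<and> r y = inv_into U \<phi> (X y))" for p \<delta> U \<phi> X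
  have "\<exists>\<delta> U \<phi> X. L p \<delta> U \<phi> X" for p
  proof -
    obtain c where c: "c \<in> A" "p \<in> fst c" "inj (frechet_derivative (\<lambda>y. f (inv_into (fst c) (snd c) y)) (at (snd c p)))"
      using imm[of p] by (auto simp: case_prod_unfold)
    have cA: "(fst c, snd c) \<in> A" using c(1) by simp
    obtain \<delta> X where "0 < \<delta>" "smooth_on X (ball (f p) \<delta>)"
      "\<And>y. y \<in> ball (f p) \<delta> \<Longrightarrow> X y \<in> snd c ` fst c" "\<And>y. y \<in> ball (f p) \<delta> \<Longrightarrow> r y = inv_into (fst c) (snd c) (X y)"
      by (rule nearest_point_chart[OF f cA c(2,3) r]) (rule that)
    then have "L p \<delta> (fst c) (snd c) X" unfolding L_def using cA by simp
    then show ?thesis by (intro exI)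
  qed
  then obtain \<delta> U \<phi> X where LL: "\<And>p. L p (\<delta> p) (U p) (\<phi> p) (X p)" by metis
  have U: "(U p, \<phi> p) \<in> A" and \<delta>: "0 < \<delta> p" and X: "smooth_on (X p) (ball (f p) (\<delta> p))"
    "\<And>y. y \<in> ball (f p) (\<delta> p) \<Longrightarrow> X p y \<in> \<phi> p ` U p" "\<And>y. y \<in> ball (f p) (\<delta> p) \<Longrightarrow> r y = inv_into (U p) (\<phi> p) (X p y)" for p
    using LL[of p] by (simp_all add: L_def)
  define D where "D = (\<Union>p. ball (f p) (\<delta> p))"
  show ?thesis
  proof (rule that[of D r])
    show "open D" unfolding D_def by (intro open_UN ballI open_ball)
    show "range f \<subseteq> D"
    proof
      fix z assume "z \<in> range f"
      then obtain p where p: "z = f p" by (rule rangeE)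
      show "z \<in> D" unfolding D_def p by (rule UN_I[OF UNIV_I], subst centre_in_ball, rule \<delta>)
    qed
    show "r (f p) = p" for p
    proof -
      have "dist (f p) (f (r (f p))) \<le> 0" using r[of "f p" p] by simp
      then have "f p = f (r (f p))" by simp
      then show ?thesis using injD[OF f(2), of p "r (f p)"] by simp
    qed
    fix V \<psi> assume V: "(V, \<psi>) \<in> A"
    have loc: "open (ball (f p) (\<delta> p) \<inter> r -` V) \<and> smooth_on (\<lambda>y. \<psi> (r y)) (ball (f p) (\<delta> p) \<inter> r -` V)" for p
    proof -
      have eq: "ball (f p) (\<delta> p) \<inter> r -` V = ball (f p) (\<delta> p) \<inter> X p -` (\<phi> p ` (V \<inter> U p))"
      proof (intro equalityI subsetI)
        fix y assume y: "y \<in> ball (f p) (\<delta> p) \<inter> r -` V"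
        then have yb: "y \<in> ball (f p) (\<delta> p)" by simp
        have "r y \<in> V \<inter> U p" using y X(3)[OF yb] chart_inv'(1)[OF X(2)[OF yb]] by simp
        moreover have "\<phi> p (r y) = X p y" using X(3)[OF yb] chart_inv'(2)[OF X(2)[OF yb]] by simp
        ultimately have "X p y \<in> \<phi> p ` (V \<inter> U p)" by (metis imageI)
        then show "y \<in> ball (f p) (\<delta> p) \<inter> X p -` (\<phi> p ` (V \<inter> U p))" using yb by simp
      next
        fix y assume y: "y \<in> ball (f p) (\<delta> p) \<inter> X p -` (\<phi> p ` (V \<inter> U p))"
        then have yb: "y \<in> ball (f p) (\<delta> p)" by simp
        obtain q where "q \<in> V \<inter> U p" "X p y = \<phi> p q" using y by blast
        then have "r y = q" using X(3)[OF yb] chart_inv[OF U] by simp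
        then show "y \<in> ball (f p) (\<delta> p) \<inter> r -` V" using yb \<open>q \<in> V \<inter> U p\<close> by simp
      qed
      have oV: "open (\<phi> p ` (V \<inter> U p))"
        by (rule chart_image_open[OF U]) (use chart_open(1)[OF V] chart_open(1)[OF U] in auto)
      have o: "open (ball (f p) (\<delta> p) \<inter> r -` V)"
        unfolding eq by (rule continuous_open_preimage[OF smooth_on_imp_continuous_on[OF X(1)] open_ball oV])
      have "smooth_on (\<lambda>y. \<psi> (inv_into (U p) (\<phi> p) (X p y))) (ball (f p) (\<delta> p) \<inter> r -` V)"
        by (rule smooth_on_compose[OF o smooth_on_subset[OF X(1)] chart_transition[OF V U]]) (use eq in auto)
      then have "smooth_on (\<lambda>y. \<psi> (r y)) (ball (f p) (\<delta> p) \<inter> r -` V)"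
        by (rule smooth_on_cong[OF o, rotated]) (simp add: X(3)[of _ p])
      with o show ?thesis by simp
    qed
    have eq: "D \<inter> r -` V = (\<Union>p. ball (f p) (\<delta> p) \<inter> r -` V)" unfolding D_def by blast
    show "open (D \<inter> r -` V) \<and> smooth_on (\<lambda>y. \<psi> (r y)) (D \<inter> r -` V)"
      unfolding eq using loc by (intro conjI open_UN smooth_on_UN) auto
  qed
qed

end

section \<open>Embedded manifolds and their tangent vectors\<close>

text \<open>Differentiating under the integral gives an integral of the same kind, so the induction
  runs over all integrands at once.\<close>

lemma smooth_on_integral_param:
  fixes g :: "'e::euclidean_space \<times> real \<Rightarrow> real"
  assumes "smooth_on g UNIV"
  shows "smooth_on (\<lambda>y. integral {0..1} (\<lambda>\<theta>. g (y, \<theta>))) UNIV"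
proof (rule smooth_onI)
  show "times_differentiable_on k (\<lambda>y. integral {0..1} (\<lambda>\<theta>. g (y, \<theta>))) UNIV" for k
    using assms
  proof (induction k arbitrary: g)
    case 0
    have "continuous_on UNIV (\<lambda>p. g (fst p, snd p))" using smooth_on_imp_continuous_on[OF 0] by simp
    from continuous_on_integral_param[OF this] show ?case by simp
  next
    case (Suc k)
    define D where "D b z = integral {0..1} (\<lambda>\<theta>. frechet_derivative g (at (z, \<theta>)) (b, 0))" for b z
    have sD: "smooth_on (\<lambda>p. frechet_derivative g (at p) (b, 0)) UNIV" for b
      by (rule smooth_on_frechet_derivative[OF Suc.prems])
    have cD: "continuous_on UNIV (\<lambda>p. frechet_derivative g (at p) (b, 0))" for b
      by (rule smooth_on_imp_continuous_on[OF sD])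
    have Dk: "times_differentiable_on k (D b) UNIV" for b
      unfolding D_def[abs_def] by (rule Suc.IH[OF sD])
    have cg: "continuous_on UNIV g" by (rule smooth_on_imp_continuous_on[OF Suc.prems])
    have "((\<lambda>y. integral {0..1} (\<lambda>\<theta>. g (y, \<theta>))) has_derivative (\<lambda>v. \<Sum>b\<in>Basis. (v \<bullet> b) *\<^sub>R D b z)) (at z)" for z
    proof (rule has_derivative_from_partials)
      show "continuous_on UNIV (D b)" for b by (rule times_differentiable_on_imp_continuous_on[OF Dk])
      fix z b
      have "((\<lambda>h. integral (cbox 0 1) (\<lambda>\<theta>. g (z + h *\<^sub>R b, \<theta>))) has_vector_derivative
        integral (cbox 0 1) (\<lambda>\<theta>. frechet_derivative g (at (z + 0 *\<^sub>R b, \<theta>)) (b, 0))) (at 0 within UNIV)"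
      proof (rule leibniz_rule_vector_derivative[where fx="\<lambda>h \<theta>. frechet_derivative g (at (z + h *\<^sub>R b, \<theta>)) (b, 0)"])
        show "((\<lambda>h. g (z + h *\<^sub>R b, \<theta>)) has_vector_derivative frechet_derivative g (at (z + h *\<^sub>R b, \<theta>)) (b, 0)) (at h within UNIV)" for h \<theta>
        proof -
          have 1: "((\<lambda>h. (z + h *\<^sub>R b, \<theta>)) has_derivative (\<lambda>h. (h *\<^sub>R b, 0))) (at h)" by (auto intro!: derivative_eq_intros)
          have 2: "(g has_derivative frechet_derivative g (at (z + h *\<^sub>R b, \<theta>))) (at (z + h *\<^sub>R b, \<theta>))"
            by (rule smooth_on_has_derivative[OF Suc.prems UNIV_I])
          have e: "frechet_derivative g (at (z + h *\<^sub>R b, \<theta>)) (x *\<^sub>R b, 0) = x *\<^sub>R frechet_derivative g (at (z + h *\<^sub>R b, \<theta>)) (b, 0)" for x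
            using linear_cmul[OF has_derivative_linear[OF 2], of x "(b, 0)"] by simp
          note eq = ext[of "\<lambda>x. frechet_derivative g (at (z + h *\<^sub>R b, \<theta>)) (x *\<^sub>R b, 0)", OF e]
          show ?thesis unfolding has_vector_derivative_def eq[symmetric] by (rule has_derivative_compose[OF 1 2])
        qed
        show "(\<lambda>\<theta>. g (z + h *\<^sub>R b, \<theta>)) integrable_on cbox 0 1" for h
          by (rule integrable_continuous, rule continuous_on_compose2[OF cg _ subset_UNIV]) (intro continuous_intros)
        show "continuous_on (UNIV \<times> cbox 0 1) (\<lambda>(h, \<theta>). frechet_derivative g (at (z + h *\<^sub>R b, \<theta>)) (b, 0))"
          unfolding split_def by (rule continuous_on_compose2[OF cD _ subset_UNIV]) (intro continuous_intros)
      qed auto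
      then show "((\<lambda>h. integral {0..1} (\<lambda>\<theta>. g (z + h *\<^sub>R b, \<theta>))) has_vector_derivative D b z) (at 0)"
        by (simp add: D_def)
    qed
    note deriv = this
    have "times_differentiable_on k (\<lambda>z. \<Sum>b\<in>Basis. (v \<bullet> b) *\<^sub>R D b z) UNIV" for v
      by (rule times_differentiable_on_sum[OF open_UNIV])
        (rule bounded_linear.times_differentiable_on[OF bounded_linear_scaleR_right open_UNIV Dk])
    then show ?case by (rule times_differentiable_on_SucI[OF open_UNIV deriv])
  qed
qed

text \<open>A derivation is known through the product rule only. This factorisation lets it be
  evaluated on a composite function, since the factors \<open>y $ k - y0 $ k\<close> vanish at
  \<open>y0\<close>.\<close>

lemma hadamard:
  fixes h :: "real^'n::finite \<Rightarrow> real"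
  assumes h: "smooth_on h UNIV"
  obtains g where "\<And>k. smooth_on (g k) UNIV" "\<And>y. h y = h y0 + (\<Sum>k\<in>UNIV. (y $ k - y0 $ k) * g k y)"
    "\<And>k. g k y0 = frechet_derivative h (at y0) (axis k 1)"
proof -
  define g where "g k y = integral {0..1} (\<lambda>\<theta>. frechet_derivative h (at (y0 + \<theta> *\<^sub>R (y - y0))) (axis k 1))" for k y
  have int: "(\<lambda>\<theta>. frechet_derivative h (at (y0 + \<theta> *\<^sub>R (y - y0))) (axis k 1)) integrable_on {0..1}" for k y
    by (rule integrable_continuous_real,
        rule continuous_on_compose2[OF smooth_on_imp_continuous_on[OF smooth_on_frechet_derivative[OF h]] _ subset_UNIV])
      (intro continuous_intros)
  show ?thesis
  proof (rule that[of g])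
    show "smooth_on (g k) UNIV" for k
    proof -
      have "smooth_on (\<lambda>p. frechet_derivative h (at (y0 + snd p *\<^sub>R (fst p - y0))) (axis k 1)) UNIV"
        by (rule smooth_on_compose[OF open_UNIV _ smooth_on_frechet_derivative[OF h] subset_UNIV])
          (intro smooth_on_add smooth_on_scaleR smooth_on_diff smooth_on_const smooth_on_fst smooth_on_snd smooth_on_ident open_UNIV)
      from smooth_on_integral_param[OF this] show ?thesis unfolding g_def[abs_def] by simp
    qed
    show "g k y0 = frechet_derivative h (at y0) (axis k 1)" for k by (simp add: g_def)
    show "h y = h y0 + (\<Sum>k\<in>UNIV. (y $ k - y0 $ k) * g k y)" for y
    proof -
      have e: "frechet_derivative h (at z) (y - y0) = (\<Sum>k\<in>UNIV. (y $ k - y0 $ k) * frechet_derivative h (at z) (axis k 1))" for z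
      proof -
        have lin: "linear (frechet_derivative h (at z))" by (rule has_derivative_linear[OF smooth_on_has_derivative[OF h UNIV_I]])
        have "y - y0 = (\<Sum>k\<in>UNIV. (y $ k - y0 $ k) *\<^sub>R axis k 1)"
          by (simp add: vec_eq_iff axis_def if_distrib cong: if_cong)
        then have "frechet_derivative h (at z) (y - y0) = frechet_derivative h (at z) (\<Sum>k\<in>UNIV. (y $ k - y0 $ k) *\<^sub>R axis k 1)" by (rule arg_cong)
        then show ?thesis by (simp add: linear_sum[OF lin] linear_cmul[OF lin])
      qed
      have "h (y0 + (y - y0)) - h y0 = integral {0..1} (\<lambda>\<theta>. frechet_derivative h (at (y0 + \<theta> *\<^sub>R (y - y0))) (y - y0))"
        by (rule integral_frechet_derivative[OF smooth_onD[OF h, of "Suc 0"]])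
      also have "\<dots> = (\<Sum>k\<in>UNIV. (y $ k - y0 $ k) * g k y)"
        unfolding e g_def by (subst integral_sum) (use int in \<open>auto intro!: integrable_on_mult_right\<close>)
      finally show ?thesis by simp
    qed
  qed
qed

text \<open>The abstract manifold with a retraction of an open set onto its embedded copy. Functions
  pass from the manifold to the ambient space by composition with \<open>r\<close>, and back by
  composition with \<open>f\<close>; since \<open>r\<close> has values in the manifold, its
  smoothness is expressed in charts.\<close>

locale embedded_manifold = compact_manifold A
  for A :: "('a::{t2_space,second_countable_topology}, 'b::euclidean_space) atlas" +
  fixes f :: "'a \<Rightarrow> real^'n::{finite,wellorder}" and r :: "real^'n::_ \<Rightarrow> 'a" and D :: "(real^'n::_) set"
  assumes f_smooth: "smooth_vec f" and D_open: "open D" and f_D: "range f \<subseteq> D" and r_f[simp]: "r (f p) = p"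
    and r_chart: "(V, \<psi>) \<in> A \<Longrightarrow> open (D \<inter> r -` V) \<and> smooth_on (\<lambda>y. \<psi> (r y)) (D \<inter> r -` V)"
begin

lemma f_in_D[simp]: "f p \<in> D" using f_D by blast

lemma r_chart_open: "(V, \<psi>) \<in> A \<Longrightarrow> open (D \<inter> r -` V)" and r_chart_smooth: "(V, \<psi>) \<in> A \<Longrightarrow> smooth_on (\<lambda>y. \<psi> (r y)) (D \<inter> r -` V)"
  using r_chart by blast+

lemma r_preimage_open:
  assumes "open W" shows "open (D \<inter> r -` W)"
proof (subst open_subopen, rule ballI)
  fix y assume y: "y \<in> D \<inter> r -` W"
  obtain V \<psi> where V: "(V, \<psi>) \<in> A" "r y \<in> V" by (rule chart_exists)
  have o: "open (\<psi> ` (W \<inter> V))" using assms chart_open(1)[OF V(1)] by (intro chart_image_open[OF V(1)]) auto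
  have "open ((D \<inter> r -` V) \<inter> (\<lambda>y. \<psi> (r y)) -` (\<psi> ` (W \<inter> V)))"
    by (rule continuous_open_preimage[OF smooth_on_imp_continuous_on[OF r_chart_smooth[OF V(1)]] r_chart_open[OF V(1)] o])
  moreover have "(D \<inter> r -` V) \<inter> (\<lambda>y. \<psi> (r y)) -` (\<psi> ` (W \<inter> V)) \<subseteq> D \<inter> r -` W"
  proof
    fix z assume z: "z \<in> (D \<inter> r -` V) \<inter> (\<lambda>y. \<psi> (r y)) -` (\<psi> ` (W \<inter> V))"
    then obtain q where q: "q \<in> W" "q \<in> V" "\<psi> (r z) = \<psi> q" by auto
    have zV: "r z \<in> V" using z by simp
    have "r z = q" using chart_inv[OF V(1) zV, unfolded q(3)] chart_inv[OF V(1) q(2)] by (rule trans[OF sym])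
    then show "z \<in> D \<inter> r -` W" using z q by simp
  qed
  moreover have "y \<in> (D \<inter> r -` V) \<inter> (\<lambda>y. \<psi> (r y)) -` (\<psi> ` (W \<inter> V))" using y V(2) by simp
  ultimately show "\<exists>T. open T \<and> y \<in> T \<and> T \<subseteq> D \<inter> r -` W" by (intro exI conjI)
qed

lemma f_continuous: "continuous_on UNIV f" by (rule smooth_vec_continuous[OF f_smooth])

lemma f_inj: "f p = f q \<longleftrightarrow> p = q" by (metis r_f)

lemma compact_range_f: "compact (range f)" by (rule compact_continuous_image[OF f_continuous compact_UNIV'])

lemma smooth_function_extension:
  assumes "u \<in> smooth_functions A" shows "smooth_on (\<lambda>y. u (r y)) D"
proof (rule smooth_on_local)
  fix y assume y: "y \<in> D"
  obtain V \<psi> where V: "(V, \<psi>) \<in> A" "r y \<in> V" by (rule chart_exists)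
  have "smooth_on (\<lambda>y. u (inv_into V \<psi> (\<psi> (r y)))) (D \<inter> r -` V)"
    by (rule smooth_on_compose[OF r_chart_open[OF V(1)] r_chart_smooth[OF V(1)] smooth_functionsD[OF assms V(1)]]) auto
  then show "\<exists>U g. open U \<and> y \<in> U \<and> smooth_on g U \<and> (\<forall>z\<in>U. u (r z) = g z)"
    using r_chart_open[OF V(1)] V y chart_inv[OF V(1)]
    by (intro exI[of _ "D \<inter> r -` V"] exI[of _ "\<lambda>y. u (inv_into V \<psi> (\<psi> (r y)))"]) auto
qed

lemma f_comp_smooth: "(\<lambda>p. f p $ k) \<in> smooth_functions A" using f_smooth by (simp add: smooth_vec_def)

lemma fr_smooth: "smooth_on (\<lambda>y. f (r y)) D"
  by (rule smooth_on_vec_lambda[OF D_open]) (rule smooth_function_extension[OF f_comp_smooth])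

lemma smooth_pullback:
  assumes h: "smooth_on h S" "range f \<subseteq> S"
  shows "(\<lambda>p. h (f p)) \<in> smooth_functions A"
  unfolding smooth_functions_def o_def
proof clarify
  fix U \<phi> assume U: "(U, \<phi>) \<in> A"
  show "smooth_on (\<lambda>y. h (f (inv_into U \<phi> y))) (\<phi> ` U)"
    by (rule smooth_on_compose[OF chart_open(2)[OF U] smooth_vecD[OF f_smooth U] h(1)]) (use h(2) in auto)
qed

text \<open>Smooth maps into the manifold become smooth maps into a Euclidean space. The converse
  direction rests on c = r \<circ> f \<circ> c.\<close>

lemma smooth_map_into_iff:
  fixes c :: "'e::euclidean_space \<Rightarrow> 'a"
  shows "smooth_map_into A c \<longleftrightarrow> smooth_on (\<lambda>x. f (c x)) UNIV"
proof
  assume c: "smooth_map_into A c"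
  then have cc: "continuous_on UNIV c" and cs: "\<And>U \<phi>. (U, \<phi>) \<in> A \<Longrightarrow> smooth_on (\<lambda>x. \<phi> (c x)) (c -` U)"
    unfolding smooth_map_into_def o_def by auto
  show "smooth_on (\<lambda>x. f (c x)) UNIV"
  proof (rule smooth_on_local)
    fix x
    obtain U \<phi> where U: "(U, \<phi>) \<in> A" "c x \<in> U" by (rule chart_exists)
    have o: "open (c -` U)" using open_vimage[OF chart_open(1)[OF U(1)] cc] .
    have "smooth_on (\<lambda>x. f (inv_into U \<phi> (\<phi> (c x)))) (c -` U)"
      by (rule smooth_on_compose[OF o cs[OF U(1)] smooth_vecD[OF f_smooth U(1)]]) auto
    then show "\<exists>U g. open U \<and> x \<in> U \<and> smooth_on g U \<and> (\<forall>z\<in>U. f (c z) = g z)"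
      using o U chart_inv[OF U(1)] by (intro exI[of _ "c -` U"] exI[of _ "\<lambda>x. f (inv_into U \<phi> (\<phi> (c x)))"]) auto
  qed
next
  assume s: "smooth_on (\<lambda>x. f (c x)) UNIV"
  have cont: "continuous_on UNIV (\<lambda>x. f (c x))" by (rule smooth_on_imp_continuous_on[OF s])
  have eq: "c -` W = (\<lambda>x. f (c x)) -` (D \<inter> r -` W)" for W by auto
  have o: "open (c -` W)" if "open W" for W unfolding eq by (rule open_vimage[OF r_preimage_open[OF that] cont])
  show "smooth_map_into A c"
    unfolding smooth_map_into_def o_def
  proof (intro conjI ballI)
    show "continuous_on UNIV c" using o by (simp add: continuous_on_open_vimage)
    fix c' assume "c' \<in> A"
    then have U: "(fst c', snd c') \<in> A" by simp
    have "smooth_on (\<lambda>x. snd c' (r (f (c x)))) (c -` fst c')"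
      by (rule smooth_on_compose[OF o[OF chart_open(1)[OF U]] smooth_on_subset[OF s subset_UNIV] r_chart_smooth[OF U]]) auto
    then show "case c' of (U, \<phi>) \<Rightarrow> smooth_on (\<lambda>x. \<phi> (c x)) (c -` U)" by (simp add: case_prod_unfold)
  qed
qed

section \<open>Derivations as vectors of the ambient space\<close>

definition emb :: "'a tvec \<Rightarrow> real^'n::_" where "emb v = (\<chi> k. v (\<lambda>p. f p $ k))"

lemma smooth_functions_const: "(\<lambda>p. c) \<in> smooth_functions A"
  using smooth_pullback[OF smooth_on_const[OF open_UNIV, of c]] by simp

lemma tangent_lin:
  assumes "v \<in> tangent_space A p" "g \<in> smooth_functions A" "h \<in> smooth_functions A"
  shows "v (\<lambda>q. a * g q + b * h q) = a * v g + b * v h" "v (\<lambda>q. g q * h q) = g p * v h + h p * v g"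
  using assms unfolding tangent_space_def by blast+

lemma tangent_const:
  assumes v: "v \<in> tangent_space A p" shows "v (\<lambda>p. c) = 0"
proof -
  have "v (\<lambda>q. 1 * 1) = 1 * v (\<lambda>q. 1) + 1 * v (\<lambda>q. 1)"
    by (rule tangent_lin(2)[OF v smooth_functions_const smooth_functions_const])
  then have "v (\<lambda>q. 1) = 0" by simp
  moreover have "v (\<lambda>q. c * 1 + 0 * 1) = c * v (\<lambda>q. 1) + 0 * v (\<lambda>q. 1)"
    by (rule tangent_lin(1)[OF v smooth_functions_const smooth_functions_const])
  ultimately show ?thesis by simp
qed

lemma smooth_functions_add: "g \<in> smooth_functions A \<Longrightarrow> h \<in> smooth_functions A \<Longrightarrow> (\<lambda>q. g q + h q) \<in> smooth_functions A"
  and smooth_functions_mult: "g \<in> smooth_functions A \<Longrightarrow> h \<in> smooth_functions A \<Longrightarrow> (\<lambda>q. g q * h q) \<in> smooth_functions A"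
proof -
  assume g: "g \<in> smooth_functions A" "h \<in> smooth_functions A"
  note s = smooth_function_extension[OF g(1)] smooth_function_extension[OF g(2)]
  show "(\<lambda>q. g q + h q) \<in> smooth_functions A" using smooth_pullback[OF smooth_on_add[OF D_open s] f_D] by simp
  show "(\<lambda>q. g q * h q) \<in> smooth_functions A" using smooth_pullback[OF smooth_on_mult[OF D_open s] f_D] by simp
qed

lemma smooth_functions_sum: "finite I \<Longrightarrow> (\<And>i. i \<in> I \<Longrightarrow> g i \<in> smooth_functions A) \<Longrightarrow> (\<lambda>q. \<Sum>i\<in>I. g i q) \<in> smooth_functions A"
  by (induction I rule: finite_induct) (simp_all add: smooth_functions_const smooth_functions_add)

lemma tangent_sum:
  assumes v: "v \<in> tangent_space A p" and I: "finite I" "\<And>i. i \<in> I \<Longrightarrow> g i \<in> smooth_functions A"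
  shows "v (\<lambda>q. \<Sum>i\<in>I. g i q) = (\<Sum>i\<in>I. v (g i))"
  using I
proof (induction I rule: finite_induct)
  case empty
  then show ?case using tangent_const[OF v] by simp
next
  case (insert i I)
  have "v (\<lambda>q. 1 * g i q + 1 * (\<Sum>i\<in>I. g i q)) = 1 * v (g i) + 1 * v (\<lambda>q. \<Sum>i\<in>I. g i q)"
    by (rule tangent_lin(1)[OF v]) (use insert.prems insert.hyps in \<open>auto intro!: smooth_functions_sum\<close>)
  then show ?case using insert by simp
qed

text \<open>After the factorisation of \<open>hadamard\<close> the product rule leaves only the
  derivatives of the components of \<open>f\<close>, weighted by the partial derivatives of
  \<open>h\<close>. So a derivation acts on such functions through the vector
  \<open>emb v\<close>.\<close>

lemma tangent_chain:
  assumes v: "v \<in> tangent_space A p" and h: "smooth_on h UNIV"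
  shows "v (\<lambda>q. h (f q)) = frechet_derivative h (at (f p)) (emb v)"
proof -
  obtain g where g: "\<And>k. smooth_on (g k) UNIV" "\<And>y. h y = h (f p) + (\<Sum>k\<in>UNIV. (y $ k - f p $ k) * g k y)"
    "\<And>k. g k (f p) = frechet_derivative h (at (f p)) (axis k 1)"
    by (rule hadamard[OF h]) (rule that)
  have gf: "(\<lambda>q. g k (f q)) \<in> smooth_functions A" for k by (rule smooth_pullback[OF g(1)]) simp
  have fk: "(\<lambda>q. f q $ k - f p $ k) \<in> smooth_functions A" for k
    using smooth_functions_add[OF f_comp_smooth smooth_functions_const, of k "- f p $ k"] by simp
  have vk: "v (\<lambda>q. f q $ k - f p $ k) = v (\<lambda>q. f q $ k)" for k
  proof -
    have "v (\<lambda>q. 1 * (f q $ k) + (- (f p $ k)) * 1) = 1 * v (\<lambda>q. f q $ k) + (- (f p $ k)) * v (\<lambda>q. 1)"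
      by (rule tangent_lin(1)[OF v f_comp_smooth smooth_functions_const])
    then show ?thesis by (simp add: tangent_const[OF v])
  qed
  have "(\<lambda>q. h (f q)) = (\<lambda>q. 1 * h (f p) + 1 * (\<Sum>k\<in>UNIV. (f q $ k - f p $ k) * g k (f q)))"
    unfolding mult_1_left by (rule ext) (rule g(2))
  then have "v (\<lambda>q. h (f q)) = v (\<lambda>q. 1 * h (f p) + 1 * (\<Sum>k\<in>UNIV. (f q $ k - f p $ k) * g k (f q)))" by (rule arg_cong)
  also have "\<dots> = 1 * v (\<lambda>q. h (f p)) + 1 * v (\<lambda>q. \<Sum>k\<in>UNIV. (f q $ k - f p $ k) * g k (f q))"
    by (rule tangent_lin(1)[OF v smooth_functions_const smooth_functions_sum]) (auto intro: smooth_functions_mult fk gf)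
  also have "\<dots> = (\<Sum>k\<in>UNIV. v (\<lambda>q. (f q $ k - f p $ k) * g k (f q)))"
    using tangent_sum[OF v finite, of UNIV "\<lambda>k q. (f q $ k - f p $ k) * g k (f q)"] smooth_functions_mult[OF fk gf]
    by (simp add: tangent_const[OF v])
  also have "\<dots> = (\<Sum>k\<in>UNIV. v (\<lambda>q. f q $ k) * frechet_derivative h (at (f p)) (axis k 1))"
  proof (rule sum.cong[OF refl])
    fix k
    show "v (\<lambda>q. (f q $ k - f p $ k) * g k (f q)) = v (\<lambda>q. f q $ k) * frechet_derivative h (at (f p)) (axis k 1)"
      unfolding tangent_lin(2)[OF v fk gf] vk g(3) by simp
  qed
  also have "\<dots> = frechet_derivative h (at (f p)) (emb v)"
  proof -
    have lin: "linear (frechet_derivative h (at (f p)))" by (rule has_derivative_linear[OF smooth_on_has_derivative[OF h UNIV_I]])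
    have "emb v = (\<Sum>k\<in>UNIV. v (\<lambda>q. f q $ k) *\<^sub>R axis k 1)"
      by (simp add: emb_def vec_eq_iff axis_def if_distrib cong: if_cong)
    then have "frechet_derivative h (at (f p)) (emb v) = frechet_derivative h (at (f p)) (\<Sum>k\<in>UNIV. v (\<lambda>q. f q $ k) *\<^sub>R axis k 1)" by (rule arg_cong)
    then show ?thesis by (simp add: linear_sum[OF lin] linear_cmul[OF lin])
  qed
  finally show ?thesis .
qed

lemma range_f_bump:
  obtains k :: "real^'n::_ \<Rightarrow> real" and V K where "smooth_on k UNIV" "open V" "range f \<subseteq> V" "\<And>y. y \<in> V \<Longrightarrow> k y = 1"
    "compact K" "K \<subseteq> D" "\<And>y. y \<notin> K \<Longrightarrow> k y = 0"
  by (rule smooth_bump[OF compact_range_f D_open f_D]) (rule that)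

text \<open>The extension u \<circ> r is smooth on \<open>D\<close>, whereas
  \<open>tangent_chain\<close> is about functions on the whole space. A cutoff equal to 1 near the
  image bridges the gap without altering the derivative at f p.\<close>

lemma tangent_extension:
  assumes v: "v \<in> tangent_space A p" and u: "u \<in> smooth_functions A"
  shows "v u = frechet_derivative (\<lambda>y. u (r y)) (at (f p)) (emb v)"
proof -
  obtain k V K where k: "smooth_on k UNIV" "open V" "range f \<subseteq> V" "\<And>y. y \<in> V \<Longrightarrow> k y = (1::real)"
    "compact K" "K \<subseteq> D" "\<And>y. y \<notin> K \<Longrightarrow> k y = 0" by (rule range_f_bump) (rule that)
  define h where "h y = (if y \<in> D then k y * u (r y) else 0)" for y
  have h: "smooth_on h UNIV" unfolding h_def
    by (rule smooth_on_extend_by_zero[OF D_open smooth_on_mult[OF D_open smooth_on_subset[OF k(1) subset_UNIV] smooth_function_extension[OF u]]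
      compact_imp_closed[OF k(5)] k(6)]) (simp add: k(7))
  have "h (f q) = u q" for q using k(3,4) by (auto simp: h_def)
  then have "v u = v (\<lambda>q. h (f q))" by simp
  also have "\<dots> = frechet_derivative h (at (f p)) (emb v)" by (rule tangent_chain[OF v h])
  also have "frechet_derivative h (at (f p)) = frechet_derivative (\<lambda>y. u (r y)) (at (f p))"
    by (rule frechet_derivative_transform[of "V \<inter> D"]) (use k D_open in \<open>auto simp: h_def\<close>)
  finally show ?thesis .
qed

text \<open>The image of an ambient vector under the differential of \<open>r\<close>, as a
  derivation at \<open>p\<close>; it is a left inverse of \<open>emb\<close> on tangent
  vectors.\<close>

definition tvec_of :: "'a \<Rightarrow> real^'n::_ \<Rightarrow> 'a tvec" where
  "tvec_of p w = (\<lambda>u. if u \<in> smooth_functions A then frechet_derivative (\<lambda>y. u (r y)) (at (f p)) w else 0)"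

lemma tvec_of_tangent: "tvec_of p w \<in> tangent_space A p"
proof -
  have d: "((\<lambda>y. u (r y)) has_derivative frechet_derivative (\<lambda>y. u (r y)) (at (f p))) (at (f p))" if "u \<in> smooth_functions A" for u
    by (rule smooth_on_has_derivative[OF smooth_function_extension[OF that]]) simp
  have lin: "tvec_of p w (\<lambda>q. a * g q + b * h q) = a * tvec_of p w g + b * tvec_of p w h"
    if "g \<in> smooth_functions A" "h \<in> smooth_functions A" for g h a b
  proof -
    have s: "(\<lambda>q. a * g q + b * h q) \<in> smooth_functions A"
      by (intro smooth_functions_add smooth_functions_mult smooth_functions_const that)
    show ?thesis unfolding tvec_of_def using that s
      by (simp add: fun_cong[OF frechet_derivative_at[OF has_derivative_add[OF has_derivative_mult_right[OF d] has_derivative_mult_right[OF d]]], symmetric])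
  qed
  have mult: "tvec_of p w (\<lambda>q. g q * h q) = g p * tvec_of p w h + h p * tvec_of p w g"
    if "g \<in> smooth_functions A" "h \<in> smooth_functions A" for g h
    unfolding tvec_of_def using that smooth_functions_mult[OF that]
    by (simp add: fun_cong[OF frechet_derivative_at[OF has_derivative_mult[OF d d]], symmetric] mult.commute)
  show ?thesis unfolding tangent_space_def using lin mult by (simp add: tvec_of_def)
qed

lemma emb_tvec_of: "emb (tvec_of p w) = frechet_derivative (\<lambda>y. f (r y)) (at (f p)) w"
proof -
  have "frechet_derivative (\<lambda>y. f (r y) $ k) (at (f p)) w = frechet_derivative (\<lambda>y. f (r y)) (at (f p)) w $ k" for k
    by (rule fun_cong[OF frechet_derivative_at[OF bounded_linear.has_derivative[OF bounded_linear_vec_nth smooth_on_has_derivative[OF fr_smooth]]], symmetric]) simp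
  then show ?thesis by (simp add: emb_def tvec_of_def f_comp_smooth vec_eq_iff)
qed

text \<open>Together with \<open>emb_tvec_of\<close> this says that the derivative of f \<circ> r at
  f p is a projection onto the embedded tangent space, so that its fixed vectors are exactly the
  embedded tangent vectors.\<close>

lemma emb_tangent:
  assumes v: "v \<in> tangent_space A p"
  shows "frechet_derivative (\<lambda>y. f (r y)) (at (f p)) (emb v) = emb v" "tvec_of p (emb v) = v"
proof -
  have "tvec_of p (emb v) u = v u" for u
  proof (cases "u \<in> smooth_functions A")
    case True
    then show ?thesis using tangent_extension[OF v True] by (simp add: tvec_of_def)
  next
    case False
    then show ?thesis using v by (simp add: tvec_of_def tangent_space_def)
  qed
  then show "tvec_of p (emb v) = v" by blast
  then show "frechet_derivative (\<lambda>y. f (r y)) (at (f p)) (emb v) = emb v" using emb_tvec_of[of p "emb v"] by simp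
qed

lemma differential_eq:
  fixes c :: "'e::euclidean_space \<Rightarrow> 'a"
  assumes c: "smooth_map_into A c"
  shows "differential A c z e = tvec_of (c z) (frechet_derivative (\<lambda>x. f (c x)) (at z) e)"
proof -
  have s: "smooth_on (\<lambda>x. f (c x)) UNIV" using c smooth_map_into_iff by blast
  have "frechet_derivative (\<lambda>x. u (c x)) (at z) e = frechet_derivative (\<lambda>y. u (r y)) (at (f (c z))) (frechet_derivative (\<lambda>x. f (c x)) (at z) e)"
    if u: "u \<in> smooth_functions A" for u
  proof -
    have "((\<lambda>x. u (r (f (c x)))) has_derivative (\<lambda>e. frechet_derivative (\<lambda>y. u (r y)) (at (f (c z))) (frechet_derivative (\<lambda>x. f (c x)) (at z) e))) (at z)"
      by (rule has_derivative_compose[OF smooth_on_has_derivative[OF s UNIV_I] smooth_on_has_derivative[OF smooth_function_extension[OF u]]]) simp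
    then have "((\<lambda>x. u (c x)) has_derivative (\<lambda>e. frechet_derivative (\<lambda>y. u (r y)) (at (f (c z))) (frechet_derivative (\<lambda>x. f (c x)) (at z) e))) (at z)" by simp
    then show ?thesis by (rule fun_cong[OF frechet_derivative_at, symmetric])
  qed
  then show ?thesis by (auto simp: differential_def tvec_of_def o_def)
qed

lemma emb_differential:
  fixes c :: "'e::euclidean_space \<Rightarrow> 'a"
  assumes c: "smooth_map_into A c"
  shows "emb (differential A c z e) = frechet_derivative (\<lambda>x. f (c x)) (at z) e"
proof -
  have s: "smooth_on (\<lambda>x. f (c x)) UNIV" using c smooth_map_into_iff by blast
  have "((\<lambda>x. f (r (f (c x)))) has_derivative (\<lambda>e. frechet_derivative (\<lambda>y. f (r y)) (at (f (c z))) (frechet_derivative (\<lambda>x. f (c x)) (at z) e))) (at z)"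
    by (rule has_derivative_compose[OF smooth_on_has_derivative[OF s UNIV_I] smooth_on_has_derivative[OF fr_smooth]]) simp
  then have "((\<lambda>x. f (c x)) has_derivative (\<lambda>e. frechet_derivative (\<lambda>y. f (r y)) (at (f (c z))) (frechet_derivative (\<lambda>x. f (c x)) (at z) e))) (at z)" by simp
  from fun_cong[OF frechet_derivative_at[OF this], of e] show ?thesis unfolding differential_eq[OF c] emb_tvec_of by simp
qed

end

section \<open>Flows in the ambient space\<close>

text \<open>The space derivatives are bounded on [-T, T] \<times> K by compactness and vanish off
  \<open>K\<close>; a bound on all of space then becomes a Lipschitz constant by convexity.\<close>

lemma compact_support_lipschitz:
  fixes H :: "real \<times> 'x::euclidean_space \<Rightarrow> 'y::euclidean_space"
  assumes H: "smooth_on H UNIV" and K: "compact K" "\<And>t x. x \<notin> K \<Longrightarrow> H (t, x) = 0"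
  obtains L B where "0 \<le> L" "\<And>t x y. \<bar>t\<bar> \<le> T \<Longrightarrow> norm (H (t, x) - H (t, y)) \<le> L * norm (x - y)"
    "0 \<le> B" "\<And>t x. \<bar>t\<bar> \<le> T \<Longrightarrow> norm (H (t, x)) \<le> B"
proof -
  have cK: "compact ({-T..T} \<times> K)" by (intro compact_Times compact_Icc K(1))
  have cont: "continuous_on ({-T..T} \<times> K) (\<lambda>z. norm (frechet_derivative H (at z) (0, b)))" for b
    by (intro continuous_on_norm continuous_on_subset[OF smooth_on_imp_continuous_on[OF smooth_on_frechet_derivative[OF H]] subset_UNIV])
  have "\<exists>M. \<forall>t x. \<bar>t\<bar> \<le> T \<longrightarrow> norm (frechet_derivative H (at (t, x)) (0, b)) \<le> M" for b
  proof -
    obtain M where M: "M \<ge> 0" "\<And>z. z \<in> {-T..T} \<times> K \<Longrightarrow> norm (frechet_derivative H (at z) (0, b)) \<le> M"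
      by (rule compact_bound[OF cK cont]) (rule that)
    have "norm (frechet_derivative H (at (t, x)) (0, b)) \<le> M" if "\<bar>t\<bar> \<le> T" for t x
    proof (cases "x \<in> K")
      case True
      then show ?thesis using that by (intro M(2)) auto
    next
      case False
      have o: "open (UNIV \<times> (- K) :: (real \<times> 'x) set)" by (intro open_Times open_UNIV open_Compl compact_imp_closed K(1))
      have "frechet_derivative H (at (t, x)) = frechet_derivative (\<lambda>z. 0) (at (t, x))"
        by (rule frechet_derivative_transform[OF o]) (use False K(2) in auto)
      also have "\<dots> = (\<lambda>v. 0)" by (rule frechet_derivative_at[symmetric]) (rule has_derivative_const)
      finally show ?thesis using M(1) by simp
    qed
    then show ?thesis by blast
  qed
  then obtain M where M: "\<And>b t x. \<bar>t\<bar> \<le> T \<Longrightarrow> norm (frechet_derivative H (at (t, x)) (0, b)) \<le> M b" by metis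
  define L where "L = \<bar>\<Sum>b\<in>(Basis :: 'x set). M b\<bar>"
  have lip: "norm (H (t, x) - H (t, y)) \<le> L * norm (x - y)" if t: "\<bar>t\<bar> \<le> T" for t x y
  proof (rule differentiable_bound[OF convex_UNIV _ _ UNIV_I UNIV_I])
    fix z
    have D: "(H has_derivative frechet_derivative H (at (t, z))) (at (t, z))" by (rule smooth_on_has_derivative[OF H UNIV_I])
    have "((\<lambda>x. (t, x)) has_derivative (\<lambda>v. (0, v))) (at z)" by (auto intro!: derivative_eq_intros)
    from has_derivative_compose[OF this D]
    show d: "((\<lambda>x. H (t, x)) has_derivative (\<lambda>v. frechet_derivative H (at (t, z)) (0, v))) (at z)" .
    show "onorm (\<lambda>v. frechet_derivative H (at (t, z)) (0, v)) \<le> L"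
    proof (rule onorm_le)
      fix v
      have "norm (frechet_derivative H (at (t, z)) (0, v)) \<le> (\<Sum>b\<in>Basis. norm (frechet_derivative H (at (t, z)) (0, b))) * norm v"
        by (rule linear_norm_le_Basis[OF has_derivative_linear[OF d]])
      also have "\<dots> \<le> L * norm v"
      proof (rule mult_right_mono)
        have "(\<Sum>b\<in>Basis. norm (frechet_derivative H (at (t, z)) (0, b))) \<le> (\<Sum>b\<in>(Basis :: 'x set). M b)"
          by (intro sum_mono M t)
        then show "(\<Sum>b\<in>Basis. norm (frechet_derivative H (at (t, z)) (0, b))) \<le> L" unfolding L_def by linarith
      qed simp
      finally show "norm (frechet_derivative H (at (t, z)) (0, v)) \<le> L * norm v" .
    qed
  qed
  obtain B where B: "B \<ge> 0" "\<And>z. z \<in> {-T..T} \<times> K \<Longrightarrow> norm (H z) \<le> B"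
    by (rule compact_bound[OF cK continuous_on_norm[OF continuous_on_subset[OF smooth_on_imp_continuous_on[OF H] subset_UNIV]]]) (rule that)
  have bd: "norm (H (t, x)) \<le> B" if "\<bar>t\<bar> \<le> T" for t x
  proof (cases "x \<in> K")
    case True then show ?thesis using that by (intro B(2)) auto
  next
    case False then show ?thesis using K(2) B(1) by simp
  qed
  have "0 \<le> L" by (simp add: L_def)
  then show ?thesis using lip B(1) bd by (rule that)
qed

lemma abs_sin_diff_le: "\<bar>sin s - sin s'\<bar> \<le> \<bar>s - s'\<bar>" for s s' :: real
proof -
  have "\<bar>sin s - sin s'\<bar> = 2 * (\<bar>sin ((s - s') / 2)\<bar> * \<bar>cos ((s + s') / 2)\<bar>)" by (simp add: sin_diff_sin abs_mult)
  also have "\<dots> \<le> 2 * (\<bar>(s - s') / 2\<bar> * 1)"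
    by (intro mult_left_mono mult_mono abs_sin_x_le_abs_x abs_cos_le_one) auto
  finally show ?thesis by simp
qed

locale embedded_flow = embedded_manifold A f r D
  for A :: "('a::{t2_space,second_countable_topology}, 'b::euclidean_space) atlas"
    and f :: "'a \<Rightarrow> real^'n::{finite,wellorder}" and r D +
  fixes Z :: "real \<Rightarrow> 'a vfield" and cutoff :: "real^'n::_ \<Rightarrow> real" and V K :: "(real^'n::_) set"
  assumes Z: "periodic_vector_field A Z" and cutoff: "smooth_on cutoff UNIV" "open V" "range f \<subseteq> V" "\<And>y. y \<in> V \<Longrightarrow> cutoff y = 1"
    "compact K" "K \<subseteq> D" "\<And>y. y \<notin> K \<Longrightarrow> cutoff y = 0"
begin

lemma Z_tangent: "Z t p \<in> tangent_space A p" and Z_periodic: "Z (t + 1) = Z t"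
  and Z_smooth: "u \<in> smooth_functions A \<Longrightarrow> (U, \<phi>) \<in> A \<Longrightarrow> smooth_on (\<lambda>(t, y). Z t (inv_into U \<phi> y) u) (UNIV \<times> \<phi> ` U)"
  using Z unfolding periodic_vector_field_def by blast+

text \<open>\<open>Z\<close> is evaluated at r y and then cut off. On the embedded copy it is
  \<open>Z\<close> itself, and its compact support in space makes it Lipschitz for bounded
  times.\<close>

definition field :: "real \<times> (real^'n::_) \<Rightarrow> real^'n::_" where
  "field z = (if z \<in> UNIV \<times> D then cutoff (snd z) *\<^sub>R emb (Z (fst z) (r (snd z))) else 0)"

lemma UNIV_D_open: "open ((UNIV :: real set) \<times> D)" by (intro open_Times open_UNIV D_open)

lemma field_smooth: "smooth_on field UNIV"
proof -
  have "smooth_on (\<lambda>z. emb (Z (fst z) (r (snd z)))) (UNIV \<times> D)"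
  proof (rule smooth_on_vec_lambda[OF UNIV_D_open], rule smooth_on_local)
    fix k and z :: "real \<times> (real^'n::_)" assume z: "z \<in> UNIV \<times> D"
    obtain U \<phi> where U: "(U, \<phi>) \<in> A" "r (snd z) \<in> U" by (rule chart_exists)
    define W where "W = (UNIV :: real set) \<times> (D \<inter> r -` U)"
    have W: "open W" unfolding W_def by (intro open_Times open_UNIV r_chart_open[OF U(1)])
    have "smooth_on (\<lambda>z. \<phi> (r (snd z))) W"
      by (rule smooth_on_compose[OF W smooth_on_snd[OF W smooth_on_ident[OF W]] r_chart_smooth[OF U(1)]]) (auto simp: W_def)
    then have p: "smooth_on (\<lambda>z. (fst z, \<phi> (r (snd z)))) W"
      by (rule smooth_on_Pair[OF W smooth_on_fst[OF W smooth_on_ident[OF W]]])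
    have "smooth_on (\<lambda>z. (\<lambda>(t, y). Z t (inv_into U \<phi> y) (\<lambda>p. f p $ k)) (fst z, \<phi> (r (snd z)))) W"
      by (rule smooth_on_compose[OF W p Z_smooth[OF f_comp_smooth U(1)]]) (auto simp: W_def)
    moreover have "\<forall>z\<in>W. emb (Z (fst z) (r (snd z))) $ k = (\<lambda>(t, y). Z t (inv_into U \<phi> y) (\<lambda>p. f p $ k)) (fst z, \<phi> (r (snd z)))"
      using chart_inv[OF U(1)] by (auto simp: W_def emb_def)
    moreover have "z \<in> W" using z U(2) by (auto simp: W_def)
    ultimately show "\<exists>U g. open U \<and> z \<in> U \<and> smooth_on g U \<and> (\<forall>z\<in>U. emb (Z (fst z) (r (snd z))) $ k = g z)"
      using W by (intro exI conjI)
  qed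
  then have s: "smooth_on (\<lambda>z. cutoff (snd z) *\<^sub>R emb (Z (fst z) (r (snd z)))) (UNIV \<times> D)"
    by (rule smooth_on_scaleR[OF UNIV_D_open smooth_on_compose[OF UNIV_D_open smooth_on_snd[OF UNIV_D_open smooth_on_ident[OF UNIV_D_open]] cutoff(1) subset_UNIV]])
  have c: "closed ((UNIV :: real set) \<times> K)" by (intro closed_Times closed_UNIV compact_imp_closed cutoff(5))
  show ?thesis
    unfolding field_def[abs_def]
  proof (rule smooth_on_extend_by_zero[OF UNIV_D_open s c Sigma_mono[OF subset_refl cutoff(6)]])
    fix z :: "real \<times> (real^'n::_)" assume "z \<notin> UNIV \<times> K"
    then have "snd z \<notin> K" by (simp add: mem_Times_iff)
    then show "cutoff (snd z) *\<^sub>R emb (Z (fst z) (r (snd z))) = 0" by (simp add: cutoff(7))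
  qed
qed

lemma f_in_V[simp]: "f p \<in> V" using cutoff(3) by blast

lemma field_f: "field (t, f p) = emb (Z t p)"
  by (simp add: field_def cutoff(4))

lemma field_V: "y \<in> V \<Longrightarrow> y \<in> D \<Longrightarrow> field (t, y) = emb (Z t (r y))"
  by (simp add: field_def cutoff(4))

lemma field_zero: "y \<notin> K \<Longrightarrow> field (t, y) = 0"
  by (simp add: field_def cutoff(7))

lemma field_periodic: "field (t + 1, y) = field (t, y)" by (simp add: field_def Z_periodic)

text \<open>The state is (s, y) with s at rest, so that joint smoothness of the solutions in s and y
  is smoothness in the initial state.\<close>

definition system :: "real \<times> (real \<times> (real^'n::_)) \<Rightarrow> real \<times> (real^'n::_)" where
  "system z = (0, sin (fst (snd z)) *\<^sub>R field (fst z, snd (snd z)))"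

lemma system_smooth: "smooth_on system UNIV"
proof -
  have 1: "smooth_on (\<lambda>z::real \<times> (real \<times> (real^'n::_)). sin (fst (snd z))) UNIV"
    by (rule smooth_on_compose[OF open_UNIV smooth_on_fst[OF open_UNIV smooth_on_snd[OF open_UNIV smooth_on_ident[OF open_UNIV]]] smooth_on_sin_cos(1) subset_UNIV])
  have 2: "smooth_on (\<lambda>z::real \<times> (real \<times> (real^'n::_)). field (fst z, snd (snd z))) UNIV"
    by (rule smooth_on_compose[OF open_UNIV smooth_on_Pair[OF open_UNIV smooth_on_fst[OF open_UNIV smooth_on_ident[OF open_UNIV]]
      smooth_on_snd[OF open_UNIV smooth_on_snd[OF open_UNIV smooth_on_ident[OF open_UNIV]]]] field_smooth subset_UNIV])
  show ?thesis unfolding system_def[abs_def]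
    by (rule smooth_on_Pair[OF open_UNIV smooth_on_const[OF open_UNIV] smooth_on_scaleR[OF open_UNIV 1 2]])
qed

lemma system_lipschitz: "\<exists>L. \<forall>t x y. \<bar>t\<bar> \<le> T \<longrightarrow> norm (system (t, x) - system (t, y)) \<le> L * norm (x - y)"
proof -
  obtain L B where L: "0 \<le> L" "\<And>t x y. \<bar>t\<bar> \<le> T \<Longrightarrow> norm (field (t, x) - field (t, y)) \<le> L * norm (x - y)"
    and B: "0 \<le> B" "\<And>t x. \<bar>t\<bar> \<le> T \<Longrightarrow> norm (field (t, x)) \<le> B"
    by (rule compact_support_lipschitz[OF field_smooth cutoff(5) field_zero], assumption) (rule that)
  have "norm (system (t, x) - system (t, y)) \<le> (B + L) * norm (x - y)" if t: "\<bar>t\<bar> \<le> T" for t x y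
  proof -
    have "system (t, x) - system (t, y) = (0, (sin (fst x) - sin (fst y)) *\<^sub>R field (t, snd x) + sin (fst y) *\<^sub>R (field (t, snd x) - field (t, snd y)))"
      by (simp add: system_def algebra_simps)
    then have "norm (system (t, x) - system (t, y)) = norm ((sin (fst x) - sin (fst y)) *\<^sub>R field (t, snd x) + sin (fst y) *\<^sub>R (field (t, snd x) - field (t, snd y)))"
      by (simp add: norm_Pair)
    also have "\<dots> \<le> \<bar>sin (fst x) - sin (fst y)\<bar> * norm (field (t, snd x)) + \<bar>sin (fst y)\<bar> * norm (field (t, snd x) - field (t, snd y))"
      by (rule order_trans[OF norm_triangle_ineq]) simp
    also have "\<dots> \<le> norm (x - y) * B + 1 * (L * norm (x - y))"
    proof (intro add_mono mult_mono B t)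
      have "norm (fst (x - y)) \<le> norm (x - y)" using norm_fst_le[of "fst (x - y)" "snd (x - y)"] unfolding prod.collapse .
      then have "\<bar>fst x - fst y\<bar> \<le> norm (x - y)" by simp
      then show "\<bar>sin (fst x) - sin (fst y)\<bar> \<le> norm (x - y)" using abs_sin_diff_le[of "fst x" "fst y"] by linarith
      have "norm (snd (x - y)) \<le> norm (x - y)" using norm_snd_le[of "snd (x - y)" "fst (x - y)"] unfolding prod.collapse .
      then have "norm (snd x - snd y) \<le> norm (x - y)" by simp
      then show "norm (field (t, snd x) - field (t, snd y)) \<le> L * norm (x - y)"
        using L(2)[OF t, of "snd x" "snd y"] mult_left_mono[OF _ L(1)] by (meson order_trans)
    qed auto
    finally show ?thesis by (simp add: algebra_simps)
  qed
  then show ?thesis by blast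
qed

section \<open>Solutions of the ambient equation and invariance of the embedded manifold\<close>

definition \<Phi> :: "real \<Rightarrow> real^'n::_ \<Rightarrow> real \<Rightarrow> real^'n::_" where
  "\<Phi> s y = (SOME Y. Y 0 = y \<and> (\<forall>t. (Y has_vector_derivative sin s *\<^sub>R field (t, Y t)) (at t)))"

lemma slice_lipschitz: "\<exists>L. \<forall>t x y. \<bar>t\<bar> \<le> T \<longrightarrow> norm (sin s *\<^sub>R field (t, x) - sin s *\<^sub>R field (t, y)) \<le> L * norm (x - y)"
proof -
  obtain L where L: "\<forall>t x y. \<bar>t\<bar> \<le> T \<longrightarrow> norm (system (t, x) - system (t, y)) \<le> L * norm (x - y)" using system_lipschitz by blast
  have "norm (sin s *\<^sub>R field (t, x) - sin s *\<^sub>R field (t, y)) \<le> L * norm (x - y)" if "\<bar>t\<bar> \<le> T" for t x y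
    using L[rule_format, OF that, of "(s, x)" "(s, y)"] by (simp add: system_def norm_Pair)
  then show ?thesis by blast
qed

lemma \<Phi>_props: "\<Phi> s y 0 = y \<and> (\<forall>t. (\<Phi> s y has_vector_derivative sin s *\<^sub>R field (t, \<Phi> s y t)) (at t))"
proof -
  have c: "continuous_on UNIV (\<lambda>(t, x). sin s *\<^sub>R field (t, x))"
    unfolding split_def by (intro continuous_on_scaleR continuous_on_const, subst prod.collapse, rule smooth_on_imp_continuous_on[OF field_smooth])
  obtain Y where "Y 0 = y" "\<And>t. (Y has_vector_derivative sin s *\<^sub>R field (t, Y t)) (at t)"
    by (rule ode_exists[OF c slice_lipschitz]) (rule that)
  then have "\<exists>Y. Y 0 = y \<and> (\<forall>t. (Y has_vector_derivative sin s *\<^sub>R field (t, Y t)) (at t))" by (intro exI conjI allI)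
  then show ?thesis unfolding \<Phi>_def by (rule someI_ex)
qed

lemma \<Phi>_0[simp]: "\<Phi> s y 0 = y" and \<Phi>_deriv: "(\<Phi> s y has_vector_derivative sin s *\<^sub>R field (t, \<Phi> s y t)) (at t)"
  using \<Phi>_props by blast+

lemma \<Phi>_unique:
  assumes "\<And>t. (Y has_vector_derivative sin s *\<^sub>R field (t, Y t)) (at t)"
  shows "Y = \<Phi> s (Y 0)"
proof
  fix t
  obtain L where L: "\<forall>t' x y. \<bar>t'\<bar> \<le> \<bar>t\<bar> \<longrightarrow> norm (sin s *\<^sub>R field (t', x) - sin s *\<^sub>R field (t', y)) \<le> L * norm (x - y)" using slice_lipschitz by blast
  show "Y t = \<Phi> s (Y 0) t"
    by (rule ode_unique[where W="\<lambda>t x. sin s *\<^sub>R field (t, x)" and T="\<bar>t\<bar>" and L=L])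
      (use L assms \<Phi>_deriv in auto)
qed

lemma \<Phi>_smooth: "smooth_on (\<lambda>z. \<Phi> (fst (snd z)) (snd (snd z)) (fst z)) UNIV"
proof -
  have "smooth_on (\<lambda>z. (\<lambda>t x. (fst x, \<Phi> (fst x) (snd x) t)) (fst z) (snd z)) UNIV"
  proof (rule smooth_flow[OF system_smooth system_lipschitz])
    show "(fst x, \<Phi> (fst x) (snd x) 0) = x" for x :: "real \<times> (real^'n::_)" by simp
    show "((\<lambda>t. (fst x, \<Phi> (fst x) (snd x) t)) has_vector_derivative system (t, (fst x, \<Phi> (fst x) (snd x) t))) (at t)" for t and x :: "real \<times> (real^'n::_)"
      unfolding system_def by (simp, rule has_vector_derivative_Pair[OF has_vector_derivative_const \<Phi>_deriv])
  qed
  from smooth_on_snd[OF open_UNIV this] show ?thesis by simp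
qed

lemma \<Phi>_smooth_compose:
  assumes "open S" "smooth_on a S" "smooth_on b S" "smooth_on c S"
  shows "smooth_on (\<lambda>x. \<Phi> (b x) (c x) (a x)) S"
  using smooth_on_compose[OF assms(1) smooth_on_Pair[OF assms(1,2) smooth_on_Pair[OF assms(1,3,4)]] \<Phi>_smooth subset_UNIV] by simp

lemma \<Phi>_time_smooth: "smooth_on (\<Phi> s y) UNIV"
  using \<Phi>_smooth_compose[OF open_UNIV smooth_on_ident[OF open_UNIV] smooth_on_const[OF open_UNIV] smooth_on_const[OF open_UNIV]] by simp

lemma \<Phi>_zero: "\<Phi> 0 y t = y"
  using fun_cong[OF \<Phi>_unique[of "\<lambda>t. y" 0], of t] by simp

text \<open>The times at which the solution lies on the image form a closed set, because the image
  is compact. They form an open set by Gronwall for the defect Y - f (r Y): its derivative is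
  bounded by a multiple of the defect itself, as the field at y is the tangent vector at r y, which
  the derivative of f \<circ> r at f (r y) fixes. The line being connected, the solution never
  leaves the image.\<close>

lemma \<Phi>_range: "\<Phi> s (f p) t \<in> range f"
proof -
  define Y where "Y = \<Phi> s (f p)"
  have cY: "continuous_on UNIV Y" unfolding Y_def by (rule smooth_on_imp_continuous_on[OF \<Phi>_time_smooth])
  have cl: "closed (Y -` range f)" by (rule closed_vimage[OF compact_imp_closed[OF compact_range_f] cY])
  have "open (Y -` range f)"
  proof (subst open_subopen, rule ballI)
    fix t0 assume "t0 \<in> Y -` range f"
    then obtain p0 where p0: "Y t0 = f p0" by auto
    have o: "open (Y -` (V \<inter> D))" by (rule open_vimage[OF open_Int[OF cutoff(2) D_open] cY])
    have "t0 \<in> Y -` (V \<inter> D)" using p0 by simp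
    then obtain \<delta>0 where \<delta>0: "\<delta>0 > 0" "cball t0 \<delta>0 \<subseteq> Y -` (V \<inter> D)" using o unfolding open_contains_cball by metis
    have YV: "Y (t0 + h) \<in> V" "Y (t0 + h) \<in> D" if "\<bar>h\<bar> \<le> \<delta>0" for h
      using \<delta>0(2) that by (auto simp: dist_real_def subset_iff)
    \<comment> \<open>The derivative of f \<circ> r along b, extended by zero. It is written as a
      function of time and space, constant in time, so that \<open>compact_support_lipschitz\<close>
      yields a Lipschitz constant for it.\<close>
    define H where "H b z = (if z \<in> UNIV \<times> D then cutoff (snd z) *\<^sub>R frechet_derivative (\<lambda>y. f (r y)) (at (snd z)) b else 0)" for b and z :: "real \<times> (real^'n::_)"
    have sH: "smooth_on (H b) UNIV" for b
    proof -
      have s0: "smooth_on (\<lambda>z::real \<times> (real^'n::_). cutoff (snd z)) (UNIV \<times> D)"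
        by (rule smooth_on_compose[OF UNIV_D_open smooth_on_snd[OF UNIV_D_open smooth_on_ident[OF UNIV_D_open]] cutoff(1) subset_UNIV])
      have s1: "smooth_on (\<lambda>z::real \<times> (real^'n::_). frechet_derivative (\<lambda>y. f (r y)) (at (snd z)) b) (UNIV \<times> D)"
        by (rule smooth_on_compose[OF UNIV_D_open smooth_on_snd[OF UNIV_D_open smooth_on_ident[OF UNIV_D_open]] smooth_on_frechet_derivative[OF fr_smooth]]) auto
      have c: "closed ((UNIV :: real set) \<times> K)" by (intro closed_Times closed_UNIV compact_imp_closed cutoff(5))
      show ?thesis unfolding H_def[abs_def]
      proof (rule smooth_on_extend_by_zero[OF UNIV_D_open smooth_on_scaleR[OF UNIV_D_open s0 s1] c Sigma_mono[OF subset_refl cutoff(6)]])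
        fix z :: "real \<times> (real^'n::_)" assume "z \<notin> UNIV \<times> K"
        then have "snd z \<notin> K" by (simp add: mem_Times_iff)
        then show "cutoff (snd z) *\<^sub>R frechet_derivative (\<lambda>y. f (r y)) (at (snd z)) b = 0" by (simp add: cutoff(7))
      qed
    qed
    have H0: "H b (t, x) = 0" if "x \<notin> K" for b t x using that by (simp add: H_def cutoff(7))
    have "\<exists>L\<ge>0. \<forall>x y. norm (H b (0, x) - H b (0, y)) \<le> L * norm (x - y)" for b
    proof -
      obtain L B where "0 \<le> L" "\<And>t x y. \<bar>t\<bar> \<le> 0 \<Longrightarrow> norm (H b (t, x) - H b (t, y)) \<le> L * norm (x - y)" "0 \<le> B" "\<And>t x. \<bar>t\<bar> \<le> 0 \<Longrightarrow> norm (H b (t, x)) \<le> B"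
        by (rule compact_support_lipschitz[OF sH cutoff(5) H0], assumption) (rule that)
      then show ?thesis by (intro exI[of _ L]) auto
    qed
    then obtain L where L: "\<And>b. 0 \<le> L b" "\<And>b x y. norm (H b (0, x) - H b (0, y)) \<le> L b * norm (x - y)" by metis
    obtain B where B: "0 \<le> B" "\<And>t x. \<bar>t\<bar> \<le> \<bar>t0\<bar> + \<delta>0 \<Longrightarrow> norm (field (t, x)) \<le> B"
      by (rule compact_support_lipschitz[OF field_smooth cutoff(5) field_zero, where T="\<bar>t0\<bar> + \<delta>0"], assumption) (rule that)
    define M where "M = (\<Sum>b\<in>(Basis :: (real^'n::_) set). L b) * B"
    have M: "0 \<le> M" unfolding M_def by (intro mult_nonneg_nonneg sum_nonneg L B)
    define d where "d h = Y (t0 + h) - f (r (Y (t0 + h)))" for h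
    define d' where "d' h = sin s *\<^sub>R field (t0 + h, Y (t0 + h)) - frechet_derivative (\<lambda>y. f (r y)) (at (Y (t0 + h))) (sin s *\<^sub>R field (t0 + h, Y (t0 + h)))" for h
    have dd: "(d has_vector_derivative d' h) (at h)" if "\<bar>h\<bar> \<le> \<delta>0" for h
    proof -
      have 0: "((\<lambda>h. t0 + h) has_vector_derivative 1) (at h)" by (auto intro!: derivative_eq_intros)
      have "((Y \<circ> (\<lambda>h. t0 + h)) has_vector_derivative (1 *\<^sub>R (sin s *\<^sub>R field (t0 + h, Y (t0 + h))))) (at h)"
        unfolding Y_def by (rule vector_diff_chain_at[OF 0 \<Phi>_deriv])
      then have 1: "((\<lambda>h. Y (t0 + h)) has_vector_derivative (sin s *\<^sub>R field (t0 + h, Y (t0 + h)))) (at h)" by (simp add: o_def)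
      have 2: "((\<lambda>y. f (r y)) has_derivative frechet_derivative (\<lambda>y. f (r y)) (at (Y (t0 + h)))) (at (Y (t0 + h)))"
        by (rule smooth_on_has_derivative[OF fr_smooth YV(2)[OF that]])
      from vector_derivative_diff_chain_within[of "\<lambda>h. Y (t0 + h)", OF 1 has_derivative_at_withinI[OF 2]]
      have 3: "((\<lambda>h. f (r (Y (t0 + h)))) has_vector_derivative frechet_derivative (\<lambda>y. f (r y)) (at (Y (t0 + h))) (sin s *\<^sub>R field (t0 + h, Y (t0 + h)))) (at h)"
        by (simp add: o_def)
      show ?thesis unfolding d_def[abs_def] d'_def by (rule has_vector_derivative_diff[OF 1 3])
    qed
    have bd: "norm (d' h) \<le> M * norm (d h) + 0" if h: "\<bar>h\<bar> \<le> \<delta>0" for h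
    proof -
      define y where "y = Y (t0 + h)"
      define e where "e = field (t0 + h, y)"
      have y: "y \<in> V" "y \<in> D" using YV[OF h] by (auto simp: y_def)
      have ee: "e = emb (Z (t0 + h) (r y))" unfolding e_def by (rule field_V[OF y])
      have lin1: "linear (frechet_derivative (\<lambda>y. f (r y)) (at z))" if "z \<in> D" for z
        by (rule has_derivative_linear[OF smooth_on_has_derivative[OF fr_smooth that]])
      have fe: "frechet_derivative (\<lambda>y. f (r y)) (at (f (r y))) e = e" unfolding ee by (rule emb_tangent(1)[OF Z_tangent])
      \<comment> \<open>The change of the derivative of f \<circ> r between y and f (r y). It is
        Lipschitz in the defect, and the velocity of the defect is \<open>sin s\<close> times its
        value on the field.\<close>
      define P where "P v = frechet_derivative (\<lambda>y. f (r y)) (at (f (r y))) v - frechet_derivative (\<lambda>y. f (r y)) (at y) v" for v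
      have linP: "linear P" unfolding P_def[abs_def] by (intro linear_compose_sub lin1 y) simp
      have Pb: "norm (P b) \<le> L b * norm (d h)" for b
      proof -
        have "P b = - (H b (0, y) - H b (0, f (r y)))" using y by (simp add: H_def P_def cutoff(4))
        then show ?thesis using L(2)[of b y "f (r y)"] by (simp only: norm_minus_cancel d_def y_def)
      qed
      have "d' h = sin s *\<^sub>R P e" unfolding d'_def y_def[symmetric] e_def[symmetric] P_def fe
        by (simp add: linear_cmul[OF lin1[OF y(2)]] algebra_simps)
      then have "norm (d' h) = \<bar>sin s\<bar> * norm (P e)" by simp
      also have "\<dots> \<le> 1 * norm (P e)" by (rule mult_right_mono) auto
      also have "norm (P e) \<le> (\<Sum>b\<in>Basis. norm (P b)) * norm e" by (rule linear_norm_le_Basis[OF linP])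
      also have "\<dots> \<le> (\<Sum>b\<in>Basis. L b * norm (d h)) * B"
      proof (rule mult_mono)
        show "norm e \<le> B" unfolding e_def by (rule B(2)) (use h in linarith)
        show "(\<Sum>b\<in>Basis. norm (P b)) \<le> (\<Sum>b\<in>Basis. L b * norm (d h))" by (intro sum_mono Pb)
        show "0 \<le> (\<Sum>b\<in>(Basis :: (real^'n::_) set). L b * norm (d h))" by (intro sum_nonneg mult_nonneg_nonneg L norm_ge_zero)
      qed simp
      also have "\<dots> = M * norm (d h)" by (simp add: M_def sum_distrib_right[symmetric])
      finally show ?thesis by simp
    qed
    have d0: "d 0 = 0" by (simp add: d_def p0)
    have "Y (t0 + h) \<in> range f" if "\<bar>h\<bar> \<le> \<delta>0" for h
    proof -
      have "(norm (d h))\<^sup>2 \<le> ((norm (d 0))\<^sup>2 + 0\<^sup>2 * \<delta>0) * exp ((2 * M + 1) * \<delta>0)"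
        by (rule gronwall[of \<delta>0 d d' M 0, OF dd bd M that])
      then have "d h = 0" by (simp add: d0)
      then show ?thesis by (simp add: d_def)
    qed
    then have "ball t0 \<delta>0 \<subseteq> Y -` range f"
    proof (intro subsetI)
      fix t assume "t \<in> ball t0 \<delta>0" and *: "\<And>h. \<bar>h\<bar> \<le> \<delta>0 \<Longrightarrow> Y (t0 + h) \<in> range f"
      then show "t \<in> Y -` range f" using *[of "t - t0"] by (simp add: dist_real_def abs_minus_commute)
    qed
    then show "\<exists>T. open T \<and> t0 \<in> T \<and> T \<subseteq> Y -` range f" using \<delta>0(1) by (intro exI[of _ "ball t0 \<delta>0"]) auto
  qed
  with cl have "Y -` range f = {} \<or> Y -` range f = UNIV" unfolding clopen[symmetric] by (rule conjI)
  moreover have m: "0 \<in> Y -` range f" by (simp add: Y_def)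
  ultimately have "Y -` range f = UNIV" by (metis empty_iff)
  then have "t \<in> Y -` range f" by (simp only: UNIV_I)
  then show ?thesis unfolding Y_def by (rule vimageD)
qed

section \<open>Trajectories on the manifold\<close>

definition traj :: "real \<Rightarrow> 'a \<Rightarrow> real \<Rightarrow> 'a" where "traj s p t = r (\<Phi> s (f p) t)"

lemma f_traj: "f (traj s p t) = \<Phi> s (f p) t"
proof -
  obtain q where "\<Phi> s (f p) t = f q" using \<Phi>_range by blast
  then show ?thesis by (simp add: traj_def)
qed

lemma traj_0[simp]: "traj s p 0 = p" by (simp add: traj_def)

lemma smooth_map_into_traj: "smooth_map_into A (traj s p)"
  unfolding smooth_map_into_iff f_traj using \<Phi>_time_smooth[of s "f p"] .

lemma \<Phi>_shift:
  assumes "\<Phi> s y 1 = y" shows "\<Phi> s y (t + 1) = \<Phi> s y t"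
proof -
  have "((\<lambda>t. \<Phi> s y (t + 1)) has_vector_derivative sin s *\<^sub>R field (t, \<Phi> s y (t + 1))) (at t)" for t
  proof -
    have 0: "((\<lambda>h. h + 1) has_vector_derivative 1) (at t)" by (auto intro!: derivative_eq_intros)
    have "((\<Phi> s y \<circ> (\<lambda>h. h + 1)) has_vector_derivative (1 *\<^sub>R (sin s *\<^sub>R field (t + 1, \<Phi> s y (t + 1))))) (at t)"
      by (rule vector_diff_chain_at[OF 0 \<Phi>_deriv])
    then show ?thesis by (simp add: o_def field_periodic)
  qed
  from fun_cong[OF \<Phi>_unique[OF this], of t] show ?thesis using assms by simp
qed

lemma traj_loop: "traj s p \<in> smooth_loops A \<longleftrightarrow> \<Phi> s (f p) 1 = f p"
proof
  assume "traj s p \<in> smooth_loops A"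
  then have "traj s p (0 + 1) = traj s p 0" unfolding smooth_loops_def by blast
  then show "\<Phi> s (f p) 1 = f p" using f_traj[of s p 1] by simp
next
  assume "\<Phi> s (f p) 1 = f p"
  from \<Phi>_shift[OF this] show "traj s p \<in> smooth_loops A" by (simp add: smooth_loops_def smooth_map_into_traj traj_def)
qed

text \<open>At s = pi/2 the factor \<open>sin s\<close> is 1, so on the image the ambient equation
  is the equation of \<open>Z\<close>.\<close>

lemma integral_curve_iff: "integral_curve A Z c \<longleftrightarrow> c = traj (pi / 2) (c 0)"
proof
  assume c: "integral_curve A Z c"
  then have cs: "smooth_map_into A c" and cv: "\<And>t. velocity A c t = Z t (c t)" by (auto simp: integral_curve_def)
  have s: "smooth_on (\<lambda>t. f (c t)) UNIV" using cs smooth_map_into_iff by blast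
  have "((\<lambda>t. f (c t)) has_vector_derivative sin (pi / 2) *\<^sub>R field (t, f (c t))) (at t)" for t
  proof -
    have "((\<lambda>h. f (c (t + h *\<^sub>R 1))) has_vector_derivative frechet_derivative (\<lambda>t. f (c t)) (at t) 1) (at 0)"
      by (rule frechet_derivative_vector[OF s UNIV_I])
    then have 1: "((\<lambda>h. f (c (t + h))) has_vector_derivative emb (Z t (c t))) (at 0)"
      by (simp add: emb_differential[OF cs, symmetric] cv)
    have 0: "((\<lambda>h. h - t) has_vector_derivative 1) (at t)" by (auto intro!: derivative_eq_intros)
    have "(((\<lambda>h. f (c (t + h))) \<circ> (\<lambda>h. h - t)) has_vector_derivative (1 *\<^sub>R emb (Z t (c t)))) (at t)"
      by (rule vector_diff_chain_at[OF 0]) (use 1 in simp)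
    then show ?thesis by (simp add: o_def field_f)
  qed
  from \<Phi>_unique[OF this] have "f (c t) = \<Phi> (pi / 2) (f (c 0)) t" for t by (rule fun_cong)
  then have "r (f (c t)) = traj (pi / 2) (c 0) t" for t unfolding traj_def by (rule arg_cong)
  then show "c = traj (pi / 2) (c 0)" unfolding r_f by (rule ext)
next
  assume c: "c = traj (pi / 2) (c 0)"
  then have cs: "smooth_map_into A c" using smooth_map_into_traj by metis
  have fc: "(\<lambda>t. f (c t)) = \<Phi> (pi / 2) (f (c 0))"
    by (rule ext, rule trans[OF arg_cong[where f=f, OF fun_cong[OF c]] f_traj])
  have "velocity A c t = Z t (c t)" for t
  proof -
    have "((\<lambda>t. f (c t)) has_vector_derivative emb (Z t (c t))) (at t)"
      using \<Phi>_deriv[of "pi / 2" "f (c 0)" t] unfolding fc[symmetric] by (simp add: field_f)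
    then have "frechet_derivative (\<lambda>t. f (c t)) (at t) = (\<lambda>h. h *\<^sub>R emb (Z t (c t)))"
      unfolding has_vector_derivative_def by (rule frechet_derivative_at[symmetric])
    then show ?thesis unfolding differential_eq[OF cs] by (simp add: emb_tangent(2)[OF Z_tangent])
  qed
  then show "integral_curve A Z c" using cs by (simp add: integral_curve_def)
qed

lemma flow_eq: "flow A Z t p = traj (pi / 2) p t"
proof -
  have "(THE c. integral_curve A Z c \<and> c 0 = p) = traj (pi / 2) p"
  proof (rule the_equality)
    show "integral_curve A Z (traj (pi / 2) p) \<and> traj (pi / 2) p 0 = p" by (simp add: integral_curve_iff)
    show "c = traj (pi / 2) p" if "integral_curve A Z c \<and> c 0 = p" for c using that integral_curve_iff by metis
  qed
  then show ?thesis by (simp add: flow_def)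
qed

lemma periodic_trajectories_iff: "x \<in> periodic_trajectories A Z \<longleftrightarrow> x = traj (pi / 2) (x 0) \<and> \<Phi> (pi / 2) (f (x 0)) 1 = f (x 0)"
proof -
  have "x \<in> periodic_trajectories A Z \<longleftrightarrow> x \<in> smooth_loops A \<and> x = traj (pi / 2) (x 0)"
    by (simp add: periodic_trajectories_def integral_curve_iff)
  also have "\<dots> \<longleftrightarrow> x = traj (pi / 2) (x 0) \<and> traj (pi / 2) (x 0) \<in> smooth_loops A" by auto
  finally show ?thesis unfolding traj_loop .
qed

text \<open>A vector \<open>w\<close> fixed by the ambient differential is not tangent a priori. But
  \<open>g\<close> takes values in the image, so f \<circ> r \<circ> g = g, and differentiating
  shows that \<open>w\<close> is fixed by the derivative of f \<circ> r. It therefore comes from a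
  tangent vector fixed by the time-1 map, and this vector is 0.\<close>

lemma nondegenerate_inj:
  assumes nd: "nondegenerate_fixed_point A (flow A Z 1) p" and fixp: "\<Phi> (pi / 2) (f p) 1 = f p"
    and w: "frechet_derivative (\<lambda>y. \<Phi> (pi / 2) (f (r y)) 1) (at (f p)) w = w"
  shows "w = 0"
proof -
  define g where "g y = \<Phi> (pi / 2) (f (r y)) 1" for y
  have sg: "smooth_on g D" unfolding g_def[abs_def]
    by (rule \<Phi>_smooth_compose[OF D_open smooth_on_const[OF D_open] smooth_on_const[OF D_open] fr_smooth])
  have dg: "(g has_derivative frechet_derivative g (at (f p))) (at (f p))" by (rule smooth_on_has_derivative[OF sg]) simp
  have gp: "g (f p) = f p" by (simp add: g_def fixp)
  have frg: "f (r (g y)) = g y" for y using f_traj[of "pi / 2" "r y" 1] by (simp add: g_def traj_def)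
  have w': "frechet_derivative g (at (f p)) w = w" using w unfolding g_def[abs_def] .
  have chain: "frechet_derivative (\<lambda>y. u (g y)) (at (f p)) w = frechet_derivative u (at (f p)) w" if u: "smooth_on u D" for u :: "real^'n::_ \<Rightarrow> 'z::euclidean_space"
  proof -
    have "((\<lambda>y. u (g y)) has_derivative (\<lambda>v. frechet_derivative u (at (f p)) (frechet_derivative g (at (f p)) v))) (at (f p))"
      by (rule has_derivative_compose[OF dg, of u], unfold gp, rule smooth_on_has_derivative[OF u]) simp
    from fun_cong[OF frechet_derivative_at[OF this], of w] show ?thesis unfolding w' by simp
  qed
  define v where "v = tvec_of p w"
  have ev: "emb v = w" unfolding v_def emb_tvec_of using chain[OF fr_smooth] unfolding frg w' by simp
  have "pushforward A (flow A Z 1) v = v"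
  proof
    fix u
    show "pushforward A (flow A Z 1) v u = v u"
    proof (cases "u \<in> smooth_functions A")
      case True
      have "(\<lambda>q. u (r (g (f q)))) \<in> smooth_functions A"
      proof (rule smooth_pullback[where h="\<lambda>y. u (r (g y))" and S=D])
        show "smooth_on (\<lambda>y. u (r (g y))) D"
          by (rule smooth_on_compose[OF D_open sg smooth_function_extension[OF True]]) (use frg f_in_D in \<open>metis image_subsetI\<close>)
      qed (rule f_D)
      moreover have e: "u \<circ> flow A Z 1 = (\<lambda>q. u (r (g (f q))))" by (simp add: fun_eq_iff flow_eq traj_def g_def)
      ultimately have s: "u \<circ> flow A Z 1 \<in> smooth_functions A" by simp
      have e2: "(\<lambda>y. (u \<circ> flow A Z 1) (r y)) = (\<lambda>y. u (r (g y)))" by (simp add: fun_eq_iff flow_eq traj_def g_def)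
      show ?thesis using True s chain[OF smooth_function_extension[OF True]]
        by (simp add: pushforward_def v_def tvec_of_def e2[unfolded o_def] o_def)
    next
      case False
      then show ?thesis by (simp add: pushforward_def v_def tvec_of_def)
    qed
  qed
  moreover have "v \<in> tangent_space A p" unfolding v_def by (rule tvec_of_tangent)
  ultimately have "v = (\<lambda>u. 0)" using nd unfolding nondegenerate_fixed_point_def by blast
  then show "w = 0" using ev by (simp add: emb_def vec_eq_iff)
qed

end

section \<open>The free loop space\<close>

lemma deriv_power_periodic:
  fixes g :: "real \<Rightarrow> real"
  assumes "\<And>t. g (t + 1) = g t"
  shows "(deriv ^^ k) g (t + 1) = (deriv ^^ k) g t"
proof (induction k arbitrary: t)
  case 0
  then show ?case by (simp add: assms)
next
  case (Suc k)
  define h where "h = (deriv ^^ k) g"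
  have "deriv h (t + 1) = deriv (\<lambda>t. h (t + 1)) t" unfolding deriv_def DERIV_shift ..
  also have "(\<lambda>t. h (t + 1)) = h" using Suc.IH by (simp add: h_def)
  finally show ?case by (simp add: h_def)
qed

lemma periodic_frac:
  fixes g :: "real \<Rightarrow> 'c"
  assumes "\<And>t. g (t + 1) = g t"
  shows "g (frac t) = g t"
proof -
  have n: "g (t + real n) = g t" for t n
  proof (induction n)
    case (Suc n)
    have "g (t + real (Suc n)) = g ((t + real n) + 1)" by (simp add: algebra_simps)
    then show ?case using Suc assms by simp
  qed simp
  show ?thesis
  proof (cases "\<lfloor>t\<rfloor> \<ge> 0")
    case True
    then have "t = frac t + real (nat \<lfloor>t\<rfloor>)" by (simp add: frac_def)
    then show ?thesis using n[of "frac t" "nat \<lfloor>t\<rfloor>"] by simp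
  next
    case False
    then have "frac t = t + real (nat (- \<lfloor>t\<rfloor>))" by (simp add: frac_def)
    then show ?thesis using n[of t "nat (- \<lfloor>t\<rfloor>)"] by simp
  qed
qed

text \<open>The topology of the loop space is given by iterated \<open>deriv\<close> in t at a fixed
  parameter u; compactness arguments need these derivatives as jointly continuous functions of (u,
  t).\<close>

lemma smooth_on_iterated_slice_deriv:
  fixes q :: "real \<times> real \<Rightarrow> real"
  assumes S: "open S" and q: "smooth_on q S"
  shows "\<exists>q'. smooth_on q' S \<and> (\<forall>u t. (u, t) \<in> S \<longrightarrow> (deriv ^^ k) (\<lambda>t. q (u, t)) t = q' (u, t))"
proof (induction k)
  case 0
  then show ?case using q by (intro exI[of _ q]) simp
next
  case (Suc k)
  then obtain q' where q': "smooth_on q' S" "\<And>u t. (u, t) \<in> S \<Longrightarrow> (deriv ^^ k) (\<lambda>t. q (u, t)) t = q' (u, t)" by blast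
  define q'' where "q'' z = frechet_derivative q' (at z) (0, 1)" for z
  have "deriv ((deriv ^^ k) (\<lambda>t. q (u, t))) t = q'' (u, t)" if ut: "(u, t) \<in> S" for u t
  proof (rule DERIV_imp_deriv)
    have o: "open ((\<lambda>t. (u, t)) -` S)" by (rule open_vimage[OF S]) (intro continuous_intros)
    have 1: "((\<lambda>t. (u, t)) has_derivative (\<lambda>v. (0, v))) (at t)" by (auto intro!: derivative_eq_intros)
    have D: "(q' has_derivative frechet_derivative q' (at (u, t))) (at (u, t))" by (rule smooth_on_has_derivative[OF q'(1) ut])
    have e: "frechet_derivative q' (at (u, t)) (0, v) = q'' (u, t) * v" for v
      using linear_cmul[OF has_derivative_linear[OF D], of v "(0, 1)"] by (simp add: q''_def)
    have "((\<lambda>t. q' (u, t)) has_field_derivative q'' (u, t)) (at t)"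
      unfolding has_field_derivative_def
      using has_derivative_compose[OF 1 D] unfolding e .
    then show "((deriv ^^ k) (\<lambda>t. q (u, t)) has_field_derivative q'' (u, t)) (at t)"
      by (rule has_field_derivative_transform_within_open[OF _ o]) (use ut q'(2) in auto)
  qed
  moreover have "smooth_on q'' S" unfolding q''_def[abs_def] by (rule smooth_on_frechet_derivative[OF q'(1)])
  ultimately show ?case by (intro exI[of _ q'']) simp
qed

context embedded_manifold
begin

section \<open>Loops seen through the embedding\<close>

lemma r_continuous: "continuous_on D r"
  using r_preimage_open by (simp add: continuous_on_open_vimage[OF D_open] Int_commute)

lemma smooth_loop_f: "x \<in> smooth_loops A \<Longrightarrow> smooth_on (\<lambda>t. f (x t)) UNIV"
  and smooth_loop_periodic: "x \<in> smooth_loops A \<Longrightarrow> x (t + 1) = x t"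
  using smooth_map_into_iff unfolding smooth_loops_def by blast+

lemma smooth_loopI: "smooth_on (\<lambda>t. f (x t)) UNIV \<Longrightarrow> (\<And>t. x (t + 1) = x t) \<Longrightarrow> x \<in> smooth_loops A"
  using smooth_map_into_iff unfolding smooth_loops_def by blast

text \<open>A generating open set is a condition uniform in t. By periodicity t may be confined to
  [0, 1], so the parameters violating it are the projection of a compact set and form a closed set.
  \<open>S\<close> is an open set around the strip because smoothness is a notion on open
  sets.\<close>

lemma continuous_map_free_loop_space:
  fixes H :: "real \<Rightarrow> real \<Rightarrow> 'a"
  assumes S: "open S" "{0..1} \<times> UNIV \<subseteq> S" and H: "smooth_on (\<lambda>z. f (H (fst z) (snd z))) S"
    and per: "\<And>u t. H u (t + 1) = H u t"
  shows "continuous_map (top_of_set {0..1}) (free_loop_space A) H"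
proof -
  have loop: "H u \<in> smooth_loops A" if u: "u \<in> {0..1}" for u
  proof (rule smooth_loopI)
    have "smooth_on (\<lambda>t. (u, t)) (UNIV :: real set)"
      by (rule smooth_on_Pair[OF open_UNIV smooth_on_const[OF open_UNIV] smooth_on_ident[OF open_UNIV]])
    moreover have "range (Pair u) \<subseteq> S"
      by (rule image_subsetI, rule subsetD[OF S(2)], rule SigmaI[OF u UNIV_I])
    ultimately show "smooth_on (\<lambda>t. f (H u t)) UNIV" using smooth_on_compose[OF open_UNIV _ H, of "Pair u"] by simp
  qed (rule per)
  have "openin (top_of_set {0..1}) (H -` {y \<in> smooth_loops A. \<forall>t. \<bar>(deriv ^^ k) (h \<circ> y) t - (deriv ^^ k) (h \<circ> x) t\<bar> < e} \<inter> {0..1})"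
    if x: "x \<in> smooth_loops A" and h: "h \<in> smooth_functions A" and "0 < e" for x h k e
  proof -
    have s1: "smooth_on (\<lambda>z. h (r (f (H (fst z) (snd z))))) S"
      by (rule smooth_on_compose[OF S(1) H smooth_function_extension[OF h]]) auto
    have s2': "smooth_on (\<lambda>z::real \<times> real. f (x (snd z))) UNIV"
      by (rule smooth_on_compose[OF open_UNIV smooth_on_snd[OF open_UNIV smooth_on_ident[OF open_UNIV]] smooth_loop_f[OF x] subset_UNIV])
    have s2: "smooth_on (\<lambda>z::real \<times> real. h (r (f (x (snd z))))) UNIV"
      by (rule smooth_on_compose[OF open_UNIV s2' smooth_function_extension[OF h]]) auto
    obtain a where a: "smooth_on a S" "\<And>u t. (u, t) \<in> S \<Longrightarrow> (deriv ^^ k) (h \<circ> H u) t = a (u, t)"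
      using smooth_on_iterated_slice_deriv[OF S(1) s1, of k] by (auto simp: o_def)
    obtain b :: "real \<times> real \<Rightarrow> real" where b: "smooth_on b UNIV" "\<And>u t. (deriv ^^ k) (h \<circ> x) t = b (u, t)"
      using smooth_on_iterated_slice_deriv[OF open_UNIV s2, of k] by (auto simp: o_def)
    define C where "C = ({0..1} \<times> {0..1}) \<inter> {z. e \<le> \<bar>a z - b z\<bar>}"
    have "compact C"
    proof -
      have "continuous_on ({0..1} \<times> {0..1}) (\<lambda>z. \<bar>a z - b z\<bar>)"
        by (intro continuous_on_rabs continuous_on_diff continuous_on_subset[OF smooth_on_imp_continuous_on[OF a(1)]]
          continuous_on_subset[OF smooth_on_imp_continuous_on[OF b(1)]]) (use S(2) in auto)
      then have "closed C"
        unfolding C_def vimage_def[symmetric] using continuous_closed_preimage[of "{0..1} \<times> {0..1}" "\<lambda>z. \<bar>a z - b z\<bar>" "{e..}"]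
        by (simp add: vimage_def closed_Times)
      then show ?thesis using compact_Int_closed[of "{0..1} \<times> {0..1}" C] by (simp add: compact_Times C_def Int_assoc[symmetric])
    qed
    then have cl: "closed (fst ` C)" by (intro compact_imp_closed compact_continuous_image continuous_on_fst continuous_on_id)
    have eq: "H -` {y \<in> smooth_loops A. \<forall>t. \<bar>(deriv ^^ k) (h \<circ> y) t - (deriv ^^ k) (h \<circ> x) t\<bar> < e} \<inter> {0..1} = {0..1} \<inter> - (fst ` C)"
    proof (intro equalityI subsetI)
      fix u assume "u \<in> H -` {y \<in> smooth_loops A. \<forall>t. \<bar>(deriv ^^ k) (h \<circ> y) t - (deriv ^^ k) (h \<circ> x) t\<bar> < e} \<inter> {0..1}"
      then have u: "u \<in> {0..1}" "\<And>t. \<bar>(deriv ^^ k) (h \<circ> H u) t - (deriv ^^ k) (h \<circ> x) t\<bar> < e" by auto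
      have "(u, t) \<notin> C" for t
      proof -
        have "(u, t) \<in> S" using S(2) u(1) by blast
        then show ?thesis using u(2)[of t] a(2) b(2)[of t u] by (simp add: C_def)
      qed
      then show "u \<in> {0..1} \<inter> - (fst ` C)" using u(1) by auto
    next
      fix u assume u: "u \<in> {0..1} \<inter> - (fst ` C)"
      have "\<bar>(deriv ^^ k) (h \<circ> H u) t - (deriv ^^ k) (h \<circ> x) t\<bar> < e" for t
      proof -
        define \<tau> where "\<tau> = frac t"
        have \<tau>: "\<tau> \<in> {0..1}" unfolding \<tau>_def using frac_lt_1[of t] by (simp add: less_imp_le)
        have p1: "(deriv ^^ k) (h \<circ> H u) \<tau> = (deriv ^^ k) (h \<circ> H u) t" unfolding \<tau>_def
          by (rule periodic_frac[where g="(deriv ^^ k) (h \<circ> H u)", OF deriv_power_periodic[where g="h \<circ> H u"]]) (simp add: per)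
        have p2: "(deriv ^^ k) (h \<circ> x) \<tau> = (deriv ^^ k) (h \<circ> x) t" unfolding \<tau>_def
          by (rule periodic_frac[where g="(deriv ^^ k) (h \<circ> x)", OF deriv_power_periodic[where g="h \<circ> x"]]) (simp add: smooth_loop_periodic[OF x])
        have "(u, \<tau>) \<in> S" by (rule subsetD[OF S(2) SigmaI[OF IntD1[OF u] UNIV_I]])
        moreover have "(u, \<tau>) \<notin> C" using u by force
        ultimately show ?thesis using u \<tau> unfolding p1[symmetric] p2[symmetric] a(2)[OF \<open>(u, \<tau>) \<in> S\<close>] b(2)[of \<tau> u] C_def by auto
      qed
      then show "u \<in> H -` {y \<in> smooth_loops A. \<forall>t. \<bar>(deriv ^^ k) (h \<circ> y) t - (deriv ^^ k) (h \<circ> x) t\<bar> < e} \<inter> {0..1}"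
        using u loop[of u] by auto
    qed
    show ?thesis unfolding eq by (rule openin_open_Int) (rule open_Compl[OF cl])
  qed
  note op = this
  have cov: "H ` topspace (top_of_set {0..1}) \<subseteq> topspace (free_loop_space A)"
  proof -
    \<comment> \<open>The zero function at order 0 imposes no condition, so every smooth loop lies
      in some generating set.\<close>
    have "y \<in> topspace (free_loop_space A)" if y: "y \<in> smooth_loops A" for y
      unfolding free_loop_space_def topology_generated_by_topspace
      by (rule UnionI[of "{z \<in> smooth_loops A. \<forall>t. \<bar>(deriv ^^ 0) ((\<lambda>p. 0) \<circ> z) t - (deriv ^^ 0) ((\<lambda>p. 0) \<circ> y) t\<bar> < 1}"])
        (use y smooth_functions_const in \<open>fastforce+\<close>)
    then show ?thesis using loop by auto
  qed
  show ?thesis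
    unfolding free_loop_space_def continuous_on_generated_topo_iff topology_generated_by_topspace[symmetric]
  proof (intro conjI allI impI)
    show "H ` topspace (top_of_set {0..1}) \<subseteq> topspace (topology_generated_by {{y \<in> smooth_loops A. \<forall>t. \<bar>(deriv ^^ k) (f \<circ> y) t - (deriv ^^ k) (f \<circ> x) t\<bar> < \<epsilon>} |x f k \<epsilon>. x \<in> smooth_loops A \<and> f \<in> smooth_functions A \<and> 0 < \<epsilon>})"
      using cov unfolding free_loop_space_def .
    fix U assume "U \<in> {{y \<in> smooth_loops A. \<forall>t. \<bar>(deriv ^^ k) (f \<circ> y) t - (deriv ^^ k) (f \<circ> x) t\<bar> < \<epsilon>} |x f k \<epsilon>. x \<in> smooth_loops A \<and> f \<in> smooth_functions A \<and> 0 < \<epsilon>}"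
    then obtain x h k e where U: "U = {y \<in> smooth_loops A. \<forall>t. \<bar>(deriv ^^ k) (h \<circ> y) t - (deriv ^^ k) (h \<circ> x) t\<bar> < e}"
      and "x \<in> smooth_loops A" "h \<in> smooth_functions A" "0 < e" by blast
    then show "openin (top_of_set {0..1}) (H -` U \<inter> topspace (top_of_set {0..1}))" using op by simp
  qed
qed

lemma free_loop_space_carrier: "topspace (free_loop_space A) \<subseteq> smooth_loops A"
  unfolding free_loop_space_def topology_generated_by_topspace by blast

text \<open>Uniformly close loops are joined by straight segments in the ambient space; these stay
  in \<open>D\<close> when \<epsilon> is the width of a uniform neighbourhood of the image inside
  \<open>D\<close>, and \<open>r\<close> brings them back to the manifold. The one deformation
  serves twice: as a connected set of smooth loops and as a continuous homotopy.\<close>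

lemma close_loops:
  obtains \<epsilon> where "0 < \<epsilon>"
    "\<And>\<gamma> x y. \<gamma> \<in> homotopy_classes_of_loops A \<Longrightarrow> x \<in> \<gamma> \<Longrightarrow> x \<in> smooth_loops A \<Longrightarrow> y \<in> smooth_loops A \<Longrightarrow>
      \<forall>t. dist (f (x t)) (f (y t)) < \<epsilon> \<Longrightarrow> y \<in> \<gamma>"
    "\<And>x y. x \<in> smooth_loops A \<Longrightarrow> y \<in> smooth_loops A \<Longrightarrow>
      \<forall>t. dist (f (x t)) (f (y t)) < \<epsilon> \<Longrightarrow> homotopic_loops UNIV x y"
proof -
  obtain \<epsilon> where \<epsilon>: "\<epsilon> > 0" "(\<Union>y\<in>range f. ball y \<epsilon>) \<subseteq> D"
    by (rule compact_subset_open_imp_ball_epsilon_subset[OF compact_range_f D_open f_D]) (rule that)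
  define P where "P x y z = f (x (snd z)) + fst z *\<^sub>R (f (y (snd z)) - f (x (snd z)))" for x y and z :: "real \<times> real"
  define H where "H x y u t = r (P x y (u, t))" for x y u t
  have sP: "smooth_on (P x y) UNIV" if "x \<in> smooth_loops A" "y \<in> smooth_loops A" for x y
  proof -
    have s: "smooth_on (\<lambda>z::real \<times> real. f (x (snd z))) UNIV" if "x \<in> smooth_loops A" for x
      by (rule smooth_on_compose[OF open_UNIV smooth_on_snd[OF open_UNIV smooth_on_ident[OF open_UNIV]] smooth_loop_f[OF that] subset_UNIV])
    show ?thesis unfolding P_def[abs_def]
      by (intro smooth_on_add smooth_on_scaleR smooth_on_diff smooth_on_fst smooth_on_ident open_UNIV s that)
  qed
  have PD: "P x y (u, t) \<in> D" if "dist (f (x t)) (f (y t)) < \<epsilon>" "u \<in> {0..1}" for x y u t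
  proof -
    have "dist (f (x t)) (P x y (u, t)) = u * dist (f (x t)) (f (y t))" using that(2) by (simp add: P_def dist_norm norm_minus_commute)
    also have "\<dots> \<le> 1 * dist (f (x t)) (f (y t))" using that(2) by (intro mult_right_mono) auto
    finally have "P x y (u, t) \<in> ball (f (x t)) \<epsilon>" using that(1) by simp
    then show ?thesis using \<epsilon>(2) by blast
  qed
  have H01: "H x y 0 = x" "H x y 1 = y" for x y by (simp_all add: H_def P_def fun_eq_iff)
  have per: "H x y u (t + 1) = H x y u t" if "x \<in> smooth_loops A" "y \<in> smooth_loops A" for x y u t
    using that by (simp add: H_def P_def smooth_loop_periodic)
  have cont: "continuous_map (top_of_set {0..1}) (free_loop_space A) (H x y)"
    if xy: "x \<in> smooth_loops A" "y \<in> smooth_loops A" and d: "\<And>t. dist (f (x t)) (f (y t)) < \<epsilon>" for x y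
  proof (rule continuous_map_free_loop_space[where S="P x y -` D"])
    show o: "open (P x y -` D)" by (rule open_vimage[OF D_open smooth_on_imp_continuous_on[OF sP[OF xy]]])
    show "{0..1} \<times> UNIV \<subseteq> P x y -` D"
    proof
      fix z :: "real \<times> real" assume "z \<in> {0..1} \<times> UNIV"
      then have "P x y (fst z, snd z) \<in> D" by (intro PD d) (simp add: mem_Times_iff)
      then show "z \<in> P x y -` D" by simp
    qed
    show "smooth_on (\<lambda>z. f (H x y (fst z) (snd z))) (P x y -` D)"
      unfolding H_def prod.collapse by (rule smooth_on_compose[OF o smooth_on_subset[OF sP[OF xy] subset_UNIV] fr_smooth]) auto
  qed (rule per[OF xy])
  show ?thesis
  proof (rule that[OF \<epsilon>(1)])
    fix \<gamma> x y assume \<gamma>: "\<gamma> \<in> homotopy_classes_of_loops A" "x \<in> \<gamma>" and xy: "x \<in> smooth_loops A" "y \<in> smooth_loops A"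
      and d': "\<forall>t. dist (f (x t)) (f (y t)) < \<epsilon>"
    note d = d'[rule_format]
    have "connectedin (top_of_set {0..1}) {0..1::real}" by (simp add: connectedin_subtopology)
    from connectedin_continuous_map_image[OF cont[OF xy d] this]
    have c: "connectedin (free_loop_space A) (H x y ` {0..1})" .
    have x: "x \<in> H x y ` {0..1}" and y: "y \<in> H x y ` {0..1}"
      by (rule image_eqI[of _ _ 0]; simp add: H01) (rule image_eqI[of _ _ 1]; simp add: H01)
    have "H x y ` {0..1} \<subseteq> \<gamma>"
      by (rule connected_components_of_maximal[OF \<gamma>(1)[unfolded homotopy_classes_of_loops_def] c]) (use \<gamma>(2) x in \<open>auto simp: disjnt_iff\<close>)
    then show "y \<in> \<gamma>" using y by blast
  next
    fix x y assume xy: "x \<in> smooth_loops A" "y \<in> smooth_loops A"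
      and d': "\<forall>t. dist (f (x t)) (f (y t)) < \<epsilon>"
    note d = d'[rule_format]
    have im: "P x y ` ({0..1} \<times> {0..1}) \<subseteq> D"
    proof (rule image_subsetI)
      fix z :: "real \<times> real" assume "z \<in> {0..1} \<times> {0..1}"
      then have "P x y (fst z, snd z) \<in> D" by (intro PD d) (simp add: mem_Times_iff)
      then show "P x y z \<in> D" by simp
    qed
    have "continuous_on ({0..1} \<times> {0..1}) (\<lambda>z. r (P x y z))"
      by (rule continuous_on_compose2[OF r_continuous continuous_on_subset[OF smooth_on_imp_continuous_on[OF sP[OF xy]] subset_UNIV] im])
    moreover have "H x y u 1 = H x y u 0" for u using per[OF xy, of u 0] by simp
    ultimately show "homotopic_loops UNIV x y"
      unfolding homotopic_loops using H01[of x y]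
      by (intro exI[of _ "\<lambda>z. r (P x y z)"]) (auto simp: H_def fun_eq_iff pathfinish_def pathstart_def)
  qed
qed

lemma open_uniform_neighbourhood:
  assumes x: "x \<in> smooth_loops A" and "0 < \<epsilon>"
  obtains N where "openin (free_loop_space A) N" "x \<in> N" "N \<subseteq> smooth_loops A" "\<And>y t. y \<in> N \<Longrightarrow> dist (f (x t)) (f (y t)) < \<epsilon>"
proof -
  \<comment> \<open>The coordinate bounds are added up to a bound for the norm; the factor 2 makes
    the final inequality strict.\<close>
  define e where "e = \<epsilon> / (2 * real CARD('n))"
  have e: "e > 0" using assms(2) by (simp add: e_def)
  define G where "G k = {y \<in> smooth_loops A. \<forall>t. \<bar>(deriv ^^ 0) ((\<lambda>p. f p $ k) \<circ> y) t - (deriv ^^ 0) ((\<lambda>p. f p $ k) \<circ> x) t\<bar> < e}" for k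
  have G: "openin (free_loop_space A) (G k)" for k
    unfolding free_loop_space_def G_def
    by (rule topology_generated_by_Basis) (use x e f_comp_smooth in blast)
  have "openin (free_loop_space A) (\<Inter>k. G k)" by (rule openin_INT2) (use G in auto)
  moreover have "x \<in> (\<Inter>k. G k)" using x e by (simp add: G_def)
  moreover have "(\<Inter>k. G k) \<subseteq> smooth_loops A" by (auto simp: G_def)
  moreover have "dist (f (x t)) (f (y t)) < \<epsilon>" if y: "y \<in> (\<Inter>k. G k)" for y t
  proof -
    have "\<bar>f (y t) $ k - f (x t) $ k\<bar> < e" for k using y by (simp add: G_def)
    then have k: "\<bar>(f (y t) - f (x t)) $ k\<bar> \<le> e" for k by (simp add: less_imp_le)
    have "norm (f (y t) - f (x t)) \<le> (\<Sum>k\<in>UNIV. \<bar>(f (y t) - f (x t)) $ k\<bar>)" by (rule norm_le_l1_cart)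
    also have "\<dots> \<le> real CARD('n) * e" using sum_bounded_above[of UNIV "\<lambda>k. \<bar>(f (y t) - f (x t)) $ k\<bar>" e] k by simp
    also have "\<dots> = \<epsilon> / 2" by (simp add: e_def)
    finally show ?thesis using assms(2) by (simp add: dist_norm norm_minus_commute)
  qed
  ultimately show ?thesis by (rule that)
qed

text \<open>\<open>nontrivial_class\<close> provides one loop that is not contractible. Close loops
  are homotopic, so contractibility is locally constant on the loop space and hence constant on the
  connected set \<gamma>.\<close>

lemma nontrivial_class_not_contractible:
  assumes \<gamma>: "\<gamma> \<in> homotopy_classes_of_loops A" "nontrivial_class \<gamma>" and x: "x \<in> \<gamma>"
  shows "\<not> contractible_loop x"
proof
  assume cx: "contractible_loop x"
  obtain \<epsilon> where \<epsilon>: "0 < \<epsilon>"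
    "\<And>\<gamma> x y. \<gamma> \<in> homotopy_classes_of_loops A \<Longrightarrow> x \<in> \<gamma> \<Longrightarrow> x \<in> smooth_loops A \<Longrightarrow> y \<in> smooth_loops A \<Longrightarrow>
      \<forall>t. dist (f (x t)) (f (y t)) < \<epsilon> \<Longrightarrow> y \<in> \<gamma>"
    "\<And>x y. x \<in> smooth_loops A \<Longrightarrow> y \<in> smooth_loops A \<Longrightarrow>
      \<forall>t. dist (f (x t)) (f (y t)) < \<epsilon> \<Longrightarrow> homotopic_loops UNIV x y"
    by (rule close_loops) (rule that)
  have contr: "contractible_loop x \<longleftrightarrow> contractible_loop y" if "homotopic_loops UNIV x y" for x y :: "real \<Rightarrow> 'a"
    using that unfolding contractible_loop_def by (meson homotopic_loops_sym homotopic_loops_trans)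
  have op: "openin (free_loop_space A) {y \<in> smooth_loops A. contractible_loop y = b}" for b
  proof (subst openin_subopen, rule ballI)
    fix y assume y: "y \<in> {y \<in> smooth_loops A. contractible_loop y = b}"
    then have yl: "y \<in> smooth_loops A" and yc: "contractible_loop y = b" by auto
    obtain N where N: "openin (free_loop_space A) N" "y \<in> N" "N \<subseteq> smooth_loops A" "\<And>z t. z \<in> N \<Longrightarrow> dist (f (y t)) (f (z t)) < \<epsilon>"
      by (rule open_uniform_neighbourhood[OF yl \<epsilon>(1)]) (rule that)
    have "N \<subseteq> {y \<in> smooth_loops A. contractible_loop y = b}"
    proof
      fix z assume z: "z \<in> N"
      have zl: "z \<in> smooth_loops A" by (rule subsetD[OF N(3) z])
      have "homotopic_loops UNIV y z" by (rule \<epsilon>(3)[OF yl zl allI[OF N(4)[OF z]]])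
      from contr[OF this] yc have zc: "contractible_loop z = b" by (rule trans[OF sym])
      show "z \<in> {y \<in> smooth_loops A. contractible_loop y = b}" by (simp only: mem_Collect_eq zl zc)
    qed
    with N(1,2) show "\<exists>T. openin (free_loop_space A) T \<and> y \<in> T \<and> T \<subseteq> {y \<in> smooth_loops A. contractible_loop y = b}" by (intro exI conjI)
  qed
  have cg: "connectedin (free_loop_space A) \<gamma>"
    using \<gamma>(1) unfolding homotopy_classes_of_loops_def by (rule connectedin_connected_components_of)
  then have sub: "\<gamma> \<subseteq> smooth_loops A" using connectedin_subset_topspace free_loop_space_carrier by blast
  obtain y where y: "y \<in> \<gamma>" "\<not> contractible_loop y" using \<gamma>(2) unfolding nontrivial_class_def by blast
  have "\<exists>E1 E2. openin (free_loop_space A) E1 \<and> openin (free_loop_space A) E2 \<and> \<gamma> \<subseteq> E1 \<union> E2 \<and> E1 \<inter> E2 \<inter> \<gamma> = {} \<and> E1 \<inter> \<gamma> \<noteq> {} \<and> E2 \<inter> \<gamma> \<noteq> {}"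
    by (rule exI[of _ "{y \<in> smooth_loops A. contractible_loop y = True}"], rule exI[of _ "{y \<in> smooth_loops A. contractible_loop y = False}"])
      (intro conjI op; use sub x cx y in auto)
  with conjunct2[OF cg[unfolded connectedin]] show False by (rule notE)
qed

lemma const_contractible: "contractible_loop (\<lambda>t. p)"
  unfolding contractible_loop_def
  by (rule exI[of _ p]) (auto simp: homotopic_loops_refl path_def pathfinish_def pathstart_def)

end

section \<open>Counting periodic trajectories\<close>

text \<open>An index type for the coordinates of the Whitney target, depending on the model space:
  \<open>{..2 * DIM('b)}\<close> starts at 0 and has 2 DIM('b) + 1 elements. It is made a well-order
  because the change of variables theorem asks this of an index type.\<close>

typedef (overloaded) ('b::euclidean_space) whitney_index = "{..2 * DIM('b)} :: nat set"
  by auto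

instantiation whitney_index :: (euclidean_space) "{finite, wellorder}"
begin

definition "i \<le> j \<longleftrightarrow> Rep_whitney_index i \<le> Rep_whitney_index j"
definition "i < j \<longleftrightarrow> Rep_whitney_index i < Rep_whitney_index j"

instance
proof
  show "finite (UNIV :: 'a whitney_index set)"
    unfolding type_definition.univ[OF type_definition_whitney_index] by simp
  fix i j k :: "'a whitney_index"
  show "i < j \<longleftrightarrow> i \<le> j \<and> \<not> j \<le> i" by (auto simp: less_eq_whitney_index_def less_whitney_index_def)
  show "i \<le> i" by (simp add: less_eq_whitney_index_def)
  show "i \<le> j \<Longrightarrow> j \<le> k \<Longrightarrow> i \<le> k" by (simp add: less_eq_whitney_index_def)
  show "i \<le> j \<Longrightarrow> j \<le> i \<Longrightarrow> i = j" by (simp add: less_eq_whitney_index_def Rep_whitney_index_inject)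
  show "i \<le> j \<or> j \<le> i" by (auto simp: less_eq_whitney_index_def)
next
  fix P :: "'a whitney_index \<Rightarrow> bool" and i
  assume step: "\<And>i. (\<And>j. j < i \<Longrightarrow> P j) \<Longrightarrow> P i"
  show "P i"
  proof (induction i rule: measure_induct_rule[of Rep_whitney_index])
    case (less i)
    show ?case by (rule step) (simp add: less less_whitney_index_def)
  qed
qed

end

lemma card_whitney_index: "CARD('b::euclidean_space whitney_index) = 2 * DIM('b) + 1"
  using type_definition.card[OF type_definition_whitney_index[where 'b='b]] by simp

context embedded_flow
begin

lemma even_card_periodic_trajectories:
  assumes \<gamma>: "\<gamma> \<in> homotopy_classes_of_loops A" "nontrivial_class \<gamma>"
    and nd: "\<forall>x\<in>periodic_trajectories A Z \<inter> \<gamma>. nondegenerate_trajectory A Z x"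
  shows "finite (periodic_trajectories A Z \<inter> \<gamma>) \<and> even (card (periodic_trajectories A Z \<inter> \<gamma>))"
proof -
  define \<Psi> where "\<Psi> z t = \<Phi> (fst z) (snd z) t" for z t
  \<comment> \<open>\<open>Fix\<close> collects the pairs of all classes, and \<open>C\<close> those
    whose loop lies in \<gamma>. Both \<open>C\<close> and the rest of \<open>Fix\<close> will turn
    out to be closed.\<close>
  define Fix where "Fix = {z \<in> {0..pi/2} \<times> range f. \<Psi> z 1 = snd z}"
  define C where "C = {z \<in> Fix. traj (fst z) (r (snd z)) \<in> \<gamma>}"
  have fr: "f (r y) = y" if "y \<in> range f" for y using that by auto
  have c\<Psi>: "continuous_on UNIV (\<lambda>w. \<Psi> (fst w) (snd w))"
    unfolding \<Psi>_def by (rule smooth_on_imp_continuous_on, rule \<Phi>_smooth_compose[OF open_UNIV])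
      (intro smooth_on_fst smooth_on_snd smooth_on_ident open_UNIV)+
  have cFix: "compact Fix"
  proof -
    have cl: "closed {z. \<Psi> z 1 = snd z}"
      by (intro closed_Collect_eq continuous_on_snd continuous_on_id continuous_on_compose2[OF c\<Psi> _ subset_UNIV, of _ "\<lambda>z. (z, 1)", simplified])
        (intro continuous_intros)
    have "Fix = ({0..pi/2} \<times> range f) \<inter> {z. \<Psi> z 1 = snd z}" unfolding Fix_def by blast
    then show ?thesis using compact_Int_closed[OF compact_Times[OF compact_Icc compact_range_f] cl] by simp
  qed
  have loopF: "traj (fst z) (r (snd z)) \<in> smooth_loops A" if "z \<in> Fix" for z
  proof -
    have "snd z \<in> range f" "\<Phi> (fst z) (snd z) 1 = snd z" using that by (auto simp: Fix_def \<Psi>_def)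
    then show ?thesis unfolding traj_loop fr[OF \<open>snd z \<in> range f\<close>] by simp
  qed
  have f_loop: "f (traj (fst z) (r (snd z)) t) = \<Psi> z t" if "z \<in> Fix" for z t
  proof -
    have "snd z \<in> range f" using that by (auto simp: Fix_def)
    then show ?thesis unfolding f_traj \<Psi>_def fr[OF \<open>snd z \<in> range f\<close>] by simp
  qed
  obtain \<epsilon> where \<epsilon>: "0 < \<epsilon>"
    "\<And>\<gamma> x y. \<gamma> \<in> homotopy_classes_of_loops A \<Longrightarrow> x \<in> \<gamma> \<Longrightarrow> x \<in> smooth_loops A \<Longrightarrow> y \<in> smooth_loops A \<Longrightarrow>
      \<forall>t. dist (f (x t)) (f (y t)) < \<epsilon> \<Longrightarrow> y \<in> \<gamma>"
    "\<And>x y. x \<in> smooth_loops A \<Longrightarrow> y \<in> smooth_loops A \<Longrightarrow>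
      \<forall>t. dist (f (x t)) (f (y t)) < \<epsilon> \<Longrightarrow> homotopic_loops UNIV x y"
    by (rule close_loops) (rule that)
  have "uniformly_continuous_on (Fix \<times> {0..1}) (\<lambda>w. \<Psi> (fst w) (snd w))"
    by (rule compact_uniformly_continuous[OF continuous_on_subset[OF c\<Psi> subset_UNIV] compact_Times[OF cFix compact_Icc]])
  then obtain \<delta> where \<delta>: "\<delta> > 0"
    "\<And>w w'. w \<in> Fix \<times> {0..1} \<Longrightarrow> w' \<in> Fix \<times> {0..1} \<Longrightarrow> dist w' w < \<delta> \<Longrightarrow> dist (\<Psi> (fst w') (snd w')) (\<Psi> (fst w) (snd w)) < \<epsilon>"
    unfolding uniformly_continuous_on_def using \<epsilon>(1) by metis
  \<comment> \<open>By uniform continuity on a compact set, nearby pairs in \<open>Fix\<close> have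
    uniformly close loops, hence loops in the same class; periodicity lets t range over
    [0, 1].\<close>
  have stable: "z' \<in> C" if z: "z \<in> C" "z' \<in> Fix" "dist z z' < \<delta>" for z z'
  proof -
    have zF: "z \<in> Fix" and z\<gamma>: "traj (fst z) (r (snd z)) \<in> \<gamma>" using z(1) by (auto simp: C_def)
    have "traj (fst z') (r (snd z')) \<in> \<gamma>"
    proof (rule \<epsilon>(2)[OF \<gamma>(1) z\<gamma> loopF[OF zF] loopF[OF z(2)]], rule allI)
      fix t
      have p: "f (traj (fst w) (r (snd w)) t) = \<Psi> w (frac t)" if "w \<in> Fix" for w
        unfolding f_loop[OF that, symmetric] using periodic_frac[where g="traj (fst w) (r (snd w))", OF smooth_loop_periodic[OF loopF[OF that]], of t] by simp
      have ft: "frac t \<in> {0..1}" using frac_lt_1[of t] by (simp add: less_imp_le)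
      have "dist (\<Psi> (fst (z, frac t)) (snd (z, frac t))) (\<Psi> (fst (z', frac t)) (snd (z', frac t))) < \<epsilon>"
        by (rule \<delta>(2)) (use zF z(2,3) ft in \<open>auto simp: dist_Pair_Pair\<close>)
      then show "dist (f (traj (fst z) (r (snd z)) t)) (f (traj (fst z') (r (snd z')) t)) < \<epsilon>"
        unfolding p[OF zF] p[OF z(2)] by simp
    qed
    then show ?thesis using z(2) by (simp add: C_def)
  qed
  \<comment> \<open>Since a single \<delta> serves all points, being open in \<open>Fix\<close> in
    this uniform sense implies being closed: a limit point lies in \<open>Fix\<close> and has a
    member of \<open>S\<close> within \<delta>.\<close>
  have clopen: "closed S" if S: "S \<subseteq> Fix" "\<And>z z'. z \<in> S \<Longrightarrow> z' \<in> Fix \<Longrightarrow> dist z z' < \<delta> \<Longrightarrow> z' \<in> S" for S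
  proof -
    have "closure S \<subseteq> S"
    proof
      fix z assume z: "z \<in> closure S"
      have "closure S \<subseteq> Fix" by (rule closure_minimal[OF S(1) compact_imp_closed[OF cFix]])
      then have zF: "z \<in> Fix" using z by (rule subsetD)
      obtain w where "w \<in> S" "dist w z < \<delta>" using z \<delta>(1) unfolding closure_approachable by metis
      then show "z \<in> S" using S(2) zF by metis
    qed
    then show ?thesis by (simp only: closure_subset_eq)
  qed
  have CF: "C \<subseteq> Fix" unfolding C_def by (rule Collect_restrict)
  have clC: "closed C" by (rule clopen[OF CF stable])
  have clN: "closed (Fix - C)"
  proof (rule clopen[OF Diff_subset])
    fix z z' assume z: "z \<in> Fix - C" "z' \<in> Fix" "dist z z' < \<delta>"
    have "z' \<notin> C"
    proof
      assume "z' \<in> C"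
      then have "z \<in> C" by (rule stable) (use z in \<open>auto simp: dist_commute\<close>)
      then show False using z(1) by simp
    qed
    then show "z' \<in> Fix - C" using z(2) by simp
  qed
  \<comment> \<open>The fixed points of the other classes are cut out of the domain. They form a
    closed set, so \<open>D'\<close> is open, and its zeros of F over [0, pi/2] are exactly
    \<open>C\<close>.\<close>
  define D' where "D' = (UNIV \<times> D) - (Fix - C)"
  define F where "F z = snd z - \<Phi> (fst z) (f (r (snd z))) 1" for z
  have oD': "open D'" unfolding D'_def by (rule open_Diff[OF UNIV_D_open clN])
  have sF: "smooth_on F (UNIV \<times> D)"
  proof -
    have s: "smooth_on (\<lambda>z::real \<times> (real^'n::_). f (r (snd z))) (UNIV \<times> D)"
      by (rule smooth_on_compose[OF UNIV_D_open smooth_on_snd[OF UNIV_D_open smooth_on_ident[OF UNIV_D_open]] fr_smooth]) auto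
    show ?thesis unfolding F_def[abs_def]
      by (rule smooth_on_diff[OF UNIV_D_open smooth_on_snd[OF UNIV_D_open smooth_on_ident[OF UNIV_D_open]]
        \<Phi>_smooth_compose[OF UNIV_D_open smooth_on_const[OF UNIV_D_open] smooth_on_fst[OF UNIV_D_open smooth_on_ident[OF UNIV_D_open]] s]])
  qed
  have cC: "compact C" using compact_Int_closed[OF cFix clC] CF by (simp add: Int_absorb1)
  have FD: "Fix \<subseteq> UNIV \<times> D" by (auto simp: Fix_def)
  have CD': "C \<subseteq> D'" using CF FD unfolding D'_def by blast
  have slab: "C \<subseteq> {0..pi/2} \<times> UNIV" using CF by (auto simp: Fix_def)
  have zeros: "F z = 0 \<longleftrightarrow> z \<in> C" if z: "z \<in> D'" "fst z \<in> {0..pi/2}" for z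
  proof
    assume "F z = 0"
    then have e: "snd z = \<Phi> (fst z) (f (r (snd z))) 1" by (simp add: F_def)
    \<comment> \<open>A zero of F is the endpoint of a solution that starts on the image, so it lies
      on the image: there are no spurious zeros off the manifold.\<close>
    have "\<Phi> (fst z) (f (r (snd z))) 1 \<in> range f" by (rule \<Phi>_range)
    then have rg: "snd z \<in> range f" unfolding e[symmetric] .
    have "z \<in> Fix" unfolding Fix_def \<Psi>_def using z(2) rg e[unfolded fr[OF rg]] by (auto simp: mem_Times_iff)
    then show "z \<in> C" using z(1) by (auto simp: D'_def)
  next
    assume "z \<in> C"
    then have "z \<in> Fix" using CF by (rule subsetD[rotated])
    then have "snd z \<in> range f" "\<Phi> (fst z) (snd z) 1 = snd z" by (auto simp: Fix_def \<Psi>_def)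
    then show "F z = 0" unfolding F_def fr[OF \<open>snd z \<in> range f\<close>] by simp
  qed
  have start: "(0, y) \<notin> C" for y
  proof
    assume "(0, y) \<in> C"
    then have t: "traj 0 (r y) \<in> \<gamma>" by (simp add: C_def)
    have "traj 0 (r y) = (\<lambda>t. r y)" by (simp add: fun_eq_iff traj_def \<Phi>_zero)
    from t[unfolded this] show False by (rule notE[OF nontrivial_class_not_contractible[OF \<gamma>] const_contractible])
  qed
  have traj_C: "traj (pi / 2) (r y) \<in> periodic_trajectories A Z \<inter> \<gamma>" "f (r y) = y" if y: "(pi / 2, y) \<in> C" for y
  proof -
    have yF: "y \<in> range f" "\<Phi> (pi / 2) y 1 = y" and y\<gamma>: "traj (pi / 2) (r y) \<in> \<gamma>" using y by (auto simp: C_def Fix_def \<Psi>_def)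
    show "f (r y) = y" by (rule fr[OF yF(1)])
    then show "traj (pi / 2) (r y) \<in> periodic_trajectories A Z \<inter> \<gamma>" using y\<gamma> yF(2) unfolding Int_iff periodic_trajectories_iff traj_0 by simp
  qed
  have nondeg: "inj (\<lambda>v. frechet_derivative F (at (pi / 2, y)) (0, v))" if y: "(pi / 2, y) \<in> C" for y
  proof -
    define g where "g y = \<Phi> (pi / 2) (f (r y)) 1" for y
    have sg: "smooth_on g D" unfolding g_def[abs_def]
      by (rule \<Phi>_smooth_compose[OF D_open smooth_on_const[OF D_open] smooth_on_const[OF D_open] fr_smooth])
    have yy: "f (r y) = y" by (rule traj_C(2)[OF y])
    have yD: "y \<in> D" using f_in_D[of "r y"] unfolding yy .
    have 1: "((\<lambda>y. (pi / 2, y)) has_derivative (\<lambda>v. (0, v))) (at y)" by (auto intro!: derivative_eq_intros)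
    have 2: "(F has_derivative frechet_derivative F (at (pi / 2, y))) (at (pi / 2, y))"
      by (rule smooth_on_has_derivative[OF sF]) (simp add: yD)
    have 3: "((\<lambda>y. F (pi / 2, y)) has_derivative (\<lambda>v. frechet_derivative F (at (pi / 2, y)) (0, v))) (at y)"
      by (rule has_derivative_compose[OF 1 2])
    have 4: "((\<lambda>y. F (pi / 2, y)) has_derivative (\<lambda>v. v - frechet_derivative g (at y) v)) (at y)"
      unfolding F_def fst_conv snd_conv g_def[symmetric]
      by (rule has_derivative_diff[OF has_derivative_ident smooth_on_has_derivative[OF sg yD]])
    \<comment> \<open>Along the final slice the derivative of F is the identity minus the derivative
      of \<open>g\<close>, so its kernel consists of the vectors fixed by the latter, which
      \<open>nondegenerate_inj\<close> handles.\<close>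
    have eq: "(\<lambda>v. frechet_derivative F (at (pi / 2, y)) (0, v)) = (\<lambda>v. v - frechet_derivative g (at y) v)"
      by (rule has_derivative_unique[OF 3 4])
    have "nondegenerate_trajectory A Z (traj (pi / 2) (r y))" by (rule bspec[OF nd traj_C(1)[OF y]])
    then have ndp: "nondegenerate_fixed_point A (flow A Z 1) (r y)" unfolding nondegenerate_trajectory_def traj_0 .
    have fixp: "\<Phi> (pi / 2) (f (r y)) 1 = f (r y)"
      using traj_C(1)[OF y] unfolding Int_iff periodic_trajectories_iff traj_0 by simp
    show ?thesis
      unfolding eq linear_injective_0[OF has_derivative_linear[OF 4]]
    proof (intro allI impI)
      fix v assume "v - frechet_derivative g (at y) v = 0"
      then have "frechet_derivative g (at (f (r y))) v = v" unfolding yy by simp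
      then show "v = 0" unfolding g_def[abs_def] by (rule nondegenerate_inj[OF ndp fixp])
    qed
  qed
  have res: "finite {y. (pi / 2, y) \<in> C}" "even (card {y. (pi / 2, y) \<in> C})"
    by (rule even_card_zeros[OF oD' smooth_on_subset[OF sF] _ cC CD' slab zeros start nondeg]; simp add: D'_def)+
  \<comment> \<open>A trajectory is determined by its starting point, so the zeros in the final
    slice count the trajectories.\<close>
  have "bij_betw (\<lambda>x. f (x 0)) (periodic_trajectories A Z \<inter> \<gamma>) {y. (pi / 2, y) \<in> C}"
  proof (rule bij_betw_byWitness[where f'="\<lambda>y. traj (pi / 2) (r y)"])
    show "\<forall>x\<in>periodic_trajectories A Z \<inter> \<gamma>. traj (pi / 2) (r (f (x 0))) = x"
    proof
      fix x assume "x \<in> periodic_trajectories A Z \<inter> \<gamma>"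
      then have "x = traj (pi / 2) (x 0)" unfolding Int_iff periodic_trajectories_iff by (elim conjE)
      then show "traj (pi / 2) (r (f (x 0))) = x" unfolding r_f by (rule sym)
    qed
    show "\<forall>y\<in>{y. (pi / 2, y) \<in> C}. f (traj (pi / 2) (r y) 0) = y" using traj_C(2) by simp
    show "(\<lambda>x. f (x 0)) ` (periodic_trajectories A Z \<inter> \<gamma>) \<subseteq> {y. (pi / 2, y) \<in> C}"
    proof (intro image_subsetI CollectI)
      fix x assume x: "x \<in> periodic_trajectories A Z \<inter> \<gamma>"
      then have x1: "x = traj (pi / 2) (x 0)" and x2: "\<Phi> (pi / 2) (f (x 0)) 1 = f (x 0)" and x3: "x \<in> \<gamma>"
        unfolding Int_iff periodic_trajectories_iff by simp_all
      have x4: "traj (pi / 2) (x 0) \<in> \<gamma>" using x3 x1 by (rule back_subst)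
      show "(pi / 2, f (x 0)) \<in> C" unfolding C_def Fix_def \<Psi>_def using x2 x4 by simp
    qed
    show "(\<lambda>y. traj (pi / 2) (r y)) ` {y. (pi / 2, y) \<in> C} \<subseteq> periodic_trajectories A Z \<inter> \<gamma>"
      using traj_C(1) by blast
  qed
  note bij = this
  show ?thesis unfolding bij_betw_finite[OF bij] bij_betw_same_card[OF bij] using res by (rule conjI)
qed

end

text \<open>Embedding, retraction and cutoff are auxiliary choices; they are made here, and the
  resulting statement depends on the manifold and the vector field alone.\<close>

theorem even_card_periodic_trajectories:
  fixes A :: "('a::{t2_space,second_countable_topology}, 'b::euclidean_space) atlas"
  assumes A: "smooth_atlas A" and cM: "compact (UNIV :: 'a set)" and Z: "periodic_vector_field A Z"
    and \<gamma>: "\<gamma> \<in> homotopy_classes_of_loops A" "nontrivial_class \<gamma>"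
    and nd: "\<forall>x\<in>periodic_trajectories A Z \<inter> \<gamma>. nondegenerate_trajectory A Z x"
  shows "finite (periodic_trajectories A Z \<inter> \<gamma>) \<and> even (card (periodic_trajectories A Z \<inter> \<gamma>))"
proof -
  interpret compact_manifold A by (rule compact_manifold.intro[OF A cM])
  have dim: "2 * DIM('b) < CARD('b whitney_index)" unfolding card_whitney_index by simp
  obtain f :: "'a \<Rightarrow> real^('b whitney_index)" and T where T: "finite T" "T \<subseteq> A" and f: "smooth_vec f" "inj f"
    and imm: "\<And>p. \<exists>(U, \<phi>)\<in>T. p \<in> U \<and> inj (frechet_derivative (\<lambda>y. f (inv_into U \<phi> y)) (at (\<phi> p)))"
    by (rule whitney_embedding[OF dim]) (rule that)
  have immA: "\<exists>(U, \<phi>)\<in>A. p \<in> U \<and> inj (frechet_derivative (\<lambda>y. f (inv_into U \<phi> y)) (at (\<phi> p)))" for p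
    by (rule bexE[OF imm[of p]]) (rule bexI, assumption, rule subsetD[OF T(2)])
  obtain r D where D: "open D" "range f \<subseteq> D" and r: "\<And>p. r (f p) = p"
    "\<And>V \<psi>. (V, \<psi>) \<in> A \<Longrightarrow> open (D \<inter> r -` V) \<and> smooth_on (\<lambda>y. \<psi> (r y)) (D \<inter> r -` V)"
    by (rule tubular_retraction[OF f immA]) (rule that)
  interpret E: embedded_manifold A f r D by unfold_locales (fact f(1) D r)+
  obtain k :: "real^('b whitney_index) \<Rightarrow> real" and V K where k: "smooth_on k UNIV" "open V" "range f \<subseteq> V" "\<And>y. y \<in> V \<Longrightarrow> k y = 1"
    "compact K" "K \<subseteq> D" "\<And>y. y \<notin> K \<Longrightarrow> k y = 0"
    by (rule E.range_f_bump) (rule that)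
  interpret F: embedded_flow A f r D Z k V K by unfold_locales (fact Z k)+
  show ?thesis by (rule F.even_card_periodic_trajectories[OF \<gamma> nd])
qed

theorem theorem1p1:
  fixes A :: "('a::{t2_space,second_countable_topology}, 'b::euclidean_space) atlas"
    and \<omega> :: "'a form2"
    and n :: nat
    and Z :: "real \<Rightarrow> 'a vfield"
    and \<beta> :: "'a form1 set"
  assumes "smooth_atlas A"
    and "compact (UNIV :: 'a set)"
    and "connected (UNIV :: 'a set)"
    and "DIM('b) = 2 * n"
    and "symplectic_form A \<omega>"
    and "weakly_monotone A n \<omega>"
    and "periodic_symplectic_vector_field A \<omega> Z"
    and "\<And>t. de_rham_class1 A (contraction (Z t) \<omega>) = \<beta>"
  shows
    "(\<forall>\<gamma>\<in>homotopy_classes_of_loops A. nontrivial_class \<gamma> \<and> pairing1 A \<beta> \<gamma> \<noteq> 0 \<longrightarrow>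
        (\<forall>x\<in>periodic_trajectories A Z \<inter> \<gamma>. nondegenerate_trajectory A Z x \<longrightarrow>
           (\<exists>y\<in>periodic_trajectories A Z \<inter> \<gamma>. y \<noteq> x)))
     \<and>
     (\<forall>\<gamma>\<in>homotopy_classes_of_loops A. nontrivial_class \<gamma> \<and> pairing1 A \<beta> \<gamma> \<noteq> 0 \<longrightarrow>
        (\<forall>x\<in>periodic_trajectories A Z \<inter> \<gamma>. nondegenerate_trajectory A Z x) \<longrightarrow>
        finite (periodic_trajectories A Z \<inter> \<gamma>) \<and> even (card (periodic_trajectories A Z \<inter> \<gamma>)))"
proof -
  have Z: "periodic_vector_field A Z" using assms(7) by (simp add: periodic_symplectic_vector_field_def)
  note even = even_card_periodic_trajectories[OF assms(1,2) Z]
  have "\<exists>y\<in>periodic_trajectories A Z \<inter> \<gamma>. y \<noteq> x"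
    if \<gamma>: "\<gamma> \<in> homotopy_classes_of_loops A" "nontrivial_class \<gamma>"
      and x: "x \<in> periodic_trajectories A Z \<inter> \<gamma>" "nondegenerate_trajectory A Z x" for \<gamma> x
  proof (rule ccontr)
    assume "\<not> (\<exists>y\<in>periodic_trajectories A Z \<inter> \<gamma>. y \<noteq> x)"
    then have eq: "periodic_trajectories A Z \<inter> \<gamma> = {x}" using x(1) by blast
    have "\<forall>x\<in>periodic_trajectories A Z \<inter> \<gamma>. nondegenerate_trajectory A Z x" unfolding eq using x(2) by simp
    from even[OF \<gamma> this] show False unfolding eq by simp
  qed
  then show ?thesis using even by blast
qed

end
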